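(* Fix $n\in\mathbb{N}$, $n\geq 1$. Let $\mathcal{P}$ be a (shaded) subfactor planar algebra whose principal graph and dual principal graph are the $\tilde{A}_{2n-1}$ Dynkin diagram, and let $P_1,Q_1\in\mathcal P_{1,+}$, $U,U^*\in\mathcal P_{n,+}$, $V,V^*\in\mathcal P_{n,-}$ be elements of $\mathcal P$ satisfying the affine $A$ relations of order $n$ with parameter some $n$th root of unity $\sigma_n$ (listed in the context). Then $P_1,Q_1,U,U^*,V,V^*$ generate $\mathcal{P}$ as a planar algebra.
   Context: Shaded planar algebras. A planar algebra $\mathcal P$ is a family of complex vector spaces $\mathcal P_{k,\pm}$ ($k\ge 0$) with an action of Jones' shaded planar operad: each checkerboard-shaded planar tangle $T$ (an outer box, inner boxes, non-crossing strands, a star marking a region at each box; every box has $k$ strands on top and $k$ on the bottom, and has type $(k,+)$ if its star is in an unshaded region, $(k,-)$ if in a shaded region) gives a multilinear map $Z_T$ from the tensor product of the spaces of its inner boxes to the space of its outer box; isotopic tangles give the same map, the identity tangle gives the identity, and composition of tangles corresponds to composition of maps. Elements generate $\mathcal P$ if every element of every $\mathcal P_{k,\pm}$ is a linear combination of planar diagrams whose boxes are labelled by these elements. Elements are drawn as diagrams with star on the left. $fg$ is $f$ stacked on top of $g$; $\otimes$ is horizontal juxtaposition (defined when shadings match); $\overline{T}$ is rotation by $\pi$; $\mathrm{tr}=\mathrm{tr}^R$ (resp. $\mathrm{tr}^L$) closes all strands up to the right (resp. left). $\emptyset_\pm\in\mathcal P_{0,\pm}$ are the empty diagrams (unshaded,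 shaded). $X\in\mathcal P_{1,+}$ is the vertical strand with unshaded left and shaded right; $Y=\overline X\in\mathcal P_{1,-}$. Number the boundary points of a $(k,\pm)$-box clockwise from the star: $1,\dots,k$ on the top from left to right, $k+1,\dots,2k$ on the bottom from right to left. The click $\mathcal F:\mathcal P_{k,\pm}\to\mathcal P_{k,\mp}$ is the one-step rotation for which the $i$-th boundary point of $T$ becomes the $(i+1)$-st (mod $2k$) boundary point of $\mathcal F(T)$. Subfactor planar algebra: a planar algebra such that (1) $\dim\mathcal P_{0,\pm}=1$ (closed diagrams are scalars, $\emptyset_\pm=1$); (2) $\mathrm{tr}^L=\mathrm{tr}^R$ on $\mathcal P_{1,\pm}$; (3) there is an antilinear adjoint $*$ on each $\mathcal P_{k,\pm}$, compatible with reflection of tangles over a horizontal line, such that $\langle f,g\rangle=\mathrm{tr}(f^*g)$ is positive definite. A closed loop is a scalar $\delta>0$; the index is $\delta^2$. Principal graphs. A projection is $p$ with $p=p^2=p^*$. $\mathrm{Hom}(p,q)$ is the space of diagrams $f$ with bottom boundary that of $p$, top boundary that of $q$ and $qfp=f$ (the numbers of bottom and top points may differ; such diagrams are identified with elements of box spaces by bending strands). $p$ is minimal if $\dim\mathrm{Hom}(p,p)=1$; $p\cong q$ if there is $f\in\mathrm{Hom}(p,q)$ with $f^*f=p$, $ff^*=q$. The principal graph (resp. dual principal graph) has as vertices the isomorphism classes of minimal projections in the $\mathcal P_{k,+}$ (resp. $\mathcal P_{k,-}$), $k\ge0$, with $\dim\mathrm{Hom}(p\otimes X^{\pm},q)$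 edges between $p$ and $q$, where $X^\pm$ is whichever of $X$, $Y$ can be placed to the right of $p$. $\tilde A_{2n-1}$ is the cycle with $2n$ vertices (for $n=1$: two vertices joined by two edges). Affine $A$ relations of order $n$ with parameter $\sigma_n$. A red (resp. blue) strand is a strand carrying $P_1$ (resp. $Q_1$): vertical with shading on the right it is $P_1$ (resp. $Q_1$), with shading on the left it is $\overline{P}_1$ (resp. $\overline{Q}_1$). Put $P_n=P_1\otimes\overline{Q}_1\otimes P_1\otimes\cdots$, $P_n'=\overline{P}_1\otimes Q_1\otimes\overline{P}_1\otimes\cdots$, $Q_n=Q_1\otimes\overline{P}_1\otimes Q_1\otimes\cdots$, $Q'_n=\overline{Q}_1\otimes P_1\otimes\overline{Q}_1\otimes\cdots$ ($n$ alternating factors each). $U$ has bottom strands coloured as $Q_n$ and top strands as $P_n$ (that is, $U=P_nUQ_n$), $V$ has bottom strands coloured as $Q'_n$ and top strands as $P'_n$ ($V=P_n'VQ_n'$); $U^*,V^*$ are their adjoints. Relations: (i) (bubble) red and blue closed loops with shaded interior in an unshaded region equal $\emptyset_+$; red and blue closed loops with unshaded interior in a shaded region equal $\emptyset_-$; (ii) (strand decomposition) $X=P_1+Q_1$, $Y=\overline{P}_1+\overline{Q}_1$; (iii) (colour disagreement) $P_1Q_1=Q_1P_1=0$; (iv) (saddle) the diagram in $\mathcal P_{2,+}$ (resp. $\mathcal P_{2,-}$) consisting of a red arc joining the two top points and a red arc joining the two bottom points equals $P_1\otimes\overline{P}_1$ (resp. $\overline{P}_1\otimes P_1$); the same with blue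 arcs equals $Q_1\otimes\overline{Q}_1$ (resp. $\overline{Q}_1\otimes Q_1$); (v) (unitary) $UU^*=P_n$, $U^*U=Q_n$, $V^*V=Q_n'$, $VV^*=P_n'$; (vi) (click) $\mathcal F(U)=\sigma_nV^*=\sigma_n\mathcal F^{-1}(U)$ and $\mathcal F(U^* )=V=\sigma_n\mathcal F^{-1}(U^* )$. *)

theory Defs
  imports Complex_Main
begin

section \<open>Shaded planar tangles\<close>

text \<open>
  A box type \<open>(k, s)\<close> stands for \<open>(k, +)\<close> if \<open>s = False\<close> (the starred region is unshaded) and
  for \<open>(k, -)\<close> if \<open>s = True\<close> (the starred region is shaded).

  Tangles are represented up to planar isotopy, by their incidence structure. Box \<open>0\<close> is the
  outer box, boxes \<open>1, ..., m\<close> are the inner boxes. The boundary points of a box of type \<open>(k, s)\<close>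
  are numbered \<open>1, ..., 2k\<close> clockwise from the star. Interval \<open>j\<close> of a box is the piece of its
  boundary between the points \<open>j\<close> and \<open>j + 1\<close>; interval \<open>0\<close> carries the star and is also called
  interval \<open>2k\<close> (if \<open>k = 0\<close> it is the whole boundary). Strands (open arcs and closed loops) and
  regions are named by natural numbers; each strand has an unshaded side \<open>uside\<close> and a shaded
  side \<open>sside\<close>. The region data record in particular where disconnected parts of the tangle
  (closed loops, boxes without boundary points, ...) are located.
\<close>

type_synonym btype = "nat \<times> bool"

record tangle =
  outer :: btype
  inner :: "btype list"
  strands :: "nat set"
  regions :: "nat set"
  shaded :: "nat set"
  uside :: "nat \<Rightarrow> nat"
  sside :: "nat \<Rightarrow> nat"
  strand_at :: "nat \<Rightarrow> nat \<Rightarrow> nat"  \<comment> \<open>box, boundary point\<close>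
  region_at :: "nat \<Rightarrow> nat \<Rightarrow> nat"  \<comment> \<open>box, boundary interval\<close>

definition box :: "tangle \<Rightarrow> nat \<Rightarrow> btype" where
  "box T i = (if i = 0 then outer T else inner T ! (i - 1))"

definition boxes :: "tangle \<Rightarrow> nat set" where
  "boxes T = {0..length (inner T)}"

definition points :: "btype \<Rightarrow> nat set" where
  "points t = {1..2 * fst t}"

definition intervals :: "btype \<Rightarrow> nat set" where
  "intervals t = {0..2 * fst t}"

definition shaded_interval :: "btype \<Rightarrow> nat \<Rightarrow> bool" where
  "shaded_interval t j \<longleftrightarrow> (snd t \<noteq> odd j)"

text \<open>Of the two intervals \<open>j - 1\<close> and \<open>j\<close> adjacent to the point \<open>j\<close>, the unshaded and the shaded one.\<close>

definition u_interval :: "btype \<Rightarrow> nat \<Rightarrow> nat" where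
  "u_interval t j = (if shaded_interval t j then j - 1 else j)"

definition s_interval :: "btype \<Rightarrow> nat \<Rightarrow> nat" where
  "s_interval t j = (if shaded_interval t j then j else j - 1)"

text \<open>
  Orient every strand so that the unshaded region is on its left. Seen from an inner box, interval
  \<open>j - 1\<close> lies to the left of the strand leaving the box at the point \<open>j\<close>; at the outer box it is
  interval \<open>j\<close> that lies to the left of the strand entering the tangle at \<open>j\<close>.
\<close>

definition starts :: "tangle \<Rightarrow> (nat \<times> nat) set" where
  "starts T = {(i, j). i \<in> boxes T \<and> j \<in> points (box T i) \<and> (shaded_interval (box T i) j \<longleftrightarrow> i \<noteq> 0)}"

definition ends :: "tangle \<Rightarrow> (nat \<times> nat) set" where
  "ends T = {(i, j). i \<in> boxes T \<and> j \<in> points (box T i) \<and> (shaded_interval (box T i) j \<longleftrightarrow> i = 0)}"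

text \<open>
  The last two conditions express planarity. Gluing discs (the boxes and the outside of the outer
  box), bands (the strands) and the regions along the given incidences yields a closed oriented
  surface. The first condition says that it is connected. The second one is the Jordan curve
  theorem: a set \<open>A\<close> of strands that meets every box in an even number of boundary points is the
  set of strands separating some set \<open>B\<close> of regions from its complement. Both together say that
  \<open>H\<^sup>0\<close> and \<open>H\<^sup>1\<close> of the surface over the field with two elements are those of the sphere, with
  every region a genuine planar region; for a connected surface the second condition is
  equivalent to Euler's formula \<open>m + card regions = card strands + c\<close>, where \<open>c\<close> is the number of
  classes of \<open>{0..m}\<close> under the relation of being linked by strands. A strand not attached to any
  boundary point is a closed loop.
\<close>

definition planar_tangle :: "tangle \<Rightarrow> bool" where
  "planar_tangle T \<longleftrightarrow>
     finite (strands T) \<and> finite (regions T) \<and> shaded T \<subseteq> regions T \<and>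
     (\<forall>s\<in>strands T. uside T s \<in> regions T - shaded T \<and> sside T s \<in> shaded T) \<and>
     (\<forall>i\<in>boxes T. \<forall>j\<in>intervals (box T i).
        region_at T i j \<in> regions T \<and>
        (region_at T i j \<in> shaded T \<longleftrightarrow> shaded_interval (box T i) j)) \<and>
     (\<forall>i\<in>boxes T. region_at T i (2 * fst (box T i)) = region_at T i 0) \<and>
     (\<forall>i\<in>boxes T. \<forall>j\<in>points (box T i).
        strand_at T i j \<in> strands T \<and>
        uside T (strand_at T i j) = region_at T i (u_interval (box T i) j) \<and>
        sside T (strand_at T i j) = region_at T i (s_interval (box T i) j)) \<and>
     inj_on (case_prod (strand_at T)) (starts T) \<and>
     inj_on (case_prod (strand_at T)) (ends T) \<and>
     case_prod (strand_at T) ` starts T = case_prod (strand_at T) ` ends T \<and>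
     (\<forall>B\<subseteq>regions T. B \<noteq> {} \<and> (\<forall>s\<in>strands T. uside T s \<in> B \<longleftrightarrow> sside T s \<in> B) \<longrightarrow> B = regions T) \<and>
     (\<forall>A\<subseteq>strands T.
        (\<forall>i\<in>boxes T. even (card {j \<in> points (box T i). strand_at T i j \<in> A})) \<longrightarrow>
        (\<exists>B\<subseteq>regions T. \<forall>s\<in>strands T. s \<in> A \<longleftrightarrow> (uside T s \<in> B) \<noteq> (sside T s \<in> B)))"

text \<open>
  Isotopy, where the inner box \<open>i\<close> of \<open>T\<close> corresponds to the inner box \<open>\<pi> i\<close> of \<open>T'\<close>. (An
  isomorphism of the incidence structures is induced by a homeomorphism of the outer box fixing
  its boundary, hence by an isotopy.)
\<close>

definition isotopic :: "(nat \<Rightarrow> nat) \<Rightarrow> tangle \<Rightarrow> tangle \<Rightarrow> bool" where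
  "isotopic \<pi> T T' \<longleftrightarrow>
     length (inner T') = length (inner T) \<and> \<pi> 0 = 0 \<and> bij_betw \<pi> (boxes T) (boxes T') \<and>
     (\<forall>i\<in>boxes T. box T' (\<pi> i) = box T i) \<and>
     (\<exists>f g. bij_betw f (strands T) (strands T') \<and> bij_betw g (regions T) (regions T') \<and>
        g ` shaded T = shaded T' \<and>
        (\<forall>s\<in>strands T. uside T' (f s) = g (uside T s) \<and> sside T' (f s) = g (sside T s)) \<and>
        (\<forall>i\<in>boxes T. \<forall>j\<in>points (box T i). strand_at T' (\<pi> i) j = f (strand_at T i j)) \<and>
        (\<forall>i\<in>boxes T. \<forall>j\<in>intervals (box T i). region_at T' (\<pi> i) j = g (region_at T i j)))"

definition identity_tangle :: "tangle \<Rightarrow> bool" where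
  "identity_tangle T \<longleftrightarrow> planar_tangle T \<and> inner T = [outer T] \<and>
     strands T = strand_at T 0 ` points (outer T) \<and>
     (\<forall>j\<in>points (outer T). strand_at T 1 j = strand_at T 0 j) \<and>
     (\<forall>j\<in>intervals (outer T). region_at T 1 j = region_at T 0 j)"

definition glue :: "('a \<times> 'b) set \<Rightarrow> (('a + 'b) \<times> ('a + 'b)) set" where
  "glue r = (let r' = (\<lambda>(x, y). (Inl x, Inr y)) ` r in (r' \<union> r'\<inverse>)\<^sup>*)"

text \<open>
  \<open>R\<close> is obtained by inserting \<open>S\<close> into the inner box \<open>i\<close> of \<open>T\<close>: strands and regions of \<open>R\<close> are
  those of \<open>T\<close> and \<open>S\<close>, identified along the common boundary. The inner boxes of \<open>S\<close> take the
  place of box \<open>i\<close> in the numbering.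
\<close>

definition composite :: "tangle \<Rightarrow> nat \<Rightarrow> tangle \<Rightarrow> tangle \<Rightarrow> bool" where
  "composite T i S R \<longleftrightarrow>
     i \<in> {1..length (inner T)} \<and> box T i = outer S \<and>
     outer R = outer T \<and> inner R = take (i - 1) (inner T) @ inner S @ drop i (inner T) \<and>
     (\<exists>f g.
        f ` (strands T <+> strands S) = strands R \<and>
        g ` (regions T <+> regions S) = regions R \<and>
        (\<forall>x\<in>strands T <+> strands S. \<forall>y\<in>strands T <+> strands S.
           f x = f y \<longleftrightarrow> (x, y) \<in> glue ((\<lambda>j. (strand_at T i j, strand_at S 0 j)) ` points (outer S))) \<and>
        (\<forall>x\<in>regions T <+> regions S. \<forall>y\<in>regions T <+> regions S.
           g x = g y \<longleftrightarrow> (x, y) \<in> glue ((\<lambda>j. (region_at T i j, region_at S 0 j)) ` intervals (outer S))) \<and>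
        g ` (shaded T <+> shaded S) = shaded R \<and>
        (\<forall>s\<in>strands T. uside R (f (Inl s)) = g (Inl (uside T s)) \<and>
                        sside R (f (Inl s)) = g (Inl (sside T s))) \<and>
        (\<forall>s\<in>strands S. uside R (f (Inr s)) = g (Inr (uside S s)) \<and>
                        sside R (f (Inr s)) = g (Inr (sside S s))) \<and>
        (\<forall>b<i. (\<forall>j\<in>points (box T b). strand_at R b j = f (Inl (strand_at T b j))) \<and>
               (\<forall>j\<in>intervals (box T b). region_at R b j = g (Inl (region_at T b j)))) \<and>
        (\<forall>b\<in>{1..length (inner S)}.
               (\<forall>j\<in>points (box S b). strand_at R (i + b - 1) j = f (Inr (strand_at S b j))) \<and>
               (\<forall>j\<in>intervals (box S b). region_at R (i + b - 1) j = g (Inr (region_at S b j)))) \<and>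
        (\<forall>b\<in>{i<..length (inner T)}.
               (\<forall>j\<in>points (box T b).
                  strand_at R (b + length (inner S) - 1) j = f (Inl (strand_at T b j))) \<and>
               (\<forall>j\<in>intervals (box T b).
                  region_at R (b + length (inner S) - 1) j = g (Inl (region_at T b j)))))"

text \<open>Reflection over a horizontal line; the stars stay on the left.\<close>

definition reflect :: "tangle \<Rightarrow> tangle" where
  "reflect T = T\<lparr>strand_at := (\<lambda>i j. strand_at T i (2 * fst (box T i) + 1 - j)),
                 region_at := (\<lambda>i j. region_at T i (2 * fst (box T i) - j))\<rparr>"


subsection \<open>The tangles used below\<close>

text \<open>
  The tangle in which every strand and every region meets the boundary of some box, and whose
  incidences are given by the names \<open>st i j\<close> and \<open>rg i j\<close> of the strand at point \<open>j\<close> and of the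
  region at interval \<open>j\<close> of box \<open>i\<close>.
\<close>

definition tangle_of :: "btype \<Rightarrow> btype list \<Rightarrow> (nat \<Rightarrow> nat \<Rightarrow> nat) \<Rightarrow> (nat \<Rightarrow> nat \<Rightarrow> nat) \<Rightarrow> tangle" where
  "tangle_of out ins st rg =
     (let bx = (\<lambda>i. if i = 0 then out else ins ! (i - 1));
          pts = {(i, j). i \<le> length ins \<and> j \<in> points (bx i)};
          ivs = {(i, j). i \<le> length ins \<and> j \<in> intervals (bx i)}
      in \<lparr>outer = out, inner = ins,
          strands = case_prod st ` pts,
          regions = case_prod rg ` ivs,
          shaded = case_prod rg ` {(i, j) \<in> ivs. shaded_interval (bx i) j},
          uside = (\<lambda>s. SOME r. \<exists>(i, j)\<in>pts. st i j = s \<and> r = rg i (u_interval (bx i) j)),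
          sside = (\<lambda>s. SOME r. \<exists>(i, j)\<in>pts. st i j = s \<and> r = rg i (s_interval (bx i) j)),
          strand_at = st, region_at = rg\<rparr>)"

text \<open>\<open>k\<close> parallel vertical strands.\<close>

definition unit_tangle :: "nat \<Rightarrow> bool \<Rightarrow> tangle" where
  "unit_tangle k s = tangle_of (k, s) []
     (\<lambda>i j. min j (2 * k + 1 - j)) (\<lambda>i j. min j (2 * k - j))"

text \<open>
  Box \<open>1\<close> with \<open>c\<close> points on top and \<open>b\<close> at the bottom, stacked on top of box \<open>2\<close> with \<open>b\<close> points
  on top and \<open>a\<close> at the bottom (\<open>a\<close>, \<open>b\<close>, \<open>c\<close> of the same parity). A box with \<open>c\<close> points on top and
  \<open>b\<close> at the bottom is identified with a box of type \<open>((c + b) / 2, s)\<close> by bending strands on the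
  right, that is, by keeping the star and the clockwise numbering of the points. If one of
  \<open>a\<close>, \<open>b\<close>, \<open>c\<close> is \<open>0\<close>, the leftmost and the rightmost region coincide.
\<close>

definition stack_tangle :: "bool \<Rightarrow> nat \<Rightarrow> nat \<Rightarrow> nat \<Rightarrow> tangle" where
  "stack_tangle s c b a =
     (let rg1 = (\<lambda>j. if j = c + b \<or> (a = 0 \<and> j = c) then 0 else j);
          rg2 = (\<lambda>j. if j \<le> b then rg1 (c + b - j) else if j = b + a then 0 else c + j)
      in tangle_of ((c + a) div 2, s) [((c + b) div 2, s), ((b + a) div 2, s)]
        (\<lambda>i j. if i = 0 then (if j \<le> c then j else b + j)
               else if i = 1 then j
               else (if j \<le> b then c + b + 1 - j else c + j))
        (\<lambda>i j. if i = 0 then (if j \<le> c then rg1 j else rg2 (b + (j - c)))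
               else if i = 1 then rg1 j
               else rg2 j))"

text \<open>Horizontal juxtaposition of a \<open>(k, s)\<close>-box and a box with \<open>2l\<close> points to its right.\<close>

definition tensor_tangle :: "bool \<Rightarrow> nat \<Rightarrow> nat \<Rightarrow> tangle" where
  "tensor_tangle s k l =
     (let rg1 = (\<lambda>j. if j = 2 * k then 0 else j);
          rg2 = (\<lambda>j. if j = 0 \<or> j = 2 * l then rg1 k else 2 * k + j)
      in tangle_of (k + l, s) [(k, s), (l, s \<noteq> odd k)]
        (\<lambda>i j. if i = 0 then (if j \<le> k then j else if j \<le> k + 2 * l then k + j else j - 2 * l)
               else if i = 1 then j
               else 2 * k + j)
        (\<lambda>i j. if i = 0 then (if j \<le> k then rg1 j else if j < k + 2 * l then rg2 (j - k) else rg1 (j - 2 * l))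
               else if i = 1 then rg1 j
               else rg2 j))"

text \<open>The click and its inverse on \<open>(k, s)\<close>-boxes, \<open>k \<ge> 1\<close>.\<close>

definition click_tangle :: "nat \<Rightarrow> bool \<Rightarrow> tangle" where
  "click_tangle k s = tangle_of (k, \<not> s) [(k, s)]
     (\<lambda>i j. if i = 0 then (if j = 1 then 2 * k else j - 1) else j)
     (\<lambda>i j. if i = 0 then (if j = 0 then 2 * k - 1 else j - 1) else if j = 2 * k then 0 else j)"

definition unclick_tangle :: "nat \<Rightarrow> bool \<Rightarrow> tangle" where
  "unclick_tangle k s = tangle_of (k, \<not> s) [(k, s)]
     (\<lambda>i j. if i = 0 then (if j = 2 * k then 1 else j + 1) else j)
     (\<lambda>i j. if i = 0 then (if j = 2 * k then 1 else if j = 2 * k - 1 then 0 else j + 1)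
            else if j = 2 * k then 0 else j)"

text \<open>
  The closures of a \<open>(k, s)\<close>-box to the right (\<open>left = False\<close>) and to the left: they only differ
  in the region that touches the outer box.
\<close>

definition closure_tangle :: "bool \<Rightarrow> nat \<Rightarrow> bool \<Rightarrow> tangle" where
  "closure_tangle left k s = tangle_of (0, if left then s \<noteq> odd k else s) [(k, s)]
     (\<lambda>i j. min j (2 * k + 1 - j))
     (\<lambda>i j. if i = 0 then (if left then k else 0) else min j (2 * k - j))"


section \<open>Planar algebras\<close>

text \<open>
  The spaces \<open>\<P> (k, s)\<close> are subspaces of an ambient complex vector space (for instance, of their
  direct sum). \<open>Z T xs\<close> is only relevant for planar tangles \<open>T\<close> and labels \<open>xs\<close> of the right
  types.
\<close>

locale planar_algebra = vector_space scale
  for scale :: "complex \<Rightarrow> 'v::ab_group_add \<Rightarrow> 'v" +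
  fixes \<P> :: "btype \<Rightarrow> 'v set"
    and Z :: "tangle \<Rightarrow> 'v list \<Rightarrow> 'v"
  assumes subspace_P: "subspace (\<P> t)"
    and Z_type: "planar_tangle T \<Longrightarrow> list_all2 (\<lambda>x t. x \<in> \<P> t) xs (inner T) \<Longrightarrow> Z T xs \<in> \<P> (outer T)"
    and Z_multilinear:
      "planar_tangle T \<Longrightarrow>
       list_all2 (\<lambda>x t. x \<in> \<P> t) (xs @ x # ys) (inner T) \<Longrightarrow>
       list_all2 (\<lambda>x t. x \<in> \<P> t) (xs @ y # ys) (inner T) \<Longrightarrow>
       Z T (xs @ (scale c x + y) # ys) = scale c (Z T (xs @ x # ys)) + Z T (xs @ y # ys)"
    and Z_isotopic:
      "planar_tangle T \<Longrightarrow> planar_tangle T' \<Longrightarrow> isotopic \<pi> T T' \<Longrightarrow>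
       list_all2 (\<lambda>x t. x \<in> \<P> t) xs (inner T) \<Longrightarrow> length ys = length xs \<Longrightarrow>
       (\<And>i. i \<in> {1..length xs} \<Longrightarrow> ys ! (\<pi> i - 1) = xs ! (i - 1)) \<Longrightarrow>
       Z T' ys = Z T xs"
    and Z_identity: "identity_tangle T \<Longrightarrow> x \<in> \<P> (outer T) \<Longrightarrow> Z T [x] = x"
    and Z_composite:
      "planar_tangle T \<Longrightarrow> planar_tangle S \<Longrightarrow> planar_tangle R \<Longrightarrow> composite T i S R \<Longrightarrow>
       length xs = i - 1 \<Longrightarrow>
       list_all2 (\<lambda>x t. x \<in> \<P> t) (xs @ ys @ zs) (inner R) \<Longrightarrow>
       list_all2 (\<lambda>x t. x \<in> \<P> t) ys (inner S) \<Longrightarrow>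
       Z R (xs @ ys @ zs) = Z T (xs @ Z S ys # zs)"
begin

text \<open>Linear combinations of planar diagrams labelled by the elements of \<open>G\<close> (with their types).\<close>

definition generates :: "(btype \<times> 'v) set \<Rightarrow> bool" where
  "generates G \<longleftrightarrow>
     (\<forall>t. \<P> t \<subseteq> span {Z T xs | T xs. planar_tangle T \<and> outer T = t \<and>
                                    list_all2 (\<lambda>x t. (t, x) \<in> G) xs (inner T)})"

definition one :: "nat \<Rightarrow> bool \<Rightarrow> 'v" where
  "one k s = Z (unit_tangle k s) []"

definition empty :: "bool \<Rightarrow> 'v" where
  "empty s = one 0 s"

definition stack :: "bool \<Rightarrow> nat \<Rightarrow> nat \<Rightarrow> nat \<Rightarrow> 'v \<Rightarrow> 'v \<Rightarrow> 'v" where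
  "stack s c b a x y = Z (stack_tangle s c b a) [x, y]"

abbreviation mult :: "btype \<Rightarrow> 'v \<Rightarrow> 'v \<Rightarrow> 'v" where
  "mult t \<equiv> stack (snd t) (fst t) (fst t) (fst t)"

definition tensor :: "bool \<Rightarrow> nat \<Rightarrow> nat \<Rightarrow> 'v \<Rightarrow> 'v \<Rightarrow> 'v" where
  "tensor s k l x y = Z (tensor_tangle s k l) [x, y]"

definition click :: "btype \<Rightarrow> 'v \<Rightarrow> 'v" where
  "click t x = Z (click_tangle (fst t) (snd t)) [x]"

definition unclick :: "btype \<Rightarrow> 'v \<Rightarrow> 'v" where
  "unclick t x = Z (unclick_tangle (fst t) (snd t)) [x]"

definition tr_right :: "btype \<Rightarrow> 'v \<Rightarrow> 'v" where
  "tr_right t x = Z (closure_tangle False (fst t) (snd t)) [x]"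

definition tr_left :: "btype \<Rightarrow> 'v \<Rightarrow> 'v" where
  "tr_left t x = Z (closure_tangle True (fst t) (snd t)) [x]"

text \<open>Rotation by \<open>\<pi>\<close> of a \<open>(1, s)\<close>-box: a single click.\<close>

definition bar :: "bool \<Rightarrow> 'v \<Rightarrow> 'v" where
  "bar s x = click (1, s) x"

definition X :: 'v where "X = one 1 False"

definition Y :: 'v where "Y = bar False X"

text \<open>\<open>x \<otimes> y \<otimes> x \<otimes> \<cdots>\<close> with \<open>n\<close> factors, where \<open>x\<close> is a \<open>(1, s)\<close>-box.\<close>

primrec alternating :: "bool \<Rightarrow> 'v \<Rightarrow> 'v \<Rightarrow> nat \<Rightarrow> 'v" where
  "alternating s x y 0 = empty s"
| "alternating s x y (Suc n) = tensor s n 1 (alternating s x y n) (if even n then x else y)"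

text \<open>
  \<open>x\<close> is a \<open>(1, s)\<close>-box on a strand; the strand is bent once to an arc joining two top points and
  once to an arc joining two bottom points.
\<close>

definition saddle :: "bool \<Rightarrow> 'v \<Rightarrow> 'v" where
  "saddle s x = stack s 2 0 2 x x"

end


section \<open>Subfactor planar algebras and principal graphs\<close>

locale subfactor_planar_algebra = planar_algebra scale \<P> Z
  for scale :: "complex \<Rightarrow> 'v::ab_group_add \<Rightarrow> 'v" and \<P> Z +
  fixes adj :: "btype \<Rightarrow> 'v \<Rightarrow> 'v"
  assumes dim_P0: "dim (\<P> (0, s)) = 1"
    and spherical:
      "x \<in> \<P> (1, s) \<Longrightarrow>
       \<exists>c. tr_right (1, s) x = scale c (empty s) \<and> tr_left (1, s) x = scale c (empty (\<not> s))"
    and adj_type: "x \<in> \<P> t \<Longrightarrow> adj t x \<in> \<P> t"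
    and adj_antilinear:
      "x \<in> \<P> t \<Longrightarrow> y \<in> \<P> t \<Longrightarrow> adj t (scale c x + y) = scale (cnj c) (adj t x) + adj t y"
    and adj_adj: "x \<in> \<P> t \<Longrightarrow> adj t (adj t x) = x"
    and adj_Z:
      "planar_tangle T \<Longrightarrow> list_all2 (\<lambda>x t. x \<in> \<P> t) xs (inner T) \<Longrightarrow>
       adj (outer T) (Z T xs) = Z (reflect T) (map2 adj (inner T) xs)"
    and positive_definite:
      "x \<in> \<P> t \<Longrightarrow> x \<noteq> 0 \<Longrightarrow>
       \<exists>r>0. tr_right t (mult t (adj t x) x) = scale (complex_of_real r) (empty (snd t))"
begin

text \<open>
  In the following, \<open>s\<close> is the shading of the starred region, and a pair \<open>(k, p)\<close> stands for an
  element \<open>p\<close> of \<open>\<P> (k, s)\<close>. There are no diagrams with \<open>k\<close> points at the bottom and \<open>l\<close> on top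
  if \<open>k + l\<close> is odd.
\<close>

definition Hom :: "bool \<Rightarrow> nat \<times> 'v \<Rightarrow> nat \<times> 'v \<Rightarrow> 'v set" where
  "Hom s = (\<lambda>(k, p) (l, q).
     if even (k + l)
     then {f \<in> \<P> ((k + l) div 2, s). stack s l l k q (stack s l k k f p) = f}
     else {0})"

definition minimal_projections :: "bool \<Rightarrow> (nat \<times> 'v) set" where
  "minimal_projections s =
     {(k, p). p \<in> \<P> (k, s) \<and> mult (k, s) p p = p \<and> adj (k, s) p = p \<and>
              dim (Hom s (k, p) (k, p)) = 1}"

definition proj_iso :: "bool \<Rightarrow> ((nat \<times> 'v) \<times> (nat \<times> 'v)) set" where
  "proj_iso s =
     {((k, p), (l, q)). (k, p) \<in> minimal_projections s \<and> (l, q) \<in> minimal_projections s \<and>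
        even (k + l) \<and>
        (\<exists>f \<in> Hom s (k, p) (l, q).
           stack s k l k (adj ((k + l) div 2, s) f) f = p \<and>
           stack s l k l f (adj ((k + l) div 2, s) f) = q)}"

text \<open>The vertices of the principal graph (\<open>s = False\<close>) and of the dual principal graph (\<open>s = True\<close>).\<close>

definition graph_vertices :: "bool \<Rightarrow> (nat \<times> 'v) set set" where
  "graph_vertices s = minimal_projections s // proj_iso s"

definition edge_count :: "bool \<Rightarrow> nat \<times> 'v \<Rightarrow> nat \<times> 'v \<Rightarrow> nat" where
  "edge_count s = (\<lambda>(k, p) q.
     dim (Hom s (k + 1, tensor s k 1 p (if s \<noteq> odd k then Y else X)) q))"

text \<open>
  The graph is a cycle with \<open>m\<close> vertices; for \<open>m = 2\<close> both summands contribute to the number of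
  edges between the two vertices.
\<close>

definition graph_is_cycle :: "bool \<Rightarrow> nat \<Rightarrow> bool" where
  "graph_is_cycle s m \<longleftrightarrow>
     (\<exists>\<phi>. bij_betw \<phi> {..<m} (graph_vertices s) \<and>
        (\<forall>i<m. \<forall>j<m. \<forall>p\<in>\<phi> i. \<forall>q\<in>\<phi> j.
           edge_count s p q = of_bool (j = (i + 1) mod m) + of_bool (i = (j + 1) mod m)))"


section \<open>Affine \<open>A\<close> relations\<close>

text \<open>
  A closed loop with unshaded interior, cut at its left, is a vertical strand with shading on the
  left, hence the right closure of a \<open>(1, -)\<close>-box.
\<close>

definition affine_A_relations :: "nat \<Rightarrow> complex \<Rightarrow> 'v \<Rightarrow> 'v \<Rightarrow> 'v \<Rightarrow> 'v \<Rightarrow> bool" where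
  "affine_A_relations n \<sigma> P1 Q1 U V \<longleftrightarrow>
     (let P1' = bar False P1; Q1' = bar False Q1;
          Pn = alternating False P1 Q1' n; Pn' = alternating True P1' Q1 n;
          Qn = alternating False Q1 P1' n; Qn' = alternating True Q1' P1 n;
          U' = adj (n, False) U; V' = adj (n, True) V
      in
        mult (n, False) Pn (mult (n, False) U Qn) = U \<and>
        mult (n, True) Pn' (mult (n, True) V Qn') = V \<and>
        \<comment> \<open>bubble\<close>
        tr_right (1, False) P1 = empty False \<and> tr_right (1, False) Q1 = empty False \<and>
        tr_right (1, True) P1' = empty True \<and> tr_right (1, True) Q1' = empty True \<and>
        \<comment> \<open>strand decomposition\<close>
        X = P1 + Q1 \<and> Y = P1' + Q1' \<and>
        \<comment> \<open>colour disagreement\<close>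
        mult (1, False) P1 Q1 = 0 \<and> mult (1, False) Q1 P1 = 0 \<and>
        \<comment> \<open>saddle\<close>
        saddle False P1 = tensor False 1 1 P1 P1' \<and> saddle True P1' = tensor True 1 1 P1' P1 \<and>
        saddle False Q1 = tensor False 1 1 Q1 Q1' \<and> saddle True Q1' = tensor True 1 1 Q1' Q1 \<and>
        \<comment> \<open>unitary\<close>
        mult (n, False) U U' = Pn \<and> mult (n, False) U' U = Qn \<and>
        mult (n, True) V' V = Qn' \<and> mult (n, True) V V' = Pn' \<and>
        \<comment> \<open>click\<close>
        click (n, False) U = scale \<sigma> V' \<and> scale \<sigma> V' = scale \<sigma> (unclick (n, False) U) \<and>
        click (n, False) U' = V \<and> V = scale \<sigma> (unclick (n, False) U'))"

end

end

theory Submission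
  imports Defs "HOL-Library.Nat_Bijection"
begin

text \<open>
The first half of the theory turns pictures into equations. All diagrams that occur are iterated
insertions: an element with \<open>c + b\<close> boundary points is glued, along \<open>b\<close> consecutive points,
to the points \<open>j + 1, ..., j + b\<close> of another one. Stacking, juxtaposition, caps, cups and labels on a
strand are instances. The laws \<open>Ins_nested\<close>, \<open>Ins_parallel\<close>, \<open>Ins_adjacent\<close> (three ways to
reassociate two insertions), \<open>Ins_slide\<close> (a label slides around a bend) and the unit laws contain all
the isotopies that are needed. They are proved by describing a tangle by the system of equations
between the names at its boundary positions; composing tangles eliminates the names at the glued box.

The second half is the mathematical argument. By the strand decomposition every element is a sum of
elements each of whose boundary points carries one of the two colours. Write \<open>+\<close> for red on a
strand with unshaded left side and for blue on one with shaded left side, \<open>-\<close> otherwise; the colours around the boundary then form a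
word, and an arc can join neighbouring points exactly if their signs differ. By the saddle
relation an element whose word contains such neighbours is a coloured cup around its cap, hence
comes from an element with fewer points (\<open>coloured_cap\<close>). The remaining words are the powers of one
letter. The empty word gives scalars. If the word has more than \<open>n\<close> letters, then among
\<open>U\<close>, \<open>U*\<close>, \<open>V\<close>, \<open>V*\<close> there are \<open>W\<close> and \<open>W'\<close> such that \<open>W W'\<close> acts as the identity
on the element \<open>f\<close> and \<open>W' f\<close> has its first \<open>n\<close> signs flipped; so \<open>W' f\<close> has neighbours that cancel,
and \<open>f = W (W' f)\<close> (\<open>generation\<close>).

It remains to see that a power with \<open>0 < m \<le> n\<close> letters carries no element \<open>v \<noteq> 0\<close>, and here the principal
graphs enter (\<open>card_vertices_le\<close>). Attach to a minimal projection \<open>p\<close> the words \<open>w\<close> for which some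
non-zero map starts at \<open>p\<close> and has its top coloured by \<open>w\<close>. This set is not empty, whether \<open>w\<close> belongs to it
depends only on the sum of the signs of \<open>w\<close>, and juxtaposing \<open>v\<close> shows that it is stable under adding
\<open>m\<close> to (or, according to the letter, subtracting \<open>m\<close> from) this sum. Two minimal projections with a common
word are isomorphic (\<open>common_word\<close>), as elements coloured by a word of sum zero are unique up to a scalar
(\<open>balanced_unique\<close>). Hence there would be at most \<open>m < 2 n\<close> isomorphism classes, one for each residue
modulo \<open>m\<close>, whereas the graphs have \<open>2 n\<close> vertices.
\<close>

section \<open>Boundary points of planar tangles\<close>

lemma planar_tangleD:
  assumes "planar_tangle T"
  shows "finite (strands T)" "finite (regions T)" "shaded T \<subseteq> regions T"
    "!!s. s \<in> strands T ==> uside T s \<in> regions T"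
    "!!s. s \<in> strands T ==> uside T s \<notin> shaded T"
    "!!s. s \<in> strands T ==> sside T s \<in> shaded T"
    "!!s. s \<in> strands T ==> sside T s \<in> regions T"
    "!!b j. b \<in> boxes T ==> j \<in> intervals (box T b) ==> region_at T b j \<in> regions T"
    "!!b j. b \<in> boxes T ==> j \<in> intervals (box T b) ==>
       region_at T b j \<in> shaded T \<longleftrightarrow> shaded_interval (box T b) j"
    "!!b. b \<in> boxes T ==> region_at T b (2 * fst (box T b)) = region_at T b 0"
    "!!b j. b \<in> boxes T ==> j \<in> points (box T b) ==> strand_at T b j \<in> strands T"
    "!!b j. b \<in> boxes T ==> j \<in> points (box T b) ==>
       uside T (strand_at T b j) = region_at T b (u_interval (box T b) j)"
    "!!b j. b \<in> boxes T ==> j \<in> points (box T b) ==>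
       sside T (strand_at T b j) = region_at T b (s_interval (box T b) j)"
proof -
  have 1: "\<forall>s\<in>strands T. uside T s \<in> regions T - shaded T \<and> sside T s \<in> shaded T"
    and 2: "\<forall>b\<in>boxes T. \<forall>j\<in>intervals (box T b). region_at T b j \<in> regions T \<and>
        (region_at T b j \<in> shaded T \<longleftrightarrow> shaded_interval (box T b) j)"
    and 3: "\<forall>b\<in>boxes T. region_at T b (2 * fst (box T b)) = region_at T b 0"
    and 4: "\<forall>b\<in>boxes T. \<forall>j\<in>points (box T b). strand_at T b j \<in> strands T \<and>
        uside T (strand_at T b j) = region_at T b (u_interval (box T b) j) \<and>
        sside T (strand_at T b j) = region_at T b (s_interval (box T b) j)"
    and 5: "finite (strands T)" "finite (regions T)" "shaded T \<subseteq> regions T"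
    using assms[unfolded planar_tangle_def] by - (elim conjE, assumption)+
  show "finite (strands T)" "finite (regions T)" "shaded T \<subseteq> regions T" by (rule 5)+
  show "uside T s \<in> regions T" "uside T s \<notin> shaded T" "sside T s \<in> shaded T" "sside T s \<in> regions T"
    if "s \<in> strands T" for s using 1 5 that by blast+
  show "region_at T b j \<in> regions T" "region_at T b j \<in> shaded T \<longleftrightarrow> shaded_interval (box T b) j"
    if "b \<in> boxes T" "j \<in> intervals (box T b)" for b j using 2 that by blast+
  show "region_at T b (2 * fst (box T b)) = region_at T b 0" if "b \<in> boxes T" for b
    using 3 that by blast
  show "strand_at T b j \<in> strands T"
    "uside T (strand_at T b j) = region_at T b (u_interval (box T b) j)"
    "sside T (strand_at T b j) = region_at T b (s_interval (box T b) j)"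
    if "b \<in> boxes T" "j \<in> points (box T b)" for b j using 4 that by blast+
qed

text \<open>
The flag distinguishes starts from ends, so that one argument serves both orientations of a strand.
\<close>

definition ports :: "bool => tangle => (nat \<times> nat) set" where
  "ports c T = (if c then starts T else ends T)"

lemma ports_iff:
  "(b, j) \<in> ports c T \<longleftrightarrow>
     b \<in> boxes T \<and> j \<in> points (box T b) \<and> (shaded_interval (box T b) j \<longleftrightarrow> (b \<noteq> 0) = c)"
  unfolding ports_def starts_def ends_def by auto

lemma planar_ports:
  assumes "planar_tangle T"
  shows "inj_on (case_prod (strand_at T)) (ports c T)"
    "case_prod (strand_at T) ` ports c T = case_prod (strand_at T) ` ports d T"
proof -
  have "inj_on (case_prod (strand_at T)) (starts T)" "inj_on (case_prod (strand_at T)) (ends T)"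
    "case_prod (strand_at T) ` starts T = case_prod (strand_at T) ` ends T"
    using assms[unfolded planar_tangle_def] by - (elim conjE, assumption)+
  then show "inj_on (case_prod (strand_at T)) (ports c T)"
    "case_prod (strand_at T) ` ports c T = case_prod (strand_at T) ` ports d T"
    by (simp_all add: ports_def)
qed

lemma planar_connected:
  assumes "planar_tangle T" "B \<subseteq> regions T" "B \<noteq> {}"
    "!!s. s \<in> strands T ==> uside T s \<in> B \<longleftrightarrow> sside T s \<in> B"
  shows "B = regions T"
proof -
  have "\<forall>B\<subseteq>regions T. B \<noteq> {} \<and> (\<forall>s\<in>strands T. uside T s \<in> B \<longleftrightarrow> sside T s \<in> B) --> B = regions T"
    using assms(1) unfolding planar_tangle_def by (elim conjE)
  then show ?thesis using assms(2-4) by blast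
qed

lemma planar_jordan:
  assumes "planar_tangle T" "A \<subseteq> strands T"
    "!!b. b \<in> boxes T ==> even (card {j \<in> points (box T b). strand_at T b j \<in> A})"
  shows "\<exists>B\<subseteq>regions T. \<forall>s\<in>strands T. s \<in> A \<longleftrightarrow> (uside T s \<in> B) \<noteq> (sside T s \<in> B)"
proof -
  have "\<forall>A\<subseteq>strands T.
        (\<forall>b\<in>boxes T. even (card {j \<in> points (box T b). strand_at T b j \<in> A})) -->
        (\<exists>B\<subseteq>regions T. \<forall>s\<in>strands T. s \<in> A \<longleftrightarrow> (uside T s \<in> B) \<noteq> (sside T s \<in> B))"
    using assms(1) unfolding planar_tangle_def by (elim conjE)
  then show ?thesis using assms(2,3) by blast
qed

lemma boxes_simp [simp]: "b \<in> boxes T \<longleftrightarrow> b \<le> length (inner T)"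
  by (auto simp: boxes_def)

lemma zero_in_intervals [simp]: "0 \<in> intervals t"
  by (auto simp: intervals_def)

lemma u_interval_in: "j \<in> points t ==> u_interval t j \<in> intervals t"
  by (auto simp: points_def intervals_def u_interval_def)

lemma s_interval_in: "j \<in> points t ==> s_interval t j \<in> intervals t"
  by (auto simp: points_def intervals_def s_interval_def)

lemma finite_points [simp]: "finite (points t)"
  by (auto simp: points_def)

text \<open>
Every strand that meets the boundary has one start and one end, so the points on a set of strands come
in pairs. In a composite this settles the parity at the box that is filled, given the parity at all
others.
\<close>

lemma ports_count_even:
  assumes "planar_tangle T"
  shows "even (\<Sum>b\<in>boxes T. card {j \<in> points (box T b). strand_at T b j \<in> A})"
proof -
  let ?f = "case_prod (strand_at T)"
  let ?P = "\<lambda>c. {p \<in> ports c T. ?f p \<in> A}"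
  have fin: "finite (ports c T)" for c
    by (rule finite_subset[of _ "Sigma (boxes T) (\<lambda>b. points (box T b))"])
      (auto simp: ports_iff boxes_def)
  have a: "?f ` ?P True = ?f ` ?P False"
  proof -
    have "?f ` ?P c = ?f ` ports c T \<inter> A" for c by auto
    then show ?thesis using planar_ports(2)[OF assms, of True False] by simp
  qed
  have b: "card (?f ` ?P c) = card (?P c)" for c
    by (rule card_image, rule inj_on_subset[OF planar_ports(1)[OF assms, of c]]) auto
  have eq: "card (?P True) = card (?P False)"
    using a b[of True] b[of False] by simp
  have "(\<Sum>b\<in>boxes T. card {j \<in> points (box T b). strand_at T b j \<in> A})
      = card (Sigma (boxes T) (\<lambda>b. {j \<in> points (box T b). strand_at T b j \<in> A}))"
    by (rule card_SigmaI[symmetric]) (auto simp: boxes_def)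
  also have "Sigma (boxes T) (\<lambda>b. {j \<in> points (box T b). strand_at T b j \<in> A}) = ?P True \<union> ?P False"
    by (auto simp: ports_iff)
  also have "card \<dots> = card (?P True) + card (?P False)"
    by (rule card_Un_disjoint) (use fin in \<open>auto simp: ports_iff\<close>)
  finally show ?thesis using eq by simp
qed

section \<open>Gluing\<close>

lemma glue_refl: "(x, x) \<in> glue r"
  by (simp add: glue_def)

lemma glue_sym: "(x, y) \<in> glue r ==> (y, x) \<in> glue r"
  unfolding glue_def Let_def
  by (rule symD[OF sym_rtrancl[OF sym_Un_converse]])

lemma glue_trans: "(x, y) \<in> glue r ==> (y, z) \<in> glue r ==> (x, z) \<in> glue r"
  unfolding glue_def Let_def by (rule rtrancl_trans)

lemma glue_base: "(a, b) \<in> r ==> (Inl a, Inr b) \<in> glue r"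
  unfolding glue_def Let_def by (rule r_into_rtrancl) force

lemma glue_invariant:
  assumes "(x, y) \<in> glue r" "!!a b. (a, b) \<in> r ==> \<phi> (Inl a) = \<phi> (Inr b)"
  shows "\<phi> x = \<phi> y"
  using assms(1) unfolding glue_def Let_def
  by (induction rule: rtrancl_induct) (use assms(2) in auto)

lemma single_valued_zigzag:
  assumes "single_valued N" "single_valued (N\<inverse>)" "(x, y) \<in> (N \<union> N\<inverse>)\<^sup>*"
  shows "(x, y) \<in> N\<^sup>* \<or> (y, x) \<in> N\<^sup>*"
  using assms(3)
proof (induction rule: rtrancl_induct)
  case (step y z)
  from step.hyps(2) show ?case
  proof
    assume yz: "(y, z) \<in> N"
    from step.IH show ?thesis
    proof
      assume "(y, x) \<in> N\<^sup>*"
      then show ?thesis using single_valued_confluent[OF assms(1), of y x z] yz by blast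
    qed (use yz in \<open>auto intro: rtrancl_into_rtrancl\<close>)
  next
    assume zy: "(y, z) \<in> N\<inverse>"
    from step.IH show ?thesis
    proof
      assume "(x, y) \<in> N\<^sup>*"
      then have "(y, x) \<in> (N\<inverse>)\<^sup>*" by (rule rtrancl_converseI)
      then have "(x, z) \<in> (N\<inverse>)\<^sup>* \<or> (z, x) \<in> (N\<inverse>)\<^sup>*"
        using single_valued_confluent[OF assms(2), of y x z] zy by blast
      then show ?thesis by (auto simp: rtrancl_converse)
    next
      assume "(y, x) \<in> N\<^sup>*"
      then show ?thesis using zy by (meson converse_iff converse_rtrancl_into_rtrancl)
    qed
  qed
qed simp

text \<open>
In a composite the pieces of a strand are linked across the interface by a partial injection. A strand
that enters through a boundary point cannot run into a cycle, so by finiteness it comes out again.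
\<close>

lemma chain_has_end:
  assumes fin: "finite M" and N: "single_valued N" "single_valued (N\<inverse>)" "N \<subseteq> M \<times> M"
    and x: "x \<in> M" "x \<notin> Range N"
  shows "\<exists>y\<in>M. (x, y) \<in> N\<^sup>* \<and> y \<notin> Domain N"
proof (rule ccontr)
  assume neg: "\<not> ?thesis"
  define C where "C = {y. (x, y) \<in> N\<^sup>*}"
  have CM: "C \<subseteq> M"
  proof
    fix y assume "y \<in> C"
    then have "(x, y) \<in> N\<^sup>*" by (simp add: C_def)
    then show "y \<in> M" by (cases rule: rtranclE) (use x N(3) in auto)
  qed
  have "\<forall>y\<in>C. \<exists>z. (y, z) \<in> N" using neg CM unfolding C_def by blast
  then obtain h where h: "!!y. y \<in> C ==> (y, h y) \<in> N" by metis
  have "inj_on h C"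
    using h N(2) unfolding inj_on_def single_valued_def by (metis converse_iff)
  moreover have "h ` C \<subseteq> C - {x}"
    using h x(2) unfolding C_def by (auto intro: rtrancl_into_rtrancl)
  moreover have finC: "finite C" using CM fin finite_subset by auto
  ultimately have "card C \<le> card (C - {x})" by (metis card_inj_on_le finite_Diff)
  moreover have "x \<in> C" by (simp add: C_def)
  ultimately show False using card_Diff1_less[OF finC, of x] by linarith
qed

section \<open>Composites of planar tangles\<close>

locale tangle_composite =
  fixes T :: tangle and i :: nat and S R :: tangle and f g :: "nat + nat => nat"
  assumes i: "i \<in> {1..length (inner T)}" and box_i: "box T i = outer S"
    and outer_R: "outer R = outer T"
    and inner_R: "inner R = take (i - 1) (inner T) @ inner S @ drop i (inner T)"
    and strands_R: "f ` (strands T <+> strands S) = strands R"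
    and regions_R: "g ` (regions T <+> regions S) = regions R"
    and f_eq: "\<forall>x\<in>strands T <+> strands S. \<forall>y\<in>strands T <+> strands S.
        f x = f y \<longleftrightarrow> (x, y) \<in> glue ((\<lambda>j. (strand_at T i j, strand_at S 0 j)) ` points (outer S))"
    and g_eq: "\<forall>x\<in>regions T <+> regions S. \<forall>y\<in>regions T <+> regions S.
        g x = g y \<longleftrightarrow> (x, y) \<in> glue ((\<lambda>j. (region_at T i j, region_at S 0 j)) ` intervals (outer S))"
    and shaded_R: "g ` (shaded T <+> shaded S) = shaded R"
    and sides_T: "!!s. s \<in> strands T ==> uside R (f (Inl s)) = g (Inl (uside T s))"
        "!!s. s \<in> strands T ==> sside R (f (Inl s)) = g (Inl (sside T s))"
    and sides_S: "!!s. s \<in> strands S ==> uside R (f (Inr s)) = g (Inr (uside S s))"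
        "!!s. s \<in> strands S ==> sside R (f (Inr s)) = g (Inr (sside S s))"
    and at_less: "!!b j. b < i ==> j \<in> points (box T b) ==>
          strand_at R b j = f (Inl (strand_at T b j))"
        "!!b j. b < i ==> j \<in> intervals (box T b) ==>
          region_at R b j = g (Inl (region_at T b j))"
    and at_S: "!!b j. b \<in> {1..length (inner S)} ==> j \<in> points (box S b) ==>
          strand_at R (i + b - 1) j = f (Inr (strand_at S b j))"
        "!!b j. b \<in> {1..length (inner S)} ==> j \<in> intervals (box S b) ==>
          region_at R (i + b - 1) j = g (Inr (region_at S b j))"
    and at_greater: "!!b j. b \<in> {i<..length (inner T)} ==> j \<in> points (box T b) ==>
          strand_at R (b + length (inner S) - 1) j = f (Inl (strand_at T b j))"
        "!!b j. b \<in> {i<..length (inner T)} ==> j \<in> intervals (box T b) ==>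
          region_at R (b + length (inner S) - 1) j = g (Inl (region_at T b j))"

lemma composite_iff: "composite T i S R \<longleftrightarrow> (\<exists>f g. tangle_composite T i S R f g)"
proof
  assume "composite T i S R"
  then show "\<exists>f g. tangle_composite T i S R f g"
    unfolding composite_def
    apply (elim conjE exE)
    subgoal for f g
      apply (rule exI[of _ f], rule exI[of _ g], unfold_locales)
      subgoal by assumption
      subgoal by assumption
      subgoal by assumption
      subgoal by assumption
      subgoal by assumption
      subgoal by assumption
      subgoal by assumption
      subgoal by assumption
      subgoal by assumption
      subgoal by simp
      subgoal by simp
      subgoal by simp
      subgoal by simp
      subgoal by simp
      subgoal by simp
      subgoal by simp
      subgoal by simp
      subgoal by simp
      subgoal by simp
      done
    done
next
  assume "\<exists>f g. tangle_composite T i S R f g"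
  then obtain f g where "tangle_composite T i S R f g" by blast
  then interpret tangle_composite T i S R f g .
  show "composite T i S R"
    unfolding composite_def
    by (intro conjI exI[of _ f] exI[of _ g] i box_i outer_R inner_R strands_R regions_R shaded_R
        f_eq g_eq ballI allI impI sides_T sides_S at_less at_S at_greater)
qed

context tangle_composite
begin

definition posT :: "nat => nat" where
  "posT b = (if b < i then b else b + length (inner S) - 1)"

definition posS :: "nat => nat" where
  "posS b = i + b - 1"

lemma length_R: "length (inner R) + 1 = length (inner T) + length (inner S)"
  using i by (auto simp: inner_R min_def)

lemma boxes_R: "boxes R = posT ` (boxes T - {i}) \<union> posS ` (boxes S - {0})"
proof (intro equalityI subsetI)
  fix b assume "b \<in> boxes R"
  then have b: "b + 1 \<le> length (inner T) + length (inner S)" using length_R by simp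
  consider "b < i" | "i \<le> b" "b < i + length (inner S)" | "i + length (inner S) \<le> b" by linarith
  then show "b \<in> posT ` (boxes T - {i}) \<union> posS ` (boxes S - {0})"
  proof cases
    case 1
    then have "b = posT b" "b \<in> boxes T - {i}" using i by (auto simp: posT_def)
    then show ?thesis by blast
  next
    case 2
    then have "b = posS (b + 1 - i)" "b + 1 - i \<in> boxes S - {0}" using i by (auto simp: posS_def)
    then show ?thesis by blast
  next
    case 3
    then have "b = posT (b + 1 - length (inner S))" "b + 1 - length (inner S) \<in> boxes T - {i}"
      using i b by (auto simp: posT_def)
    then show ?thesis by blast
  qed
next
  fix b assume "b \<in> posT ` (boxes T - {i}) \<union> posS ` (boxes S - {0})"
  then show "b \<in> boxes R"
    using length_R i by (auto simp: posT_def posS_def split: if_splits)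
qed

lemma box_R_T: "b \<in> boxes T - {i} ==> box R (posT b) = box T b"
proof -
  assume b: "b \<in> boxes T - {i}"
  show ?thesis
  proof (cases "b < i")
    case True
    then have "b \<noteq> 0 ==> b - 1 < i - 1" by simp
    then show ?thesis using i True by (simp add: posT_def box_def outer_R inner_R nth_append)
  next
    case False
    then obtain d where d: "b = i + 1 + d" using b less_imp_Suc_add[of i b] by auto
    obtain i' where i': "i = Suc i'" using i by (cases i) auto
    have "drop i (inner T) ! d = inner T ! (b - 1)" using b d by simp
    then have "(take i' (inner T) @ inner S @ drop i (inner T)) ! (i' + (length (inner S) + d)) =
        inner T ! (b - 1)"
      using i i' by (simp add: nth_append)
    moreover have "posT b = Suc (i' + (length (inner S) + d))"
      unfolding posT_def using d i' by simp
    ultimately show ?thesis using d i' by (simp add: box_def inner_R)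
  qed
qed

lemma box_R_S: "b \<in> boxes S - {0} ==> box R (posS b) = box S b"
proof -
  assume b: "b \<in> boxes S - {0}"
  obtain i' where i': "i = Suc i'" using i by (cases i) auto
  obtain d where d: "b = Suc d" using b by (cases b) auto
  have "(take i' (inner T) @ inner S @ drop i (inner T)) ! (i' + d) = inner S ! d"
    using i i' b d by (simp add: nth_append)
  moreover have "posS b = Suc (i' + d)" unfolding posS_def using d i' by simp
  ultimately show ?thesis using d i' by (simp add: box_def inner_R)
qed

lemma pos_zero: "posT b = 0 \<longleftrightarrow> b = 0" if "b \<in> boxes T - {i}"
  using i that by (auto simp: posT_def)

lemma posS_nonzero: "posS b \<noteq> 0" if "b \<in> boxes S - {0}"
  using i that by (auto simp: posS_def)

lemma strand_at_T: "b \<in> boxes T - {i} ==> j \<in> points (box T b) ==>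
    strand_at R (posT b) j = f (Inl (strand_at T b j))"
  using at_less(1)[of b j] at_greater(1)[of b j] by (cases "b < i") (auto simp: posT_def)

lemma region_at_T: "b \<in> boxes T - {i} ==> j \<in> intervals (box T b) ==>
    region_at R (posT b) j = g (Inl (region_at T b j))"
  using at_less(2)[of b j] at_greater(2)[of b j] by (cases "b < i") (auto simp: posT_def)

lemma strand_at_S: "b \<in> boxes S - {0} ==> j \<in> points (box S b) ==>
    strand_at R (posS b) j = f (Inr (strand_at S b j))"
  using at_S(1)[of b j] by (auto simp: posS_def)

lemma region_at_S: "b \<in> boxes S - {0} ==> j \<in> intervals (box S b) ==>
    region_at R (posS b) j = g (Inr (region_at S b j))"
  using at_S(2)[of b j] by (auto simp: posS_def)

lemma boxes_R_cases [consumes 1, case_names T S]: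
  assumes "b \<in> boxes R"
  obtains b' where "b' \<in> boxes T" "b' \<noteq> i" "b = posT b'"
  | b' where "b' \<in> boxes S" "b' \<noteq> 0" "b = posS b'"
  using assms unfolding boxes_R by blast

end

lemma Inl_in_Plus_iff: "Inl x \<in> A <+> B \<longleftrightarrow> x \<in> A"
  and Inr_in_Plus_iff: "Inr y \<in> A <+> B \<longleftrightarrow> y \<in> B"
  by auto

locale planar_composite = tangle_composite +
  assumes planar_T: "planar_tangle T" and planar_S: "planar_tangle S"
begin

lemmas T_D = planar_tangleD[OF planar_T] and S_D = planar_tangleD[OF planar_S]

lemma i_box: "i \<in> boxes T" "i \<noteq> 0"
  using i by auto

lemma outer_box: "box S 0 = outer S" "0 \<in> boxes S"
  by (auto simp: box_def)

lemma interface_sides: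
  assumes "j \<in> points (outer S)"
  shows "strand_at T i j \<in> strands T" "strand_at S 0 j \<in> strands S"
    "uside T (strand_at T i j) = region_at T i (u_interval (outer S) j)"
    "uside S (strand_at S 0 j) = region_at S 0 (u_interval (outer S) j)"
    "sside T (strand_at T i j) = region_at T i (s_interval (outer S) j)"
    "sside S (strand_at S 0 j) = region_at S 0 (s_interval (outer S) j)"
  using assms T_D(11-13)[OF i_box(1)] S_D(11-13)[OF outer_box(2)] unfolding box_i outer_box(1) by auto

lemma interface_regions:
  assumes "j \<in> intervals (outer S)"
  shows "region_at T i j \<in> regions T" "region_at S 0 j \<in> regions S"
    "region_at T i j \<in> shaded T \<longleftrightarrow> region_at S 0 j \<in> shaded S"
  using assms T_D(8,9)[OF i_box(1)] S_D(8,9)[OF outer_box(2)] unfolding box_i outer_box(1) by auto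

lemma f_interface: "j \<in> points (outer S) ==> f (Inl (strand_at T i j)) = f (Inr (strand_at S 0 j))"
  using f_eq interface_sides(1,2)[of j] by (simp add: InlI InrI glue_base)

lemma g_interface:
  "j \<in> intervals (outer S) ==> g (Inl (region_at T i j)) = g (Inr (region_at S 0 j))"
  using g_eq interface_regions(1,2)[of j] by (simp add: InlI InrI glue_base)

lemma f_invariant:
  assumes "f x = f y" "x \<in> strands T <+> strands S" "y \<in> strands T <+> strands S"
    "!!j. j \<in> points (outer S) ==> \<phi> (Inl (strand_at T i j)) = \<phi> (Inr (strand_at S 0 j))"
  shows "\<phi> x = \<phi> y"
proof -
  have "(x, y) \<in> glue ((\<lambda>j. (strand_at T i j, strand_at S 0 j)) ` points (outer S))"
    using assms(1-3) f_eq by blast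
  then show ?thesis by (rule glue_invariant) (use assms(4) in auto)
qed

lemma g_invariant:
  assumes "g x = g y" "x \<in> regions T <+> regions S" "y \<in> regions T <+> regions S"
    "!!j. j \<in> intervals (outer S) ==> \<phi> (Inl (region_at T i j)) = \<phi> (Inr (region_at S 0 j))"
  shows "\<phi> x = \<phi> y"
proof -
  have "(x, y) \<in> glue ((\<lambda>j. (region_at T i j, region_at S 0 j)) ` intervals (outer S))"
    using assms(1-3) g_eq by blast
  then show ?thesis by (rule glue_invariant) (use assms(4) in auto)
qed

lemma strand_R_cases:
  assumes "s \<in> strands R"
  obtains s' where "s' \<in> strands T" "s = f (Inl s')" | s' where "s' \<in> strands S" "s = f (Inr s')"
  using assms unfolding strands_R[symmetric] by (auto elim!: PlusE)

lemma region_R_cases: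
  assumes "r \<in> regions R"
  obtains r' where "r' \<in> regions T" "r = g (Inl r')" | r' where "r' \<in> regions S" "r = g (Inr r')"
  using assms unfolding regions_R[symmetric] by (auto elim!: PlusE)

lemma in_R:
  "s \<in> strands T ==> f (Inl s) \<in> strands R" "s \<in> strands S ==> f (Inr s) \<in> strands R"
  "r \<in> regions T ==> g (Inl r) \<in> regions R" "r' \<in> regions S ==> g (Inr r') \<in> regions R"
  unfolding strands_R[symmetric] regions_R[symmetric] by auto

lemma shaded_iff:
  assumes "x \<in> regions T <+> regions S"
  shows "g x \<in> shaded R \<longleftrightarrow> x \<in> shaded T <+> shaded S"
proof
  assume "g x \<in> shaded R"
  then obtain y where y: "y \<in> shaded T <+> shaded S" "g x = g y"
    unfolding shaded_R[symmetric] by blast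
  have "y \<in> regions T <+> regions S" using y(1) T_D(3) S_D(3) by auto
  from g_invariant[OF y(2) assms this, of "\<lambda>x. x \<in> shaded T <+> shaded S"] interface_regions(3) y(1)
  show "x \<in> shaded T <+> shaded S" by (simp add: Inl_in_Plus_iff Inr_in_Plus_iff)
qed (unfold shaded_R[symmetric], blast)

text \<open>
The pieces of a strand of the composite, in the order in which they are traversed.
\<close>

definition next_strand :: "bool => ((nat + nat) \<times> (nat + nat)) set" where
  "next_strand c =
     {(Inl (strand_at T i j), Inr (strand_at S 0 j)) | j. (i, j) \<in> ports (\<not> c) T} \<union>
     {(Inr (strand_at S 0 j), Inl (strand_at T i j)) | j. (i, j) \<in> ports c T}"

lemma interface_ports: "(i, j) \<in> ports c T \<longleftrightarrow> (0, j) \<in> ports (\<not> c) S"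
  using i_box by (simp add: ports_iff box_i outer_box)

lemma port_unique:
  assumes "planar_tangle M" "(b, j) \<in> ports c M" "(b', j') \<in> ports c M"
    "strand_at M b j = strand_at M b' j'"
  shows "b = b' \<and> j = j'"
  using inj_onD[OF planar_ports(1)[OF assms(1)], of "(b, j)" "(b', j')"] assms(2-4) by auto

lemma next_strand_converse: "(next_strand c)\<inverse> = next_strand (\<not> c)"
  unfolding next_strand_def by auto

lemma next_strand_single_valued: "single_valued (next_strand c)"
proof (rule single_valuedI)
  fix x y z assume xyz: "(x, y) \<in> next_strand c" "(x, z) \<in> next_strand c"
  have T: "j = j'" if "(i, j) \<in> ports d T" "(i, j') \<in> ports d T"
    "strand_at T i j = strand_at T i j'" for d j j'
    using port_unique[OF planar_T that] by simp
  have S: "j = j'" if "(i, j) \<in> ports d T" "(i, j') \<in> ports d T"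
    "strand_at S 0 j = strand_at S 0 j'" for d j j'
    using port_unique[OF planar_S that[unfolded interface_ports(1)]] by simp
  show "y = z" using xyz unfolding next_strand_def by (auto dest: T S)
qed

lemma next_strand_glue:
  "glue ((\<lambda>j. (strand_at T i j, strand_at S 0 j)) ` points (outer S)) =
     (next_strand c \<union> (next_strand c)\<inverse>)\<^sup>*"
proof -
  define P :: "((nat + nat) \<times> (nat + nat)) set" where
    "P = {(Inl (strand_at T i j), Inr (strand_at S 0 j)) | j. j \<in> points (outer S)}"
  have "next_strand c \<union> (next_strand c)\<inverse> = P \<union> P\<inverse>"
    using i_box unfolding next_strand_converse next_strand_def P_def
    by (auto simp: ports_iff box_i)
  moreover have "(\<lambda>(x, y). (Inl x, Inr y)) ` (\<lambda>j. (strand_at T i j, strand_at S 0 j)) ` points (outer S) = P"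
    by (auto simp: P_def)
  ultimately show ?thesis unfolding glue_def Let_def by (simp only:)
qed

lemma next_strand_subset:
  "next_strand c \<subseteq> (strands T <+> strands S) \<times> (strands T <+> strands S)"
  using interface_sides i_box unfolding next_strand_def by (auto simp: ports_iff box_i)

lemma port_R_origin:
  assumes "(b, j) \<in> ports c R"
  obtains (T) b' where "b = posT b'" "(b', j) \<in> ports c T" "b' \<noteq> i"
      "strand_at R b j = f (Inl (strand_at T b' j))"
  | (S) b' where "b = posS b'" "(b', j) \<in> ports c S" "b' \<noteq> 0"
      "strand_at R b j = f (Inr (strand_at S b' j))"
proof -
  have "b \<in> boxes R" using assms by (simp add: ports_iff)
  then show ?thesis
  proof (cases rule: boxes_R_cases)
    case (T b')
    have "(b', j) \<in> ports c T"
      using assms T box_R_T[of b'] pos_zero[of b'] by (auto simp: ports_iff)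
    with T that(1) strand_at_T[of b' j] show ?thesis by (simp add: ports_iff)
  next
    case (S b')
    have "(b', j) \<in> ports c S"
      using assms S box_R_S[of b'] posS_nonzero[of b'] by (auto simp: ports_iff)
    with S that(2) strand_at_S[of b' j] show ?thesis by (simp add: ports_iff)
  qed
qed

lemma port_R_T:
  assumes "(b', j) \<in> ports c T" "b' \<noteq> i"
  shows "(posT b', j) \<in> ports c R" "strand_at R (posT b') j = f (Inl (strand_at T b' j))"
proof -
  have "posT b' \<in> boxes R" using assms boxes_R by (auto simp: ports_iff simp del: boxes_simp)
  then show "(posT b', j) \<in> ports c R"
    using assms box_R_T[of b'] pos_zero[of b'] by (auto simp: ports_iff)
  show "strand_at R (posT b') j = f (Inl (strand_at T b' j))"
    using assms strand_at_T[of b' j] by (simp add: ports_iff)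
qed

lemma port_R_S:
  assumes "(b', j) \<in> ports c S" "b' \<noteq> 0"
  shows "(posS b', j) \<in> ports c R" "strand_at R (posS b') j = f (Inr (strand_at S b' j))"
proof -
  have "posS b' \<in> boxes R" using assms boxes_R by (auto simp: ports_iff simp del: boxes_simp)
  then show "(posS b', j) \<in> ports c R"
    using assms box_R_S[of b'] posS_nonzero[of b'] by (auto simp: ports_iff)
  show "strand_at R (posS b') j = f (Inr (strand_at S b' j))"
    using assms strand_at_S[of b' j] by (simp add: ports_iff)
qed

lemma origin_not_range_T:
  assumes "(b', j) \<in> ports c T" "b' \<noteq> i"
  shows "Inl (strand_at T b' j) \<notin> Range (next_strand c)"
  using assms port_unique[OF planar_T assms(1)] unfolding next_strand_def by auto

lemma origin_not_range_S:
  assumes "(b', j) \<in> ports c S" "b' \<noteq> 0"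
  shows "Inr (strand_at S b' j) \<notin> Range (next_strand c)"
  using assms port_unique[OF planar_S assms(1)] unfolding next_strand_def
  by (auto simp: interface_ports)

lemma rtrancl_not_Range: "(x, y) \<in> N\<^sup>* ==> y \<notin> Range N ==> x = y"
  by (erule rtranclE) auto

lemma f_eq_no_range:
  assumes "f x = f y" "x \<in> strands T <+> strands S" "y \<in> strands T <+> strands S"
    "x \<notin> Range (next_strand c)" "y \<notin> Range (next_strand c)"
  shows "x = y"
proof -
  have "(x, y) \<in> (next_strand c \<union> (next_strand c)\<inverse>)\<^sup>*"
    using f_eq assms(1-3) unfolding next_strand_glue[of c] by blast
  then have "(x, y) \<in> (next_strand c)\<^sup>* \<or> (y, x) \<in> (next_strand c)\<^sup>*"
    by (intro single_valued_zigzag) (simp_all add: next_strand_converse next_strand_single_valued)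
  then show ?thesis using rtrancl_not_Range[OF _ assms(4)] rtrancl_not_Range[OF _ assms(5)] by blast
qed

lemma port_strand_in:
  "(b, j) \<in> ports c T ==> strand_at T b j \<in> strands T"
  "(b, j) \<in> ports c S ==> strand_at S b j \<in> strands S"
  using T_D(11) S_D(11) by (auto simp: ports_iff)

lemma ports_R_inj: "inj_on (case_prod (strand_at R)) (ports c R)"
proof (rule inj_onI, clarify)
  fix b j b' j'
  assume p: "(b, j) \<in> ports c R" "(b', j') \<in> ports c R" and eq: "strand_at R b j = strand_at R b' j'"
  from p(1) show "b = b' \<and> j = j'"
  proof (cases rule: port_R_origin)
    case (T d)
    note 1 = this
    from p(2) show ?thesis
    proof (cases rule: port_R_origin)
      case (T d')
      have "Inl (strand_at T d j) = (Inl (strand_at T d' j') :: nat + nat)"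
        by (rule f_eq_no_range[where c = c])
          (use 1 T eq port_strand_in(1)[OF 1(2)] port_strand_in(1)[OF T(2)]
            origin_not_range_T[OF 1(2,3)] origin_not_range_T[OF T(2,3)] in
            \<open>simp_all add: Inl_in_Plus_iff\<close>)
      then show ?thesis using port_unique[OF planar_T 1(2) T(2)] 1 T by simp
    next
      case (S d')
      have "Inl (strand_at T d j) = (Inr (strand_at S d' j') :: nat + nat)"
        by (rule f_eq_no_range[where c = c])
          (use 1 S eq port_strand_in(1)[OF 1(2)] port_strand_in(2)[OF S(2)]
            origin_not_range_T[OF 1(2,3)] origin_not_range_S[OF S(2,3)] in
            \<open>simp_all add: Inl_in_Plus_iff Inr_in_Plus_iff\<close>)
      then show ?thesis by simp
    qed
  next
    case (S d)
    note 1 = this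
    from p(2) show ?thesis
    proof (cases rule: port_R_origin)
      case (T d')
      have "Inr (strand_at S d j) = (Inl (strand_at T d' j') :: nat + nat)"
        by (rule f_eq_no_range[where c = c])
          (use 1 T eq port_strand_in(2)[OF 1(2)] port_strand_in(1)[OF T(2)]
            origin_not_range_S[OF 1(2,3)] origin_not_range_T[OF T(2,3)] in
            \<open>simp_all add: Inl_in_Plus_iff Inr_in_Plus_iff\<close>)
      then show ?thesis by simp
    next
      case (S d')
      have "Inr (strand_at S d j) = (Inr (strand_at S d' j') :: nat + nat)"
        by (rule f_eq_no_range[where c = c])
          (use 1 S eq port_strand_in(2)[OF 1(2)] port_strand_in(2)[OF S(2)]
            origin_not_range_S[OF 1(2,3)] origin_not_range_S[OF S(2,3)] in
            \<open>simp_all add: Inr_in_Plus_iff\<close>)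
      then show ?thesis using port_unique[OF planar_S 1(2) S(2)] 1 S by simp
    qed
  qed
qed

lemma attached_end:
  assumes "planar_tangle M" "s \<in> case_prod (strand_at M) ` ports c M"
  obtains b j where "(b, j) \<in> ports d M" "s = strand_at M b j"
  using assms planar_ports(2)[OF assms(1), of c d] by auto

lemma ports_R_image: "case_prod (strand_at R) ` ports c R \<subseteq> case_prod (strand_at R) ` ports (\<not> c) R"
proof clarify
  fix b j assume bj: "(b, j) \<in> ports c R"
  define At where "At = Inl ` case_prod (strand_at T) ` ports c T \<union>
    Inr ` case_prod (strand_at S) ` ports c S"
  have "\<exists>x. x \<in> At \<and> x \<in> strands T <+> strands S \<and> strand_at R b j = f x \<and> x \<notin> Range (next_strand c)"
    using bj
  proof (cases rule: port_R_origin)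
    case (T b')
    then show ?thesis using origin_not_range_T[of b' j c] port_strand_in(1)[of b' j c]
      by (intro exI[of _ "Inl (strand_at T b' j)"]) (auto simp: At_def)
  next
    case (S b')
    then show ?thesis using origin_not_range_S[of b' j c] port_strand_in(2)[of b' j c]
      by (intro exI[of _ "Inr (strand_at S b' j)"]) (auto simp: At_def)
  qed
  then obtain x where x: "x \<in> At" "x \<in> strands T <+> strands S" "strand_at R b j = f x"
    "x \<notin> Range (next_strand c)" by blast
  have "\<exists>y\<in>strands T <+> strands S. (x, y) \<in> (next_strand c)\<^sup>* \<and> y \<notin> Domain (next_strand c)"
    by (rule chain_has_end)
      (use T_D(1) S_D(1) x next_strand_subset in
        \<open>auto simp: next_strand_converse next_strand_single_valued simp del: Domain_Un_eq\<close>)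
  then obtain y where y: "y \<in> strands T <+> strands S" "(x, y) \<in> (next_strand c)\<^sup>*"
    "y \<notin> Domain (next_strand c)" by blast
  have "(x, y) \<in> (next_strand c \<union> (next_strand c)\<inverse>)\<^sup>*"
    using y(2) by (meson in_rtrancl_UnI)
  then have fxy: "f x = f y" using f_eq x(2) y(1) unfolding next_strand_glue[of c] by blast
  have "y \<in> At"
    using y(2)
  proof (cases rule: rtranclE)
    case (step z)
    from step(2) consider j where "y = Inr (strand_at S 0 j)" "(0, j) \<in> ports c S"
      | j where "y = Inl (strand_at T i j)" "(i, j) \<in> ports c T"
      unfolding next_strand_def using interface_ports[of _ "\<not> c"] by auto
    then show ?thesis by cases (force simp: At_def)+
  qed (use x in simp)
  then consider (T) s where "y = Inl s" "s \<in> case_prod (strand_at T) ` ports c T"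
    | (S) s where "y = Inr s" "s \<in> case_prod (strand_at S) ` ports c S"
    unfolding At_def by blast
  then show "strand_at R b j \<in> case_prod (strand_at R) ` ports (\<not> c) R"
  proof cases
    case T
    from attached_end[OF planar_T T(2), of "\<not> c"] obtain b' j' where
      b': "(b', j') \<in> ports (\<not> c) T" "s = strand_at T b' j'" by blast
    have "b' \<noteq> i" using b' y(3) T(1) unfolding next_strand_def by auto
    from port_R_T[OF b'(1) this] have "(posT b', j') \<in> ports (\<not> c) R"
      "strand_at R (posT b') j' = strand_at R b j"
      using x(3) fxy T(1) b'(2) by simp_all
    then show ?thesis by force
  next
    case S
    from attached_end[OF planar_S S(2), of "\<not> c"] obtain b' j' where
      b': "(b', j') \<in> ports (\<not> c) S" "s = strand_at S b' j'" by blast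
    have "b' \<noteq> 0" using b' y(3) S(1) unfolding next_strand_def by (auto simp: interface_ports)
    from port_R_S[OF b'(1) this] have "(posS b', j') \<in> ports (\<not> c) R"
      "strand_at R (posS b') j' = strand_at R b j"
      using x(3) fxy S(1) b'(2) by simp_all
    then show ?thesis by force
  qed
qed

lemma connected_R:
  assumes B: "B \<subseteq> regions R" "B \<noteq> {}"
    and sides: "\<forall>s\<in>strands R. uside R s \<in> B \<longleftrightarrow> sside R s \<in> B"
  shows "B = regions R"
proof -
  define BT where "BT = {r \<in> regions T. g (Inl r) \<in> B}"
  define BS where "BS = {r \<in> regions S. g (Inr r) \<in> B}"
  have T: "BT = regions T" if "BT \<noteq> {}"
  proof (rule planar_connected[OF planar_T _ that])
    fix s assume s: "s \<in> strands T"
    show "uside T s \<in> BT \<longleftrightarrow> sside T s \<in> BT"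
      using bspec[OF sides in_R(1)[OF s]] sides_T[OF s] T_D(4,7)[OF s] by (simp add: BT_def)
  qed (auto simp: BT_def)
  have S: "BS = regions S" if "BS \<noteq> {}"
  proof (rule planar_connected[OF planar_S _ that])
    fix s assume s: "s \<in> strands S"
    show "uside S s \<in> BS \<longleftrightarrow> sside S s \<in> BS"
      using bspec[OF sides in_R(2)[OF s]] sides_S[OF s] S_D(4,7)[OF s] by (simp add: BS_def)
  qed (auto simp: BS_def)
  have link: "region_at T i 0 \<in> BT \<longleftrightarrow> region_at S 0 0 \<in> BS"
    using interface_regions[of 0] g_interface[of 0] by (simp add: BT_def BS_def)
  have "BT \<noteq> {} \<or> BS \<noteq> {}"
  proof -
    obtain r where r: "r \<in> B" using B(2) by blast
    then have "r \<in> regions R" using B(1) by blast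
    then show ?thesis by (cases rule: region_R_cases) (use r in \<open>auto simp: BT_def BS_def\<close>)
  qed
  then have "BT = regions T" "BS = regions S"
    using T S link interface_regions(1,2)[of 0] by auto
  then have "regions R \<subseteq> B" by (auto simp: BT_def BS_def elim!: region_R_cases)
  then show ?thesis using B(1) by blast
qed

text \<open>
A set of strands of the composite restricts to sets of strands of \<open>T\<close> and \<open>S\<close> that are even at
every box away from the interface, hence even at the interface as well, because the ends of strands
come in pairs. The sets of regions that they separate jump at the same points of the interface.
Thus along the interface they agree or are complementary, and after complementing one of them
they can be glued.
\<close>

lemma jordan_R:
  assumes A: "A \<subseteq> strands R"
    and ev: "\<forall>b\<in>boxes R. even (card {j \<in> points (box R b). strand_at R b j \<in> A})"
  shows "\<exists>B\<subseteq>regions R. \<forall>s\<in>strands R. s \<in> A \<longleftrightarrow> (uside R s \<in> B) \<noteq> (sside R s \<in> B)"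
proof -
  define AT where "AT = {s \<in> strands T. f (Inl s) \<in> A}"
  define AS where "AS = {s \<in> strands S. f (Inr s) \<in> A}"
  have evT: "even (card {j \<in> points (box T b). strand_at T b j \<in> AT})" if b: "b \<in> boxes T - {i}" for b
  proof -
    have "posT b \<in> boxes R" using b boxes_R by blast
    then have "even (card {j \<in> points (box T b). strand_at R (posT b) j \<in> A})"
      using ev box_R_T[OF b] by metis
    moreover have "{j \<in> points (box T b). strand_at R (posT b) j \<in> A} =
        {j \<in> points (box T b). strand_at T b j \<in> AT}"
      using strand_at_T[OF b] T_D(11)[of b] b by (auto simp: AT_def)
    ultimately show ?thesis by simp
  qed
  have evS: "even (card {j \<in> points (box S b). strand_at S b j \<in> AS})" if b: "b \<in> boxes S - {0}" for b
  proof -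
    have "posS b \<in> boxes R" using b boxes_R by blast
    then have "even (card {j \<in> points (box S b). strand_at R (posS b) j \<in> A})"
      using ev box_R_S[OF b] by metis
    moreover have "{j \<in> points (box S b). strand_at R (posS b) j \<in> A} =
        {j \<in> points (box S b). strand_at S b j \<in> AS}"
      using strand_at_S[OF b] S_D(11)[of b] b by (auto simp: AS_def)
    ultimately show ?thesis by simp
  qed
  have evS0: "even (card {j \<in> points (box S 0). strand_at S 0 j \<in> AS})"
  proof -
    let ?c = "\<lambda>b. card {j \<in> points (box S b). strand_at S b j \<in> AS}"
    have "boxes S = insert 0 (boxes S - {0})" by auto
    then have "(\<Sum>b\<in>boxes S. ?c b) = ?c 0 + (\<Sum>b\<in>boxes S - {0}. ?c b)"
      by (subst sum.remove[of _ 0]) (auto simp: boxes_def)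
    moreover have "even (\<Sum>b\<in>boxes S - {0}. ?c b)" using evS by (intro dvd_sum) auto
    ultimately show ?thesis using ports_count_even[OF planar_S, of AS] by simp
  qed
  have iface: "strand_at T i j \<in> AT \<longleftrightarrow> strand_at S 0 j \<in> AS" if "j \<in> points (outer S)" for j
    using f_interface[OF that] interface_sides(1,2)[OF that] by (simp add: AT_def AS_def)
  have evTi: "even (card {j \<in> points (box T i). strand_at T i j \<in> AT})"
  proof -
    have "{j \<in> points (box T i). strand_at T i j \<in> AT} = {j \<in> points (box S 0). strand_at S 0 j \<in> AS}"
      using iface by (auto simp: box_i outer_box)
    then show ?thesis using evS0 by simp
  qed
  have allT: "even (card {j \<in> points (box T b). strand_at T b j \<in> AT})" if "b \<in> boxes T" for b
    using evT[of b] evTi that by (cases "b = i") simp_all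
  have allS: "even (card {j \<in> points (box S b). strand_at S b j \<in> AS})" if "b \<in> boxes S" for b
    using evS[of b] evS0 that by (cases "b = 0") simp_all
  have AT_sub: "AT \<subseteq> strands T" and AS_sub: "AS \<subseteq> strands S"
    by (simp_all add: AT_def AS_def)
  obtain BT where BT: "BT \<subseteq> regions T"
    "!!s. s \<in> strands T ==> s \<in> AT \<longleftrightarrow> (uside T s \<in> BT) \<noteq> (sside T s \<in> BT)"
    using planar_jordan[OF planar_T AT_sub allT] by blast
  obtain BS0 where BS0: "BS0 \<subseteq> regions S"
    "!!s. s \<in> strands S ==> s \<in> AS \<longleftrightarrow> (uside S s \<in> BS0) \<noteq> (sside S s \<in> BS0)"
    using planar_jordan[OF planar_S AS_sub allS] by blast
  define BS where "BS = (if region_at T i 0 \<in> BT \<longleftrightarrow> region_at S 0 0 \<in> BS0 then BS0 else regions S - BS0)"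
  have BS: "BS \<subseteq> regions S"
    "s \<in> strands S ==> s \<in> AS \<longleftrightarrow> (uside S s \<in> BS) \<noteq> (sside S s \<in> BS)" for s
    using BS0 S_D(4,7)[of s] by (auto simp: BS_def)
  have BS_0: "region_at T i 0 \<in> BT \<longleftrightarrow> region_at S 0 0 \<in> BS"
    using interface_regions[of 0] by (auto simp: BS_def)
  have step: "(region_at T i (j - 1) \<in> BT) \<noteq> (region_at T i j \<in> BT) \<longleftrightarrow>
      (region_at S 0 (j - 1) \<in> BS) \<noteq> (region_at S 0 j \<in> BS)" if j: "j \<in> points (outer S)" for j
  proof -
    note sd = interface_sides[OF j]
    have "(region_at T i (u_interval (outer S) j) \<in> BT) \<noteq> (region_at T i (s_interval (outer S) j) \<in> BT)
       \<longleftrightarrow> (region_at S 0 (u_interval (outer S) j) \<in> BS) \<noteq> (region_at S 0 (s_interval (outer S) j) \<in> BS)"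
      using BT(2)[OF sd(1)] BS(2)[OF sd(2)] iface[OF j] unfolding sd(3-6) by simp
    then show ?thesis by (auto simp: u_interval_def s_interval_def split: if_splits)
  qed
  have agree: "region_at T i j \<in> BT \<longleftrightarrow> region_at S 0 j \<in> BS" if "j \<in> intervals (outer S)" for j
    using that
  proof (induction j)
    case (Suc j)
    then have "Suc j \<in> points (outer S)" "j \<in> intervals (outer S)"
      by (auto simp: points_def intervals_def)
    then show ?case using step[of "Suc j"] Suc.IH by auto
  qed (rule BS_0)
  define B where "B = g ` (BT <+> BS)"
  have B_iff: "g x \<in> B \<longleftrightarrow> x \<in> BT <+> BS" if x: "x \<in> regions T <+> regions S" for x
  proof
    assume "g x \<in> B"
    then obtain y where y: "y \<in> BT <+> BS" "g x = g y" unfolding B_def by blast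
    have "y \<in> regions T <+> regions S" using y(1) BT(1) BS(1) by auto
    from g_invariant[OF y(2) x this, of "\<lambda>x. x \<in> BT <+> BS"] agree y(1)
    show "x \<in> BT <+> BS" by (simp add: Inl_in_Plus_iff Inr_in_Plus_iff)
  qed (auto simp: B_def)
  show ?thesis
  proof (intro exI[of _ B] conjI ballI)
    show "B \<subseteq> regions R" using BT(1) BS(1) unfolding B_def regions_R[symmetric] by blast
    fix s assume "s \<in> strands R"
    then show "s \<in> A \<longleftrightarrow> (uside R s \<in> B) \<noteq> (sside R s \<in> B)"
    proof (cases rule: strand_R_cases)
      case (1 s')
      then show ?thesis using BT(2)[OF 1(1)] T_D(4,7)[OF 1(1)]
        by (simp add: sides_T B_iff AT_def Inl_in_Plus_iff)
    next
      case (2 s')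
      then show ?thesis using BS(2)[OF 2(1)] S_D(4,7)[OF 2(1)]
        by (simp add: sides_S B_iff AS_def Inr_in_Plus_iff)
    qed
  qed
qed

lemma planar_R: "planar_tangle R"
  unfolding planar_tangle_def
proof (intro conjI ballI)
  show "finite (strands R)" unfolding strands_R[symmetric] using T_D(1) S_D(1) by simp
  show "finite (regions R)" unfolding regions_R[symmetric] using T_D(2) S_D(2) by simp
  show "shaded R \<subseteq> regions R"
    unfolding shaded_R[symmetric] regions_R[symmetric] using T_D(3) S_D(3) by (intro image_mono) auto
  show "uside R s \<in> regions R - shaded R" "sside R s \<in> shaded R" if "s \<in> strands R" for s
    using that
    by (cases rule: strand_R_cases;
        simp add: sides_T sides_S in_R shaded_iff T_D S_D Inl_in_Plus_iff Inr_in_Plus_iff)+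
  fix b assume b: "b \<in> boxes R"
  show "region_at R b j \<in> regions R" "region_at R b j \<in> shaded R \<longleftrightarrow> shaded_interval (box R b) j"
    if "j \<in> intervals (box R b)" for j
    using b that
    by (cases rule: boxes_R_cases;
        simp add: box_R_T box_R_S region_at_T region_at_S in_R shaded_iff T_D S_D
          Inl_in_Plus_iff Inr_in_Plus_iff)+
  show "region_at R b (2 * fst (box R b)) = region_at R b 0"
    using b
    by (cases rule: boxes_R_cases;
        simp add: box_R_T box_R_S region_at_T region_at_S T_D S_D intervals_def)
  fix j assume j: "j \<in> points (box R b)"
  show "strand_at R b j \<in> strands R"
    "uside R (strand_at R b j) = region_at R b (u_interval (box R b) j)"
    "sside R (strand_at R b j) = region_at R b (s_interval (box R b) j)"
    using b j
    by (cases rule: boxes_R_cases;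
        simp add: box_R_T box_R_S region_at_T region_at_S strand_at_T strand_at_S in_R T_D S_D
          sides_T sides_S u_interval_in s_interval_in)+
next
  show "inj_on (case_prod (strand_at R)) (starts R)" using ports_R_inj[of True] by (simp add: ports_def)
  show "inj_on (case_prod (strand_at R)) (ends R)" using ports_R_inj[of False] by (simp add: ports_def)
  show "case_prod (strand_at R) ` starts R = case_prod (strand_at R) ` ends R"
    using ports_R_image[of True] ports_R_image[of False] by (simp add: ports_def)
  show "\<forall>B\<subseteq>regions R. B \<noteq> {} \<and> (\<forall>s\<in>strands R. uside R s \<in> B \<longleftrightarrow> sside R s \<in> B) --> B = regions R"
    using connected_R by blast
  show "\<forall>A\<subseteq>strands R. (\<forall>b\<in>boxes R. even (card {j \<in> points (box R b). strand_at R b j \<in> A})) -->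
      (\<exists>B\<subseteq>regions R. \<forall>s\<in>strands R. s \<in> A \<longleftrightarrow> (uside R s \<in> B) \<noteq> (sside R s \<in> B))"
    using jordan_R by blast
qed

end

theorem planar_composite:
  assumes "planar_tangle T" "planar_tangle S" "composite T i S R"
  shows "planar_tangle R"
proof -
  obtain f g where "tangle_composite T i S R f g" using assms(3) composite_iff by blast
  then interpret planar_composite T i S R f g
    using assms(1,2) by (simp add: planar_composite_def planar_composite_axioms_def)
  show ?thesis by (rule planar_R)
qed

subsection \<open>Existence of composites\<close>

definition glue_name :: "(nat \<times> nat) set => nat + nat => nat" where
  "glue_name r x = (LEAST n. \<exists>y. sum_encode y = n \<and> (x, y) \<in> glue r)"

lemma glue_name_eq: "glue_name r x = glue_name r y \<longleftrightarrow> (x, y) \<in> glue r"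
proof
  have ex: "\<exists>z. sum_encode z = glue_name r x \<and> (x, z) \<in> glue r" for x
    unfolding glue_name_def by (rule LeastI_ex) (use glue_refl in blast)
  assume "glue_name r x = glue_name r y"
  moreover obtain z where "sum_encode z = glue_name r x" "(x, z) \<in> glue r" using ex by blast
  moreover obtain z' where "sum_encode z' = glue_name r y" "(y, z') \<in> glue r" using ex by blast
  ultimately show "(x, y) \<in> glue r" by (metis glue_sym glue_trans sum_encode_inverse)
next
  assume "(x, y) \<in> glue r"
  then have "(x, z) \<in> glue r \<longleftrightarrow> (y, z) \<in> glue r" for z by (meson glue_sym glue_trans)
  then show "glue_name r x = glue_name r y" unfolding glue_name_def by simp
qed

theorem composite_exists:
  assumes T: "planar_tangle T" and S: "planar_tangle S"
    and i: "i \<in> {1..length (inner T)}" and box: "box T i = outer S"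
  shows "\<exists>R. composite T i S R \<and> planar_tangle R"
proof -
  define f where "f = glue_name ((\<lambda>j. (strand_at T i j, strand_at S 0 j)) ` points (outer S))"
  define g where "g = glue_name ((\<lambda>j. (region_at T i j, region_at S 0 j)) ` intervals (outer S))"
  define preimage where "preimage = (\<lambda>t. SOME x. x \<in> strands T <+> strands S \<and> f x = t)"
  define side :: "(tangle => nat => nat) => nat + nat => nat + nat" where
    "side sd x = map_sum (sd T) (sd S) x" for sd x
  define R where "R = \<lparr>outer = outer T, inner = take (i - 1) (inner T) @ inner S @ drop i (inner T),
    strands = f ` (strands T <+> strands S), regions = g ` (regions T <+> regions S),
    shaded = g ` (shaded T <+> shaded S),
    uside = (\<lambda>t. g (side uside (preimage t))), sside = (\<lambda>t. g (side sside (preimage t))),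
    strand_at = (\<lambda>b j. f (if b < i then Inl (strand_at T b j)
       else if b < i + length (inner S) then Inr (strand_at S (b + 1 - i) j)
       else Inl (strand_at T (b + 1 - length (inner S)) j))),
    region_at = (\<lambda>b j. g (if b < i then Inl (region_at T b j)
       else if b < i + length (inner S) then Inr (region_at S (b + 1 - i) j)
       else Inl (region_at T (b + 1 - length (inner S)) j)))\<rparr>"
  have "i \<in> boxes T" using i by simp
  note iT = planar_tangleD(12,13)[OF T this, unfolded box]
  have "0 \<in> boxes S" "box S 0 = outer S" by (simp_all add: box_def)
  note iS = planar_tangleD(12,13)[OF S this(1), unfolded this(2)]
  have g_glue: "g (Inl (region_at T i j)) = g (Inr (region_at S 0 j))" if "j \<in> intervals (outer S)" for j
    unfolding g_def glue_name_eq using that by (intro glue_base) auto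
  have g_side: "g (side sd x) = g (side sd y)" if "f x = f y" "sd = uside \<or> sd = sside" for sd x y
  proof (rule glue_invariant[where \<phi> = "\<lambda>x. g (side sd x)"])
    show "(x, y) \<in> glue ((\<lambda>j. (strand_at T i j, strand_at S 0 j)) ` points (outer S))"
      using that(1) unfolding f_def glue_name_eq .
    fix a b assume "(a, b) \<in> (\<lambda>j. (strand_at T i j, strand_at S 0 j)) ` points (outer S)"
    then obtain j where j: "j \<in> points (outer S)" "a = strand_at T i j" "b = strand_at S 0 j" by blast
    show "g (side sd (Inl a)) = g (side sd (Inr b))"
      using that(2) iT[OF j(1)] iS[OF j(1)] g_glue u_interval_in[OF j(1)] s_interval_in[OF j(1)]
      unfolding side_def j(2,3) by auto
  qed
  have pre: "preimage (f x) \<in> strands T <+> strands S \<and> f (preimage (f x)) = f x"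
    if "x \<in> strands T <+> strands S" for x
    unfolding preimage_def by (rule someI_ex) (use that in blast)
  have sides: "g (side sd (preimage (f x))) = g (side sd x)"
    if "x \<in> strands T <+> strands S" "sd = uside \<or> sd = sside" for x sd
    using g_side pre that by blast
  have "tangle_composite T i S R f g"
  proof unfold_locales
    show "\<forall>x\<in>strands T <+> strands S. \<forall>y\<in>strands T <+> strands S. f x = f y \<longleftrightarrow>
      (x, y) \<in> glue ((\<lambda>j. (strand_at T i j, strand_at S 0 j)) ` points (outer S))"
      unfolding f_def glue_name_eq by simp
    show "\<forall>x\<in>regions T <+> regions S. \<forall>y\<in>regions T <+> regions S. g x = g y \<longleftrightarrow>
      (x, y) \<in> glue ((\<lambda>j. (region_at T i j, region_at S 0 j)) ` intervals (outer S))"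
      unfolding g_def glue_name_eq by simp
    show "uside R (f (Inl s)) = g (Inl (uside T s))" "sside R (f (Inl s)) = g (Inl (sside T s))"
      if "s \<in> strands T" for s
      using sides[of "Inl s" uside] sides[of "Inl s" sside] that by (simp_all add: R_def side_def InlI)
    show "uside R (f (Inr s)) = g (Inr (uside S s))" "sside R (f (Inr s)) = g (Inr (sside S s))"
      if "s \<in> strands S" for s
      using sides[of "Inr s" uside] sides[of "Inr s" sside] that by (simp_all add: R_def side_def InrI)
    show "strand_at R b j = f (Inl (strand_at T b j))" "region_at R b j = g (Inl (region_at T b j))"
      if "b < i" for b j
      using that by (simp_all add: R_def)
    show "strand_at R (i + b - 1) j = f (Inr (strand_at S b j))"
      "region_at R (i + b - 1) j = g (Inr (region_at S b j))" if "b \<in> {1..length (inner S)}" for b j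
    proof -
      have "\<not> i + b - 1 < i" "i + b - 1 < i + length (inner S)" "i + b - 1 + 1 - i = b" using that i by auto
      then show "strand_at R (i + b - 1) j = f (Inr (strand_at S b j))"
        "region_at R (i + b - 1) j = g (Inr (region_at S b j))" unfolding R_def by simp_all
    qed
    show "strand_at R (b + length (inner S) - 1) j = f (Inl (strand_at T b j))"
      "region_at R (b + length (inner S) - 1) j = g (Inl (region_at T b j))"
      if "b \<in> {i<..length (inner T)}" for b j
    proof -
      define d where "d = b + length (inner S) - 1"
      have "\<not> d < i" "\<not> d < i + length (inner S)" "d + 1 - length (inner S) = b"
        using that i by (auto simp: d_def)
      then show "strand_at R (b + length (inner S) - 1) j = f (Inl (strand_at T b j))"
        "region_at R (b + length (inner S) - 1) j = g (Inl (region_at T b j))"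
        unfolding d_def[symmetric] R_def by simp_all
    qed
  qed (use i box in \<open>simp_all add: R_def\<close>)
  then have "composite T i S R" unfolding composite_iff by blast
  then show ?thesis using planar_composite[OF T S] by blast
qed

section \<open>Incidence systems\<close>

text \<open>
The incidences are recorded by names at the \<open>4 k + 1\<close> positions around a box: the even
positions are the intervals, the odd ones the points. The positions \<open>0\<close> and \<open>4 k\<close> both stand for
the starred interval.
\<close>

definition nodes :: "tangle => (nat \<times> nat) set" where
  "nodes T = {(b, p). b \<in> boxes T \<and> p \<le> 4 * fst (box T b)}"

definition name :: "tangle => nat \<times> nat => nat + nat" where
  "name T = (\<lambda>(b, p). if even p then Inr (region_at T b (p div 2))
                      else Inl (strand_at T b (Suc p div 2)))"

definition attached :: "tangle => bool" where
  "attached T \<longleftrightarrow>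
     (\<forall>s\<in>strands T. \<exists>b\<in>boxes T. \<exists>j\<in>points (box T b). s = strand_at T b j) \<and>
     (\<forall>r\<in>regions T. \<exists>b\<in>boxes T. \<exists>j\<in>intervals (box T b). r = region_at T b j)"

lemma attached_strandE:
  assumes "attached T" "s \<in> strands T"
  obtains b j where "b \<in> boxes T" "j \<in> points (box T b)" "s = strand_at T b j"
proof -
  have "\<forall>s\<in>strands T. \<exists>b\<in>boxes T. \<exists>j\<in>points (box T b). s = strand_at T b j"
    using assms(1) unfolding attached_def by (elim conjE)
  then show thesis using assms(2) that by blast
qed

lemma attached_regionE:
  assumes "attached T" "r \<in> regions T"
  obtains b j where "b \<in> boxes T" "j \<in> intervals (box T b)" "r = region_at T b j"
proof -
  have "\<forall>r\<in>regions T. \<exists>b\<in>boxes T. \<exists>j\<in>intervals (box T b). r = region_at T b j"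
    using assms(1) unfolding attached_def by (elim conjE)
  then show thesis using assms(2) that by blast
qed

type_synonym system = "(nat \<times> nat => nat + nat) => bool"

text \<open>
A system is a set of equations between names. It presents \<open>T\<close> if the names of \<open>T\<close> are its universal
solution: positions of \<open>T\<close> share a strand or region exactly if every solution gives them the same
name. Closure under renaming \<open>h\<close> ensures that only equations are involved.
\<close>

definition presented :: "tangle => system => bool" where
  "presented T Q \<longleftrightarrow> attached T \<and> Q (name T) \<and> (\<forall>\<phi> h. Q \<phi> --> Q (h \<circ> \<phi>)) \<and>
     (\<forall>\<phi>. Q \<phi> --> (\<forall>u\<in>nodes T. \<forall>v\<in>nodes T. name T u = name T v --> \<phi> u = \<phi> v))"

lemma presentedD:
  assumes "presented T Q"
  shows "attached T" "Q (name T)" "!!\<phi> h. Q \<phi> ==> Q (h \<circ> \<phi>)"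
    "!!\<phi> u v. Q \<phi> ==> u \<in> nodes T ==> v \<in> nodes T ==> name T u = name T v ==> \<phi> u = \<phi> v"
  using assms unfolding presented_def by blast+

lemma presented_cong: "presented T Q ==> (!!\<phi>. Q \<phi> = Q' \<phi>) ==> presented T Q'"
  unfolding presented_def by simp

lemma node_even: "(b, 2 * j) \<in> nodes T \<longleftrightarrow> b \<in> boxes T \<and> j \<in> intervals (box T b)"
  by (auto simp: nodes_def intervals_def)

lemma node_odd: "0 < j ==> (b, 2 * j - Suc 0) \<in> nodes T \<longleftrightarrow> b \<in> boxes T \<and> j \<in> points (box T b)"
  by (auto simp: nodes_def points_def)

lemma name_even [simp]: "name T (b, 2 * j) = Inr (region_at T b j)"
  by (simp add: name_def)

lemma name_odd: "0 < j ==> name T (b, 2 * j - Suc 0) = Inl (strand_at T b j)"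
  by (cases j) (auto simp: name_def)

lemma pos_cases [case_names even odd]:
  fixes p :: nat
  obtains (even) j where "p = 2 * j" | (odd) j where "0 < j" "p = 2 * j - 1"
proof (cases "even p")
  case True
  then show thesis using even by (elim evenE) blast
next
  case False
  then obtain k where "p = 2 * k + 1" by (elim oddE)
  then show thesis using odd[of "Suc k"] by simp
qed

lemma (in planar_composite) composite_presented:
  assumes QT: "presented T QT" and QS: "presented S QS"
    and touch: "(\<forall>p\<le>4 * fst (outer S). \<exists>u\<in>nodes T. fst u \<noteq> i \<and> name T (i, p) = name T u) \<or>
      (\<forall>p\<le>4 * fst (outer S). \<exists>u\<in>nodes S. fst u \<noteq> 0 \<and> name S (0, p) = name S u)"
  shows "presented R (\<lambda>\<psi>. \<exists>\<phi> \<chi>. QT \<phi> \<and> QS \<chi> \<and> (\<forall>p\<le>4 * fst (outer S). \<phi> (i, p) = \<chi> (0, p)) \<and>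
      (\<forall>b\<in>boxes T - {i}. \<forall>p\<le>4 * fst (box T b). \<psi> (posT b, p) = \<phi> (b, p)) \<and>
      (\<forall>b\<in>boxes S - {0}. \<forall>p\<le>4 * fst (box S b). \<psi> (posS b, p) = \<chi> (b, p)))"
    (is "presented R ?Q")
proof -
  note T_pres = presentedD[OF QT] and S_pres = presentedD[OF QS]
  define hT :: "nat + nat => nat + nat" where "hT = map_sum (\<lambda>s. f (Inl s)) (\<lambda>r. g (Inl r))"
  define hS :: "nat + nat => nat + nat" where "hS = map_sum (\<lambda>s. f (Inr s)) (\<lambda>r. g (Inr r))"
  have iface: "hT (name T (i, p)) = hS (name S (0, p))" if "p \<le> 4 * fst (outer S)" for p
  proof (cases p rule: pos_cases)
    case (even j)
    then show ?thesis using that g_interface[of j] by (simp add: hT_def hS_def intervals_def)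
  next
    case (odd j)
    then show ?thesis using that f_interface[of j]
      by (simp add: hT_def hS_def name_odd points_def)
  qed
  have nameT: "name R (posT b, p) = hT (name T (b, p))"
    if "b \<in> boxes T - {i}" "p \<le> 4 * fst (box T b)" for b p
  proof (cases p rule: pos_cases)
    case (even j)
    then show ?thesis using that region_at_T[of b j] by (simp add: hT_def intervals_def)
  next
    case (odd j)
    then show ?thesis using that strand_at_T[of b j] by (simp add: hT_def name_odd points_def)
  qed
  have nameS: "name R (posS b, p) = hS (name S (b, p))"
    if "b \<in> boxes S - {0}" "p \<le> 4 * fst (box S b)" for b p
  proof (cases p rule: pos_cases)
    case (even j)
    then show ?thesis using that region_at_S[of b j] by (simp add: hS_def intervals_def)
  next
    case (odd j)
    then show ?thesis using that strand_at_S[of b j] by (simp add: hS_def name_odd points_def)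
  qed
  have Qn: "?Q (name R)"
    by (rule exI[of _ "hT \<circ> name T"], rule exI[of _ "hS \<circ> name S"])
      (use T_pres(2,3) S_pres(2,3) iface nameT nameS in auto)
  have Qh: "?Q (h \<circ> \<psi>)" if "?Q \<psi>" for h \<psi>
  proof -
    from that obtain \<phi> \<chi> where "QT \<phi>" "QS \<chi>" "\<forall>p\<le>4 * fst (outer S). \<phi> (i, p) = \<chi> (0, p)"
      "\<forall>b\<in>boxes T - {i}. \<forall>p\<le>4 * fst (box T b). \<psi> (posT b, p) = \<phi> (b, p)"
      "\<forall>b\<in>boxes S - {0}. \<forall>p\<le>4 * fst (box S b). \<psi> (posS b, p) = \<chi> (b, p)" by blast
    then show ?thesis
      by (intro exI[of _ "h \<circ> \<phi>"] exI[of _ "h \<circ> \<chi>"]) (use T_pres(3) S_pres(3) in auto)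
  qed
  have att: "attached R"
  proof -
    define orig where "orig x \<longleftrightarrow> (\<exists>u\<in>nodes R. name R u = x)" for x
    have orig_T: "orig (hT (name T u))" if "u \<in> nodes T" "fst u \<noteq> i" for u
    proof -
      obtain b p where u: "u = (b, p)" by (cases u)
      have "b \<in> boxes T - {i}" "p \<le> 4 * fst (box T b)" using that u by (auto simp: nodes_def)
      moreover from this have "(posT b, p) \<in> nodes R"
        using box_R_T[of b] boxes_R by (auto simp: nodes_def simp del: boxes_simp)
      ultimately show ?thesis using nameT[of b p] u unfolding orig_def by force
    qed
    have orig_S: "orig (hS (name S u))" if "u \<in> nodes S" "fst u \<noteq> 0" for u
    proof -
      obtain b p where u: "u = (b, p)" by (cases u)
      have "b \<in> boxes S - {0}" "p \<le> 4 * fst (box S b)" using that u by (auto simp: nodes_def)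
      moreover from this have "(posS b, p) \<in> nodes R"
        using box_R_S[of b] boxes_R by (auto simp: nodes_def simp del: boxes_simp)
      ultimately show ?thesis using nameS[of b p] u unfolding orig_def by force
    qed
    have orig_i: "orig (hT (name T (i, p)))" if p: "p \<le> 4 * fst (outer S)" for p
      using touch
    proof
      assume "\<forall>p\<le>4 * fst (outer S). \<exists>u\<in>nodes T. fst u \<noteq> i \<and> name T (i, p) = name T u"
      then show ?thesis using p orig_T by metis
    next
      assume "\<forall>p\<le>4 * fst (outer S). \<exists>u\<in>nodes S. fst u \<noteq> 0 \<and> name S (0, p) = name S u"
      then show ?thesis using p orig_S iface[OF p] by metis
    qed
    have T_all: "orig (hT (name T (b, p)))" if "(b, p) \<in> nodes T" for b p
      using that orig_i[of p] orig_T[of "(b, p)"] box_i by (cases "b = i") (auto simp: nodes_def)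
    have S_all: "orig (hS (name S (b, p)))" if "(b, p) \<in> nodes S" for b p
      using that orig_i[of p] iface[of p] orig_S[of "(b, p)"] outer_box(1)
      by (cases "b = 0") (auto simp: nodes_def)
    have strand: "\<exists>b\<in>boxes R. \<exists>j\<in>points (box R b). s = strand_at R b j" if "orig (Inl s)" for s
    proof -
      from that obtain b p where bp: "(b, p) \<in> nodes R" "name R (b, p) = Inl s" unfolding orig_def by auto
      show ?thesis
      proof (cases p rule: pos_cases)
        case (odd j)
        then have "j \<in> points (box R b)" "b \<in> boxes R" "s = strand_at R b j"
          using bp node_odd[of j b R] name_odd[of j R b] by simp_all
        then show ?thesis by blast
      next
        case (even j)
        then show ?thesis using bp(2) name_even[of R b j] by simp
      qed
    qed
    have region: "\<exists>b\<in>boxes R. \<exists>j\<in>intervals (box R b). r = region_at R b j" if "orig (Inr r)" for r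
    proof -
      from that obtain b p where bp: "(b, p) \<in> nodes R" "name R (b, p) = Inr r" unfolding orig_def by auto
      show ?thesis
      proof (cases p rule: pos_cases)
        case (even j)
        then have "j \<in> intervals (box R b)" "b \<in> boxes R" "r = region_at R b j"
          using bp node_even[of b j R] name_even[of R b j] by simp_all
        then show ?thesis by blast
      next
        case (odd j)
        then show ?thesis using bp(2) name_odd[of j R b] by simp
      qed
    qed
    have strand_T: "orig (Inl (f (Inl s)))" if in_set: "s \<in> strands T" for s
    proof -
      obtain b j where "b \<in> boxes T" "j \<in> points (box T b)" "s = strand_at T b j"
        by (rule attached_strandE[OF T_pres(1) in_set])
      moreover from this have "0 < j" by (simp add: points_def)
      ultimately show ?thesis using T_all[of b "2 * j - Suc 0"] node_odd[of j b T] name_odd[of j T b]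
        by (simp add: hT_def)
    qed
    have strand_S: "orig (Inl (f (Inr s)))" if in_set: "s \<in> strands S" for s
    proof -
      obtain b j where "b \<in> boxes S" "j \<in> points (box S b)" "s = strand_at S b j"
        by (rule attached_strandE[OF S_pres(1) in_set])
      moreover from this have "0 < j" by (simp add: points_def)
      ultimately show ?thesis using S_all[of b "2 * j - Suc 0"] node_odd[of j b S] name_odd[of j S b]
        by (simp add: hS_def)
    qed
    have region_T: "orig (Inr (g (Inl r)))" if in_set: "r \<in> regions T" for r
    proof -
      obtain b j where "b \<in> boxes T" "j \<in> intervals (box T b)" "r = region_at T b j"
        by (rule attached_regionE[OF T_pres(1) in_set])
      then show ?thesis using T_all[of b "2 * j"] node_even[of b j T] by (simp add: hT_def)
    qed
    have region_S: "orig (Inr (g (Inr r)))" if in_set: "r \<in> regions S" for r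
    proof -
      obtain b j where "b \<in> boxes S" "j \<in> intervals (box S b)" "r = region_at S b j"
        by (rule attached_regionE[OF S_pres(1) in_set])
      then show ?thesis using S_all[of b "2 * j"] node_even[of b j S] by (simp add: hS_def)
    qed
    show ?thesis
      unfolding attached_def
    proof (intro conjI ballI)
      fix s assume "s \<in> strands R"
      then have "orig (Inl s)" by (cases rule: strand_R_cases) (simp_all add: strand_T strand_S)
      then show "\<exists>b\<in>boxes R. \<exists>j\<in>points (box R b). s = strand_at R b j" by (rule strand)
    next
      fix r assume "r \<in> regions R"
      then have "orig (Inr r)" by (cases rule: region_R_cases) (simp_all add: region_T region_S)
      then show "\<exists>b\<in>boxes R. \<exists>j\<in>intervals (box R b). r = region_at R b j" by (rule region)
    qed
  qed
  have inv: "\<psi> u = \<psi> v"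
    if "?Q \<psi>" "u \<in> nodes R" "v \<in> nodes R" "name R u = name R v" for \<psi> u v
  proof -
    from that(1) obtain \<phi> \<chi> where QQ: "QT \<phi>" "QS \<chi>"
      and ch: "!!p. p \<le> 4 * fst (outer S) ==> \<phi> (i, p) = \<chi> (0, p)"
      and \<psi>T: "!!b p. b \<in> boxes T - {i} ==> p \<le> 4 * fst (box T b) ==> \<psi> (posT b, p) = \<phi> (b, p)"
      and \<psi>S: "!!b p. b \<in> boxes S - {0} ==> p \<le> 4 * fst (box S b) ==> \<psi> (posS b, p) = \<chi> (b, p)" by blast
    define tT where "tT x = (SOME y. \<exists>u\<in>nodes T. name T u = x \<and> y = \<phi> u)" for x
    define tS where "tS x = (SOME y. \<exists>u\<in>nodes S. name S u = x \<and> y = \<chi> u)" for x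
    have tT: "tT (name T u) = \<phi> u" if "u \<in> nodes T" for u
    proof -
      have "\<exists>w\<in>nodes T. name T w = name T u \<and> tT (name T u) = \<phi> w"
        unfolding tT_def by (rule someI_ex) (use that in blast)
      then show ?thesis using T_pres(4)[OF QQ(1)] that by metis
    qed
    have tS: "tS (name S u) = \<chi> u" if "u \<in> nodes S" for u
    proof -
      have "\<exists>w\<in>nodes S. name S w = name S u \<and> tS (name S u) = \<chi> w"
        unfolding tS_def by (rule someI_ex) (use that in blast)
      then show ?thesis using S_pres(4)[OF QQ(2)] that by metis
    qed
    have t_i: "tT (name T (i, p)) = tS (name S (0, p))" if "p \<le> 4 * fst (outer S)" for p
      using tT[of "(i, p)"] tS[of "(0, p)"] ch[OF that] that i_box outer_box
      by (simp add: nodes_def box_i)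
    define strand_val where "strand_val x = (case x of Inl s => tT (Inl s) | Inr s => tS (Inl s))"
      for x :: "nat + nat"
    define region_val where "region_val x = (case x of Inl r => tT (Inr r) | Inr r => tS (Inr r))"
      for x :: "nat + nat"
    have sv: "strand_val x = strand_val y"
      if "f x = f y" "x \<in> strands T <+> strands S" "y \<in> strands T <+> strands S" for x y
    proof (rule f_invariant[OF that])
      fix j assume "j \<in> points (outer S)"
      then have "0 < j" "2 * j - Suc 0 \<le> 4 * fst (outer S)" by (auto simp: points_def)
      then show "strand_val (Inl (strand_at T i j)) = strand_val (Inr (strand_at S 0 j))"
        using t_i[of "2 * j - Suc 0"] by (simp add: strand_val_def name_odd)
    qed
    have rv: "region_val x = region_val y"
      if "g x = g y" "x \<in> regions T <+> regions S" "y \<in> regions T <+> regions S" for x y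
    proof (rule g_invariant[OF that])
      fix j assume "j \<in> intervals (outer S)"
      then show "region_val (Inl (region_at T i j)) = region_val (Inr (region_at S 0 j))"
        using t_i[of "2 * j"] by (simp add: region_val_def intervals_def)
    qed
    have key: "(\<exists>x\<in>strands T <+> strands S. name R w = Inl (f x) \<and> \<psi> w = strand_val x) \<or>
        (\<exists>x\<in>regions T <+> regions S. name R w = Inr (g x) \<and> \<psi> w = region_val x)"
      if "w \<in> nodes R" for w
    proof -
      obtain b p where w: "w = (b, p)" by (cases w)
      have b: "b \<in> boxes R" and p: "p \<le> 4 * fst (box R b)" using that w by (auto simp: nodes_def)
      from b show ?thesis
      proof (cases rule: boxes_R_cases)
        case (T c)
        then have c: "c \<in> boxes T - {i}" "p \<le> 4 * fst (box T c)" using p box_R_T[of c] by auto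
        then have nd: "(c, p) \<in> nodes T" by (auto simp: nodes_def)
        show ?thesis
        proof (cases p rule: pos_cases)
          case (even j)
          then show ?thesis
            using nameT[OF c] \<psi>T[OF c] tT[OF nd] nd T_D(8)[of c j] T w
            by (intro disjI2 bexI[of _ "Inl (region_at T c j)"])
              (auto simp: hT_def region_val_def node_even)
        next
          case (odd j)
          then show ?thesis
            using nameT[OF c] \<psi>T[OF c] tT[OF nd] nd T_D(11)[of c j] T w node_odd[of j c T]
            by (intro disjI1 bexI[of _ "Inl (strand_at T c j)"])
              (auto simp: hT_def strand_val_def name_odd)
        qed
      next
        case (S c)
        then have c: "c \<in> boxes S - {0}" "p \<le> 4 * fst (box S c)" using p box_R_S[of c] by auto
        then have nd: "(c, p) \<in> nodes S" by (auto simp: nodes_def)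
        show ?thesis
        proof (cases p rule: pos_cases)
          case (even j)
          then show ?thesis
            using nameS[OF c] \<psi>S[OF c] tS[OF nd] nd S_D(8)[of c j] S w
            by (intro disjI2 bexI[of _ "Inr (region_at S c j)"])
              (auto simp: hS_def region_val_def node_even)
        next
          case (odd j)
          then show ?thesis
            using nameS[OF c] \<psi>S[OF c] tS[OF nd] nd S_D(11)[of c j] S w node_odd[of j c S]
            by (intro disjI1 bexI[of _ "Inr (strand_at S c j)"])
              (auto simp: hS_def strand_val_def name_odd)
        qed
      qed
    qed
    from key[OF that(2)] show ?thesis
    proof (elim disjE bexE conjE)
      fix x assume x: "x \<in> strands T <+> strands S" "name R u = Inl (f x)" "\<psi> u = strand_val x"
      with key[OF that(3)] that(4) obtain y where
        "y \<in> strands T <+> strands S" "f x = f y" "\<psi> v = strand_val y" by (metis Inl_Inr_False Inl_inject)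
      then show ?thesis using sv[of x y] x by simp
    next
      fix x assume x: "x \<in> regions T <+> regions S" "name R u = Inr (g x)" "\<psi> u = region_val x"
      with key[OF that(3)] that(4) obtain y where
        "y \<in> regions T <+> regions S" "g x = g y" "\<psi> v = region_val y" by (metis Inl_Inr_False Inr_inject)
      then show ?thesis using rv[of x y] x by simp
    qed
  qed
  show ?thesis
    unfolding presented_def
  proof (intro conjI allI impI ballI)
    show "attached R" by (rule att)
    show "?Q (name R)" by (rule Qn)
    show "?Q (h \<circ> \<phi>)" if "?Q \<phi>" for \<phi> h using that by (rule Qh)
    show "\<phi> u = \<phi> v" if "?Q \<phi>" "u \<in> nodes R" "v \<in> nodes R" "name R u = name R v" for \<phi> u v
      using that by (rule inv)
  qed
qed

subsection \<open>Isotopy\<close>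

text \<open>
The part of the incidence data that has to be respected by an isotopy of attached tangles.
\<close>

definition incident :: "tangle => bool" where
  "incident T \<longleftrightarrow>
     (\<forall>b\<in>boxes T. \<forall>j\<in>points (box T b). strand_at T b j \<in> strands T \<and>
        uside T (strand_at T b j) = region_at T b (u_interval (box T b) j) \<and>
        sside T (strand_at T b j) = region_at T b (s_interval (box T b) j)) \<and>
     (\<forall>b\<in>boxes T. \<forall>j\<in>intervals (box T b). region_at T b j \<in> regions T) \<and>
     shaded T = {region_at T b j | b j. b \<in> boxes T \<and> j \<in> intervals (box T b) \<and> shaded_interval (box T b) j}"

lemma incidentD:
  assumes "incident T"
  shows "!!b j. b \<in> boxes T ==> j \<in> points (box T b) ==> strand_at T b j \<in> strands T"
    "!!b j. b \<in> boxes T ==> j \<in> points (box T b) ==>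
       uside T (strand_at T b j) = region_at T b (u_interval (box T b) j)"
    "!!b j. b \<in> boxes T ==> j \<in> points (box T b) ==>
       sside T (strand_at T b j) = region_at T b (s_interval (box T b) j)"
    "!!b j. b \<in> boxes T ==> j \<in> intervals (box T b) ==> region_at T b j \<in> regions T"
    "shaded T = {region_at T b j | b j. b \<in> boxes T \<and> j \<in> intervals (box T b) \<and> shaded_interval (box T b) j}"
proof -
  have 1: "\<forall>b\<in>boxes T. \<forall>j\<in>points (box T b). strand_at T b j \<in> strands T \<and>
        uside T (strand_at T b j) = region_at T b (u_interval (box T b) j) \<and>
        sside T (strand_at T b j) = region_at T b (s_interval (box T b) j)"
    and 2: "\<forall>b\<in>boxes T. \<forall>j\<in>intervals (box T b). region_at T b j \<in> regions T"
    and 3: "shaded T = {region_at T b j | b j. b \<in> boxes T \<and> j \<in> intervals (box T b) \<and> shaded_interval (box T b) j}"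
    using assms[unfolded incident_def] by - (elim conjE, assumption)+
  show "strand_at T b j \<in> strands T"
    "uside T (strand_at T b j) = region_at T b (u_interval (box T b) j)"
    "sside T (strand_at T b j) = region_at T b (s_interval (box T b) j)"
    if "b \<in> boxes T" "j \<in> points (box T b)" for b j using 1 that by blast+
  show "region_at T b j \<in> regions T" if "b \<in> boxes T" "j \<in> intervals (box T b)" for b j
    using 2 that by blast
  show "shaded T = {region_at T b j | b j. b \<in> boxes T \<and> j \<in> intervals (box T b) \<and> shaded_interval (box T b) j}"
    by (rule 3)
qed

lemma planar_incident:
  assumes "planar_tangle T" "attached T"
  shows "incident T"
proof -
  note D = planar_tangleD[OF assms(1)]
  have "shaded T = {region_at T b j | b j. b \<in> boxes T \<and> j \<in> intervals (box T b) \<and> shaded_interval (box T b) j}"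
  proof (intro equalityI subsetI)
    fix r assume r: "r \<in> shaded T"
    then have "r \<in> regions T" using D(3) by blast
    then obtain b j where "b \<in> boxes T" "j \<in> intervals (box T b)" "r = region_at T b j"
      by (rule attached_regionE[OF assms(2)])
    then show "r \<in> {region_at T b j | b j. b \<in> boxes T \<and> j \<in> intervals (box T b) \<and> shaded_interval (box T b) j}"
      using r D(9) by blast
  next
    fix r
    assume "r \<in> {region_at T b j | b j. b \<in> boxes T \<and> j \<in> intervals (box T b) \<and> shaded_interval (box T b) j}"
    then show "r \<in> shaded T" using D(9) by blast
  qed
  moreover have "\<forall>b\<in>boxes T. \<forall>j\<in>points (box T b). strand_at T b j \<in> strands T \<and>
        uside T (strand_at T b j) = region_at T b (u_interval (box T b) j) \<and>
        sside T (strand_at T b j) = region_at T b (s_interval (box T b) j)"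
    using D(11-13) by blast
  moreover have "\<forall>b\<in>boxes T. \<forall>j\<in>intervals (box T b). region_at T b j \<in> regions T"
    using D(8) by blast
  ultimately show ?thesis unfolding incident_def by (intro conjI)
qed

text \<open>
If no strand or region is detached from all boxes, then the bijections demanded of an isotopy are
forced by the names, and they exist as soon as the two tangles identify the same positions.
\<close>

lemma isotopicI:
  assumes T: "attached T" "incident T" and T': "attached T'" "incident T'"
    and len: "length (inner T') = length (inner T)" and \<pi>0: "\<pi> 0 = 0"
    and bij: "bij_betw \<pi> (boxes T) (boxes T')"
    and bx: "!!b. b \<in> boxes T ==> box T' (\<pi> b) = box T b"
    and kernel: "!!b p c q. (b, p) \<in> nodes T ==> (c, q) \<in> nodes T ==>
      name T (b, p) = name T (c, q) \<longleftrightarrow> name T' (\<pi> b, p) = name T' (\<pi> c, q)"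
  shows "isotopic \<pi> T T'"
proof -
  define f where "f s = (SOME t. \<exists>b\<in>boxes T. \<exists>j\<in>points (box T b). s = strand_at T b j \<and> t = strand_at T' (\<pi> b) j)" for s
  define g where "g s = (SOME t. \<exists>b\<in>boxes T. \<exists>j\<in>intervals (box T b). s = region_at T b j \<and> t = region_at T' (\<pi> b) j)" for s
  have strand_eq: "strand_at T b j = strand_at T c k \<longleftrightarrow> strand_at T' (\<pi> b) j = strand_at T' (\<pi> c) k"
    if "b \<in> boxes T" "j \<in> points (box T b)" "c \<in> boxes T" "k \<in> points (box T c)" for b j c k
  proof -
    have "0 < j" "0 < k" using that by (auto simp: points_def)
    then show ?thesis using kernel[of b "2 * j - 1" c "2 * k - 1"] that node_odd[of j b T] node_odd[of k c T]
      by (simp add: name_odd)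
  qed
  have region_eq: "region_at T b j = region_at T c k \<longleftrightarrow> region_at T' (\<pi> b) j = region_at T' (\<pi> c) k"
    if "b \<in> boxes T" "j \<in> intervals (box T b)" "c \<in> boxes T" "k \<in> intervals (box T c)" for b j c k
    using kernel[of b "2 * j" c "2 * k"] that node_even[of b j T] node_even[of c k T] by simp
  have f: "f (strand_at T b j) = strand_at T' (\<pi> b) j" if "b \<in> boxes T" "j \<in> points (box T b)" for b j
  proof -
    have "\<exists>c\<in>boxes T. \<exists>k\<in>points (box T c). strand_at T b j = strand_at T c k \<and>
        f (strand_at T b j) = strand_at T' (\<pi> c) k"
      unfolding f_def by (rule someI_ex) (use that in blast)
    then show ?thesis using strand_eq that by metis
  qed
  have g: "g (region_at T b j) = region_at T' (\<pi> b) j" if "b \<in> boxes T" "j \<in> intervals (box T b)" for b j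
  proof -
    have "\<exists>c\<in>boxes T. \<exists>k\<in>intervals (box T c). region_at T b j = region_at T c k \<and>
        g (region_at T b j) = region_at T' (\<pi> c) k"
      unfolding g_def by (rule someI_ex) (use that in blast)
    then show ?thesis using region_eq that by metis
  qed
  note \<pi>_in = bij_betwE[OF bij]
  have \<pi>_surj: "\<exists>c\<in>boxes T. b = \<pi> c" if "b \<in> boxes T'" for b
    using bij that unfolding bij_betw_def by blast
  have T_inc: "strand_at T b j \<in> strands T" "uside T (strand_at T b j) = region_at T b (u_interval (box T b) j)"
      "sside T (strand_at T b j) = region_at T b (s_interval (box T b) j)"
    if "b \<in> boxes T" "j \<in> points (box T b)" for b j
    using incidentD(1-3)[OF T(2)] that by blast+
  have T'_inc: "strand_at T' (\<pi> b) j \<in> strands T'"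
      "uside T' (strand_at T' (\<pi> b) j) = region_at T' (\<pi> b) (u_interval (box T b) j)"
      "sside T' (strand_at T' (\<pi> b) j) = region_at T' (\<pi> b) (s_interval (box T b) j)"
    if "b \<in> boxes T" "j \<in> points (box T b)" for b j
  proof -
    have "\<pi> b \<in> boxes T'" "j \<in> points (box T' (\<pi> b))" using that \<pi>_in bx by auto
    then show "strand_at T' (\<pi> b) j \<in> strands T'"
      "uside T' (strand_at T' (\<pi> b) j) = region_at T' (\<pi> b) (u_interval (box T b) j)"
      "sside T' (strand_at T' (\<pi> b) j) = region_at T' (\<pi> b) (s_interval (box T b) j)"
      using incidentD(1-3)[OF T'(2), of "\<pi> b" j] bx[OF that(1)] by simp_all
  qed
  have T_reg: "region_at T b j \<in> regions T" "region_at T' (\<pi> b) j \<in> regions T'"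
    if "b \<in> boxes T" "j \<in> intervals (box T b)" for b j
    using incidentD(4)[OF T(2), of b j] incidentD(4)[OF T'(2), of "\<pi> b" j] that \<pi>_in bx by simp_all
  have strand_ex: "\<exists>b\<in>boxes T. \<exists>j\<in>points (box T b). s = strand_at T b j" if "s \<in> strands T" for s
    by (rule attached_strandE[OF T(1) that]) blast
  have region_ex: "\<exists>b\<in>boxes T. \<exists>j\<in>intervals (box T b). s = region_at T b j" if "s \<in> regions T" for s
    by (rule attached_regionE[OF T(1) that]) blast
  have bij_f: "bij_betw f (strands T) (strands T')"
    unfolding bij_betw_def
  proof (intro conjI equalityI subsetI)
    show "inj_on f (strands T)"
    proof (rule inj_onI)
      fix s t assume st: "s \<in> strands T" "t \<in> strands T" "f s = f t"
      obtain b j where bj: "b \<in> boxes T" "j \<in> points (box T b)" "s = strand_at T b j"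
        using strand_ex[OF st(1)] by blast
      obtain c k where ck: "c \<in> boxes T" "k \<in> points (box T c)" "t = strand_at T c k"
        using strand_ex[OF st(2)] by blast
      show "s = t"
        using st(3) f[OF bj(1,2)] f[OF ck(1,2)] strand_eq[OF bj(1,2) ck(1,2)] bj(3) ck(3) by simp
    qed
    show "t \<in> strands T'" if "t \<in> f ` strands T" for t
      using that strand_ex f T'_inc(1) by force
    show "t \<in> f ` strands T" if t: "t \<in> strands T'" for t
    proof -
      obtain b j where "b \<in> boxes T'" "j \<in> points (box T' b)" "t = strand_at T' b j"
        by (rule attached_strandE[OF T'(1) t])
      then obtain c where "c \<in> boxes T" "b = \<pi> c" "j \<in> points (box T c)" "t = strand_at T' (\<pi> c) j"
        using \<pi>_surj bx by metis
      then show ?thesis using f[of c j] T_inc(1)[of c j] by force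
    qed
  qed
  have bij_g: "bij_betw g (regions T) (regions T')"
    unfolding bij_betw_def
  proof (intro conjI equalityI subsetI)
    show "inj_on g (regions T)"
    proof (rule inj_onI)
      fix s t assume st: "s \<in> regions T" "t \<in> regions T" "g s = g t"
      obtain b j where bj: "b \<in> boxes T" "j \<in> intervals (box T b)" "s = region_at T b j"
        using region_ex[OF st(1)] by blast
      obtain c k where ck: "c \<in> boxes T" "k \<in> intervals (box T c)" "t = region_at T c k"
        using region_ex[OF st(2)] by blast
      show "s = t"
        using st(3) g[OF bj(1,2)] g[OF ck(1,2)] region_eq[OF bj(1,2) ck(1,2)] bj(3) ck(3) by simp
    qed
    show "t \<in> regions T'" if "t \<in> g ` regions T" for t
      using that region_ex g T_reg(2) by force
    show "t \<in> g ` regions T" if t: "t \<in> regions T'" for t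
    proof -
      obtain b j where "b \<in> boxes T'" "j \<in> intervals (box T' b)" "t = region_at T' b j"
        by (rule attached_regionE[OF T'(1) t])
      then obtain c where "c \<in> boxes T" "b = \<pi> c" "j \<in> intervals (box T c)" "t = region_at T' (\<pi> c) j"
        using \<pi>_surj bx by metis
      then show ?thesis using g[of c j] T_reg(1)[of c j] by force
    qed
  qed
  have shT: "shaded T = {region_at T b j | b j. b \<in> boxes T \<and> j \<in> intervals (box T b) \<and> shaded_interval (box T b) j}"
    and shT': "shaded T' = {region_at T' b j | b j. b \<in> boxes T' \<and> j \<in> intervals (box T' b) \<and> shaded_interval (box T' b) j}"
    by (rule incidentD(5)[OF T(2)], rule incidentD(5)[OF T'(2)])
  have sh: "g ` shaded T = shaded T'"
  proof (intro equalityI subsetI)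
    fix r assume "r \<in> g ` shaded T"
    then obtain b j where "b \<in> boxes T" "j \<in> intervals (box T b)" "shaded_interval (box T b) j"
      "r = region_at T' (\<pi> b) j" unfolding shT using g by blast
    then show "r \<in> shaded T'" unfolding shT' using \<pi>_in bx by force
  next
    fix r assume "r \<in> shaded T'"
    then obtain b j where "b \<in> boxes T'" "j \<in> intervals (box T' b)" "shaded_interval (box T' b) j"
      "r = region_at T' b j" unfolding shT' by blast
    then obtain c where c: "c \<in> boxes T" "j \<in> intervals (box T c)" "shaded_interval (box T c) j"
      "r = region_at T' (\<pi> c) j" using \<pi>_surj bx by metis
    then have "r = g (region_at T c j)" using g by simp
    moreover have "region_at T c j \<in> shaded T" unfolding shT using c by blast
    ultimately show "r \<in> g ` shaded T" by blast
  qed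
  have sides: "uside T' (f s) = g (uside T s) \<and> sside T' (f s) = g (sside T s)" if s: "s \<in> strands T" for s
  proof -
    obtain b j where bj: "b \<in> boxes T" "j \<in> points (box T b)" "s = strand_at T b j"
      using strand_ex s by blast
    show ?thesis
      using f[OF bj(1,2)] T_inc[OF bj(1,2)] T'_inc[OF bj(1,2)] bj(3)
        g[OF bj(1) u_interval_in[OF bj(2)]] g[OF bj(1) s_interval_in[OF bj(2)]] by simp
  qed
  show ?thesis
    unfolding isotopic_def
    using len \<pi>0 bij bx bij_f bij_g sh sides f g
    by (intro conjI exI[of _ f] exI[of _ g]) simp_all
qed

lemma isotopic_presented:
  assumes T: "presented T Q" "incident T" and T': "presented T' Q'" "incident T'"
    and len: "length (inner T') = length (inner T)" and \<pi>0: "\<pi> 0 = 0"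
    and bij: "bij_betw \<pi> (boxes T) (boxes T')"
    and bx: "!!b. b \<in> boxes T ==> box T' (\<pi> b) = box T b"
    and to: "!!\<psi>. Q' \<psi> ==> Q (\<lambda>(b, p). \<psi> (\<pi> b, p))"
    and fro: "!!\<psi>. Q \<psi> ==> \<exists>\<psi>'. Q' \<psi>' \<and> (\<forall>b\<in>boxes T. \<forall>p\<le>4 * fst (box T b). \<psi>' (\<pi> b, p) = \<psi> (b, p))"
  shows "isotopic \<pi> T T'"
proof (rule isotopicI[OF presentedD(1)[OF T(1)] T(2) presentedD(1)[OF T'(1)] T'(2) len \<pi>0 bij bx])
  fix b p c q assume bp: "(b, p) \<in> nodes T" and cq: "(c, q) \<in> nodes T"
  have bp': "(\<pi> b, p) \<in> nodes T'" and cq': "(\<pi> c, q) \<in> nodes T'"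
    using bp cq bij_betwE[OF bij] bx by (auto simp: nodes_def simp del: boxes_simp)
  show "name T (b, p) = name T (c, q) \<longleftrightarrow> name T' (\<pi> b, p) = name T' (\<pi> c, q)"
  proof
    assume "name T (b, p) = name T (c, q)"
    from presentedD(4)[OF T(1) to[OF presentedD(2)[OF T'(1)]] bp cq this]
    show "name T' (\<pi> b, p) = name T' (\<pi> c, q)" by simp
  next
    assume eq: "name T' (\<pi> b, p) = name T' (\<pi> c, q)"
    obtain \<psi>' where "Q' \<psi>'" "\<forall>b\<in>boxes T. \<forall>p\<le>4 * fst (box T b). \<psi>' (\<pi> b, p) = name T (b, p)"
      using fro[OF presentedD(2)[OF T(1)]] by blast
    then show "name T (b, p) = name T (c, q)"
      using presentedD(4)[OF T'(1) _ bp' cq' eq, of \<psi>'] bp cq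
      by (auto simp: nodes_def simp del: boxes_simp)
  qed
qed

section \<open>The basic tangles\<close>

subsection \<open>Tangles given by their incidences\<close>

lemma tangle_of_sel [simp]:
  "outer (tangle_of out ins st rg) = out" "inner (tangle_of out ins st rg) = ins"
  "strand_at (tangle_of out ins st rg) = st" "region_at (tangle_of out ins st rg) = rg"
  by (simp_all add: tangle_of_def)

lemma tangle_of_sets:
  fixes out ins st rg
  defines "T \<equiv> tangle_of out ins st rg"
  shows "strands T = {st b j | b j. b \<in> boxes T \<and> j \<in> points (box T b)}"
    "regions T = {rg b j | b j. b \<in> boxes T \<and> j \<in> intervals (box T b)}"
    "shaded T = {rg b j | b j. b \<in> boxes T \<and> j \<in> intervals (box T b) \<and> shaded_interval (box T b) j}"
    "uside T s = (SOME r. \<exists>b j. b \<in> boxes T \<and> j \<in> points (box T b) \<and> st b j = s \<and>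
        r = rg b (u_interval (box T b) j))"
    "sside T s = (SOME r. \<exists>b j. b \<in> boxes T \<and> j \<in> points (box T b) \<and> st b j = s \<and>
        r = rg b (s_interval (box T b) j))"
proof -
  have bx: "(if b = 0 then out else ins ! (b - 1)) = box T b" and bs: "b \<le> length ins \<longleftrightarrow> b \<in> boxes T" for b
    by (simp_all add: T_def box_def)
  note * = T_def[unfolded tangle_of_def Let_def bx bs, THEN meta_eq_to_obj_eq]
  have ex: "(\<exists>(b, j)\<in>{(b, j). b \<in> boxes T \<and> j \<in> points (box T b)}. st b j = s \<and> r = h b j) \<longleftrightarrow>
      (\<exists>b j. b \<in> boxes T \<and> j \<in> points (box T b) \<and> st b j = s \<and> r = h b j)" for h :: "nat => nat => nat" and r s
    by blast
  have st: "strands T = case_prod st ` {(b, j). b \<in> boxes T \<and> j \<in> points (box T b)}"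
    and rg: "regions T = case_prod rg ` {(b, j). b \<in> boxes T \<and> j \<in> intervals (box T b)}"
    and sh: "shaded T = case_prod rg ` {(b, j) \<in> {(b, j). b \<in> boxes T \<and> j \<in> intervals (box T b)}.
        shaded_interval (box T b) j}"
    and us: "uside T = (\<lambda>s. SOME r. \<exists>(b, j)\<in>{(b, j). b \<in> boxes T \<and> j \<in> points (box T b)}. st b j = s \<and>
        r = rg b (u_interval (box T b) j))"
    and ss: "sside T = (\<lambda>s. SOME r. \<exists>(b, j)\<in>{(b, j). b \<in> boxes T \<and> j \<in> points (box T b)}. st b j = s \<and>
        r = rg b (s_interval (box T b) j))"
    using arg_cong[OF *, of strands] arg_cong[OF *, of regions] arg_cong[OF *, of shaded]
      arg_cong[OF *, of uside] arg_cong[OF *, of sside]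
    by (simp_all only: tangle.select_convs)
  show "strands T = {st b j | b j. b \<in> boxes T \<and> j \<in> points (box T b)}" unfolding st by auto
  show "regions T = {rg b j | b j. b \<in> boxes T \<and> j \<in> intervals (box T b)}" unfolding rg by auto
  show "shaded T = {rg b j | b j. b \<in> boxes T \<and> j \<in> intervals (box T b) \<and> shaded_interval (box T b) j}"
    unfolding sh by auto
  show "uside T s = (SOME r. \<exists>b j. b \<in> boxes T \<and> j \<in> points (box T b) \<and> st b j = s \<and>
        r = rg b (u_interval (box T b) j))" unfolding us ex ..
  show "sside T s = (SOME r. \<exists>b j. b \<in> boxes T \<and> j \<in> points (box T b) \<and> st b j = s \<and>
        r = rg b (s_interval (box T b) j))" unfolding ss ex ..
qed

lemma tangle_of_attached: "attached (tangle_of out ins st rg)"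
  unfolding attached_def tangle_of_sets tangle_of_sel by blast

lemma tangle_of_incident:
  fixes out ins st rg
  defines "T \<equiv> tangle_of out ins st rg"
  assumes sides: "!!b j c k. b \<in> boxes T ==> j \<in> points (box T b) ==> c \<in> boxes T ==>
      k \<in> points (box T c) ==> st b j = st c k ==>
      rg b (u_interval (box T b) j) = rg c (u_interval (box T c) k) \<and>
      rg b (s_interval (box T b) j) = rg c (s_interval (box T c) k)"
  shows "incident T"
proof -
  have u: "uside T (st b j) = rg b (u_interval (box T b) j)"
    if "b \<in> boxes T" "j \<in> points (box T b)" for b j
  proof -
    have "\<exists>c k. c \<in> boxes T \<and> k \<in> points (box T c) \<and> st c k = st b j \<and>
        uside T (st b j) = rg c (u_interval (box T c) k)"
      unfolding T_def tangle_of_sets(4)[of out ins st rg] by (rule someI_ex) (use that T_def in blast)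
    then show ?thesis using sides that by metis
  qed
  have s: "sside T (st b j) = rg b (s_interval (box T b) j)"
    if "b \<in> boxes T" "j \<in> points (box T b)" for b j
  proof -
    have "\<exists>c k. c \<in> boxes T \<and> k \<in> points (box T c) \<and> st c k = st b j \<and>
        sside T (st b j) = rg c (s_interval (box T c) k)"
      unfolding T_def tangle_of_sets(5)[of out ins st rg] by (rule someI_ex) (use that T_def in blast)
    then show ?thesis using sides that by metis
  qed
  have sel: "strand_at T = st" "region_at T = rg" by (simp_all add: T_def)
  have sets: "st b j \<in> strands T" if "b \<in> boxes T" "j \<in> points (box T b)" for b j
    using that unfolding T_def tangle_of_sets(1) by blast
  have setr: "rg b j \<in> regions T" if "b \<in> boxes T" "j \<in> intervals (box T b)" for b j
    using that unfolding T_def tangle_of_sets(2) by blast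
  have sh: "shaded T = {rg b j | b j. b \<in> boxes T \<and> j \<in> intervals (box T b) \<and> shaded_interval (box T b) j}"
    unfolding T_def tangle_of_sets(3) ..
  have "\<forall>b\<in>boxes T. \<forall>j\<in>points (box T b). st b j \<in> strands T \<and>
        uside T (st b j) = rg b (u_interval (box T b) j) \<and>
        sside T (st b j) = rg b (s_interval (box T b) j)"
    using sets u s by blast
  moreover have "\<forall>b\<in>boxes T. \<forall>j\<in>intervals (box T b). rg b j \<in> regions T"
    using setr by blast
  ultimately show ?thesis unfolding incident_def sel using sh by (intro conjI)
qed

subsection \<open>A criterion for planarity\<close>

primrec parity :: "(nat => bool) => nat => bool" where
  "parity a 0 = False"
| "parity a (Suc n) = (parity a n \<noteq> a (Suc n))"

lemma parity_card: "parity a n \<longleftrightarrow> odd (card {j \<in> {1..n}. a j})"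
proof (induction n)
  case (Suc n)
  have "{j \<in> {1..Suc n}. a j} = (if a (Suc n) then insert (Suc n) {j \<in> {1..n}. a j} else {j \<in> {1..n}. a j})"
    by (auto simp: le_Suc_eq)
  then show ?case using Suc.IH by (auto simp: card_insert_if)
qed simp

lemma parity_shift:
  assumes "!!q. 0 < q ==> q \<le> n ==> a (s + q) = a' (t + q)"
  shows "(parity a (s + n) \<noteq> parity a s) = (parity a' (t + n) \<noteq> parity a' t)"
  using assms
proof (induction n)
  case (Suc n)
  have "a (Suc (s + n)) = a' (Suc (t + n))" using Suc.prems[of "Suc n"] by simp
  moreover have "(parity a (s + n) \<noteq> parity a s) = (parity a' (t + n) \<noteq> parity a' t)"
    using Suc by simp
  ultimately show ?case by auto
qed simp

lemma parity_reverse: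
  assumes "!!q. 0 < q ==> q \<le> n ==> a (s + q) = a' (t + 1 - q)" "n \<le> t"
  shows "(parity a (s + n) \<noteq> parity a s) = (parity a' t \<noteq> parity a' (t - n))"
  using assms
proof (induction n)
  case (Suc n)
  then have "t - n = Suc (t - Suc n)" by simp
  then have "parity a' (t - n) = (parity a' (t - Suc n) \<noteq> a' (t - n))" by simp
  moreover have "a (Suc (s + n)) = a' (t - n)" using Suc.prems(1)[of "Suc n"] by simp
  ultimately show ?case using Suc by auto
qed simp

definition is_start :: "tangle => nat \<times> nat => bool" where
  "is_start T = (\<lambda>(b, j). shaded_interval (box T b) j \<longleftrightarrow> b \<noteq> 0)"

definition pts :: "tangle => (nat \<times> nat) set" where
  "pts T = {(b, j). b \<in> boxes T \<and> j \<in> points (box T b)}"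

text \<open>
Planarity from local data. The involution \<open>m\<close> pairs the two ends of each strand; the
solutions \<open>Q_m\<close> and \<open>Q_shade\<close> show that the system identifies neither different strands nor regions of
different shading. \<open>Q_conn\<close> gives connectedness. For the
Jordan condition, walk around each box and change sides at every point that lies on a strand of
the given set; evenness makes this consistent at the star, and \<open>Q_parity\<close> says that, after swapping
sides at suitable boxes, the resulting sides satisfy the equations of the tangle.
\<close>

locale matched_tangle =
  fixes out :: btype and ins :: "btype list" and st rg :: "nat => nat => nat"
    and Q :: system and m :: "nat \<times> nat => nat \<times> nat" and T :: tangle
  defines "T \<equiv> tangle_of out ins st rg"
  assumes pres: "presented T Q"
    and m_in: "u \<in> pts T ==> m u \<in> pts T" and m_m: "u \<in> pts T ==> m (m u) = u"
    and m_start: "u \<in> pts T ==> is_start T (m u) \<longleftrightarrow> \<not> is_start T u"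
    and m_Q: "Q \<phi> ==> (b, j) \<in> pts T ==> m (b, j) = (c, k) ==> \<phi> (b, 2 * j - 1) = \<phi> (c, 2 * k - 1) \<and>
        \<phi> (b, 2 * u_interval (box T b) j) = \<phi> (c, 2 * u_interval (box T c) k) \<and>
        \<phi> (b, 2 * s_interval (box T b) j) = \<phi> (c, 2 * s_interval (box T c) k)"
    and Q_m: "Q (\<lambda>(b, p). if even p then Inr 0
        else Inl (min (prod_encode (b, Suc p div 2)) (prod_encode (m (b, Suc p div 2)))))"
    and Q_shade: "Q (\<lambda>(b, p). if even p then Inr (of_bool (shaded_interval (box T b) (p div 2))) else Inl 0)"
    and Q_wrap: "Q \<phi> ==> b \<in> boxes T ==> \<phi> (b, 0) = \<phi> (b, 4 * fst (box T b))"
    and Q_conn: "b \<in> boxes T ==>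
        \<exists>j\<in>intervals (box T b). \<exists>k\<in>intervals (box T 0). \<forall>\<phi>. Q \<phi> --> \<phi> (b, 2 * j) = \<phi> (0, 2 * k)"
    and Q_parity: "Q \<phi> ==> (!!b. b \<in> boxes T ==> \<not> parity (\<lambda>j. \<phi> (b, 2 * j - 1) = Inl 1) (2 * fst (box T b))) ==>
        \<exists>off. Q (\<lambda>(b, p). if even p then
           Inr (of_bool (parity (\<lambda>j. \<phi> (b, 2 * j - 1) = Inl 1) (p div 2) \<noteq> off b)) else \<phi> (b, p))"
begin

lemmas T_pres = presentedD[OF pres]

lemma sel [simp]: "strand_at T = st" "region_at T = rg" "outer T = out" "inner T = ins"
  by (simp_all add: T_def)

lemma name_pt: "(b, j) \<in> pts T ==> name T (b, 2 * j - 1) = Inl (st b j)"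
  using name_odd[of j T b] by (auto simp: pts_def points_def)

lemma node_pt: "(b, j) \<in> pts T ==> (b, 2 * j - 1) \<in> nodes T"
  by (auto simp: pts_def nodes_def points_def)

lemma node_iv: "b \<in> boxes T ==> j \<in> intervals (box T b) ==> (b, 2 * j) \<in> nodes T"
  by (simp add: node_even)

lemma st_m: "(b, j) \<in> pts T ==> m (b, j) = (c, k) ==> st b j = st c k \<and>
    rg b (u_interval (box T b) j) = rg c (u_interval (box T c) k) \<and>
    rg b (s_interval (box T b) j) = rg c (s_interval (box T c) k)"
  using m_Q[OF T_pres(2), of b j c k] m_in[of "(b, j)"] name_pt[of b j] name_pt[of c k] by simp

lemma st_eq:
  assumes "(b, j) \<in> pts T" "(c, k) \<in> pts T" "st b j = st c k"
  shows "(c, k) = (b, j) \<or> (c, k) = m (b, j)"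
proof -
  have "min (prod_encode (b, j)) (prod_encode (m (b, j))) = min (prod_encode (c, k)) (prod_encode (m (c, k)))"
    using T_pres(4)[OF Q_m node_pt[OF assms(1)] node_pt[OF assms(2)]] name_pt[OF assms(1)]
      name_pt[OF assms(2)] assms by (auto simp: pts_def points_def)
  then have "(b, j) = (c, k) \<or> (b, j) = m (c, k) \<or> m (b, j) = (c, k) \<or> m (b, j) = m (c, k)"
    by (auto simp: min_def prod_encode_eq split: if_splits)
  then show ?thesis using m_m[OF assms(1)] m_m[OF assms(2)] by metis
qed

lemma incident: "incident T"
  unfolding T_def
proof (rule tangle_of_incident, fold T_def)
  fix b j c k
  assume "b \<in> boxes T" "j \<in> points (box T b)" "c \<in> boxes T" "k \<in> points (box T c)" and eq: "st b j = st c k"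
  then have p: "(b, j) \<in> pts T" "(c, k) \<in> pts T" by (auto simp: pts_def)
  show "rg b (u_interval (box T b) j) = rg c (u_interval (box T c) k) \<and>
      rg b (s_interval (box T b) j) = rg c (s_interval (box T c) k)"
    using st_eq[OF p eq] st_m[OF p(1), of c k] by auto
qed

lemmas T_inc = incidentD[OF incident]

lemma region_cases:
  assumes "r \<in> regions T"
  obtains b j where "b \<in> boxes T" "j \<in> intervals (box T b)" "r = rg b j"
  using assms unfolding T_def tangle_of_sets(2) by blast

lemma strand_cases:
  assumes "s \<in> strands T"
  obtains b j where "(b, j) \<in> pts T" "b \<in> boxes T" "j \<in> points (box T b)" "s = st b j"
  using assms unfolding T_def tangle_of_sets(1) pts_def by blast

lemma shade: "rg b j \<in> shaded T \<longleftrightarrow> shaded_interval (box T b) j"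
  if "b \<in> boxes T" "j \<in> intervals (box T b)" for b j
proof
  assume "rg b j \<in> shaded T"
  then obtain c k where ck: "c \<in> boxes T" "k \<in> intervals (box T c)" "shaded_interval (box T c) k" "rg c k = rg b j"
    unfolding T_inc(5) by auto
  show "shaded_interval (box T b) j"
    using T_pres(4)[OF Q_shade node_iv[OF that] node_iv[OF ck(1,2)]] ck(3,4) by (simp add: of_bool_def split: if_splits)
next
  assume "shaded_interval (box T b) j"
  then show "rg b j \<in> shaded T" unfolding T_inc(5) using that by auto
qed

lemma sides_shaded:
  assumes "j \<in> points t" shows "\<not> shaded_interval t (u_interval t j)" "shaded_interval t (s_interval t j)"
  using assms by (auto simp: u_interval_def s_interval_def shaded_interval_def points_def)

lemma ports_pts: "u \<in> ports c T \<longleftrightarrow> u \<in> pts T \<and> is_start T u = c"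
  by (cases u) (auto simp: ports_iff pts_def is_start_def)

lemma ports_inj: "inj_on (case_prod st) (ports c T)"
proof (rule inj_onI, clarify)
  fix b j d k
  assume p: "(b, j) \<in> ports c T" "(d, k) \<in> ports c T" and eq: "st b j = st d k"
  then have "(d, k) = (b, j) \<or> (d, k) = m (b, j)" by (intro st_eq) (auto simp: ports_pts)
  then show "b = d \<and> j = k" using m_start[of "(b, j)"] p by (auto simp: ports_pts)
qed

lemma ports_image: "case_prod st ` ports c T \<subseteq> case_prod st ` ports (\<not> c) T"
proof clarify
  fix b j assume "(b, j) \<in> ports c T"
  then have p: "(b, j) \<in> pts T" and s: "is_start T (b, j) = c" by (auto simp: ports_pts)
  have "m (b, j) \<in> ports (\<not> c) T" using m_in[OF p] m_start[OF p] s by (simp add: ports_pts)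
  moreover have "case_prod st (m (b, j)) = st b j"
    using st_m[OF p, of "fst (m (b, j))" "snd (m (b, j))"] by (simp add: case_prod_unfold)
  ultimately show "st b j \<in> case_prod st ` ports (\<not> c) T" by force
qed

lemma connected:
  assumes B: "B \<subseteq> regions T" "B \<noteq> {}"
    and sides: "\<forall>s\<in>strands T. uside T s \<in> B \<longleftrightarrow> sside T s \<in> B"
  shows "B = regions T"
proof -
  have step: "rg b j \<in> B \<longleftrightarrow> rg b 0 \<in> B" if "b \<in> boxes T" "j \<in> intervals (box T b)" for b j
    using that(2)
  proof (induction j)
    case (Suc j)
    then have pt: "Suc j \<in> points (box T b)" and iv: "j \<in> intervals (box T b)"
      by (auto simp: points_def intervals_def)
    have "st b (Suc j) \<in> strands T" using T_inc(1)[OF that(1) pt] by simp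
    then have "rg b (u_interval (box T b) (Suc j)) \<in> B \<longleftrightarrow> rg b (s_interval (box T b) (Suc j)) \<in> B"
      using bspec[OF sides, of "st b (Suc j)"] T_inc(2,3)[OF that(1) pt] by simp
    then have "rg b (Suc j) \<in> B \<longleftrightarrow> rg b j \<in> B"
      by (auto simp: u_interval_def s_interval_def split: if_splits)
    then show ?case using Suc.IH iv by simp
  qed simp
  have all: "rg b j \<in> B \<longleftrightarrow> rg 0 0 \<in> B" if b: "b \<in> boxes T" "j \<in> intervals (box T b)" for b j
  proof -
    obtain j' k' where jk: "j' \<in> intervals (box T b)" "k' \<in> intervals (box T 0)"
      "\<forall>\<phi>. Q \<phi> --> \<phi> (b, 2 * j') = \<phi> (0, 2 * k')" using Q_conn[OF b(1)] by blast
    then have "name T (b, 2 * j') = name T (0, 2 * k')" using T_pres(2) by blast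
    then have "rg b j' = rg 0 k'" by (simp only: name_even sel sum.inject)
    then show ?thesis using step[OF b] step[OF b(1) jk(1)] step[OF _ jk(2)] by simp
  qed
  obtain r where r: "r \<in> B" using B(2) by blast
  then have "r \<in> regions T" using B(1) by blast
  then obtain b j where "b \<in> boxes T" "j \<in> intervals (box T b)" "r = rg b j" by (rule region_cases)
  then have r0: "rg 0 0 \<in> B" using all[of b j] r by simp
  have "r \<in> B" if in_set: "r \<in> regions T" for r
  proof -
    from in_set obtain b j where "b \<in> boxes T" "j \<in> intervals (box T b)" "r = rg b j" by (rule region_cases)
    then show "r \<in> B" using all[of b j] r0 by simp
  qed
  then show ?thesis using B(1) by blast
qed

lemma jordan:
  assumes A: "A \<subseteq> strands T"
    and ev: "\<forall>b\<in>boxes T. even (card {j \<in> points (box T b). st b j \<in> A})"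
  shows "\<exists>B\<subseteq>regions T. \<forall>s\<in>strands T. s \<in> A \<longleftrightarrow> (uside T s \<in> B) \<noteq> (sside T s \<in> B)"
proof -
  define h :: "nat + nat => nat + nat" where
    "h = map_sum (\<lambda>s. of_bool (s \<in> A)) (\<lambda>r. 0)"
  define \<phi> where "\<phi> = h \<circ> name T"
  define a where "a b j \<longleftrightarrow> \<phi> (b, 2 * j - 1) = Inl 1" for b j
  have Q\<phi>: "Q \<phi>" unfolding \<phi>_def by (rule T_pres(3)[OF T_pres(2)])
  have a: "a b j \<longleftrightarrow> st b j \<in> A" if "0 < j" for b j
    using that name_odd[of j T b] by (simp add: a_def \<phi>_def h_def)
  have "\<not> parity (a b) (2 * fst (box T b))" if b: "b \<in> boxes T" for b
  proof -
    have "{j \<in> {1..2 * fst (box T b)}. a b j} = {j \<in> points (box T b). st b j \<in> A}"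
      using a by (auto simp: points_def)
    then show ?thesis unfolding parity_card using ev b by simp
  qed
  from Q_parity[OF Q\<phi>] this obtain off where
    off: "Q (\<lambda>(b, p). if even p then Inr (of_bool (parity (a b) (p div 2) \<noteq> off b)) else \<phi> (b, p))"
    unfolding a_def by blast
  define B where "B = {rg b j | b j. b \<in> boxes T \<and> j \<in> intervals (box T b) \<and> (parity (a b) j \<noteq> off b)}"
  have B_iff: "rg b j \<in> B \<longleftrightarrow> (parity (a b) j \<noteq> off b)" if "b \<in> boxes T" "j \<in> intervals (box T b)" for b j
  proof
    assume "rg b j \<in> B"
    then obtain c k where ck: "c \<in> boxes T" "k \<in> intervals (box T c)" "parity (a c) k \<noteq> off c" "rg b j = rg c k"
      unfolding B_def by blast
    show "parity (a b) j \<noteq> off b"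
      using T_pres(4)[OF off node_iv[OF that] node_iv[OF ck(1,2)]] ck(3,4) by (auto simp: of_bool_def split: if_splits)
  qed (use that in \<open>auto simp: B_def\<close>)
  show ?thesis
  proof (intro exI[of _ B] conjI ballI)
    show "B \<subseteq> regions T" unfolding B_def T_def tangle_of_sets(2) by blast
    fix s assume "s \<in> strands T"
    then obtain b j where bj: "(b, j) \<in> pts T" "b \<in> boxes T" "j \<in> points (box T b)" "s = st b j"
      by (rule strand_cases)
    obtain i where i: "j = Suc i" using bj(3) by (cases j) (auto simp: points_def)
    have sides: "uside T s = rg b (u_interval (box T b) j)" "sside T s = rg b (s_interval (box T b) j)"
      using T_inc(2,3)[OF bj(2,3)] bj(4) by simp_all
    have "(uside T s \<in> B) \<noteq> (sside T s \<in> B) \<longleftrightarrow> a b j"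
      unfolding sides B_iff[OF bj(2) u_interval_in[OF bj(3)]] B_iff[OF bj(2) s_interval_in[OF bj(3)]]
      using i by (auto simp: u_interval_def s_interval_def)
    then show "s \<in> A \<longleftrightarrow> (uside T s \<in> B) \<noteq> (sside T s \<in> B)"
      using a[of j b] i bj(4) by simp
  qed
qed

lemma planar: "planar_tangle T"
  unfolding planar_tangle_def
proof (intro conjI ballI)
  have fin: "finite {(b, j). b \<in> boxes T \<and> j \<in> X (box T b)}" if "!!t. finite (X t)" for X :: "btype => nat set"
    by (rule finite_subset[of _ "Sigma (boxes T) (\<lambda>b. X (box T b))"]) (use that in \<open>auto simp: boxes_def\<close>)
  have "strands T = case_prod st ` {(b, j). b \<in> boxes T \<and> j \<in> points (box T b)}"
    unfolding T_def tangle_of_sets(1) by auto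
  then show "finite (strands T)" using fin[of points] by simp
  have "regions T = case_prod rg ` {(b, j). b \<in> boxes T \<and> j \<in> intervals (box T b)}"
    unfolding T_def tangle_of_sets(2) by auto
  then show "finite (regions T)" using fin[of intervals] by (simp add: intervals_def)
  show "shaded T \<subseteq> regions T" unfolding T_inc(5) using T_inc(4) by auto
  show "uside T s \<in> regions T - shaded T" "sside T s \<in> shaded T" if "s \<in> strands T" for s
  proof -
    obtain b j where bj: "(b, j) \<in> pts T" "b \<in> boxes T" "j \<in> points (box T b)" "s = st b j"
      using \<open>s \<in> strands T\<close> by (rule strand_cases)
    note i = u_interval_in[OF bj(3)] s_interval_in[OF bj(3)]
    show "uside T s \<in> regions T - shaded T" "sside T s \<in> shaded T"
      using T_inc(2,3)[OF bj(2,3)] bj(4) shade[OF bj(2) i(1)] shade[OF bj(2) i(2)]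
        T_inc(4)[OF bj(2) i(1)] sides_shaded[OF bj(3)] by simp_all
  qed
  fix b assume b: "b \<in> boxes T"
  show "region_at T b j \<in> regions T" "region_at T b j \<in> shaded T \<longleftrightarrow> shaded_interval (box T b) j"
    if "j \<in> intervals (box T b)" for j
    using T_inc(4)[OF b that] shade[OF b that] by simp_all
  show "region_at T b (2 * fst (box T b)) = region_at T b 0"
    using Q_wrap[OF T_pres(2) b] name_even[of T b "2 * fst (box T b)"] name_even[of T b 0] by simp
  show "strand_at T b j \<in> strands T"
    "uside T (strand_at T b j) = region_at T b (u_interval (box T b) j)"
    "sside T (strand_at T b j) = region_at T b (s_interval (box T b) j)" if "j \<in> points (box T b)" for j
    by (rule T_inc(1-3)[OF b that])+
next
  show "inj_on (case_prod (strand_at T)) (starts T)" using ports_inj[of True] by (simp add: ports_def)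
  show "inj_on (case_prod (strand_at T)) (ends T)" using ports_inj[of False] by (simp add: ports_def)
  show "case_prod (strand_at T) ` starts T = case_prod (strand_at T) ` ends T"
    using ports_image[of True] ports_image[of False] by (simp add: ports_def)
  show "\<forall>B\<subseteq>regions T. B \<noteq> {} \<and> (\<forall>s\<in>strands T. uside T s \<in> B \<longleftrightarrow> sside T s \<in> B) --> B = regions T"
    using connected by blast
  show "\<forall>A\<subseteq>strands T. (\<forall>b\<in>boxes T. even (card {j \<in> points (box T b). strand_at T b j \<in> A})) -->
      (\<exists>B\<subseteq>regions T. \<forall>s\<in>strands T. s \<in> A \<longleftrightarrow> (uside T s \<in> B) \<noteq> (sside T s \<in> B))"
    using jordan by simp
qed

end

lemma presented_tangle_ofI:
  assumes "Q (name (tangle_of out ins st rg))" "!!\<phi> h. Q \<phi> ==> Q (h \<circ> \<phi>)"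
    "!!\<phi>. Q \<phi> ==> \<exists>d. \<forall>u\<in>nodes (tangle_of out ins st rg). \<phi> u = d (name (tangle_of out ins st rg) u)"
  shows "presented (tangle_of out ins st rg) Q"
  unfolding presented_def
proof (intro conjI allI impI ballI)
  fix \<phi> u v assume "Q \<phi>" "u \<in> nodes (tangle_of out ins st rg)" "v \<in> nodes (tangle_of out ins st rg)"
    "name (tangle_of out ins st rg) u = name (tangle_of out ins st rg) v"
  then show "\<phi> u = \<phi> v" using assms(3)[of \<phi>] by metis
qed (use assms(1,2) tangle_of_attached in blast)+

subsection \<open>Parallel strands\<close>

definition unit_sys :: "nat => system" where
  "unit_sys k \<phi> \<longleftrightarrow> (\<forall>p\<le>4 * k. \<phi> (0, p) = \<phi> (0, 4 * k - p))"

lemma unit_presented: "presented (unit_tangle k s) (unit_sys k)"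
  unfolding unit_tangle_def
proof (rule presented_tangle_ofI, fold unit_tangle_def)
  have nm: "name (unit_tangle k s) (0, p) =
      (if even p then Inr (min (p div 2) (2 * k - p div 2))
       else Inl (min (Suc p div 2) (2 * k + 1 - Suc p div 2)))" for p
    by (simp add: name_def unit_tangle_def)
  show "unit_sys k (name (unit_tangle k s))"
    unfolding unit_sys_def nm
  proof (intro allI impI)
    fix p assume "p \<le> 4 * k"
    show "(if even p then Inr (min (p div 2) (2 * k - p div 2))
        else Inl (min (Suc p div 2) (2 * k + 1 - Suc p div 2))) =
      (if even (4 * k - p) then Inr (min ((4 * k - p) div 2) (2 * k - (4 * k - p) div 2))
        else Inl (min (Suc (4 * k - p) div 2) (2 * k + 1 - Suc (4 * k - p) div 2)))"
    proof (cases p rule: pos_cases)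
      case (even j)
      then have "4 * k - p = 2 * (2 * k - j)" "j \<le> 2 * k" using \<open>p \<le> 4 * k\<close> by auto
      then show ?thesis using even by simp
    next
      case (odd j)
      then have "4 * k - p = 2 * (2 * k + 1 - j) - 1" "j \<le> 2 * k" "0 < 2 * k + 1 - j"
        using \<open>p \<le> 4 * k\<close> by auto
      then show ?thesis using odd by simp
    qed
  qed
  show "unit_sys k (h \<circ> \<phi>)" if "unit_sys k \<phi>" for h \<phi>
    using that unfolding unit_sys_def comp_def by (intro allI impI arg_cong[of _ _ h]) blast
  show "\<exists>d. \<forall>u\<in>nodes (unit_tangle k s). \<phi> u = d (name (unit_tangle k s) u)" if "unit_sys k \<phi>" for \<phi>
  proof -
    define d where "d = case_sum (\<lambda>j. \<phi> (0, 2 * j - 1)) (\<lambda>j. \<phi> (0, 2 * j))"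
    have "\<phi> (0, p) = d (name (unit_tangle k s) (0, p))" if p: "p \<le> 4 * k" for p
    proof (cases p rule: pos_cases)
      case (even j)
      have "\<phi> (0, p) = \<phi> (0, 4 * k - p)" using \<open>unit_sys k \<phi>\<close> p unfolding unit_sys_def by blast
      moreover have "4 * k - p = 2 * (2 * k - j)" using even p by auto
      ultimately have "\<phi> (0, 2 * j) = \<phi> (0, 2 * (2 * k - j))" unfolding even by simp
      then show ?thesis unfolding even d_def nm by (simp add: min_def)
    next
      case (odd j)
      have eq: "\<phi> (0, p) = \<phi> (0, 4 * k - p)" using \<open>unit_sys k \<phi>\<close> p unfolding unit_sys_def by blast
      have e: "4 * k - p = 2 * (2 * k + 1 - j) - 1" using odd p by auto
      have nm': "name (unit_tangle k s) (0, p) = Inl (min j (2 * k + 1 - j))"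
        using odd by (auto simp: nm)
      show ?thesis unfolding nm' d_def sum.case min_def
        by (cases "j \<le> 2 * k + 1 - j") (simp_all only: if_True if_False eq[unfolded e] odd(2)[symmetric])
    qed
    moreover have "u = (0, snd u)" "snd u \<le> 4 * k" if "u \<in> nodes (unit_tangle k s)" for u
      using that by (auto simp: nodes_def unit_tangle_def box_def)
    ultimately have "\<forall>u\<in>nodes (unit_tangle k s). \<phi> u = d (name (unit_tangle k s) u)" by metis
    then show ?thesis by blast
  qed
qed

lemma unit_matched: "matched_tangle (k, s) [] (\<lambda>b j. min j (2 * k + 1 - j)) (\<lambda>b j. min j (2 * k - j))
    (unit_sys k) (\<lambda>(b, j). (b, 2 * k + 1 - j))"
proof (unfold_locales, fold unit_tangle_def)
  have bx [simp]: "boxes (unit_tangle k s) = {0}" "box (unit_tangle k s) 0 = (k, s)"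
    by (auto simp: boxes_def box_def unit_tangle_def)
  have pts: "(b, j) \<in> pts (unit_tangle k s) \<longleftrightarrow> b = 0 \<and> 0 < j \<and> j \<le> 2 * k" for b j
    unfolding pts_def by (auto simp: points_def simp del: boxes_simp)
  have ui: "u_interval (k, s) (2 * k + 1 - j) = 2 * k - u_interval (k, s) j"
    "s_interval (k, s) (2 * k + 1 - j) = 2 * k - s_interval (k, s) j" if "0 < j" "j \<le> 2 * k" for j
    using that by (auto simp: u_interval_def s_interval_def shaded_interval_def)
  have ui_le: "u_interval (k, s) j \<le> 2 * k" "s_interval (k, s) j \<le> 2 * k" if "0 < j" "j \<le> 2 * k" for j
    using that by (auto simp: u_interval_def s_interval_def)
  show "presented (unit_tangle k s) (unit_sys k)" by (rule unit_presented)
  show "(case u of (b, j) => (b, 2 * k + 1 - j)) \<in> pts (unit_tangle k s)"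
    if "u \<in> pts (unit_tangle k s)" for u using that by (cases u) (auto simp: pts)
  show "(case case u of (b, j) => (b, 2 * k + 1 - j) of (b, j) => (b, 2 * k + 1 - j)) = u"
    if "u \<in> pts (unit_tangle k s)" for u using that by (cases u) (auto simp: pts)
  show "is_start (unit_tangle k s) (case u of (b, j) => (b, 2 * k + 1 - j)) \<longleftrightarrow> \<not> is_start (unit_tangle k s) u"
    if "u \<in> pts (unit_tangle k s)" for u
    using that by (cases u) (auto simp: pts is_start_def shaded_interval_def)
  show "\<phi> (b, 2 * j - 1) = \<phi> (c, 2 * i - 1) \<and>
        \<phi> (b, 2 * u_interval (box (unit_tangle k s) b) j) = \<phi> (c, 2 * u_interval (box (unit_tangle k s) c) i) \<and>
        \<phi> (b, 2 * s_interval (box (unit_tangle k s) b) j) = \<phi> (c, 2 * s_interval (box (unit_tangle k s) c) i)"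
    if "unit_sys k \<phi>" "(b, j) \<in> pts (unit_tangle k s)" "(case (b, j) of (b, j) => (b, 2 * k + 1 - j)) = (c, i)"
    for \<phi> b j c i
  proof -
    have j: "0 < j" "j \<le> 2 * k" and [simp]: "b = 0" "c = 0" "i = 2 * k + 1 - j" using that(2,3) by (auto simp: pts)
    have *: "\<phi> (0, p) = \<phi> (0, q)" if "p + q = 4 * k" for p q
      using \<open>unit_sys k \<phi>\<close> that unfolding unit_sys_def
      by (metis add_diff_cancel_left' le_add1)
    show ?thesis using ui_le[OF j] ui[OF j] j by (auto intro!: *)
  qed
  show "unit_sys k (\<lambda>(b, p). if even p then Inr 0 else Inl (min (prod_encode (b, Suc p div 2))
      (prod_encode (case (b, Suc p div 2) of (b, j) => (b, 2 * k + 1 - j)))))"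
    unfolding unit_sys_def
  proof (intro allI impI)
    fix p assume p: "p \<le> 4 * k"
    show "(case (0, p) of (b, p) => if even p then Inr 0 else Inl (min (prod_encode (b, Suc p div 2))
      (prod_encode (case (b, Suc p div 2) of (b, j) => (b, 2 * k + 1 - j))))) =
      (case (0, 4 * k - p) of (b, p) => if even p then Inr 0 else Inl (min (prod_encode (b, Suc p div 2))
      (prod_encode (case (b, Suc p div 2) of (b, j) => (b, 2 * k + 1 - j)))))"
    proof (cases p rule: pos_cases)
      case (odd j)
      then have "Suc (4 * k - p) div 2 = 2 * k + 1 - j" "Suc p div 2 = j" "j \<le> 2 * k"
        "odd p" "odd (4 * k - p)" using p by auto
      then show ?thesis by (simp add: min.commute)
    qed (use p in simp)
  qed
  show "unit_sys k (\<lambda>(b, p). if even p then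
      Inr (of_bool (shaded_interval (box (unit_tangle k s) b) (p div 2))) else Inl 0)"
    unfolding unit_sys_def
  proof (intro allI impI)
    fix p assume p: "p \<le> 4 * k"
    show "(case (0, p) of (b, p) => if even p then
        Inr (of_bool (shaded_interval (box (unit_tangle k s) b) (p div 2))) else Inl 0) =
      (case (0, 4 * k - p) of (b, p) => if even p then
        Inr (of_bool (shaded_interval (box (unit_tangle k s) b) (p div 2))) else Inl 0)"
    proof (cases p rule: pos_cases)
      case (even j)
      then have "(4 * k - p) div 2 = 2 * k - j" "p div 2 = j" "j \<le> 2 * k" using p by auto
      then show ?thesis using even p by (simp add: shaded_interval_def)
    qed (use p in auto)
  qed
  show "\<phi> (b, 0) = \<phi> (b, 4 * fst (box (unit_tangle k s) b))"
    if "unit_sys k \<phi>" "b \<in> boxes (unit_tangle k s)" for \<phi> b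
  proof -
    have "\<phi> (0, 0) = \<phi> (0, 4 * k - 0)" using that(1) unfolding unit_sys_def by blast
    then show ?thesis using that(2) unfolding bx by simp
  qed
  show "\<exists>j\<in>intervals (box (unit_tangle k s) b). \<exists>i\<in>intervals (box (unit_tangle k s) 0).
      \<forall>\<phi>. unit_sys k \<phi> --> \<phi> (b, 2 * j) = \<phi> (0, 2 * i)" if "b \<in> boxes (unit_tangle k s)" for b
    using that unfolding bx by (intro bexI[of _ 0]) simp_all
  show "\<exists>off. unit_sys k (\<lambda>(b, p). if even p then
      Inr (of_bool (parity (\<lambda>j. \<phi> (b, 2 * j - 1) = Inl 1) (p div 2) \<noteq> off b)) else \<phi> (b, p))"
    if \<phi>: "unit_sys k \<phi>" and ev: "!!b. b \<in> boxes (unit_tangle k s) ==>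
      \<not> parity (\<lambda>j. \<phi> (b, 2 * j - 1) = Inl 1) (2 * fst (box (unit_tangle k s) b))" for \<phi>
  proof (intro exI[of _ "\<lambda>_. False"])
    define a where "a b j \<longleftrightarrow> \<phi> (b, 2 * j - 1) = Inl 1" for b j
    have sym: "a 0 (0 + q) = a 0 (2 * k + 1 - q)" if "0 < q" "q \<le> 2 * k" for q
    proof -
      have "4 * k - (2 * q - 1) = 2 * (2 * k + 1 - q) - 1" "2 * q - 1 \<le> 4 * k" using that by auto
      then show ?thesis using \<phi> unfolding unit_sys_def a_def by (metis add_0)
    qed
    have "a 0 = (\<lambda>j. \<phi> (0, 2 * j - 1) = Inl 1)" by (rule ext) (simp add: a_def)
    then have npar: "\<not> parity (a 0) (2 * k)" using ev[of 0] by simp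
    have key: "(parity (a 0) (0 + n) \<noteq> parity (a 0) 0) = (parity (a 0) (2 * k) \<noteq> parity (a 0) (2 * k - n))"
      if "n \<le> 2 * k" for n
      by (rule parity_reverse, rule sym) (use that in linarith)+
    have par: "parity (a 0) n = parity (a 0) (2 * k - n)" if "n \<le> 2 * k" for n
      using key[OF that] npar by simp
    show "unit_sys k (\<lambda>(b, p). if even p then
      Inr (of_bool (parity (\<lambda>j. \<phi> (b, 2 * j - 1) = Inl 1) (p div 2) \<noteq> False)) else \<phi> (b, p))"
      unfolding a_def[symmetric] unit_sys_def
    proof (intro allI impI)
      fix p assume p: "p \<le> 4 * k"
      show "(case (0, p) of (b, p) => if even p then Inr (of_bool (parity (a b) (p div 2) \<noteq> False)) else \<phi> (b, p)) =
        (case (0, 4 * k - p) of (b, p) => if even p then Inr (of_bool (parity (a b) (p div 2) \<noteq> False)) else \<phi> (b, p))"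
      proof (cases p rule: pos_cases)
        case (even j)
        then have "(4 * k - p) div 2 = 2 * k - j" "p div 2 = j" "j \<le> 2 * k" using p by auto
        then show ?thesis using even p par[of j] by simp
      next
        case (odd j)
        then have "odd p" "odd (4 * k - p)" using p by auto
        moreover have "\<phi> (0, p) = \<phi> (0, 4 * k - p)" using \<phi> p unfolding unit_sys_def by blast
        ultimately show ?thesis by simp
      qed
    qed
  qed
qed

lemma unit_planar: "planar_tangle (unit_tangle k s)"
  using matched_tangle.planar[OF unit_matched] unfolding unit_tangle_def .

subsection \<open>Insertion\<close>

text \<open>
An inner box \<open>1\<close> with \<open>c\<close> free and then \<open>b\<close> glued points is attached to the points
\<open>j + 1, ..., j + b\<close> of box \<open>2\<close>, which has \<open>d\<close> further points. The glued points are met in opposite orders.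
The last equation is the identification of the two names of the star interval of box \<open>2\<close>.
\<close>

definition ins_sys :: "nat => nat => nat => nat => system" where
  "ins_sys j c b d \<phi> \<longleftrightarrow>
     (\<forall>p\<le>2 * j. \<phi> (0, p) = \<phi> (2, p)) \<and>
     (\<forall>p\<le>2 * c. \<phi> (0, 2 * j + p) = \<phi> (1, p)) \<and>
     (\<forall>p\<le>2 * b. \<phi> (1, 2 * c + p) = \<phi> (2, 2 * j + 2 * b - p)) \<and>
     (\<forall>p\<le>2 * d. \<phi> (0, 2 * j + 2 * c + p) = \<phi> (2, 2 * j + 2 * b + p)) \<and>
     \<phi> (2, 0) = \<phi> (2, 2 * j + 2 * b + 2 * d)"

lemma ins_sysD:
  assumes "ins_sys j c b d \<phi>"
  shows "!!p. p \<le> 2 * j ==> \<phi> (0, p) = \<phi> (2, p)"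
    "!!p. p \<le> 2 * c ==> \<phi> (0, 2 * j + p) = \<phi> (1, p)"
    "!!p. p \<le> 2 * b ==> \<phi> (1, 2 * c + p) = \<phi> (2, 2 * j + 2 * b - p)"
    "!!p. p \<le> 2 * d ==> \<phi> (0, 2 * j + 2 * c + p) = \<phi> (2, 2 * j + 2 * b + p)"
    "\<phi> (2, 0) = \<phi> (2, 2 * j + 2 * b + 2 * d)"
  using assms unfolding ins_sys_def by blast+

lemma ins_sys_splitI:
  assumes "!!q. q \<le> j ==> \<phi> (0, 2 * q) = \<phi> (2, 2 * q)"
    "!!q. 0 < q ==> q \<le> j ==> \<phi> (0, 2 * q - 1) = \<phi> (2, 2 * q - 1)"
    "!!q. q \<le> c ==> \<phi> (0, 2 * (j + q)) = \<phi> (1, 2 * q)"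
    "!!q. 0 < q ==> q \<le> c ==> \<phi> (0, 2 * (j + q) - 1) = \<phi> (1, 2 * q - 1)"
    "!!q. q \<le> b ==> \<phi> (1, 2 * (c + q)) = \<phi> (2, 2 * (j + b - q))"
    "!!q. 0 < q ==> q \<le> b ==> \<phi> (1, 2 * (c + q) - 1) = \<phi> (2, 2 * (j + b + 1 - q) - 1)"
    "!!q. q \<le> d ==> \<phi> (0, 2 * (j + c + q)) = \<phi> (2, 2 * (j + b + q))"
    "!!q. 0 < q ==> q \<le> d ==> \<phi> (0, 2 * (j + c + q) - 1) = \<phi> (2, 2 * (j + b + q) - 1)"
    "\<phi> (2, 0) = \<phi> (2, 2 * (j + b + d))"
  shows "ins_sys j c b d \<phi>"
  unfolding ins_sys_def
proof (intro conjI allI impI)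
  fix p assume p: "p \<le> 2 * j"
  show "\<phi> (0, p) = \<phi> (2, p)"
    by (cases p rule: pos_cases) (use p assms(1,2) in auto)
next
  fix p assume p: "p \<le> 2 * c"
  show "\<phi> (0, 2 * j + p) = \<phi> (1, p)"
  proof (cases p rule: pos_cases)
    case (odd q)
    then have "2 * j + p = 2 * (j + q) - 1" by simp
    then show ?thesis using assms(4)[of q] odd p by simp
  qed (use p assms(3) in \<open>simp add: algebra_simps\<close>)
next
  fix p assume p: "p \<le> 2 * b"
  show "\<phi> (1, 2 * c + p) = \<phi> (2, 2 * j + 2 * b - p)"
  proof (cases p rule: pos_cases)
    case (odd q)
    then have "2 * c + p = 2 * (c + q) - 1" "2 * j + 2 * b - p = 2 * (j + b + 1 - q) - 1" by auto
    moreover have "q \<le> b" using odd p by linarith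
    ultimately show ?thesis using assms(6)[of q] odd by simp
  next
    case (even q)
    then have "2 * c + p = 2 * (c + q)" "2 * j + 2 * b - p = 2 * (j + b - q)" by auto
    then show ?thesis using assms(5)[of q] even p by simp
  qed
next
  fix p assume p: "p \<le> 2 * d"
  show "\<phi> (0, 2 * j + 2 * c + p) = \<phi> (2, 2 * j + 2 * b + p)"
  proof (cases p rule: pos_cases)
    case (odd q)
    then have "2 * j + 2 * c + p = 2 * (j + c + q) - 1" "2 * j + 2 * b + p = 2 * (j + b + q) - 1" by auto
    moreover have "q \<le> d" using odd p by linarith
    ultimately show ?thesis using assms(8)[of q] odd by simp
  qed (use p assms(7) in \<open>simp add: algebra_simps\<close>)
next
  show "\<phi> (2, 0) = \<phi> (2, 2 * j + 2 * b + 2 * d)" using assms(9) by (simp add: algebra_simps)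
qed

text \<open>
Two positions get the same number exactly if the system forces their names to agree. A tangle built from
these numbers is presented by the system without any computation of strands or regions.
\<close>

definition sys_name :: "system => nat \<times> nat => nat" where
  "sys_name Q u = (LEAST n. \<exists>v. prod_encode v = n \<and> (\<forall>\<phi>. Q \<phi> --> \<phi> u = \<phi> v))"

lemma sys_name_eq: "sys_name Q u = sys_name Q v \<longleftrightarrow> (\<forall>\<phi>. Q \<phi> --> \<phi> u = \<phi> v)"
proof
  have ex: "\<exists>v. prod_encode v = sys_name Q u \<and> (\<forall>\<phi>. Q \<phi> --> \<phi> u = \<phi> v)" for u
    unfolding sys_name_def by (rule LeastI_ex) blast
  assume eq: "sys_name Q u = sys_name Q v"
  obtain x where "prod_encode x = sys_name Q u" "\<forall>\<phi>. Q \<phi> --> \<phi> u = \<phi> x" using ex by blast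
  moreover obtain y where "prod_encode y = sys_name Q v" "\<forall>\<phi>. Q \<phi> --> \<phi> v = \<phi> y" using ex by blast
  ultimately show "\<forall>\<phi>. Q \<phi> --> \<phi> u = \<phi> v" using eq by (metis prod_encode_eq)
next
  assume "\<forall>\<phi>. Q \<phi> --> \<phi> u = \<phi> v"
  then have "(\<forall>\<phi>. Q \<phi> --> \<phi> u = \<phi> w) \<longleftrightarrow> (\<forall>\<phi>. Q \<phi> --> \<phi> v = \<phi> w)" for w by metis
  then show "sys_name Q u = sys_name Q v" unfolding sys_name_def by simp
qed

definition sys_tangle :: "btype => btype list => system => tangle" where
  "sys_tangle out ins Q = tangle_of out ins (\<lambda>b j. sys_name Q (b, 2 * j - 1)) (\<lambda>b j. sys_name Q (b, 2 * j))"

lemma sys_tangle_name: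
  "name (sys_tangle out ins Q) (b, p) = (if even p then Inr (sys_name Q (b, p)) else Inl (sys_name Q (b, p)))"
proof (cases p rule: pos_cases)
  case (odd j)
  then show ?thesis using name_odd[of j "sys_tangle out ins Q" b] by (simp add: sys_tangle_def)
qed (simp add: sys_tangle_def)

definition ins_tangle :: "bool => nat => nat => nat => nat => tangle" where
  "ins_tangle s j c b d = sys_tangle ((j + c + d) div 2, s)
     [((c + b) div 2, s \<noteq> odd j), ((j + b + d) div 2, s)] (ins_sys j c b d)"

lemma ins_tangle_sel [simp]:
  "outer (ins_tangle s j c b d) = ((j + c + d) div 2, s)"
  "inner (ins_tangle s j c b d) = [((c + b) div 2, s \<noteq> odd j), ((j + b + d) div 2, s)]"
  by (simp_all add: ins_tangle_def sys_tangle_def)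

lemma ins_sys_comp: "ins_sys j c b d \<phi> ==> ins_sys j c b d (h \<circ> \<phi>)"
  unfolding ins_sys_def comp_def by (elim conjE) (intro conjI allI impI arg_cong[of _ _ h]; blast)

lemma ins_presented: "presented (ins_tangle s j c b d) (ins_sys j c b d)"
  unfolding presented_def
proof (intro conjI allI impI ballI)
  let ?T = "ins_tangle s j c b d"
  show "attached ?T" unfolding ins_tangle_def sys_tangle_def by (rule tangle_of_attached)
  have nm: "name ?T (b', p) = name ?T (c', q)"
    if "even p \<longleftrightarrow> even q" "!!\<phi>. ins_sys j c b d \<phi> ==> \<phi> (b', p) = \<phi> (c', q)" for b' p c' q
    unfolding ins_tangle_def sys_tangle_name using that(1) sys_name_eq that(2) by auto
  show "ins_sys j c b d (name ?T)"
    by (rule ins_sys_def[THEN iffD2], intro conjI allI impI; rule nm; (erule ins_sysD; assumption)?;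
        (erule ins_sysD(5))?; simp?)
  show "ins_sys j c b d (h \<circ> \<phi>)" if "ins_sys j c b d \<phi>" for \<phi> h using that by (rule ins_sys_comp)
  show "\<phi> u = \<phi> v" if "ins_sys j c b d \<phi>" "u \<in> nodes ?T" "v \<in> nodes ?T" "name ?T u = name ?T v" for \<phi> u v
    using that(4) sys_name_eq[of _ u v] that(1)
    by (cases u; cases v) (auto simp: ins_tangle_def sys_tangle_name split: if_splits)
qed

definition ins_match :: "nat => nat => nat => nat \<times> nat => nat \<times> nat" where
  "ins_match j c b = (\<lambda>(e, i).
     if e = 0 then (if i \<le> j then (2, i) else if i \<le> j + c then (1, i - j) else (2, i + b - c))
     else if e = 1 then (if i \<le> c then (0, j + i) else (2, j + b + c + 1 - i))
     else (if i \<le> j then (0, i) else if i \<le> j + b then (1, j + b + c + 1 - i) else (0, i + c - b)))"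

lemma parallel_points:
  fixes \<phi> :: "nat \<times> nat => 'a"
  assumes "shaded_interval t i = shaded_interval t' i'" "0 < i" "0 < i'"
    "\<phi> (e, 2 * (i - 1)) = \<phi> (e', 2 * (i' - 1))" "\<phi> (e, 2 * i - 1) = \<phi> (e', 2 * i' - 1)"
    "\<phi> (e, 2 * i) = \<phi> (e', 2 * i')"
  shows "\<phi> (e, 2 * i - 1) = \<phi> (e', 2 * i' - 1) \<and>
    \<phi> (e, 2 * u_interval t i) = \<phi> (e', 2 * u_interval t' i') \<and>
    \<phi> (e, 2 * s_interval t i) = \<phi> (e', 2 * s_interval t' i')"
  using assms by (simp add: u_interval_def s_interval_def)

lemma antiparallel_points:
  fixes \<phi> :: "nat \<times> nat => 'a"
  assumes "shaded_interval t i \<noteq> shaded_interval t' i'" "0 < i" "0 < i'"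
    "\<phi> (e, 2 * (i - 1)) = \<phi> (e', 2 * i')" "\<phi> (e, 2 * i - 1) = \<phi> (e', 2 * i' - 1)"
    "\<phi> (e, 2 * i) = \<phi> (e', 2 * (i' - 1))"
  shows "\<phi> (e, 2 * i - 1) = \<phi> (e', 2 * i' - 1) \<and>
    \<phi> (e, 2 * u_interval t i) = \<phi> (e', 2 * u_interval t' i') \<and>
    \<phi> (e, 2 * s_interval t i) = \<phi> (e', 2 * s_interval t' i')"
  using assms by (auto simp: u_interval_def s_interval_def)

locale insertion =
  fixes s :: bool and j c b d :: nat
  assumes even1: "even (c + b)" and even2: "even (j + b + d)"
begin

abbreviation "T \<equiv> ins_tangle s j c b d"

lemma even0: "even (j + c + d)"
  using even1 even2 by auto

lemma boxes_T: "boxes T = {0, 1, 2}"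
  by (auto simp: boxes_def)

lemma box_T: "box T 0 = ((j + c + d) div 2, s)" "box T (Suc 0) = ((c + b) div 2, s \<noteq> odd j)"
  "box T 2 = ((j + b + d) div 2, s)"
  by (simp_all add: box_def)

lemma size_T: "2 * fst (box T 0) = j + c + d" "2 * fst (box T (Suc 0)) = c + b" "2 * fst (box T 2) = j + b + d"
  using even0 even1 even2 unfolding box_T by simp_all

lemma pts_T: "(e, i) \<in> pts T \<longleftrightarrow> 0 < i \<and> (e = 0 \<and> i \<le> j + c + d \<or> e = 1 \<and> i \<le> c + b \<or> e = 2 \<and> i \<le> j + b + d)"
  unfolding pts_def points_def boxes_T using size_T by auto

lemma even_D:
  assumes "ins_sys j c b d \<phi>"
  shows "!!q. q \<le> j ==> \<phi> (0, 2 * q) = \<phi> (2, 2 * q)"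
    "!!q. q \<le> c ==> \<phi> (0, 2 * (j + q)) = \<phi> (1, 2 * q)"
    "!!q. q \<le> b ==> \<phi> (1, 2 * (c + q)) = \<phi> (2, 2 * (j + b - q))"
    "!!q. q \<le> d ==> \<phi> (0, 2 * (j + c + q)) = \<phi> (2, 2 * (j + b + q))"
proof -
  note D = ins_sysD[OF assms]
  show "\<phi> (0, 2 * q) = \<phi> (2, 2 * q)" if "q \<le> j" for q using D(1)[of "2 * q"] that by simp
  show "\<phi> (0, 2 * (j + q)) = \<phi> (1, 2 * q)" if "q \<le> c" for q
    using D(2)[of "2 * q"] that by (simp add: algebra_simps)
  show "\<phi> (1, 2 * (c + q)) = \<phi> (2, 2 * (j + b - q))" if "q \<le> b" for q
    using D(3)[of "2 * q"] that by (simp add: algebra_simps)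
  show "\<phi> (0, 2 * (j + c + q)) = \<phi> (2, 2 * (j + b + q))" if "q \<le> d" for q
    using D(4)[of "2 * q"] that by (simp add: algebra_simps)
qed

lemma odd_D:
  assumes "ins_sys j c b d \<phi>"
  shows "!!q. 0 < q ==> q \<le> j ==> \<phi> (0, 2 * q - 1) = \<phi> (2, 2 * q - 1)"
    "!!q. 0 < q ==> q \<le> c ==> \<phi> (0, 2 * (j + q) - 1) = \<phi> (1, 2 * q - 1)"
    "!!q. 0 < q ==> q \<le> b ==> \<phi> (1, 2 * (c + q) - 1) = \<phi> (2, 2 * (j + b + 1 - q) - 1)"
    "!!q. 0 < q ==> q \<le> d ==> \<phi> (0, 2 * (j + c + q) - 1) = \<phi> (2, 2 * (j + b + q) - 1)"
proof -
  note D = ins_sysD[OF assms]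
  show "\<phi> (0, 2 * q - 1) = \<phi> (2, 2 * q - 1)" if "0 < q" "q \<le> j" for q
    using D(1)[of "2 * q - 1"] that by simp
  show "\<phi> (0, 2 * (j + q) - 1) = \<phi> (1, 2 * q - 1)" if "0 < q" "q \<le> c" for q
  proof -
    have "2 * (j + q) - 1 = 2 * j + (2 * q - 1)" "2 * q - 1 \<le> 2 * c" using that by auto
    then show ?thesis using D(2)[of "2 * q - 1"] by simp
  qed
  show "\<phi> (1, 2 * (c + q) - 1) = \<phi> (2, 2 * (j + b + 1 - q) - 1)" if "0 < q" "q \<le> b" for q
  proof -
    have "2 * (c + q) - 1 = 2 * c + (2 * q - 1)" "2 * (j + b + 1 - q) - 1 = 2 * j + 2 * b - (2 * q - 1)"
      "2 * q - 1 \<le> 2 * b" using that by auto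
    then show ?thesis using D(3)[of "2 * q - 1"] by simp
  qed
  show "\<phi> (0, 2 * (j + c + q) - 1) = \<phi> (2, 2 * (j + b + q) - 1)" if "0 < q" "q \<le> d" for q
  proof -
    have "2 * (j + c + q) - 1 = 2 * j + 2 * c + (2 * q - 1)" "2 * (j + b + q) - 1 = 2 * j + 2 * b + (2 * q - 1)"
      "2 * q - 1 \<le> 2 * d" using that by auto
    then show ?thesis using D(4)[of "2 * q - 1"] by simp
  qed
qed

text \<open>The matching consists of four families of pairs.\<close>

lemma pair_cases [consumes 1]:
  assumes "(e, i) \<in> pts T"
  obtains (left) "0 < i" "i \<le> j" "e = 0 \<or> e = 2" "ins_match j c b (e, i) = (2 - e, i)"
  | (free0) q where "e = 0" "0 < q" "q \<le> c" "i = j + q" "ins_match j c b (e, i) = (1, q)"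
  | (free1) "e = 1" "0 < i" "i \<le> c" "ins_match j c b (e, i) = (0, j + i)"
  | (glued1) q where "e = 1" "0 < q" "q \<le> b" "i = c + q" "ins_match j c b (e, i) = (2, j + b + 1 - q)"
  | (glued2) q where "e = 2" "0 < q" "q \<le> b" "i = j + b + 1 - q" "ins_match j c b (e, i) = (1, c + q)"
  | (right0) q where "e = 0" "0 < q" "q \<le> d" "i = j + c + q" "ins_match j c b (e, i) = (2, j + b + q)"
  | (right2) q where "e = 2" "0 < q" "q \<le> d" "i = j + b + q" "ins_match j c b (e, i) = (0, j + c + q)"
proof -
  from assms have "0 < i" unfolding pts_T by simp
  consider "e = 0" "i \<le> j" | "e = 0" "j < i" "i \<le> j + c" | "e = 0" "j + c < i" "i \<le> j + c + d"
    | "e = 1" "i \<le> c" | "e = 1" "c < i" "i \<le> c + b"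
    | "e = 2" "i \<le> j" | "e = 2" "j < i" "i \<le> j + b" | "e = 2" "j + b < i" "i \<le> j + b + d"
    using assms unfolding pts_T by (elim conjE disjE) (simp_all add: not_le, linarith+)
  then show thesis
  proof cases
    case 1 then show thesis using left \<open>0 < i\<close> by (simp add: ins_match_def)
  next
    case 2 then show thesis using free0[of "i - j"] by (simp add: ins_match_def)
  next
    case 3 then show thesis using right0[of "i - (j + c)"] by (simp add: ins_match_def)
  next
    case 4 then show thesis using free1 \<open>0 < i\<close> by (simp add: ins_match_def)
  next
    case 5 then show thesis using glued1[of "i - c"] by (simp add: ins_match_def)
  next
    case 6 then show thesis using left \<open>0 < i\<close> by (simp add: ins_match_def)
  next
    case 7 then show thesis using glued2[of "j + b + 1 - i"] by (simp add: ins_match_def)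
  next
    case 8 then show thesis using right2[of "i - (j + b)"] by (simp add: ins_match_def)
  qed
qed

lemma match_simps:
  "i \<le> j ==> ins_match j c b (0, i) = (2, i)" "i \<le> j ==> ins_match j c b (2, i) = (0, i)"
  "0 < q ==> q \<le> c ==> ins_match j c b (0, j + q) = (1, q)"
  "q \<le> c ==> ins_match j c b (1, q) = (0, j + q)"
  "0 < q ==> q \<le> b ==> ins_match j c b (1, c + q) = (2, j + b + 1 - q)"
  "0 < q ==> q \<le> b ==> ins_match j c b (2, j + b + 1 - q) = (1, c + q)"
  "0 < q ==> ins_match j c b (0, j + c + q) = (2, j + b + q)"
  "0 < q ==> ins_match j c b (2, j + b + q) = (0, j + c + q)"
  by (auto simp: ins_match_def)

lemma match_in: "u \<in> pts T ==> ins_match j c b u \<in> pts T"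
proof (cases u)
  case (Pair e i)
  assume "u \<in> pts T"
  then have "(e, i) \<in> pts T" using Pair by simp
  then show ?thesis by (cases rule: pair_cases) (auto simp: Pair pts_T)
qed

lemma match_match: "u \<in> pts T ==> ins_match j c b (ins_match j c b u) = u"
proof (cases u)
  case (Pair e i)
  assume "u \<in> pts T"
  then have "(e, i) \<in> pts T" using Pair by simp
  then show ?thesis unfolding Pair by (cases rule: pair_cases) (auto simp: match_simps simp del: One_nat_def)
qed

lemma glued_parity: "q \<le> b ==> odd (j + b + 1 - q) \<longleftrightarrow> (odd q \<longleftrightarrow> odd (j + b))"
  by (subst even_diff_nat) auto

lemma match_start: "u \<in> pts T ==> is_start T (ins_match j c b u) \<longleftrightarrow> \<not> is_start T u"
proof (cases u)
  case (Pair e i)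
  assume "u \<in> pts T"
  then have pt: "(e, i) \<in> pts T" using Pair by simp
  have st: "is_start T (0, i) \<longleftrightarrow> s = odd i" "is_start T (1, i) \<longleftrightarrow> ((s \<noteq> odd j) \<noteq> odd i)"
    "is_start T (2, i) \<longleftrightarrow> s \<noteq> odd i" for i
    unfolding is_start_def shaded_interval_def prod.case box_T One_nat_def by (simp_all)
  have cb: "odd c \<longleftrightarrow> odd b" using even1 by simp
  from pt show ?thesis unfolding Pair
  proof (cases rule: pair_cases)
    case left
    from left(3) show "is_start T (ins_match j c b (e, i)) \<longleftrightarrow> \<not> is_start T (e, i)"
    proof
      assume e: "e = 0"
      show ?thesis unfolding left(4) unfolding e diff_zero st by blast
    next
      assume e: "e = 2"
      show ?thesis unfolding left(4) unfolding e diff_self_eq_0 st by blast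
    qed
  next
    case (free0 q)
    show "is_start T (ins_match j c b (e, i)) \<longleftrightarrow> \<not> is_start T (e, i)"
      unfolding free0(5) unfolding free0(1,4) st odd_add by blast
  next
    case free1
    show "is_start T (ins_match j c b (e, i)) \<longleftrightarrow> \<not> is_start T (e, i)"
      unfolding free1(4) unfolding free1(1) st odd_add by blast
  next
    case (glued1 q)
    show "is_start T (ins_match j c b (e, i)) \<longleftrightarrow> \<not> is_start T (e, i)"
      unfolding glued1(5) unfolding glued1(1,4) st glued_parity[OF glued1(3)] odd_add cb by blast
  next
    case (glued2 q)
    show "is_start T (ins_match j c b (e, i)) \<longleftrightarrow> \<not> is_start T (e, i)"
      unfolding glued2(5) unfolding glued2(1,4) st glued_parity[OF glued2(3)] odd_add cb by blast
  next
    case (right0 q)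
    show "is_start T (ins_match j c b (e, i)) \<longleftrightarrow> \<not> is_start T (e, i)"
      unfolding right0(5) unfolding right0(1,4) st odd_add cb by blast
  next
    case (right2 q)
    show "is_start T (ins_match j c b (e, i)) \<longleftrightarrow> \<not> is_start T (e, i)"
      unfolding right2(5) unfolding right2(1,4) st odd_add cb by blast
  qed
qed

lemma match_sys:
  assumes "ins_sys j c b d \<phi>" "(e, i) \<in> pts T" "ins_match j c b (e, i) = (e', i')"
  shows "\<phi> (e, 2 * i - 1) = \<phi> (e', 2 * i' - 1) \<and>
    \<phi> (e, 2 * u_interval (box T e) i) = \<phi> (e', 2 * u_interval (box T e') i') \<and>
    \<phi> (e, 2 * s_interval (box T e) i) = \<phi> (e', 2 * s_interval (box T e') i')"
proof -
  note E = even_D[OF assms(1)] and O = odd_D[OF assms(1)]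
  from assms(2) show ?thesis
  proof (cases rule: pair_cases)
    case left
    then have e': "e' = 2 - e" "i' = i" using assms(3) by auto
    have i: "\<phi> (0, 2 * (i - 1)) = \<phi> (2, 2 * (i - 1))" "\<phi> (0, 2 * i - 1) = \<phi> (2, 2 * i - 1)"
      "\<phi> (0, 2 * i) = \<phi> (2, 2 * i)" using left(1,2) E(1)[of i] E(1)[of "i - 1"] O(1)[of i] by auto
    have sh: "shaded_interval (box T 0) i = shaded_interval (box T 2) i"
      unfolding box_T shaded_interval_def by simp
    from left(3) show ?thesis
    proof
      assume e: "e = 0"
      show ?thesis unfolding e' unfolding e diff_zero
        by (rule parallel_points) (use sh left(1) i in simp_all)
    next
      assume e: "e = 2"
      show ?thesis unfolding e' unfolding e diff_self_eq_0
        by (rule parallel_points) (use sh left(1) i in simp_all)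
    qed
  next
    case (free0 q)
    then have e': "e' = 1" "i' = q" using assms(3) by auto
    have "j + q - 1 = j + (q - 1)" using free0 by simp
    then show ?thesis unfolding e' free0(1,4)
      by (intro parallel_points) (use free0 E(2)[of q] E(2)[of "q - 1"] O(2)[of q] in \<open>auto simp: box_T shaded_interval_def\<close>)
  next
    case free1
    then have e': "e' = 0" "i' = j + i" using assms(3) by auto
    have "j + i - 1 = j + (i - 1)" using free1 by simp
    then show ?thesis unfolding e' free1(1)
      by (intro parallel_points) (use free1 E(2)[of i] E(2)[of "i - 1"] O(2)[of i] in \<open>auto simp: box_T shaded_interval_def\<close>)
  next
    case (glued1 q)
    then have e': "e' = 2" "i' = j + b + 1 - q" using assms(3) by auto
    have "c + q - 1 = c + (q - 1)" "j + b + 1 - q - 1 = j + b - q" "j + b - (q - 1) = j + b + 1 - q"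
      using glued1 by auto
    then show ?thesis unfolding e' glued1(1,4)
      by (intro antiparallel_points) (use glued1 even1 E(3)[of q] E(3)[of "q - 1"] O(3)[of q] in \<open>auto simp: box_T shaded_interval_def\<close>)
  next
    case (glued2 q)
    then have e': "e' = 1" "i' = c + q" using assms(3) by auto
    have "c + q - 1 = c + (q - 1)" "j + b + 1 - q - 1 = j + b - q" "j + b - (q - 1) = j + b + 1 - q"
      using glued2 by auto
    then show ?thesis unfolding e' glued2(1,4)
      by (intro antiparallel_points) (use glued2 even1 E(3)[of q] E(3)[of "q - 1"] O(3)[of q] in \<open>auto simp: box_T shaded_interval_def\<close>)
  next
    case (right0 q)
    then have e': "e' = 2" "i' = j + b + q" using assms(3) by auto
    have "j + c + q - 1 = j + c + (q - 1)" "j + b + q - 1 = j + b + (q - 1)" using right0 by auto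
    then show ?thesis unfolding e' right0(1,4)
      by (intro parallel_points) (use right0 even1 E(4)[of q] E(4)[of "q - 1"] O(4)[of q] in \<open>auto simp: box_T shaded_interval_def\<close>)
  next
    case (right2 q)
    then have e': "e' = 0" "i' = j + c + q" using assms(3) by auto
    have "j + c + q - 1 = j + c + (q - 1)" "j + b + q - 1 = j + b + (q - 1)" using right2 by auto
    then show ?thesis unfolding e' right2(1,4)
      by (intro parallel_points) (use right2 even1 E(4)[of q] E(4)[of "q - 1"] O(4)[of q] in \<open>auto simp: box_T shaded_interval_def\<close>)
  qed
qed

lemma ins_sys_match: "ins_sys j c b d (\<lambda>(e, p). if even p then Inr 0
    else Inl (min (prod_encode (e, Suc p div 2)) (prod_encode (ins_match j c b (e, Suc p div 2)))))"
  (is "ins_sys j c b d ?\<phi>")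
proof -
  have pair: "?\<phi> (e, 2 * i - 1) = ?\<phi> (e', 2 * i' - 1)"
    if "ins_match j c b (e, i) = (e', i')" "ins_match j c b (e', i') = (e, i)" "0 < i" "0 < i'" for e i e' i'
  proof -
    have "odd (2 * i - 1)" "odd (2 * i' - 1)" "Suc (2 * i - 1) div 2 = i" "Suc (2 * i' - 1) div 2 = i'"
      using that(3,4) by auto
    then show ?thesis using that(1,2) by (simp add: min.commute)
  qed
  show ?thesis
  proof (rule ins_sys_splitI)
    fix q :: nat
    show "?\<phi> (0, 2 * q - 1) = ?\<phi> (2, 2 * q - 1)" if "0 < q" "q \<le> j"
      by (rule pair) (use that match_simps in auto)
    show "?\<phi> (0, 2 * (j + q) - 1) = ?\<phi> (1, 2 * q - 1)" if "0 < q" "q \<le> c"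
      by (rule pair) (use that match_simps in auto)
    show "?\<phi> (1, 2 * (c + q) - 1) = ?\<phi> (2, 2 * (j + b + 1 - q) - 1)" if "0 < q" "q \<le> b"
      by (rule pair) (use that match_simps(5,6)[OF that] in auto)
    show "?\<phi> (0, 2 * (j + c + q) - 1) = ?\<phi> (2, 2 * (j + b + q) - 1)" if "0 < q" "q \<le> d"
      by (rule pair) (use that match_simps in auto)
  qed simp_all
qed

lemma ins_sys_shade: "ins_sys j c b d (\<lambda>(e, p). if even p then
    Inr (of_bool (shaded_interval (box T e) (p div 2))) else Inl 0)"
  by (rule ins_sys_splitI) (use even1 even2 in \<open>auto simp: box_T shaded_interval_def\<close>)

lemma ins_sys_parity:
  assumes \<phi>: "ins_sys j c b d \<phi>"
    and ev: "!!e. e \<in> boxes T ==> \<not> parity (\<lambda>i. \<phi> (e, 2 * i - 1) = Inl 1) (2 * fst (box T e))"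
  shows "\<exists>off. ins_sys j c b d (\<lambda>(e, p). if even p then
      Inr (of_bool (parity (\<lambda>i. \<phi> (e, 2 * i - 1) = Inl 1) (p div 2) \<noteq> off e)) else \<phi> (e, p))"
proof -
  define a where "a e = (\<lambda>i. \<phi> (e, 2 * i - 1) = Inl 1)" for e :: nat
  note O = odd_D[OF \<phi>]
  have ev': "\<not> parity (a 1) (c + b)" "\<not> parity (a 2) (j + b + d)"
    using ev[of 1] ev[of 2] size_T by (simp_all add: a_def)
  have p1: "parity (a 0) q = parity (a 2) q" if "q \<le> j" for q
    using parity_shift[of q "a 0" 0 "a 2" 0] O(1) that by (simp add: a_def)
  have p2: "(parity (a 0) (j + q) \<noteq> parity (a 0) j) = parity (a 1) q" if "q \<le> c" for q
    using parity_shift[of q "a 0" j "a 1" 0] O(2) that by (simp add: a_def)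
  have p3: "(parity (a 1) (c + q) \<noteq> parity (a 1) c) = (parity (a 2) (j + b) \<noteq> parity (a 2) (j + b - q))"
    if "q \<le> b" for q
    using parity_reverse[of q "a 1" c "a 2" "j + b"] O(3) that by (simp add: a_def)
  have p4: "(parity (a 0) (j + c + q) \<noteq> parity (a 0) (j + c)) = (parity (a 2) (j + b + q) \<noteq> parity (a 2) (j + b))"
    if "q \<le> d" for q
    using parity_shift[of q "a 0" "j + c" "a 2" "j + b"] O(4) that by (simp add: a_def)
  define off where "off e \<longleftrightarrow> e = 1 \<and> parity (a 2) j" for e :: nat
  define \<psi> where "\<psi> = (\<lambda>(e, p). if even p then
      Inr (of_bool (parity (a e) (p div 2) \<noteq> off e)) else \<phi> (e, p))"
  have ev_val: "\<psi> (e, 2 * q) = Inr (of_bool (parity (a e) q \<noteq> off e))" for e q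
    by (simp add: \<psi>_def)
  have odd_val: "\<psi> (e, 2 * q - 1) = \<phi> (e, 2 * q - 1)" if "0 < q" for e q
    using that by (simp add: \<psi>_def)
  have "ins_sys j c b d \<psi>"
  proof (rule ins_sys_splitI)
    fix q
    show "\<psi> (0, 2 * q) = \<psi> (2, 2 * q)" if "q \<le> j"
      unfolding ev_val using p1[OF that] by (simp add: off_def)
    show "\<psi> (0, 2 * (j + q)) = \<psi> (1, 2 * q)" if "q \<le> c"
      unfolding ev_val using p2[OF that] p1[of j] by (auto simp: off_def)
    show "\<psi> (1, 2 * (c + q)) = \<psi> (2, 2 * (j + b - q))" if "q \<le> b"
      unfolding ev_val using p3[OF that] p3[of b] ev'(1) by (auto simp: off_def)
    show "\<psi> (0, 2 * (j + c + q)) = \<psi> (2, 2 * (j + b + q))" if "q \<le> d"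
      unfolding ev_val using p4[OF that] p2[of c] p1[of j] p3[of b] ev'(1) by (auto simp: off_def)
  next
    fix q :: nat assume q: "0 < q"
    then have q': "0 < j + q" "0 < c + q" "0 < j + c + q" "0 < j + b + q" by auto
    show "\<psi> (0, 2 * q - 1) = \<psi> (2, 2 * q - 1)" if "q \<le> j"
      using O(1)[OF q that] unfolding odd_val[OF q] .
    show "\<psi> (0, 2 * (j + q) - 1) = \<psi> (1, 2 * q - 1)" if "q \<le> c"
      using O(2)[OF q that] unfolding odd_val[OF q] odd_val[OF q'(1)] .
    show "\<psi> (1, 2 * (c + q) - 1) = \<psi> (2, 2 * (j + b + 1 - q) - 1)" if "q \<le> b"
    proof -
      have "0 < j + b + 1 - q" using that by simp
      from odd_val[OF this] show ?thesis using O(3)[OF q that] unfolding odd_val[OF q'(2)] by simp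
    qed
    show "\<psi> (0, 2 * (j + c + q) - 1) = \<psi> (2, 2 * (j + b + q) - 1)" if "q \<le> d"
      using O(4)[OF q that] unfolding odd_val[OF q'(3)] odd_val[OF q'(4)] .
  next
    show "\<psi> (2, 0) = \<psi> (2, 2 * (j + b + d))"
      using ev_val[of 2 0] ev_val[of 2 "j + b + d"] ev'(2) by simp
  qed
  then show ?thesis unfolding \<psi>_def a_def by blast
qed

lemma matched: "matched_tangle ((j + c + d) div 2, s) [((c + b) div 2, s \<noteq> odd j), ((j + b + d) div 2, s)]
    (\<lambda>e i. sys_name (ins_sys j c b d) (e, 2 * i - 1)) (\<lambda>e i. sys_name (ins_sys j c b d) (e, 2 * i))
    (ins_sys j c b d) (ins_match j c b)"
proof (unfold_locales, fold sys_tangle_def, fold ins_tangle_def)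
  show "presented T (ins_sys j c b d)" by (rule ins_presented)
  show "\<phi> (e, 0) = \<phi> (e, 4 * fst (box T e))" if \<phi>: "ins_sys j c b d \<phi>" and e: "e \<in> boxes T" for \<phi> e
  proof -
    note D = ins_sysD[OF \<phi>]
    have sz: "4 * fst (box T 0) = 2 * j + 2 * c + 2 * d" "4 * fst (box T (Suc 0)) = 2 * c + 2 * b"
      "4 * fst (box T 2) = 2 * j + 2 * b + 2 * d"
      using size_T by simp_all
    have "\<phi> (0, 0) = \<phi> (0, 2 * j + 2 * c + 2 * d)" using D(1)[of 0] D(4)[of "2 * d"] D(5) by simp
    moreover have "\<phi> (1, 0) = \<phi> (1, 2 * c + 2 * b)" using D(2)[of 0] D(1)[of "2 * j"] D(3)[of "2 * b"] by simp
    ultimately show ?thesis using e D(5) sz unfolding boxes_T by auto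
  qed
  show "\<exists>i\<in>intervals (box T e). \<exists>k\<in>intervals (box T 0). \<forall>\<phi>. ins_sys j c b d \<phi> --> \<phi> (e, 2 * i) = \<phi> (0, 2 * k)"
    if "e \<in> boxes T" for e
  proof -
    have "\<phi> (1, 2 * 0) = \<phi> (0, 2 * j)" "\<phi> (2, 2 * 0) = \<phi> (0, 2 * 0)" if "ins_sys j c b d \<phi>" for \<phi>
      using even_D(2)[OF that, of 0] even_D(1)[OF that, of 0] by simp_all
    moreover have "j \<in> intervals (box T 0)" using size_T(1) by (simp add: intervals_def)
    ultimately show ?thesis using that zero_in_intervals unfolding boxes_T by blast
  qed
qed (fact match_in match_match match_start match_sys ins_sys_match ins_sys_shade ins_sys_parity)+

lemma planar: "planar_tangle T"
  using matched_tangle.planar[OF matched] unfolding ins_tangle_def sys_tangle_def .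

end

section \<open>Associativity of insertion, in terms of boundary labels\<close>

definition ins_eqs :: "nat => nat => nat => nat => (nat => 'a) => (nat => 'a) => (nat => 'a) => bool" where
  "ins_eqs j c b d w x y \<longleftrightarrow>
     (\<forall>p\<le>2 * j. w p = y p) \<and> (\<forall>p\<le>2 * c. w (2 * j + p) = x p) \<and>
     (\<forall>u v. u + v = 2 * b --> x (2 * c + u) = y (2 * j + v)) \<and>
     (\<forall>p\<le>2 * d. w (2 * j + 2 * c + p) = y (2 * j + 2 * b + p)) \<and>
     y 0 = y (2 * j + 2 * b + 2 * d)"

lemma ins_eqsD:
  assumes "ins_eqs j c b d w x y"
  shows "!!p. p \<le> 2 * j ==> w p = y p" "!!p. p \<le> 2 * c ==> w (2 * j + p) = x p"
    "!!u v. u + v = 2 * b ==> x (2 * c + u) = y (2 * j + v)"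
    "!!p. p \<le> 2 * d ==> w (2 * j + 2 * c + p) = y (2 * j + 2 * b + p)"
    "y 0 = y (2 * j + 2 * b + 2 * d)"
  using assms unfolding ins_eqs_def by blast+

lemma ins_eqsI:
  assumes "!!p. p \<le> 2 * j ==> w p = y p" "!!p. p \<le> 2 * c ==> w (2 * j + p) = x p"
    "!!u v. u + v = 2 * b ==> x (2 * c + u) = y (2 * j + v)"
    "!!p. p \<le> 2 * d ==> w (2 * j + 2 * c + p) = y (2 * j + 2 * b + p)"
    "y 0 = y (2 * j + 2 * b + 2 * d)"
  shows "ins_eqs j c b d w x y"
  using assms unfolding ins_eqs_def by blast

lemma ins_sys_eqs: "ins_sys j c b d \<phi> = ins_eqs j c b d (\<lambda>p. \<phi> (0, p)) (\<lambda>p. \<phi> (1, p)) (\<lambda>p. \<phi> (2, p))"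
proof -
  have "(\<forall>p\<le>2 * b. \<phi> (1, 2 * c + p) = \<phi> (2, 2 * j + 2 * b - p)) \<longleftrightarrow>
    (\<forall>u v. u + v = 2 * b --> \<phi> (1, 2 * c + u) = \<phi> (2, 2 * j + v))"
  proof (intro iffI allI impI)
    fix u v assume "\<forall>p\<le>2 * b. \<phi> (1, 2 * c + p) = \<phi> (2, 2 * j + 2 * b - p)" "u + v = 2 * b"
    moreover from this have "2 * j + 2 * b - u = 2 * j + v" "u \<le> 2 * b" by auto
    ultimately show "\<phi> (1, 2 * c + u) = \<phi> (2, 2 * j + v)" by metis
  next
    fix p assume "\<forall>u v. u + v = 2 * b --> \<phi> (1, 2 * c + u) = \<phi> (2, 2 * j + v)" "p \<le> 2 * b"
    moreover from this have "2 * j + 2 * b - p = 2 * j + (2 * b - p)" "p + (2 * b - p) = 2 * b" by auto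
    ultimately show "\<phi> (1, 2 * c + p) = \<phi> (2, 2 * j + 2 * b - p)" by metis
  qed
  then show ?thesis unfolding ins_sys_def ins_eqs_def by simp
qed

lemma ins_eqs_cong:
  assumes "ins_eqs j c b d w x y" "!!p. p \<le> 2 * (j + c + d) ==> w p = w' p"
    "!!p. p \<le> 2 * (c + b) ==> x p = x' p" "!!p. p \<le> 2 * (j + b + d) ==> y p = y' p"
  shows "ins_eqs j c b d w' x' y'"
proof (rule ins_eqsI)
  note D = ins_eqsD[OF assms(1)]
  show "w' p = y' p" if "p \<le> 2 * j" for p using D(1)[OF that] assms(2,4)[of p] that by simp
  show "w' (2 * j + p) = x' p" if "p \<le> 2 * c" for p
    using D(2)[OF that] assms(2)[of "2 * j + p"] assms(3)[of p] that by simp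
  show "x' (2 * c + u) = y' (2 * j + v)" if "u + v = 2 * b" for u v
    using D(3)[OF that] assms(3)[of "2 * c + u"] assms(4)[of "2 * j + v"] that by simp
  show "w' (2 * j + 2 * c + p) = y' (2 * j + 2 * b + p)" if "p \<le> 2 * d" for p
    using D(4)[OF that] assms(2)[of "2 * j + 2 * c + p"] assms(4)[of "2 * j + 2 * b + p"] that by simp
  show "y' 0 = y' (2 * j + 2 * b + 2 * d)"
    using D(5) assms(4)[of 0] assms(4)[of "2 * j + 2 * b + 2 * d"] by simp
qed

definition ins_fun :: "nat => nat => nat => (nat => 'a) => (nat => 'a) => nat => 'a" where
  "ins_fun j c b x y p =
     (if p \<le> 2 * j then y p else if p \<le> 2 * j + 2 * c then x (p - 2 * j) else y (p - 2 * c + 2 * b))"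

lemma ins_fun_eqs:
  assumes "x 0 = y (2 * j)" "!!u v. u + v = 2 * b ==> x (2 * c + u) = y (2 * j + v)"
    "y 0 = y (2 * j + 2 * b + 2 * d)"
  shows "ins_eqs j c b d (ins_fun j c b x y) x y"
proof (rule ins_eqsI)
  show "ins_fun j c b x y p = y p" if "p \<le> 2 * j" for p using that by (simp add: ins_fun_def)
  show "ins_fun j c b x y (2 * j + p) = x p" if "p \<le> 2 * c" for p
    using that assms(1) by (auto simp: ins_fun_def)
  show "ins_fun j c b x y (2 * j + 2 * c + p) = y (2 * j + 2 * b + p)" if "p \<le> 2 * d" for p
    using assms(2)[of 0 "2 * b"] assms(1) by (auto simp: ins_fun_def algebra_simps)
qed (use assms in auto)

lemma split2:
  fixes t :: nat
  assumes "t \<le> m + n"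
  obtains "t \<le> m" | u where "t = m + u" "u \<le> n"
  using assms by (metis add_le_cancel_left le_add_diff_inverse nat_le_linear)

lemma split3:
  fixes t :: nat
  assumes "t \<le> m + n + k"
  obtains "t \<le> m" | u where "t = m + u" "u \<le> n" | u where "t = m + n + u" "u \<le> k"
  using assms by (metis add_le_cancel_left add.assoc le_add_diff_inverse nat_le_linear)

text \<open>
In the following equivalences the label \<open>I\<close> belongs to the boundary of a box that has been filled.
Each of them says that two ways of filling boxes leave the same relation between the visible
labels; the label on one side is spliced together from the labels on the other.
\<close>

lemma nested_eqs:
  "(\<exists>I. ins_eqs (j + p) c b (q + d) w x I \<and> ins_eqs j (p + b + q) b' d I y z) \<longleftrightarrow>
   (\<exists>J. ins_eqs j (p + c + q) b' d w J z \<and> ins_eqs p c b (q + b') J x y)"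
proof
  assume "\<exists>I. ins_eqs (j + p) c b (q + d) w x I \<and> ins_eqs j (p + b + q) b' d I y z"
  then obtain I where 1: "ins_eqs (j + p) c b (q + d) w x I" and 2: "ins_eqs j (p + b + q) b' d I y z" by blast
  note A = ins_eqsD[OF 1] and B = ins_eqsD[OF 2]
  have D': "ins_eqs p c b (q + b') (ins_fun p c b x y) x y"
  proof (rule ins_fun_eqs)
    show "x 0 = y (2 * p)" using A(2)[of 0] A(1)[of "2 * j + 2 * p"] B(2)[of "2 * p"] by (simp add: algebra_simps)
    show "x (2 * c + u) = y (2 * p + v)" if "u + v = 2 * b" for u v
      using A(3)[OF that] B(2)[of "2 * p + v"] that by (simp add: algebra_simps)
    show "y 0 = y (2 * p + 2 * b + 2 * (q + b'))"
      using B(2)[of 0] B(1)[of "2 * j"] B(3)[of "2 * b'" 0] by (simp add: algebra_simps)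
  qed
  note D = ins_eqsD[OF D']
  define J where "J = ins_fun p c b x y"
  note D = D[folded J_def]
  have "ins_eqs j (p + c + q) b' d w J z"
  proof (rule ins_eqsI)
    show "w t = z t" if "t \<le> 2 * j" for t using A(1)[of t] B(1)[of t] that by simp
    show "w (2 * j + t) = J t" if "t \<le> 2 * (p + c + q)" for t
    proof -
      have "t \<le> 2 * p + 2 * c + 2 * q" using that by simp
      then show ?thesis
      proof (cases rule: split3)
        case 1 then show ?thesis using A(1)[of "2 * j + t"] B(2)[of t] D(1)[of t] by simp
      next
        case (2 u) then show ?thesis using A(2)[of u] D(2)[of u] by (simp add: algebra_simps)
      next
        case (3 u) then show ?thesis using A(4)[of u] B(2)[of "2 * p + 2 * b + u"] D(4)[of u] by (simp add: algebra_simps)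
      qed
    qed
    show "J (2 * (p + c + q) + u) = z (2 * j + v)" if "u + v = 2 * b'" for u v
      using D(4)[of "2 * q + u"] B(3)[OF that] that by (simp add: algebra_simps)
    show "w (2 * j + 2 * (p + c + q) + t) = z (2 * j + 2 * b' + t)" if "t \<le> 2 * d" for t
      using A(4)[of "2 * q + t"] B(4)[of t] that by (simp add: algebra_simps)
    show "z 0 = z (2 * j + 2 * b' + 2 * d)" using B(5) .
  qed
  then show "\<exists>J. ins_eqs j (p + c + q) b' d w J z \<and> ins_eqs p c b (q + b') J x y"
    using D' J_def by blast
next
  assume "\<exists>J. ins_eqs j (p + c + q) b' d w J z \<and> ins_eqs p c b (q + b') J x y"
  then obtain J where 1: "ins_eqs j (p + c + q) b' d w J z" and 2: "ins_eqs p c b (q + b') J x y" by blast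
  note C = ins_eqsD[OF 1] and D = ins_eqsD[OF 2]
  have B': "ins_eqs j (p + b + q) b' d (ins_fun j (p + b + q) b' y z) y z"
  proof (rule ins_fun_eqs)
    show "y 0 = z (2 * j)" using D(1)[of 0] C(2)[of 0] C(1)[of "2 * j"] by simp
    show "y (2 * (p + b + q) + u) = z (2 * j + v)" if "u + v = 2 * b'" for u v
      using D(4)[of "2 * q + u"] C(3)[OF that] that by (simp add: algebra_simps)
    show "z 0 = z (2 * j + 2 * b' + 2 * d)" using C(5) .
  qed
  note B = ins_eqsD[OF B']
  define I where "I = ins_fun j (p + b + q) b' y z"
  note B = B[folded I_def]
  have "ins_eqs (j + p) c b (q + d) w x I"
  proof (rule ins_eqsI)
    show "w t = I t" if "t \<le> 2 * (j + p)" for t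
    proof -
      have "t \<le> 2 * j + 2 * p" using that by simp
      then show ?thesis
      proof (cases rule: split2)
        case 1 then show ?thesis using C(1)[of t] B(1)[of t] by simp
      next
        case (2 u) then show ?thesis using C(2)[of u] D(1)[of u] B(2)[of u] by simp
      qed
    qed
    show "w (2 * (j + p) + t) = x t" if "t \<le> 2 * c" for t
      using C(2)[of "2 * p + t"] D(2)[of t] that by (simp add: algebra_simps)
    show "x (2 * c + u) = I (2 * (j + p) + v)" if "u + v = 2 * b" for u v
      using D(3)[OF that] B(2)[of "2 * p + v"] that by (simp add: algebra_simps)
    show "w (2 * (j + p) + 2 * c + t) = I (2 * (j + p) + 2 * b + t)" if "t \<le> 2 * (q + d)" for t
    proof -
      have "t \<le> 2 * q + 2 * d" using that by simp
      then show ?thesis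
      proof (cases rule: split2)
        case 1 then show ?thesis
          using C(2)[of "2 * p + 2 * c + t"] D(4)[of t] B(2)[of "2 * p + 2 * b + t"] by (simp add: algebra_simps)
      next
        case (2 u) then show ?thesis using C(4)[of u] B(4)[of u] by (simp add: algebra_simps)
      qed
    qed
    show "I 0 = I (2 * (j + p) + 2 * b + 2 * (q + d))"
      using B(1)[of 0] B(4)[of "2 * d"] C(5) by (simp add: algebra_simps)
  qed
  then show "\<exists>I. ins_eqs (j + p) c b (q + d) w x I \<and> ins_eqs j (p + b + q) b' d I y z"
    using B' I_def by blast
qed

lemma parallel_eqs:
  "(\<exists>I. ins_eqs j c1 b1 (e + c2 + d) w y I \<and> ins_eqs (j + b1 + e) c2 b2 d I x z) \<longleftrightarrow>
   (\<exists>J. ins_eqs (j + c1 + e) c2 b2 d w x J \<and> ins_eqs j c1 b1 (e + b2 + d) J y z)"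
proof
  assume "\<exists>I. ins_eqs j c1 b1 (e + c2 + d) w y I \<and> ins_eqs (j + b1 + e) c2 b2 d I x z"
  then obtain I where 1: "ins_eqs j c1 b1 (e + c2 + d) w y I" and 2: "ins_eqs (j + b1 + e) c2 b2 d I x z" by blast
  note A = ins_eqsD[OF 1] and B = ins_eqsD[OF 2]
  have D': "ins_eqs j c1 b1 (e + b2 + d) (ins_fun j c1 b1 y z) y z"
  proof (rule ins_fun_eqs)
    show "y 0 = z (2 * j)" using A(2)[of 0] A(1)[of "2 * j"] B(1)[of "2 * j"] by simp
    show "y (2 * c1 + u) = z (2 * j + v)" if "u + v = 2 * b1" for u v
      using A(3)[OF that] B(1)[of "2 * j + v"] that by simp
    show "z 0 = z (2 * j + 2 * b1 + 2 * (e + b2 + d))" using B(5) by (simp add: algebra_simps)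
  qed
  note D = ins_eqsD[OF D']
  define J where "J = ins_fun j c1 b1 y z"
  note D = D[folded J_def]
  have "ins_eqs (j + c1 + e) c2 b2 d w x J"
  proof (rule ins_eqsI)
    show "w t = J t" if "t \<le> 2 * (j + c1 + e)" for t
    proof -
      have "t \<le> 2 * j + 2 * c1 + 2 * e" using that by simp
      then show ?thesis
      proof (cases rule: split3)
        case 1 then show ?thesis using A(1)[of t] B(1)[of t] D(1)[of t] by simp
      next
        case (2 u) then show ?thesis using A(2)[of u] D(2)[of u] by simp
      next
        case (3 u) then show ?thesis using A(4)[of u] B(1)[of "2 * j + 2 * b1 + u"] D(4)[of u] by simp
      qed
    qed
    show "w (2 * (j + c1 + e) + t) = x t" if "t \<le> 2 * c2" for t
      using A(4)[of "2 * e + t"] B(2)[of t] that by (simp add: algebra_simps)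
    show "x (2 * c2 + u) = J (2 * (j + c1 + e) + v)" if "u + v = 2 * b2" for u v
      using B(3)[OF that] D(4)[of "2 * e + v"] that by (simp add: algebra_simps)
    show "w (2 * (j + c1 + e) + 2 * c2 + t) = J (2 * (j + c1 + e) + 2 * b2 + t)" if "t \<le> 2 * d" for t
      using A(4)[of "2 * e + 2 * c2 + t"] B(4)[of t] D(4)[of "2 * e + 2 * b2 + t"] that by (simp add: algebra_simps)
    show "J 0 = J (2 * (j + c1 + e) + 2 * b2 + 2 * d)"
      using D(1)[of 0] D(4)[of "2 * e + 2 * b2 + 2 * d"] B(5) by (simp add: algebra_simps)
  qed
  then show "\<exists>J. ins_eqs (j + c1 + e) c2 b2 d w x J \<and> ins_eqs j c1 b1 (e + b2 + d) J y z"
    using D' J_def by blast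
next
  assume "\<exists>J. ins_eqs (j + c1 + e) c2 b2 d w x J \<and> ins_eqs j c1 b1 (e + b2 + d) J y z"
  then obtain J where 1: "ins_eqs (j + c1 + e) c2 b2 d w x J" and 2: "ins_eqs j c1 b1 (e + b2 + d) J y z" by blast
  note C = ins_eqsD[OF 1] and D = ins_eqsD[OF 2]
  have B': "ins_eqs (j + b1 + e) c2 b2 d (ins_fun (j + b1 + e) c2 b2 x z) x z"
  proof (rule ins_fun_eqs)
    show "x 0 = z (2 * (j + b1 + e))"
      using C(2)[of 0] C(1)[of "2 * (j + c1 + e)"] D(4)[of "2 * e"] by (simp add: algebra_simps)
    show "x (2 * c2 + u) = z (2 * (j + b1 + e) + v)" if "u + v = 2 * b2" for u v
      using C(3)[OF that] D(4)[of "2 * e + v"] that by (simp add: algebra_simps)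
    show "z 0 = z (2 * (j + b1 + e) + 2 * b2 + 2 * d)" using D(5) by (simp add: algebra_simps)
  qed
  note B = ins_eqsD[OF B']
  define I where "I = ins_fun (j + b1 + e) c2 b2 x z"
  note B = B[folded I_def]
  have "ins_eqs j c1 b1 (e + c2 + d) w y I"
  proof (rule ins_eqsI)
    show "w t = I t" if "t \<le> 2 * j" for t using C(1)[of t] D(1)[of t] B(1)[of t] that by simp
    show "w (2 * j + t) = y t" if "t \<le> 2 * c1" for t using C(1)[of "2 * j + t"] D(2)[of t] that by simp
    show "y (2 * c1 + u) = I (2 * j + v)" if "u + v = 2 * b1" for u v
      using D(3)[OF that] B(1)[of "2 * j + v"] that by simp
    show "w (2 * j + 2 * c1 + t) = I (2 * j + 2 * b1 + t)" if "t \<le> 2 * (e + c2 + d)" for t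
    proof -
      have "t \<le> 2 * e + 2 * c2 + 2 * d" using that by simp
      then show ?thesis
      proof (cases rule: split3)
        case 1 then show ?thesis
          using C(1)[of "2 * j + 2 * c1 + t"] D(4)[of t] B(1)[of "2 * j + 2 * b1 + t"] by simp
      next
        case (2 u) then show ?thesis using C(2)[of u] B(2)[of u] by (simp add: algebra_simps)
      next
        case (3 u) then show ?thesis
          using C(4)[of u] D(4)[of "2 * e + 2 * b2 + u"] B(4)[of u] by (simp add: algebra_simps)
      qed
    qed
    show "I 0 = I (2 * j + 2 * b1 + 2 * (e + c2 + d))"
      using B(1)[of 0] B(4)[of "2 * d"] D(5) by (simp add: algebra_simps)
  qed
  then show "\<exists>I. ins_eqs j c1 b1 (e + c2 + d) w y I \<and> ins_eqs (j + b1 + e) c2 b2 d I x z"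
    using B' I_def by blast
qed

lemma adjacent_eqs:
  "(\<exists>I. ins_eqs j (c' + c) (b + b') d w I z \<and> ins_eqs c' (c + b) 0 b' I x y) \<longleftrightarrow>
   (\<exists>J. ins_eqs (j + c') c b d w x J \<and> ins_eqs j c' b' (b + d) J y z)"
proof
  assume "\<exists>I. ins_eqs j (c' + c) (b + b') d w I z \<and> ins_eqs c' (c + b) 0 b' I x y"
  then obtain I where 1: "ins_eqs j (c' + c) (b + b') d w I z" and 2: "ins_eqs c' (c + b) 0 b' I x y" by blast
  note A = ins_eqsD[OF 1] and B = ins_eqsD[OF 2]
  have D': "ins_eqs j c' b' (b + d) (ins_fun j c' b' y z) y z"
  proof (rule ins_fun_eqs)
    show "y 0 = z (2 * j)" using B(1)[of 0] A(2)[of 0] A(1)[of "2 * j"] by simp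
    show "y (2 * c' + u) = z (2 * j + v)" if "u + v = 2 * b'" for u v
      using B(4)[of u] A(3)[of "2 * b + u" v] that by (simp add: algebra_simps)
    show "z 0 = z (2 * j + 2 * b' + 2 * (b + d))" using A(5) by (simp add: algebra_simps)
  qed
  note D = ins_eqsD[OF D']
  define J where "J = ins_fun j c' b' y z"
  note D = D[folded J_def]
  have "ins_eqs (j + c') c b d w x J"
  proof (rule ins_eqsI)
    show "w t = J t" if "t \<le> 2 * (j + c')" for t
    proof -
      have "t \<le> 2 * j + 2 * c'" using that by simp
      then show ?thesis
      proof (cases rule: split2)
        case 1 then show ?thesis using A(1)[of t] D(1)[of t] by simp
      next
        case (2 u) then show ?thesis using A(2)[of u] B(1)[of u] D(2)[of u] by simp
      qed
    qed
    show "w (2 * (j + c') + t) = x t" if "t \<le> 2 * c" for t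
      using A(2)[of "2 * c' + t"] B(2)[of t] that by (simp add: algebra_simps)
    show "x (2 * c + u) = J (2 * (j + c') + v)" if "u + v = 2 * b" for u v
      using B(2)[of "2 * c + u"] A(3)[of u "2 * b' + v"] D(4)[of v] that by (simp add: algebra_simps)
    show "w (2 * (j + c') + 2 * c + t) = J (2 * (j + c') + 2 * b + t)" if "t \<le> 2 * d" for t
      using A(4)[of t] D(4)[of "2 * b + t"] that by (simp add: algebra_simps)
    show "J 0 = J (2 * (j + c') + 2 * b + 2 * d)"
      using D(1)[of 0] D(4)[of "2 * b + 2 * d"] A(5) by (simp add: algebra_simps)
  qed
  then show "\<exists>J. ins_eqs (j + c') c b d w x J \<and> ins_eqs j c' b' (b + d) J y z" using D' J_def by blast
next
  assume "\<exists>J. ins_eqs (j + c') c b d w x J \<and> ins_eqs j c' b' (b + d) J y z"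
  then obtain J where 1: "ins_eqs (j + c') c b d w x J" and 2: "ins_eqs j c' b' (b + d) J y z" by blast
  note C = ins_eqsD[OF 1] and D = ins_eqsD[OF 2]
  have B': "ins_eqs c' (c + b) 0 b' (ins_fun c' (c + b) 0 x y) x y"
  proof (rule ins_fun_eqs)
    have J: "J (2 * (j + c')) = y (2 * c')" using D(2)[of "2 * c'"] by (simp add: algebra_simps)
    show "x 0 = y (2 * c')" using C(2)[of 0] C(1)[of "2 * (j + c')"] J by simp
    show "x (2 * (c + b) + u) = y (2 * c' + v)" if "u + v = 2 * 0" for u v
      using C(3)[of "2 * b" 0] J that by (simp add: algebra_simps)
    show "y 0 = y (2 * c' + 2 * 0 + 2 * b')"
      using D(2)[of 0] D(1)[of "2 * j"] D(3)[of "2 * b'" 0] by simp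
  qed
  note B = ins_eqsD[OF B']
  define I where "I = ins_fun c' (c + b) 0 x y"
  note B = B[folded I_def]
  have "ins_eqs j (c' + c) (b + b') d w I z"
  proof (rule ins_eqsI)
    show "w t = z t" if "t \<le> 2 * j" for t using C(1)[of t] D(1)[of t] that by simp
    show "w (2 * j + t) = I t" if "t \<le> 2 * (c' + c)" for t
    proof -
      have "t \<le> 2 * c' + 2 * c" using that by simp
      then show ?thesis
      proof (cases rule: split2)
        case 1 then show ?thesis using C(1)[of "2 * j + t"] D(2)[of t] B(1)[of t] by simp
      next
        case (2 u) then show ?thesis using C(2)[of u] B(2)[of u] by (simp add: algebra_simps)
      qed
    qed
    show "I (2 * (c' + c) + u) = z (2 * j + v)" if uv: "u + v = 2 * (b + b')" for u v
    proof -
      have "u \<le> 2 * b + 2 * b'" using uv by simp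
      then show ?thesis
      proof (cases rule: split2)
        case 1
        then obtain r where r: "u + r = 2 * b" using le_Suc_ex by metis
        then have "v = 2 * b' + r" using uv by simp
        then show ?thesis using B(2)[of "2 * c + u"] C(3)[OF r] D(4)[of r] r by (simp add: algebra_simps)
      next
        case (2 r) then show ?thesis using B(4)[of r] D(3)[of r v] uv by (simp add: algebra_simps)
      qed
    qed
    show "w (2 * j + 2 * (c' + c) + t) = z (2 * j + 2 * (b + b') + t)" if "t \<le> 2 * d" for t
      using C(4)[of t] D(4)[of "2 * b + t"] that by (simp add: algebra_simps)
    show "z 0 = z (2 * j + 2 * (b + b') + 2 * d)" using D(5) by (simp add: algebra_simps)
  qed
  then show "\<exists>I. ins_eqs j (c' + c) (b + b') d w I z \<and> ins_eqs c' (c + b) 0 b' I x y" using B' I_def by blast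
qed

definition click_eqs :: "(nat => 'a) => (nat => 'a) => bool" where
  "click_eqs w x \<longleftrightarrow> (\<forall>p\<le>2. w p = x (2 + p)) \<and> (\<forall>p\<le>2. w (2 + p) = x p)"

lemma slide_eqs:
  "(\<exists>I. ins_eqs 0 c (i + 1 + i') d w h I \<and> ins_eqs i 1 1 (i' + d) I x y) \<longleftrightarrow>
   (\<exists>K J. ins_eqs 0 c (i + 1 + i') d w K y \<and> ins_eqs (c + i') 1 1 i K J h \<and> click_eqs J x)"
proof
  assume "\<exists>I. ins_eqs 0 c (i + 1 + i') d w h I \<and> ins_eqs i 1 1 (i' + d) I x y"
  then obtain I where 1: "ins_eqs 0 c (i + 1 + i') d w h I" and 2: "ins_eqs i 1 1 (i' + d) I x y" by blast
  note A = ins_eqsD[OF 1] and B = ins_eqsD[OF 2]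
  have x04: "x 0 = x 4"
    using B(2)[of 0] B(1)[of "2 * i"] B(3)[of 2 0] by simp
  define J where "J p = (if p \<le> 2 then x (2 + p) else x (p - 2))" for p
  have J1: "J p = x (2 + p)" if "p \<le> 2" for p using that by (simp add: J_def)
  have J2: "J (2 + p) = x p" for p using x04 by (simp add: J_def)
  have J: "click_eqs J x" unfolding click_eqs_def using J1 J2 by blast
  have D': "ins_eqs (c + i') 1 1 i (ins_fun (c + i') 1 1 J h) J h"
  proof (rule ins_fun_eqs)
    show "J 0 = h (2 * (c + i'))"
      using J1[of 0] B(2)[of 2] A(3)[of "2 * i'" "2 * i + 2"] by (simp add: algebra_simps numeral_2_eq_2)
    show "J (2 * 1 + u) = h (2 * (c + i') + v)" if "u + v = 2 * 1" for u v
      using J2[of u] B(2)[of u] A(3)[of "2 * i' + v" "2 * i + u"] that by (simp add: algebra_simps)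
    show "h 0 = h (2 * (c + i') + 2 * 1 + 2 * i)"
      using A(2)[of 0] A(1)[of 0] A(3)[of "2 * (i + 1 + i')" 0] by (simp add: algebra_simps)
  qed
  note D = ins_eqsD[OF D']
  define K where "K = ins_fun (c + i') 1 1 J h"
  note D = D[folded K_def]
  have "ins_eqs 0 c (i + 1 + i') d w K y"
  proof (rule ins_eqsI)
    show "w t = y t" if "t \<le> 2 * 0" for t using A(1)[of 0] B(1)[of 0] that by simp
    show "w (2 * 0 + t) = K t" if "t \<le> 2 * c" for t using A(2)[of t] D(1)[of t] that by simp
    show "K (2 * c + u) = y (2 * 0 + v)" if uv: "u + v = 2 * (i + 1 + i')" for u v
    proof -
      have "u \<le> 2 * i' + 2 + 2 * i" using uv by simp
      then show ?thesis
      proof (cases rule: split3)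
        case 1
        then obtain r where "u + r = 2 * i'" using le_Suc_ex by metis
        moreover from this have "v = 2 * i + 2 + r" using uv by simp
        ultimately show ?thesis
          using D(1)[of "2 * c + u"] A(3)[of u v] B(4)[of r] uv by (simp add: algebra_simps)
      next
        case (2 r)
        then obtain r' where "r + r' = 2" using le_Suc_ex by metis
        moreover from this have "v = 2 * i + r'" using uv 2 by simp
        ultimately show ?thesis
          using 2 D(2)[of r] J1[of r] B(3)[of r r'] by (simp add: algebra_simps)
      next
        case (3 r)
        moreover from this have "v \<le> 2 * i" using uv by simp
        ultimately show ?thesis
          using D(4)[of r] A(3)[of u v] B(1)[of v] uv by (simp add: algebra_simps)
      qed
    qed
    show "w (2 * 0 + 2 * c + t) = y (2 * 0 + 2 * (i + 1 + i') + t)" if "t \<le> 2 * d" for t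
      using A(4)[of t] B(4)[of "2 * i' + t"] that by (simp add: algebra_simps)
    show "y 0 = y (2 * 0 + 2 * (i + 1 + i') + 2 * d)" using B(5) by (simp add: algebra_simps)
  qed
  then show "\<exists>K J. ins_eqs 0 c (i + 1 + i') d w K y \<and> ins_eqs (c + i') 1 1 i K J h \<and> click_eqs J x"
    using D' K_def J by blast
next
  assume "\<exists>K J. ins_eqs 0 c (i + 1 + i') d w K y \<and> ins_eqs (c + i') 1 1 i K J h \<and> click_eqs J x"
  then obtain K J where 1: "ins_eqs 0 c (i + 1 + i') d w K y" and 2: "ins_eqs (c + i') 1 1 i K J h"
    and 3: "click_eqs J x" by blast
  note C = ins_eqsD[OF 1] and D = ins_eqsD[OF 2]
  have J1: "J p = x (2 + p)" and J2: "J (2 + p) = x p" if "p \<le> 2" for p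
    using 3 that unfolding click_eqs_def by blast+
  have B': "ins_eqs i 1 1 (i' + d) (ins_fun i 1 1 x y) x y"
  proof (rule ins_fun_eqs)
    show "x 0 = y (2 * i)"
      using J2[of 0] D(2)[of 2] C(3)[of "2 * i' + 2" "2 * i"] by (simp add: algebra_simps numeral_2_eq_2)
    show "x (2 * 1 + u) = y (2 * i + v)" if "u + v = 2 * 1" for u v
      using J1[of u] D(2)[of u] C(3)[of "2 * i' + u" "2 * i + v"] that by (simp add: algebra_simps)
    show "y 0 = y (2 * i + 2 * 1 + 2 * (i' + d))" using C(5) by (simp add: algebra_simps)
  qed
  note B = ins_eqsD[OF B']
  define I where "I = ins_fun i 1 1 x y"
  note B = B[folded I_def]
  have "ins_eqs 0 c (i + 1 + i') d w h I"
  proof (rule ins_eqsI)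
    show "w t = I t" if "t \<le> 2 * 0" for t using C(1)[of 0] B(1)[of 0] that by simp
    show "w (2 * 0 + t) = h t" if "t \<le> 2 * c" for t using C(2)[of t] D(1)[of t] that by simp
    show "h (2 * c + u) = I (2 * 0 + v)" if uv: "u + v = 2 * (i + 1 + i')" for u v
    proof -
      have "u \<le> 2 * i' + 2 + 2 * i" using uv by simp
      then show ?thesis
      proof (cases rule: split3)
        case 1
        then obtain r where "u + r = 2 * i'" using le_Suc_ex by metis
        moreover from this have "v = 2 * i + 2 + r" using uv by simp
        ultimately show ?thesis
          using D(1)[of "2 * c + u"] C(3)[of u v] B(4)[of r] uv by (simp add: algebra_simps)
      next
        case (2 r)
        then obtain r' where r': "r' + r = 2" using le_Suc_ex by (metis add.commute)
        moreover from this have "v = 2 * i + r'" using uv 2 by simp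
        ultimately show ?thesis
          using 2 D(3)[of r' r] J2[of r'] B(2)[of r'] by (simp add: algebra_simps)
      next
        case (3 r)
        moreover from this have "v \<le> 2 * i" using uv by simp
        ultimately show ?thesis
          using D(4)[of r] C(3)[of u v] B(1)[of v] uv by (simp add: algebra_simps)
      qed
    qed
    show "w (2 * 0 + 2 * c + t) = I (2 * 0 + 2 * (i + 1 + i') + t)" if "t \<le> 2 * d" for t
      using C(4)[of t] B(4)[of "2 * i' + t"] that by (simp add: algebra_simps)
    show "I 0 = I (2 * 0 + 2 * (i + 1 + i') + 2 * d)"
      using B(1)[of 0] B(4)[of "2 * i' + 2 * d"] C(5) by (simp add: algebra_simps)
  qed
  then show "\<exists>I. ins_eqs 0 c (i + 1 + i') d w h I \<and> ins_eqs i 1 1 (i' + d) I x y" using B' I_def by blast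
qed

text \<open>
A reflection reverses all labels and turns the composition upside down.
\<close>

lemma reflect_eqs:
  "ins_eqs 0 c b a (\<lambda>p. w (2 * (c + a) - p)) (\<lambda>p. x (2 * (c + b) - p)) (\<lambda>p. y (2 * (b + a) - p)) \<longleftrightarrow>
   ins_eqs 0 a b c w y x"
proof -
  have "ins_eqs 0 a b c w y x"
    if "ins_eqs 0 c b a (\<lambda>p. w (2 * (c + a) - p)) (\<lambda>p. x (2 * (c + b) - p)) (\<lambda>p. y (2 * (b + a) - p))"
    for a c and w x y :: "nat => 'a"
  proof -
    note D = ins_eqsD[OF that]
    show ?thesis
    proof (rule ins_eqsI)
      have wx: "w (2 * (c + a) - p) = x (2 * (c + b) - p)" if "p \<le> 2 * c" for p using D(2)[OF that] by simp
      have wy: "w p = y p" if "p \<le> 2 * a" for p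
      proof -
        obtain r where r: "p + r = 2 * a" using \<open>p \<le> 2 * a\<close> le_Suc_ex by metis
        then have "2 * (c + a) - (2 * 0 + 2 * c + r) = p" "2 * (b + a) - (2 * 0 + 2 * b + r) = p" by auto
        then show ?thesis using D(4)[of r] r by simp
      qed
      have xy: "x v = y (2 * a + u)" if "u + v = 2 * b" for u v
      proof -
        have "2 * (c + b) - (2 * c + u) = v" "2 * (b + a) - (2 * 0 + v) = 2 * a + u" using that by auto
        then show ?thesis using D(3)[OF that] by simp
      qed
      show "w p = x p" if "p \<le> 2 * 0" for p
        using that wy[of 0] D(5) xy[of "2 * b" 0] by (simp add: algebra_simps)
      show "w (2 * 0 + p) = y p" if "p \<le> 2 * a" for p using wy[OF that] by simp
      show "y (2 * a + u) = x (2 * 0 + v)" if "u + v = 2 * b" for u v using xy[OF that] by simp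
      show "w (2 * 0 + 2 * a + p) = x (2 * 0 + 2 * b + p)" if "p \<le> 2 * c" for p
      proof -
        obtain r where r: "p + r = 2 * c" using \<open>p \<le> 2 * c\<close> le_Suc_ex by metis
        then have "2 * (c + a) - r = 2 * 0 + 2 * a + p" "2 * (c + b) - r = 2 * 0 + 2 * b + p" by auto
        then show ?thesis using wx[of r] r by simp
      qed
      show "x 0 = x (2 * 0 + 2 * b + 2 * c)"
        using wx[of 0] D(1)[of 0] D(5) xy[of "2 * b" 0] by (simp add: algebra_simps)
    qed
  qed note R = this
  have "ins_eqs 0 c b a (\<lambda>p. w (2 * (c + a) - p)) (\<lambda>p. x (2 * (c + b) - p)) (\<lambda>p. y (2 * (b + a) - p))"
    if "ins_eqs 0 a b c w y x"
  proof (rule R, rule ins_eqs_cong[OF that])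
  qed (auto simp: algebra_simps)
  then show ?thesis using R by blast
qed

section \<open>Composites and isotopies of the basic tangles\<close>

lemma planar_isotopic:
  assumes T: "planar_tangle T" and iso: "isotopic \<pi> T T'"
  shows "planar_tangle T'"
proof -
  note D = planar_tangleD[OF T]
  from iso[unfolded isotopic_def] obtain f g where len: "length (inner T') = length (inner T)" and \<pi>0: "\<pi> 0 = 0"
    and bij: "bij_betw \<pi> (boxes T) (boxes T')"
    and bx_all: "\<forall>b\<in>boxes T. box T' (\<pi> b) = box T b"
    and f: "bij_betw f (strands T) (strands T')" and g: "bij_betw g (regions T) (regions T')"
    and sh: "g ` shaded T = shaded T'"
    and sides_all: "\<forall>s\<in>strands T. uside T' (f s) = g (uside T s) \<and> sside T' (f s) = g (sside T s)"
    and st_all: "\<forall>b\<in>boxes T. \<forall>j\<in>points (box T b). strand_at T' (\<pi> b) j = f (strand_at T b j)"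
    and rg_all: "\<forall>b\<in>boxes T. \<forall>j\<in>intervals (box T b). region_at T' (\<pi> b) j = g (region_at T b j)"
    by (elim conjE exE) (rule that, assumption+)
  have bx: "box T' (\<pi> b) = box T b" if "b \<in> boxes T" for b using bx_all that by blast
  have us: "uside T' (f s) = g (uside T s)" and ss: "sside T' (f s) = g (sside T s)" if "s \<in> strands T" for s
    using sides_all that by blast+
  have st: "strand_at T' (\<pi> b) j = f (strand_at T b j)" if "b \<in> boxes T" "j \<in> points (box T b)" for b j
    using st_all that by blast
  have rg: "region_at T' (\<pi> b) j = g (region_at T b j)" if "b \<in> boxes T" "j \<in> intervals (box T b)" for b j
    using rg_all that by blast
  have boxes': "boxes T' = \<pi> ` boxes T" using bij by (simp add: bij_betw_def)
  have strands': "strands T' = f ` strands T" and inj_f: "inj_on f (strands T)"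
    using f by (simp_all add: bij_betw_def)
  have regions': "regions T' = g ` regions T" and inj_g: "inj_on g (regions T)"
    using g by (simp_all add: bij_betw_def)
  have \<pi>_eq_0: "\<pi> b = 0 \<longleftrightarrow> b = 0" if "b \<in> boxes T" for b
    using bij \<pi>0 that unfolding bij_betw_def inj_on_def by (metis boxes_simp le0)
  have g_shaded: "g r \<in> shaded T' \<longleftrightarrow> r \<in> shaded T" if "r \<in> regions T" for r
    using inj_g that D(3) unfolding sh[symmetric] by (auto dest: inj_onD)
  have ports': "ports c T' = (\<lambda>(b, j). (\<pi> b, j)) ` ports c T" for c
  proof (intro equalityI subsetI)
    fix u assume u: "u \<in> ports c T'"
    obtain b' j where [simp]: "u = (b', j)" by (cases u)
    have "b' \<in> boxes T'" using u by (simp add: ports_iff)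
    then obtain b where b: "b \<in> boxes T" "b' = \<pi> b" using boxes' by blast
    then have "(b, j) \<in> ports c T" using u bx \<pi>_eq_0[OF b(1)] by (simp add: ports_iff)
    then show "u \<in> (\<lambda>(b, j). (\<pi> b, j)) ` ports c T" using b by force
  next
    fix u assume "u \<in> (\<lambda>(b, j). (\<pi> b, j)) ` ports c T"
    then obtain b j where u: "u = (\<pi> b, j)" "(b, j) \<in> ports c T" by auto
    then have b: "b \<in> boxes T" by (simp add: ports_iff)
    then have "\<pi> b \<in> boxes T'" using boxes' by blast
    then show "u \<in> ports c T'" using u bx[OF b] \<pi>_eq_0[OF b] by (simp add: ports_iff)
  qed
  have st_ports: "case_prod (strand_at T') ((\<lambda>(b, j). (\<pi> b, j)) u) = f (case_prod (strand_at T) u)"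
    if "u \<in> ports c T" for u c
    using that st by (cases u) (simp add: ports_iff)
  have inj': "inj_on (case_prod (strand_at T')) (ports c T')" for c
    unfolding ports'
  proof (rule inj_onI, elim imageE)
    fix x y u v assume uv: "x = (\<lambda>(b, j). (\<pi> b, j)) u" "y = (\<lambda>(b, j). (\<pi> b, j)) v" "u \<in> ports c T" "v \<in> ports c T"
      and "case_prod (strand_at T') x = case_prod (strand_at T') y"
    then have "f (case_prod (strand_at T) u) = f (case_prod (strand_at T) v)"
      using st_ports by metis
    moreover have "case_prod (strand_at T) u \<in> strands T" "case_prod (strand_at T) v \<in> strands T"
      using uv(3,4) D(11) by (cases u, cases v, simp add: ports_iff)+
    ultimately have "case_prod (strand_at T) u = case_prod (strand_at T) v"
      using inj_f by (auto dest: inj_onD)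
    then have "u = v" using inj_onD[OF planar_ports(1)[OF T]] uv(3,4) by blast
    then show "x = y" using uv by simp
  qed
  have image': "case_prod (strand_at T') ` ports c T' = f ` case_prod (strand_at T) ` ports c T" for c
    unfolding ports' image_image by (rule image_cong) (use st_ports in auto)
  show ?thesis
    unfolding planar_tangle_def
  proof (intro conjI ballI)
    show "finite (strands T')" "finite (regions T')" using D(1,2) strands' regions' by simp_all
    show "shaded T' \<subseteq> regions T'" using D(3) sh regions' by blast
    show "uside T' s \<in> regions T' - shaded T'" "sside T' s \<in> shaded T'" if s: "s \<in> strands T'" for s
    proof -
      obtain t where t: "t \<in> strands T" "s = f t" using s strands' by blast
      show "uside T' s \<in> regions T' - shaded T'" "sside T' s \<in> shaded T'"
        using us[OF t(1)] ss[OF t(1)] D(4-7)[OF t(1)] g_shaded regions' t(2) by auto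
    qed
    fix b' assume "b' \<in> boxes T'"
    then obtain b where b: "b \<in> boxes T" "b' = \<pi> b" using boxes' by blast
    note bxb = bx[OF b(1)]
    show "region_at T' b' j \<in> regions T'"
      "region_at T' b' j \<in> shaded T' \<longleftrightarrow> shaded_interval (box T' b') j" if "j \<in> intervals (box T' b')" for j
      using that rg[OF b(1), of j] D(8,9)[OF b(1), of j] g_shaded regions' unfolding b(2) bxb by auto
    have "0 \<in> intervals (box T b)" "2 * fst (box T b) \<in> intervals (box T b)" by (auto simp: intervals_def)
    then show "region_at T' b' (2 * fst (box T' b')) = region_at T' b' 0"
      using rg[OF b(1)] D(10)[OF b(1)] unfolding b(2) bxb by simp
    fix j assume j: "j \<in> points (box T' b')"
    then have j': "j \<in> points (box T b)" unfolding b(2) bxb .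
    show "strand_at T' b' j \<in> strands T'"
      "uside T' (strand_at T' b' j) = region_at T' b' (u_interval (box T' b') j)"
      "sside T' (strand_at T' b' j) = region_at T' b' (s_interval (box T' b') j)"
      unfolding b(2) bxb st[OF b(1) j'] us[OF D(11)[OF b(1) j']] ss[OF D(11)[OF b(1) j']]
        rg[OF b(1) u_interval_in[OF j']] rg[OF b(1) s_interval_in[OF j']] D(12,13)[OF b(1) j']
      using imageI[OF D(11)[OF b(1) j'], of f] unfolding strands' by simp_all
  next
    show "inj_on (case_prod (strand_at T')) (starts T')" using inj'[of True] by (simp add: ports_def)
    show "inj_on (case_prod (strand_at T')) (ends T')" using inj'[of False] by (simp add: ports_def)
    show "case_prod (strand_at T') ` starts T' = case_prod (strand_at T') ` ends T'"
      using image'[of True] image'[of False] planar_ports(2)[OF T, of True False] by (simp add: ports_def)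
    show "\<forall>B\<subseteq>regions T'. B \<noteq> {} \<and> (\<forall>s\<in>strands T'. uside T' s \<in> B \<longleftrightarrow> sside T' s \<in> B) --> B = regions T'"
    proof (intro allI impI, elim conjE)
      fix B assume B: "B \<subseteq> regions T'" "B \<noteq> {}" "\<forall>s\<in>strands T'. uside T' s \<in> B \<longleftrightarrow> sside T' s \<in> B"
      have "{r \<in> regions T. g r \<in> B} = regions T"
      proof (rule planar_connected[OF T])
        obtain r' where r': "r' \<in> B" using B(2) by blast
        then obtain r where "r \<in> regions T" "r' = g r" using B(1) unfolding regions' by blast
        then show "{r \<in> regions T. g r \<in> B} \<noteq> {}" using r' by blast
        fix s assume s: "s \<in> strands T"
        then have "f s \<in> strands T'" using strands' by blast
        then show "uside T s \<in> {r \<in> regions T. g r \<in> B} \<longleftrightarrow> sside T s \<in> {r \<in> regions T. g r \<in> B}"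
          using bspec[OF B(3), of "f s"] us[OF s] ss[OF s] D(4,7)[OF s] by simp
      qed auto
      then have "g r \<in> B" if "r \<in> regions T" for r using that by blast
      then have "regions T' \<subseteq> B" unfolding regions' by blast
      then show "B = regions T'" using B(1) by blast
    qed
    show "\<forall>A\<subseteq>strands T'. (\<forall>b\<in>boxes T'. even (card {j \<in> points (box T' b). strand_at T' b j \<in> A})) -->
      (\<exists>B\<subseteq>regions T'. \<forall>s\<in>strands T'. s \<in> A \<longleftrightarrow> (uside T' s \<in> B) \<noteq> (sside T' s \<in> B))"
    proof (intro allI impI)
      fix A assume A: "A \<subseteq> strands T'"
        and ev: "\<forall>b\<in>boxes T'. even (card {j \<in> points (box T' b). strand_at T' b j \<in> A})"
      define A0 where "A0 = {s \<in> strands T. f s \<in> A}"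
      have "\<exists>B\<subseteq>regions T. \<forall>s\<in>strands T. s \<in> A0 \<longleftrightarrow> (uside T s \<in> B) \<noteq> (sside T s \<in> B)"
      proof (rule planar_jordan[OF T])
        fix b assume b: "b \<in> boxes T"
        then have "\<pi> b \<in> boxes T'" using boxes' by blast
        moreover have "{j \<in> points (box T b). strand_at T b j \<in> A0} =
            {j \<in> points (box T' (\<pi> b)). strand_at T' (\<pi> b) j \<in> A}"
          using st[OF b] D(11)[OF b] by (auto simp: A0_def bx[OF b])
        ultimately show "even (card {j \<in> points (box T b). strand_at T b j \<in> A0})" using ev by simp
      qed (auto simp: A0_def)
      then obtain B where B: "B \<subseteq> regions T"
        "!!s. s \<in> strands T ==> s \<in> A0 \<longleftrightarrow> (uside T s \<in> B) \<noteq> (sside T s \<in> B)" by blast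
      have gB: "g r \<in> g ` B \<longleftrightarrow> r \<in> B" if "r \<in> regions T" for r
        using inj_g that B(1) by (auto dest: inj_onD)
      show "\<exists>B\<subseteq>regions T'. \<forall>s\<in>strands T'. s \<in> A \<longleftrightarrow> (uside T' s \<in> B) \<noteq> (sside T' s \<in> B)"
      proof (intro exI[of _ "g ` B"] conjI ballI)
        show "g ` B \<subseteq> regions T'" using B(1) regions' by blast
        fix s assume "s \<in> strands T'"
        then obtain t where t: "t \<in> strands T" "s = f t" using strands' by blast
        show "s \<in> A \<longleftrightarrow> (uside T' s \<in> g ` B) \<noteq> (sside T' s \<in> g ` B)"
          using B(2)[OF t(1)] us[OF t(1)] ss[OF t(1)] gB D(4,7)[OF t(1)] t by (simp add: A0_def)
      qed
    qed
  qed
qed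

lemma kernel_presented:
  assumes T: "presented T Q" and T': "presented T' Q'"
    and bij: "bij_betw \<pi> (boxes T) (boxes T')"
    and bx: "!!b. b \<in> boxes T ==> box T' (\<pi> b) = box T b"
    and fro: "!!\<psi>. Q \<psi> ==> \<exists>\<psi>'. Q' \<psi>' \<and> (\<forall>b\<in>boxes T. \<forall>p\<le>4 * fst (box T b). \<psi>' (\<pi> b, p) = \<psi> (b, p))"
    and nodes: "(b, p) \<in> nodes T" "(c, q) \<in> nodes T" and eq: "name T' (\<pi> b, p) = name T' (\<pi> c, q)"
  shows "name T (b, p) = name T (c, q)"
proof -
  have bp': "(\<pi> b, p) \<in> nodes T'" and cq': "(\<pi> c, q) \<in> nodes T'"
    using nodes bij_betwE[OF bij] bx by (auto simp: nodes_def simp del: boxes_simp)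
  obtain \<psi>' where "Q' \<psi>'" "\<forall>b\<in>boxes T. \<forall>p\<le>4 * fst (box T b). \<psi>' (\<pi> b, p) = name T (b, p)"
    using fro[OF presentedD(2)[OF T]] by blast
  then show ?thesis
    using presentedD(4)[OF T' _ bp' cq' eq, of \<psi>'] nodes by (auto simp: nodes_def simp del: boxes_simp)
qed

text \<open>
The tangles of the definitions are given by explicit names. Planarity, which would be laborious to check
from the names, is transported from a composite of tangles already known to be planar.
\<close>

lemma isotopic_tangle_of:
  fixes out ins st rg
  defines "T' \<equiv> tangle_of out ins st rg"
  assumes planar: "planar_tangle T" and T: "presented T Q" and T': "presented T' Q'"
    and len: "length (inner T') = length (inner T)" and \<pi>0: "\<pi> 0 = 0"
    and bij: "bij_betw \<pi> (boxes T) (boxes T')"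
    and bx: "!!b. b \<in> boxes T ==> box T' (\<pi> b) = box T b"
    and to: "!!\<psi>. Q' \<psi> ==> Q (\<lambda>(b, p). \<psi> (\<pi> b, p))"
    and fro: "!!\<psi>. Q \<psi> ==> \<exists>\<psi>'. Q' \<psi>' \<and> (\<forall>b\<in>boxes T. \<forall>p\<le>4 * fst (box T b). \<psi>' (\<pi> b, p) = \<psi> (b, p))"
  shows "isotopic \<pi> T T'" "planar_tangle T'"
proof -
  note D = planar_tangleD[OF planar]
  have sel: "strand_at T' = st" "region_at T' = rg" by (simp_all add: T'_def)
  have region: "rg (\<pi> b) j = rg (\<pi> c) k"
    if "b \<in> boxes T" "j \<in> intervals (box T b)" "c \<in> boxes T" "k \<in> intervals (box T c)"
      "region_at T b j = region_at T c k" for b j c k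
    using presentedD(4)[OF T to[OF presentedD(2)[OF T']], of "(b, 2 * j)" "(c, 2 * k)"] that sel
    by (simp add: node_even)
  have "incident T'"
    unfolding T'_def
  proof (rule tangle_of_incident, fold T'_def)
    fix b' j c' k
    assume *: "b' \<in> boxes T'" "j \<in> points (box T' b')" "c' \<in> boxes T'" "k \<in> points (box T' c')" "st b' j = st c' k"
    obtain b where b: "b \<in> boxes T" "b' = \<pi> b" using *(1) bij unfolding bij_betw_def by blast
    obtain c where c: "c \<in> boxes T" "c' = \<pi> c" using *(3) bij unfolding bij_betw_def by blast
    have j: "j \<in> points (box T b)" "0 < j" and k: "k \<in> points (box T c)" "0 < k"
      using *(2,4) bx b c by (auto simp: points_def)
    have "name T (b, 2 * j - Suc 0) = name T (c, 2 * k - Suc 0)"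
      by (rule kernel_presented[OF T T' bij bx fro])
        (use *(5) b c j k sel in \<open>simp_all add: node_odd name_odd\<close>)
    then have "strand_at T b j = strand_at T c k" using j k by (simp add: name_odd)
    then have "region_at T b (u_interval (box T b) j) = region_at T c (u_interval (box T c) k)"
      "region_at T b (s_interval (box T b) j) = region_at T c (s_interval (box T c) k)"
      using D(12,13)[OF b(1) j(1)] D(12,13)[OF c(1) k(1)] by simp_all
    then show "rg b' (u_interval (box T' b') j) = rg c' (u_interval (box T' c') k) \<and>
        rg b' (s_interval (box T' b') j) = rg c' (s_interval (box T' c') k)"
      using region[OF b(1) u_interval_in[OF j(1)] c(1) u_interval_in[OF k(1)]]
        region[OF b(1) s_interval_in[OF j(1)] c(1) s_interval_in[OF k(1)]] b c bx by simp
  qed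
  with isotopic_presented[OF T planar_incident[OF planar presentedD(1)[OF T]] T' _ len \<pi>0 bij bx to fro]
  show "isotopic \<pi> T T'" by blast
  then show "planar_tangle T'" by (rule planar_isotopic[OF planar])
qed

lemma isotopic_id:
  assumes "planar_tangle T" "presented T Q" "planar_tangle T'" "presented T' Q'"
    "outer T' = outer T" "inner T' = inner T" "!!\<psi>. Q \<psi> \<longleftrightarrow> Q' \<psi>"
  shows "isotopic id T T'"
proof (rule isotopic_presented[OF assms(2) planar_incident[OF assms(1) presentedD(1)[OF assms(2)]]
      assms(4) planar_incident[OF assms(3) presentedD(1)[OF assms(4)]]])
  show "bij_betw id (boxes T) (boxes T')" using assms(6) by (simp add: boxes_def)
qed (use assms in \<open>auto simp: box_def\<close>)

subsection \<open>Systems of composites\<close>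

text \<open>
The labels \<open>\<phi>\<close> of \<open>T\<close> and \<open>\<chi>\<close> of \<open>S\<close> agree on the common boundary and are then forgotten.
\<close>

definition comp_sys :: "tangle => nat => tangle => system => system => system" where
  "comp_sys T i S QT QS \<psi> \<longleftrightarrow> (\<exists>\<phi> \<chi>. QT \<phi> \<and> QS \<chi> \<and> (\<forall>p\<le>4 * fst (outer S). \<phi> (i, p) = \<chi> (0, p)) \<and>
      (\<forall>b\<in>boxes T - {i}. \<forall>p\<le>4 * fst (box T b).
         \<psi> (if b < i then b else b + length (inner S) - 1, p) = \<phi> (b, p)) \<and>
      (\<forall>b\<in>boxes S - {0}. \<forall>p\<le>4 * fst (box S b). \<psi> (i + b - 1, p) = \<chi> (b, p)))"

text \<open>
If every name at the box \<open>i\<close> of \<open>T\<close> also occurs at another box, then filling this box leaves no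
strand or region without contact to a box, so the composite is determined by its names.
\<close>

definition touching :: "tangle => nat => bool" where
  "touching T i \<longleftrightarrow> (\<forall>p\<le>4 * fst (box T i). \<exists>u\<in>nodes T. fst u \<noteq> i \<and> name T (i, p) = name T u)"

lemma composite_realized:
  assumes T: "planar_tangle T" "presented T QT" and S: "planar_tangle S" "presented S QS"
    and i: "i \<in> {1..length (inner T)}" and box: "box T i = outer S"
    and touch: "touching T i \<or> touching S 0"
  obtains R where "composite T i S R" "planar_tangle R" "outer R = outer T"
    "inner R = take (i - 1) (inner T) @ inner S @ drop i (inner T)"
    "presented R (comp_sys T i S QT QS)"
proof -
  obtain R where R: "composite T i S R" "planar_tangle R"
    using composite_exists[OF T(1) S(1) i box] by blast
  obtain f g where "tangle_composite T i S R f g" using R(1) composite_iff by blast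
  then interpret planar_composite T i S R f g
    using T(1) S(1) by (simp add: planar_composite_def planar_composite_axioms_def)
  have "presented R (comp_sys T i S QT QS)"
    using composite_presented[OF T(2) S(2)] touch
    unfolding touching_def comp_sys_def posT_def posS_def box_i outer_box(1) by simp
  then show thesis using that R outer_R inner_R by blast
qed

lemma four_half: "even n ==> 4 * (n div 2) = 2 * (n :: nat)"
  by (elim evenE) simp

lemma ins_touching: "touching (ins_tangle s j c b d) e" if "e \<le> 2" "even (c + b)" "even (j + b + d)"
proof -
  interpret insertion s j c b d using that by unfold_locales
  note sz = size_T[unfolded One_nat_def[symmetric]]
  have node: "(e, p) \<in> nodes T \<longleftrightarrow> e = 0 \<and> p \<le> 2 * (j + c + d) \<or> e = 1 \<and> p \<le> 2 * (c + b) \<or>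
      e = 2 \<and> p \<le> 2 * (j + b + d)" for e p
    unfolding nodes_def boxes_T using sz by auto
  have E: "ins_eqs j c b d (\<lambda>p. name T (0, p)) (\<lambda>p. name T (1, p)) (\<lambda>p. name T (2, p))"
    using presentedD(2)[OF ins_presented] unfolding ins_sys_eqs .
  note E = ins_eqsD[OF E]
  have "\<exists>u\<in>nodes T. fst u \<noteq> e \<and> name T (e, p) = name T u" if p: "p \<le> 4 * fst (box T e)" for p
  proof -
    consider "e = 0" "p \<le> 2 * j + 2 * c + 2 * d" | "e = 1" "p \<le> 2 * c + 2 * b" | "e = 2" "p \<le> 2 * j + 2 * b + 2 * d"
      using \<open>e \<le> 2\<close> p sz by (cases "e = 0"; cases "e = 1"; cases "e = 2") auto
    then show ?thesis
    proof cases
      case 1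
      note out = this
      from out(2) show ?thesis
      proof (cases rule: split3)
        case 1
        then show ?thesis using out E(1)[of p] node by (intro bexI[of _ "(2, p)"]) auto
      next
        case (2 u)
        then show ?thesis using out E(2)[of u] node by (intro bexI[of _ "(1, u)"]) auto
      next
        case (3 u)
        then show ?thesis using out E(4)[of u] node by (intro bexI[of _ "(2, 2 * j + 2 * b + u)"]) auto
      qed
    next
      case 2
      note one = this
      from one(2) show ?thesis
      proof (cases rule: split2)
        case 1
        then show ?thesis using one E(2)[of p] node by (intro bexI[of _ "(0, 2 * j + p)"]) auto
      next
        case (2 u)
        then obtain v where "u + v = 2 * b" using le_Suc_ex by metis
        then show ?thesis using one(1) 2 E(3)[of u v] node by (intro bexI[of _ "(2, 2 * j + v)"]) auto
      qed
    next
      case 3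
      note two = this
      from two(2) show ?thesis
      proof (cases rule: split3)
        case 1
        then show ?thesis using two E(1)[of p] node by (intro bexI[of _ "(0, p)"]) auto
      next
        case (2 u)
        then obtain v where "v + u = 2 * b" using le_Suc_ex by (metis add.commute)
        then show ?thesis using two(1) 2 E(3)[of v u] node by (intro bexI[of _ "(1, 2 * c + v)"]) auto
      next
        case (3 u)
        then show ?thesis using two(1) 3 E(4)[of u] node by (intro bexI[of _ "(0, 2 * j + 2 * c + u)"]) auto
      qed
    qed
  qed
  then show ?thesis unfolding touching_def by blast
qed

text \<open>
When an insertion is composed with another tangle, the label \<open>I\<close> is that of the box that
disappears.
\<close>

lemma ins_second:
  assumes ev: "even (c + b)" "even (j + b + d)"
    and S: "planar_tangle S" "presented S QS" "outer S = ((j + b + d) div 2, s)"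
  obtains R where "composite (ins_tangle s j c b d) 2 S R" "planar_tangle R"
    "outer R = ((j + c + d) div 2, s)" "inner R = ((c + b) div 2, s \<noteq> odd j) # inner S"
    "presented R (\<lambda>\<psi>. \<exists>I. ins_eqs j c b d (\<lambda>p. \<psi> (0, p)) (\<lambda>p. \<psi> (1, p)) I \<and>
       (\<exists>\<chi>. QS \<chi> \<and> (\<forall>p\<le>2 * (j + b + d). I p = \<chi> (0, p)) \<and>
          (\<forall>e\<in>boxes S - {0}. \<forall>p\<le>4 * fst (box S e). \<psi> (e + 1, p) = \<chi> (e, p))))"
proof -
  let ?T = "ins_tangle s j c b d"
  interpret insertion s j c b d using ev by unfold_locales
  obtain R where R: "composite ?T 2 S R" "planar_tangle R" "outer R = outer ?T"
    "inner R = take (2 - 1) (inner ?T) @ inner S @ drop 2 (inner ?T)"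
    "presented R (comp_sys ?T 2 S (ins_sys j c b d) QS)"
    by (rule composite_realized[OF planar ins_presented S(1,2), of 2])
      (use ins_touching[OF _ ev, of 2 s] S(3) in \<open>simp_all add: box_def\<close>)
  have sz: "4 * fst (outer S) = 2 * (j + b + d)" unfolding S(3) fst_conv by (rule four_half[OF ev(2)])
  have b2: "boxes ?T - {2} = {0, 1}" unfolding boxes_T by auto
  have sz': "4 * fst (box ?T 0) = 2 * (j + c + d)" "4 * fst (box ?T 1) = 2 * (c + b)" using size_T by simp_all
  have "comp_sys ?T 2 S (ins_sys j c b d) QS \<psi> \<longleftrightarrow>
    (\<exists>I. ins_eqs j c b d (\<lambda>p. \<psi> (0, p)) (\<lambda>p. \<psi> (1, p)) I \<and>
       (\<exists>\<chi>. QS \<chi> \<and> (\<forall>p\<le>2 * (j + b + d). I p = \<chi> (0, p)) \<and>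
          (\<forall>e\<in>boxes S - {0}. \<forall>p\<le>4 * fst (box S e). \<psi> (e + 1, p) = \<chi> (e, p))))" (is "?L = ?R") for \<psi>
  proof
    assume ?L
    then obtain \<phi> \<chi> where *: "ins_sys j c b d \<phi>" "QS \<chi>" "\<forall>p\<le>2 * (j + b + d). \<phi> (2, p) = \<chi> (0, p)"
      "\<forall>p\<le>2 * (j + c + d). \<psi> (0, p) = \<phi> (0, p)" "\<forall>p\<le>2 * (c + b). \<psi> (1, p) = \<phi> (1, p)"
      "\<forall>e\<in>boxes S - {0}. \<forall>p\<le>4 * fst (box S e). \<psi> (2 + e - 1, p) = \<chi> (e, p)"
      unfolding comp_sys_def b2 sz by (auto simp: sz'[unfolded One_nat_def])
    then have "ins_eqs j c b d (\<lambda>p. \<psi> (0, p)) (\<lambda>p. \<psi> (1, p)) (\<lambda>p. \<phi> (2, p))"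
      unfolding ins_sys_eqs by (elim ins_eqs_cong) simp_all
    then show ?R using *(2,3,6) by (intro exI[of _ "\<lambda>p. \<phi> (2, p)"] conjI exI[of _ \<chi>]) simp_all
  next
    assume ?R
    then obtain I \<chi> where *: "ins_eqs j c b d (\<lambda>p. \<psi> (0, p)) (\<lambda>p. \<psi> (1, p)) I" "QS \<chi>"
      "\<forall>p\<le>2 * (j + b + d). I p = \<chi> (0, p)"
      "\<forall>e\<in>boxes S - {0}. \<forall>p\<le>4 * fst (box S e). \<psi> (e + 1, p) = \<chi> (e, p)" by blast
    show ?L
      unfolding comp_sys_def b2 sz
      by (rule exI[of _ "\<lambda>(e, p). if e = 2 then I p else \<psi> (e, p)"], rule exI[of _ \<chi>])
        (use * in \<open>simp add: ins_sys_eqs\<close>)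
  qed
  then have "presented R (\<lambda>\<psi>. \<exists>I. ins_eqs j c b d (\<lambda>p. \<psi> (0, p)) (\<lambda>p. \<psi> (1, p)) I \<and>
       (\<exists>\<chi>. QS \<chi> \<and> (\<forall>p\<le>2 * (j + b + d). I p = \<chi> (0, p)) \<and>
          (\<forall>e\<in>boxes S - {0}. \<forall>p\<le>4 * fst (box S e). \<psi> (e + 1, p) = \<chi> (e, p))))"
    by (rule presented_cong[OF R(5)])
  then show thesis using that R(1-4) by simp
qed

lemma ins_first:
  assumes ev: "even (c + b)" "even (j + b + d)"
    and S: "planar_tangle S" "presented S QS" "outer S = ((c + b) div 2, s \<noteq> odd j)"
  obtains R where "composite (ins_tangle s j c b d) 1 S R" "planar_tangle R"
    "outer R = ((j + c + d) div 2, s)" "inner R = inner S @ [((j + b + d) div 2, s)]"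
    "presented R (\<lambda>\<psi>. \<exists>I. ins_eqs j c b d (\<lambda>p. \<psi> (0, p)) I (\<lambda>p. \<psi> (length (inner S) + 1, p)) \<and>
       (\<exists>\<chi>. QS \<chi> \<and> (\<forall>p\<le>2 * (c + b). I p = \<chi> (0, p)) \<and>
          (\<forall>e\<in>boxes S - {0}. \<forall>p\<le>4 * fst (box S e). \<psi> (e, p) = \<chi> (e, p))))"
proof -
  let ?T = "ins_tangle s j c b d" and ?l = "length (inner S)"
  interpret insertion s j c b d using ev by unfold_locales
  obtain R where R: "composite ?T 1 S R" "planar_tangle R" "outer R = outer ?T"
    "inner R = take (1 - 1) (inner ?T) @ inner S @ drop 1 (inner ?T)"
    "presented R (comp_sys ?T 1 S (ins_sys j c b d) QS)"
    by (rule composite_realized[OF planar ins_presented S(1,2), of 1])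
      (use ins_touching[OF _ ev, of 1 s] S(3) in \<open>simp_all add: box_def\<close>)
  have sz: "4 * fst (outer S) = 2 * (c + b)" unfolding S(3) fst_conv by (rule four_half[OF ev(1)])
  have b2: "boxes ?T - {1} = {0, 2}" unfolding boxes_T by auto
  have sz': "4 * fst (box ?T 0) = 2 * (j + c + d)" "4 * fst (box ?T 2) = 2 * (j + b + d)" using size_T by simp_all
  have "comp_sys ?T 1 S (ins_sys j c b d) QS \<psi> \<longleftrightarrow>
    (\<exists>I. ins_eqs j c b d (\<lambda>p. \<psi> (0, p)) I (\<lambda>p. \<psi> (?l + 1, p)) \<and>
       (\<exists>\<chi>. QS \<chi> \<and> (\<forall>p\<le>2 * (c + b). I p = \<chi> (0, p)) \<and>
          (\<forall>e\<in>boxes S - {0}. \<forall>p\<le>4 * fst (box S e). \<psi> (e, p) = \<chi> (e, p))))" (is "?L = ?R") for \<psi>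
  proof
    assume ?L
    then obtain \<phi> \<chi> where *: "ins_sys j c b d \<phi>" "QS \<chi>" "\<forall>p\<le>2 * (c + b). \<phi> (1, p) = \<chi> (0, p)"
      "\<forall>p\<le>2 * (j + c + d). \<psi> (0, p) = \<phi> (0, p)" "\<forall>p\<le>2 * (j + b + d). \<psi> (?l + 1, p) = \<phi> (2, p)"
      "\<forall>e\<in>boxes S - {0}. \<forall>p\<le>4 * fst (box S e). \<psi> (1 + e - 1, p) = \<chi> (e, p)"
      unfolding comp_sys_def b2 sz by (auto simp: sz')
    then have "ins_eqs j c b d (\<lambda>p. \<psi> (0, p)) (\<lambda>p. \<phi> (1, p)) (\<lambda>p. \<psi> (?l + 1, p))"
      unfolding ins_sys_eqs by (elim ins_eqs_cong) simp_all
    then show ?R using *(2,3,6) by (intro exI[of _ "\<lambda>p. \<phi> (1, p)"] conjI exI[of _ \<chi>]) simp_all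
  next
    assume ?R
    then obtain I \<chi> where *: "ins_eqs j c b d (\<lambda>p. \<psi> (0, p)) I (\<lambda>p. \<psi> (?l + 1, p))" "QS \<chi>"
      "\<forall>p\<le>2 * (c + b). I p = \<chi> (0, p)"
      "\<forall>e\<in>boxes S - {0}. \<forall>p\<le>4 * fst (box S e). \<psi> (e, p) = \<chi> (e, p)" by blast
    show ?L
      unfolding comp_sys_def b2 sz
      by (rule exI[of _ "\<lambda>(e, p). if e = 1 then I p else if e = 0 then \<psi> (0, p) else \<psi> (?l + 1, p)"],
          rule exI[of _ \<chi>])
        (use * in \<open>simp add: ins_sys_eqs\<close>)
  qed
  then have "presented R (\<lambda>\<psi>. \<exists>I. ins_eqs j c b d (\<lambda>p. \<psi> (0, p)) I (\<lambda>p. \<psi> (?l + 1, p)) \<and>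
       (\<exists>\<chi>. QS \<chi> \<and> (\<forall>p\<le>2 * (c + b). I p = \<chi> (0, p)) \<and>
          (\<forall>e\<in>boxes S - {0}. \<forall>p\<le>4 * fst (box S e). \<psi> (e, p) = \<chi> (e, p))))"
    by (rule presented_cong[OF R(5)])
  then show thesis using that R(1-4) by simp
qed

lemma ins_ins_second:
  assumes ev: "even (c + b)" "even (j + b + d)" "even (c' + b')" "even (j' + b' + d')"
    and eq: "j + b + d = j' + c' + d'"
  obtains R where "composite (ins_tangle s j c b d) 2 (ins_tangle s j' c' b' d') R" "planar_tangle R"
    "outer R = ((j + c + d) div 2, s)"
    "inner R = [((c + b) div 2, s \<noteq> odd j), ((c' + b') div 2, s \<noteq> odd j'), ((j' + b' + d') div 2, s)]"
    "presented R (\<lambda>\<psi>. \<exists>I. ins_eqs j c b d (\<lambda>p. \<psi> (0, p)) (\<lambda>p. \<psi> (1, p)) I \<and>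
       ins_eqs j' c' b' d' I (\<lambda>p. \<psi> (2, p)) (\<lambda>p. \<psi> (3, p)))"
proof -
  let ?S = "ins_tangle s j' c' b' d'"
  interpret S: insertion s j' c' b' d' using ev by unfold_locales
  have bS: "boxes ?S - {0} = {1, 2}" unfolding S.boxes_T by auto
  have szS: "4 * fst (box ?S 1) = 2 * (c' + b')" "4 * fst (box ?S 2) = 2 * (j' + b' + d')"
    using S.size_T by simp_all
  obtain R where R: "composite (ins_tangle s j c b d) 2 ?S R" "planar_tangle R"
    "outer R = ((j + c + d) div 2, s)" "inner R = ((c + b) div 2, s \<noteq> odd j) # inner ?S"
    "presented R (\<lambda>\<psi>. \<exists>I. ins_eqs j c b d (\<lambda>p. \<psi> (0, p)) (\<lambda>p. \<psi> (1, p)) I \<and>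
       (\<exists>\<chi>. ins_sys j' c' b' d' \<chi> \<and> (\<forall>p\<le>2 * (j + b + d). I p = \<chi> (0, p)) \<and>
          (\<forall>e\<in>boxes ?S - {0}. \<forall>p\<le>4 * fst (box ?S e). \<psi> (e + 1, p) = \<chi> (e, p))))"
    by (rule ins_second[OF ev(1,2) S.planar ins_presented, of s]) (simp_all add: eq)
  have "(\<exists>\<chi>. ins_sys j' c' b' d' \<chi> \<and> (\<forall>p\<le>2 * (j + b + d). I p = \<chi> (0, p)) \<and>
          (\<forall>e\<in>boxes ?S - {0}. \<forall>p\<le>4 * fst (box ?S e). \<psi> (e + 1, p) = \<chi> (e, p))) \<longleftrightarrow>
       ins_eqs j' c' b' d' I (\<lambda>p. \<psi> (2, p)) (\<lambda>p. \<psi> (3, p))" for I and \<psi> :: "nat \<times> nat => nat + nat"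
  proof
    assume "\<exists>\<chi>. ins_sys j' c' b' d' \<chi> \<and> (\<forall>p\<le>2 * (j + b + d). I p = \<chi> (0, p)) \<and>
          (\<forall>e\<in>boxes ?S - {0}. \<forall>p\<le>4 * fst (box ?S e). \<psi> (e + 1, p) = \<chi> (e, p))"
    then obtain \<chi> where \<chi>: "ins_sys j' c' b' d' \<chi>" "\<forall>p\<le>2 * (j' + c' + d'). I p = \<chi> (0, p)"
      "\<forall>e\<in>{1, 2}. \<forall>p\<le>4 * fst (box ?S e). \<psi> (e + 1, p) = \<chi> (e, p)"
      unfolding bS eq by blast
    have sm: "(1 :: nat) + 1 = 2" "(2 :: nat) + 1 = 3" by simp_all
    have "\<psi> (1 + 1, p) = \<chi> (1, p)" if "p \<le> 2 * (c' + b')" for p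
      using \<chi>(3) that[folded szS] by blast
    moreover have "\<psi> (2 + 1, p) = \<chi> (2, p)" if "p \<le> 2 * (j' + b' + d')" for p
      using \<chi>(3) that[folded szS] by blast
    ultimately have "\<forall>p\<le>2 * (c' + b'). \<psi> (2, p) = \<chi> (1, p)" "\<forall>p\<le>2 * (j' + b' + d'). \<psi> (3, p) = \<chi> (2, p)"
      unfolding sm by blast+
    with \<chi>(1,2) show "ins_eqs j' c' b' d' I (\<lambda>p. \<psi> (2, p)) (\<lambda>p. \<psi> (3, p))"
      unfolding ins_sys_eqs by (elim ins_eqs_cong) simp_all
  next
    assume "ins_eqs j' c' b' d' I (\<lambda>p. \<psi> (2, p)) (\<lambda>p. \<psi> (3, p))"
    then show "\<exists>\<chi>. ins_sys j' c' b' d' \<chi> \<and> (\<forall>p\<le>2 * (j + b + d). I p = \<chi> (0, p)) \<and>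
          (\<forall>e\<in>boxes ?S - {0}. \<forall>p\<le>4 * fst (box ?S e). \<psi> (e + 1, p) = \<chi> (e, p))"
      by (intro exI[of _ "\<lambda>(e, p). if e = 0 then I p else \<psi> (e + 1, p)"])
        (simp add: ins_sys_eqs numeral_2_eq_2 numeral_3_eq_3)
  qed
  note R5 = R(5)[unfolded this]
  show thesis using that R(1-4) R5 by simp
qed

lemma ins_ins_first:
  assumes ev: "even (c + b)" "even (j + b + d)" "even (c' + b')" "even (j' + b' + d')"
    and eq: "c + b = j' + c' + d'"
  obtains R where "composite (ins_tangle s j c b d) 1 (ins_tangle (s \<noteq> odd j) j' c' b' d') R" "planar_tangle R"
    "outer R = ((j + c + d) div 2, s)"
    "inner R = [((c' + b') div 2, (s \<noteq> odd j) \<noteq> odd j'), ((j' + b' + d') div 2, s \<noteq> odd j),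
       ((j + b + d) div 2, s)]"
    "presented R (\<lambda>\<psi>. \<exists>I. ins_eqs j c b d (\<lambda>p. \<psi> (0, p)) I (\<lambda>p. \<psi> (3, p)) \<and>
       ins_eqs j' c' b' d' I (\<lambda>p. \<psi> (1, p)) (\<lambda>p. \<psi> (2, p)))"
proof -
  let ?S = "ins_tangle (s \<noteq> odd j) j' c' b' d'"
  interpret S: insertion "s \<noteq> odd j" j' c' b' d' using ev by unfold_locales
  have bS: "boxes ?S - {0} = {1, 2}" unfolding S.boxes_T by auto
  have szS: "4 * fst (box ?S 1) = 2 * (c' + b')" "4 * fst (box ?S 2) = 2 * (j' + b' + d')"
    using S.size_T by simp_all
  obtain R where R: "composite (ins_tangle s j c b d) 1 ?S R" "planar_tangle R"
    "outer R = ((j + c + d) div 2, s)" "inner R = inner ?S @ [((j + b + d) div 2, s)]"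
    "presented R (\<lambda>\<psi>. \<exists>I. ins_eqs j c b d (\<lambda>p. \<psi> (0, p)) I (\<lambda>p. \<psi> (length (inner ?S) + 1, p)) \<and>
       (\<exists>\<chi>. ins_sys j' c' b' d' \<chi> \<and> (\<forall>p\<le>2 * (c + b). I p = \<chi> (0, p)) \<and>
          (\<forall>e\<in>boxes ?S - {0}. \<forall>p\<le>4 * fst (box ?S e). \<psi> (e, p) = \<chi> (e, p))))"
    by (rule ins_first[OF ev(1,2) S.planar ins_presented, of s]) (simp_all add: eq)
  have "(\<exists>\<chi>. ins_sys j' c' b' d' \<chi> \<and> (\<forall>p\<le>2 * (c + b). I p = \<chi> (0, p)) \<and>
          (\<forall>e\<in>boxes ?S - {0}. \<forall>p\<le>4 * fst (box ?S e). \<psi> (e, p) = \<chi> (e, p))) \<longleftrightarrow>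
       ins_eqs j' c' b' d' I (\<lambda>p. \<psi> (1, p)) (\<lambda>p. \<psi> (2, p))" for I and \<psi> :: "nat \<times> nat => nat + nat"
  proof
    assume "\<exists>\<chi>. ins_sys j' c' b' d' \<chi> \<and> (\<forall>p\<le>2 * (c + b). I p = \<chi> (0, p)) \<and>
          (\<forall>e\<in>boxes ?S - {0}. \<forall>p\<le>4 * fst (box ?S e). \<psi> (e, p) = \<chi> (e, p))"
    then obtain \<chi> where \<chi>: "ins_sys j' c' b' d' \<chi>" "\<forall>p\<le>2 * (j' + c' + d'). I p = \<chi> (0, p)"
      "\<forall>e\<in>{1, 2}. \<forall>p\<le>4 * fst (box ?S e). \<psi> (e, p) = \<chi> (e, p)"
      unfolding bS eq by blast
    have "\<forall>p\<le>2 * (c' + b'). \<psi> (1, p) = \<chi> (1, p)" "\<forall>p\<le>2 * (j' + b' + d'). \<psi> (2, p) = \<chi> (2, p)"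
      using \<chi>(3) unfolding szS[symmetric] by blast+
    with \<chi>(1,2) show "ins_eqs j' c' b' d' I (\<lambda>p. \<psi> (1, p)) (\<lambda>p. \<psi> (2, p))"
      unfolding ins_sys_eqs by (elim ins_eqs_cong) simp_all
  next
    assume "ins_eqs j' c' b' d' I (\<lambda>p. \<psi> (1, p)) (\<lambda>p. \<psi> (2, p))"
    then show "\<exists>\<chi>. ins_sys j' c' b' d' \<chi> \<and> (\<forall>p\<le>2 * (c + b). I p = \<chi> (0, p)) \<and>
          (\<forall>e\<in>boxes ?S - {0}. \<forall>p\<le>4 * fst (box ?S e). \<psi> (e, p) = \<chi> (e, p))"
      by (intro exI[of _ "\<lambda>(e, p). if e = 0 then I p else \<psi> (e, p)"]) (simp add: ins_sys_eqs)
  qed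
  moreover have "length (inner ?S) + 1 = 3" by simp
  ultimately have R5: "presented R (\<lambda>\<psi>. \<exists>I. ins_eqs j c b d (\<lambda>p. \<psi> (0, p)) I (\<lambda>p. \<psi> (3, p)) \<and>
       ins_eqs j' c' b' d' I (\<lambda>p. \<psi> (1, p)) (\<lambda>p. \<psi> (2, p)))"
    using R(5) by (simp only:)
  show thesis using that R(1-4) R5 by simp
qed

subsection \<open>The given tangles as insertions\<close>

lemma name_tangle_of:
  "name (tangle_of out ins st rg) (e, 2 * q) = Inr (rg e q)"
  "0 < q ==> name (tangle_of out ins st rg) (e, 2 * q - 1) = Inl (st e q)"
  using name_odd[of q "tangle_of out ins st rg" e] by simp_all

lemma nodes_012:
  assumes "inner T = [t1, t2]" "u \<in> nodes T"
    "!!q. q \<le> 2 * fst (outer T) ==> P (0, 2 * q)" "!!q. 0 < q ==> q \<le> 2 * fst (outer T) ==> P (0, 2 * q - 1)"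
    "!!q. q \<le> 2 * fst t1 ==> P (1, 2 * q)" "!!q. 0 < q ==> q \<le> 2 * fst t1 ==> P (1, 2 * q - 1)"
    "!!q. q \<le> 2 * fst t2 ==> P (2, 2 * q)" "!!q. 0 < q ==> q \<le> 2 * fst t2 ==> P (2, 2 * q - 1)"
  shows "P u"
proof -
  obtain e p where u: "u = (e, p)" by (cases u)
  have "e = 0 \<or> e = 1 \<or> e = 2" and p: "p \<le> 4 * fst (box T e)"
    using assms(1,2) u by (auto simp: nodes_def)
  moreover have "box T 0 = outer T" "box T 1 = t1" "box T 2 = t2" using assms(1) by (simp_all add: box_def)
  ultimately consider "e = 0" "p \<le> 4 * fst (outer T)" | "e = 1" "p \<le> 4 * fst t1" | "e = 2" "p \<le> 4 * fst t2"
    by auto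
  then show ?thesis
  proof cases
    case 1 then show ?thesis unfolding u 1(1) by (cases p rule: pos_cases) (simp_all add: assms(3,4) del: One_nat_def)
  next
    case 2 then show ?thesis unfolding u 2(1) by (cases p rule: pos_cases) (simp_all add: assms(5,6) del: One_nat_def)
  next
    case 3 then show ?thesis unfolding u 3(1) by (cases p rule: pos_cases) (simp_all add: assms(7,8) del: One_nat_def)
  qed
qed

lemma stack_presented:
  assumes "even (c + b)" "even (b + a)"
  shows "presented (stack_tangle s c b a) (ins_sys 0 c b a)"
proof -
  define rg1 where "rg1 j = (if j = c + b \<or> (a = 0 \<and> j = c) then 0 else j)" for j
  define rg2 where "rg2 j = (if j \<le> b then rg1 (c + b - j) else if j = b + a then 0 else c + j)" for j
  define st where "st i j = (if i = 0 then (if j \<le> c then j else b + j)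
               else if i = 1 then j else (if j \<le> b then c + b + 1 - j else c + j))" for i j :: nat
  define rg where "rg i j = (if i = 0 then (if j \<le> c then rg1 j else rg2 (b + (j - c)))
               else if i = 1 then rg1 j else rg2 j)" for i j :: nat
  let ?T = "tangle_of ((c + a) div 2, s) [((c + b) div 2, s), ((b + a) div 2, s)] st rg"
  have T: "stack_tangle s c b a = ?T"
    unfolding stack_tangle_def Let_def st_def rg_def rg2_def rg1_def ..
  have sz: "2 * ((c + a) div 2) = c + a" "2 * ((c + b) div 2) = c + b" "2 * ((b + a) div 2) = b + a"
    using assms by auto
  note nm = name_tangle_of[where out = "((c + a) div 2, s)" and ins = "[((c + b) div 2, s), ((b + a) div 2, s)]" and st = st and rg = rg]
  show ?thesis
    unfolding T
  proof (rule presented_tangle_ofI)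
    show "ins_sys 0 c b a (name ?T)"
    proof (rule ins_sys_splitI)
      show "name ?T (0, 2 * q) = name ?T (2, 2 * q)" if "q \<le> 0" for q
        unfolding nm using that by (auto simp: rg_def rg2_def rg1_def)
      show "name ?T (0, 2 * (0 + q)) = name ?T (1, 2 * q)" if "q \<le> c" for q
        unfolding nm using that by (auto simp: rg_def rg2_def rg1_def)
      show "name ?T (0, 2 * (0 + q) - 1) = name ?T (1, 2 * q - 1)" if "0 < q" "q \<le> c" for q
        using nm(2)[of q 0] nm(2)[of q 1] that by (simp add: st_def)
      show "name ?T (1, 2 * (c + q)) = name ?T (2, 2 * (0 + b - q))" if "q \<le> b" for q
        unfolding nm using that by (auto simp: rg_def rg2_def rg1_def)
      show "name ?T (1, 2 * (c + q) - 1) = name ?T (2, 2 * (0 + b + 1 - q) - 1)" if "0 < q" "q \<le> b" for q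
        using nm(2)[of "c + q" 1] nm(2)[of "0 + b + 1 - q" 2] that by (auto simp: st_def)
      show "name ?T (0, 2 * (0 + c + q)) = name ?T (2, 2 * (0 + b + q))" if "q \<le> a" for q
        unfolding nm using that by (auto simp: rg_def rg2_def rg1_def)
      show "name ?T (0, 2 * (0 + c + q) - 1) = name ?T (2, 2 * (0 + b + q) - 1)" if "0 < q" "q \<le> a" for q
        using nm(2)[of "0 + c + q" 0] nm(2)[of "0 + b + q" 2] that by (auto simp: st_def)
      have "name ?T (2, 2 * 0) = name ?T (2, 2 * (0 + b + a))"
        unfolding nm by (auto simp: rg_def rg2_def rg1_def)
      then show "name ?T (2, 0) = name ?T (2, 2 * (0 + b + a))" by simp
    qed simp_all
    show "ins_sys 0 c b a (h \<circ> \<phi>)" if "ins_sys 0 c b a \<phi>" for h \<phi> using that by (rule ins_sys_comp)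
    fix \<phi> assume \<phi>: "ins_sys 0 c b a \<phi>"
    interpret insertion s 0 c b a using assms by unfold_locales simp_all
    note E = even_D[OF \<phi>] and O = odd_D[OF \<phi>] and wrap = ins_sysD(5)[OF \<phi>]
    define d where "d = case_sum (\<lambda>n. if n \<le> c + b then \<phi> (1, 2 * n - 1) else \<phi> (2, 2 * (n - c) - 1))
      (\<lambda>r. if r \<le> c + b then \<phi> (1, 2 * r) else \<phi> (2, 2 * (r - c)))"
    have x0: "\<phi> (1, 0) = \<phi> (2, 0)" using E(1)[of 0] E(2)[of 0] by simp
    have xend: "\<phi> (1, 2 * (c + b)) = \<phi> (1, 0)" using E(3)[of b] x0 by simp
    have yend: "\<phi> (2, 2 * (b + a)) = \<phi> (1, 0)" using wrap x0 by (simp add: algebra_simps)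
    have xc: "\<phi> (1, 2 * c) = \<phi> (1, 0)" if "a = 0" using E(3)[of 0] yend that by simp
    have r1: "\<phi> (1, 2 * q) = d (Inr (rg1 q))" if "q \<le> c + b" for q
      using that xend xc by (auto simp: d_def rg1_def)
    have r2: "\<phi> (2, 2 * q) = d (Inr (rg2 q))" if "q \<le> b + a" for q
    proof (cases "q \<le> b")
      case True
      then have "\<phi> (2, 2 * q) = \<phi> (1, 2 * (c + b - q))" using E(3)[of "b - q"] by simp
      then show ?thesis using r1[of "c + b - q"] True by (simp add: rg2_def)
    next
      case False
      then show ?thesis using yend by (auto simp: d_def rg2_def)
    qed
    have s1: "\<phi> (1, 2 * q - 1) = d (Inl (st 1 q))" if "q \<le> c + b" for q using that by (simp add: d_def st_def)
    have s2: "\<phi> (2, 2 * q - 1) = d (Inl (st 2 q))" if "0 < q" "q \<le> b + a" for q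
    proof (cases "q \<le> b")
      case True
      then have "c + (b + 1 - q) = c + b + 1 - q" "0 + b + 1 - (b + 1 - q) = q" by auto
      then show ?thesis using O(3)[of "b + 1 - q"] that True by (simp add: d_def st_def)
    next
      case False
      then show ?thesis by (simp add: d_def st_def)
    qed
    have "\<phi> u = d (name ?T u)" if "u \<in> nodes ?T" for u
    proof (rule nodes_012[OF _ that])
      show "inner ?T = [((c + b) div 2, s), ((b + a) div 2, s)]" by simp
      fix q
      show "\<phi> (1, 2 * q) = d (name ?T (1, 2 * q))" if "q \<le> 2 * fst ((c + b) div 2, s)"
        unfolding nm using r1[of q] that sz by (simp add: rg_def)
      show "\<phi> (2, 2 * q) = d (name ?T (2, 2 * q))" if "q \<le> 2 * fst ((b + a) div 2, s)"
        unfolding nm using r2[of q] that sz by (simp add: rg_def)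
      show "\<phi> (1, 2 * q - 1) = d (name ?T (1, 2 * q - 1))" if "0 < q" "q \<le> 2 * fst ((c + b) div 2, s)"
        unfolding nm(2)[OF that(1)] using s1[of q] that sz by simp
      show "\<phi> (2, 2 * q - 1) = d (name ?T (2, 2 * q - 1))" if "0 < q" "q \<le> 2 * fst ((b + a) div 2, s)"
        unfolding nm(2)[OF that(1)] using s2[of q] that sz by simp
      show "\<phi> (0, 2 * q) = d (name ?T (0, 2 * q))" if "q \<le> 2 * fst (outer ?T)"
      proof (cases "q \<le> c")
        case True
        then show ?thesis unfolding nm using E(2)[of q] r1[of q] by (simp add: rg_def)
      next
        case False
        then obtain r where r: "q = c + r" using le_Suc_ex nat_le_linear by blast
        then show ?thesis unfolding nm using E(4)[of r] r2[of "b + r"] False that sz by (simp add: rg_def)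
      qed
      show "\<phi> (0, 2 * q - 1) = d (name ?T (0, 2 * q - 1))" if "0 < q" "q \<le> 2 * fst (outer ?T)"
      proof (cases "q \<le> c")
        case True
        then show ?thesis unfolding nm(2)[OF that(1)] using O(2)[of q] s1[of q] that by (simp add: st_def)
      next
        case False
        then obtain r where r: "q = c + r" using le_Suc_ex nat_le_linear by blast
        then show ?thesis unfolding nm(2)[OF that(1)]
          using O(4)[of r] s2[of "b + r"] False that sz by (simp add: st_def ac_simps)
      qed
    qed
    then show "\<exists>d. \<forall>u\<in>nodes ?T. \<phi> u = d (name ?T u)" by blast
  qed
qed

lemma isotopic_tangle_of_id:
  assumes "planar_tangle T" "presented T Q" "presented (tangle_of out ins st rg) Q'"
    "outer T = out" "inner T = ins" "!!\<psi>. Q' \<psi> \<longleftrightarrow> Q \<psi>"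
  shows "isotopic id T (tangle_of out ins st rg)" "planar_tangle (tangle_of out ins st rg)"
proof -
  have bx: "box (tangle_of out ins st rg) (id b) = box T b" for b using assms(4,5) by (simp add: box_def)
  have bij: "bij_betw id (boxes T) (boxes (tangle_of out ins st rg))"
    using assms(5) by (simp add: boxes_def)
  have to: "Q (\<lambda>(b, p). \<psi> (id b, p))" if "Q' \<psi>" for \<psi> using that assms(6) by simp
  have fro: "\<exists>\<psi>'. Q' \<psi>' \<and> (\<forall>b\<in>boxes T. \<forall>p\<le>4 * fst (box T b). \<psi>' (id b, p) = \<psi> (b, p))" if "Q \<psi>" for \<psi>
    using that assms(6) by auto
  have len: "length (inner (tangle_of out ins st rg)) = length (inner T)" using assms(5) by simp
  show "isotopic id T (tangle_of out ins st rg)" "planar_tangle (tangle_of out ins st rg)"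
    by (rule isotopic_tangle_of[OF assms(1-3) len id_apply bij bx to fro]; assumption)+
qed

lemma stack_isotopic:
  assumes "even (c + b)" "even (b + a)"
  shows "isotopic id (ins_tangle s 0 c b a) (stack_tangle s c b a)" "planar_tangle (stack_tangle s c b a)"
proof -
  interpret insertion s 0 c b a using assms by unfold_locales simp_all
  note * = isotopic_tangle_of_id[OF planar ins_presented stack_presented[OF assms, unfolded stack_tangle_def Let_def]]
  show "isotopic id T (stack_tangle s c b a)" "planar_tangle (stack_tangle s c b a)"
    unfolding stack_tangle_def Let_def by (rule *; simp)+
qed

lemma tensor_presented: "presented (tensor_tangle s k l)
    (\<lambda>\<phi>. ins_sys k (2 * l) 0 k (\<lambda>(e, p). \<phi> (if e = 0 then 0 else 3 - e, p)))"
proof -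
  define rg1 where "rg1 j = (if j = 2 * k then 0 else j)" for j :: nat
  define rg2 where "rg2 j = (if j = 0 \<or> j = 2 * l then rg1 k else 2 * k + j)" for j :: nat
  define st where "st i j = (if i = 0 then (if j \<le> k then j else if j \<le> k + 2 * l then k + j else j - 2 * l)
               else if i = 1 then j else 2 * k + j)" for i j :: nat
  define rg where "rg i j = (if i = 0 then (if j \<le> k then rg1 j else if j < k + 2 * l then rg2 (j - k) else rg1 (j - 2 * l))
               else if i = 1 then rg1 j else rg2 j)" for i j :: nat
  let ?T = "tangle_of (k + l, s) [(k, s), (l, s \<noteq> odd k)] st rg"
  let ?w = "\<lambda>\<phi> :: nat \<times> nat => nat + nat. \<lambda>(e, p). \<phi> (if e = 0 then 0 else 3 - e, p)"
  have T: "tensor_tangle s k l = ?T"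
    unfolding tensor_tangle_def Let_def st_def rg_def rg2_def rg1_def ..
  note nm = name_tangle_of[where out = "(k + l, s)" and ins = "[(k, s), (l, s \<noteq> odd k)]" and st = st and rg = rg]
  show ?thesis
    unfolding T
  proof (rule presented_tangle_ofI)
    show "ins_sys k (2 * l) 0 k (?w (name ?T))"
    proof (rule ins_sys_splitI; unfold prod.case)
      note sw = if_True if_False
      have [simp]: "(if (2::nat) = 0 then 0 else 3 - 2) = (1::nat)" "(if (1::nat) = 0 then 0 else 3 - 1) = (2::nat)"
        by simp_all
      fix q
      show "name ?T (if (0::nat) = 0 then 0 else 3 - 0, 2 * q) = name ?T (if (2::nat) = 0 then 0 else 3 - 2, 2 * q)" if "q \<le> k"
        unfolding nm using that by (auto simp: rg_def rg1_def)
      show "name ?T (if (0::nat) = 0 then 0 else 3 - 0, 2 * q - 1) = name ?T (if (2::nat) = 0 then 0 else 3 - 2, 2 * q - 1)"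
        if "0 < q" "q \<le> k"
        unfolding nm(2)[OF that(1)] using that by (auto simp: st_def)
      show "name ?T (if (0::nat) = 0 then 0 else 3 - 0, 2 * (k + q)) = name ?T (if (1::nat) = 0 then 0 else 3 - 1, 2 * q)"
        if "q \<le> 2 * l"
        unfolding nm using that by (auto simp: rg_def rg1_def rg2_def)
      show "name ?T (if (0::nat) = 0 then 0 else 3 - 0, 2 * (k + q) - 1) = name ?T (if (1::nat) = 0 then 0 else 3 - 1, 2 * q - 1)"
        if "0 < q" "q \<le> 2 * l"
      proof -
        have "0 < k + q" using that by simp
        then show ?thesis unfolding nm(2)[OF that(1)] nm(2)[OF \<open>0 < k + q\<close>] using that by (auto simp: st_def)
      qed
      show "name ?T (if (1::nat) = 0 then 0 else 3 - 1, 2 * (2 * l + q)) =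
          name ?T (if (2::nat) = 0 then 0 else 3 - 2, 2 * (k + 0 - q))" if "q \<le> 0"
        unfolding nm using that by (auto simp: rg_def rg1_def rg2_def)
      show "name ?T (if (0::nat) = 0 then 0 else 3 - 0, 2 * (k + 2 * l + q)) =
          name ?T (if (2::nat) = 0 then 0 else 3 - 2, 2 * (k + 0 + q))" if "q \<le> k"
        unfolding nm using that by (auto simp: rg_def rg1_def rg2_def)
      show "name ?T (if (0::nat) = 0 then 0 else 3 - 0, 2 * (k + 2 * l + q) - 1) =
          name ?T (if (2::nat) = 0 then 0 else 3 - 2, 2 * (k + 0 + q) - 1)" if "0 < q" "q \<le> k"
      proof -
        have *: "0 < k + 2 * l + q" "0 < k + 0 + q" using that by simp_all
        show ?thesis unfolding nm(2)[OF *(1)] nm(2)[OF *(2)] using that by (auto simp: st_def)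
      qed
      have "name ?T (1, 2 * 0) = name ?T (1, 2 * (k + 0 + k))" unfolding nm by (simp add: rg_def rg1_def)
      then show "name ?T (if (2::nat) = 0 then 0 else 3 - 2, 0) = name ?T (if (2::nat) = 0 then 0 else 3 - 2, 2 * (k + 0 + k))"
        by simp
    qed simp_all
    show "ins_sys k (2 * l) 0 k (?w (h \<circ> \<phi>))" if "ins_sys k (2 * l) 0 k (?w \<phi>)" for h \<phi>
    proof -
      have "?w (h \<circ> \<phi>) = h \<circ> ?w \<phi>" by (rule ext) auto
      then show ?thesis using ins_sys_comp[OF that, of h] by (simp only:)
    qed
    fix \<phi> assume \<phi>: "ins_sys k (2 * l) 0 k (?w \<phi>)"
    interpret insertion s k "2 * l" 0 k by unfold_locales simp_all
    have vals: "?w \<phi> (0, p) = \<phi> (0, p)" "?w \<phi> (1, p) = \<phi> (2, p)" "?w \<phi> (2, p) = \<phi> (1, p)" for p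
      by simp_all
    note E = even_D[OF \<phi>, unfolded vals] and O = odd_D[OF \<phi>, unfolded vals] and wrap = ins_sysD(5)[OF \<phi>, unfolded vals]
    define d where "d = case_sum (\<lambda>n. if n \<le> 2 * k then \<phi> (1, 2 * n - 1) else \<phi> (2, 2 * (n - 2 * k) - 1))
      (\<lambda>r. if r \<le> 2 * k then \<phi> (1, 2 * r) else \<phi> (2, 2 * (r - 2 * k)))"
    have yend: "\<phi> (1, 2 * (2 * k)) = \<phi> (1, 0)" using wrap by (simp add: algebra_simps)
    have x0: "\<phi> (2, 0) = \<phi> (1, 2 * k)" using E(1)[of k] E(2)[of 0] by simp
    have xend: "\<phi> (2, 2 * (2 * l)) = \<phi> (1, 2 * k)" using E(3)[of 0] by simp
    have r1: "\<phi> (1, 2 * q) = d (Inr (rg1 q))" if "q \<le> 2 * k" for q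
      using that yend by (auto simp: d_def rg1_def)
    have r2: "\<phi> (2, 2 * q) = d (Inr (rg2 q))" if "q \<le> 2 * l" for q
      using that x0 xend r1[of k] by (auto simp: d_def rg2_def)
    have s1: "\<phi> (1, 2 * q - 1) = d (Inl (st 1 q))" if "q \<le> 2 * k" for q using that by (simp add: d_def st_def)
    have s2: "\<phi> (2, 2 * q - 1) = d (Inl (st 2 q))" if "0 < q" for q using that by (simp add: d_def st_def)
    have "\<phi> u = d (name ?T u)" if "u \<in> nodes ?T" for u
    proof (rule nodes_012[OF _ that])
      show "inner ?T = [(k, s), (l, s \<noteq> odd k)]" by simp
      fix q
      show "\<phi> (1, 2 * q) = d (name ?T (1, 2 * q))" if "q \<le> 2 * fst (k, s)"
        unfolding nm using r1[of q] that by (simp add: rg_def)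
      show "\<phi> (2, 2 * q) = d (name ?T (2, 2 * q))" if "q \<le> 2 * fst (l, s \<noteq> odd k)"
        unfolding nm using r2[of q] that by (simp add: rg_def)
      show "\<phi> (1, 2 * q - 1) = d (name ?T (1, 2 * q - 1))" if "0 < q" "q \<le> 2 * fst (k, s)"
        unfolding nm(2)[OF that(1)] using s1[of q] that by simp
      show "\<phi> (2, 2 * q - 1) = d (name ?T (2, 2 * q - 1))" if "0 < q" "q \<le> 2 * fst (l, s \<noteq> odd k)"
        unfolding nm(2)[OF that(1)] using s2[of q] that by simp
      show "\<phi> (0, 2 * q) = d (name ?T (0, 2 * q))" if "q \<le> 2 * fst (outer ?T)"
      proof -
        have "q \<le> k + 2 * l + k" using that by simp
        then show ?thesis
        proof (cases rule: split3)
          case 1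
          then show ?thesis unfolding nm using E(1)[of q] r1[of q] by (simp add: rg_def)
        next
          case (2 r)
          show ?thesis
          proof (cases "r = 0 \<or> r = 2 * l")
            case False
            then show ?thesis unfolding nm using 2 E(2)[of r] r2[of r] by (simp add: rg_def)
          next
            case True
            then have "\<phi> (2, 2 * r) = d (Inr (rg1 k))" using r2[OF 2(2)] by (auto simp: rg2_def)
            then show ?thesis unfolding nm using 2 True E(2)[of r] by (auto simp: rg_def)
          qed
        next
          case (3 r)
          then have "rg 0 q = rg1 (k + r)" by (auto simp: rg_def)
          then show ?thesis unfolding nm using 3 E(4)[of r] r1[of "k + r"] by simp
        qed
      qed
      show "\<phi> (0, 2 * q - 1) = d (name ?T (0, 2 * q - 1))" if q: "0 < q" "q \<le> 2 * fst (outer ?T)"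
      proof -
        have "q \<le> k + 2 * l + k" using q by simp
        then show ?thesis
        proof (cases rule: split3)
          case 1
          then show ?thesis unfolding nm(2)[OF q(1)] using O(1)[of q] s1[of q] q by (simp add: st_def)
        next
          case (2 r)
          show ?thesis
          proof (cases "r = 0")
            case True
            then show ?thesis unfolding nm(2)[OF q(1)] using 2 O(1)[of q] s1[of q] q by (simp add: st_def)
          next
            case False
            then have "st 0 q = st 2 r" using 2 by (simp add: st_def)
            then show ?thesis unfolding nm(2)[OF q(1)] using 2 O(2)[of r] s2[of r] False by simp
          qed
        next
          case (3 r)
          show ?thesis
          proof (cases "r = 0 \<and> l = 0")
            case True
            then show ?thesis unfolding nm(2)[OF q(1)] using 3 O(1)[of q] s1[of q] q by (simp add: st_def)
          next
            case nz: False
            show ?thesis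
            proof (cases "r = 0")
              case True
              then show ?thesis unfolding nm(2)[OF q(1)] using 3 nz O(2)[of "2 * l"] s2[of "2 * l"]
                by (simp add: st_def ac_simps)
            next
              case False
              then show ?thesis unfolding nm(2)[OF q(1)] using 3 O(4)[of r] s1[of "k + r"] by (simp add: st_def)
            qed
          qed
        qed
      qed
    qed
    then show "\<exists>d. \<forall>u\<in>nodes ?T. \<phi> u = d (name ?T u)" by blast
  qed
qed

definition flip :: "nat => nat" where
  "flip e = (if e = 0 then 0 else 3 - e)"

lemma flip_simps [simp]: "flip 0 = 0" "flip (Suc 0) = 2" "flip 2 = Suc 0"
  by (simp_all add: flip_def)

lemma flip_bij:
  assumes "length (inner T) = 2" "length (inner T') = 2"
  shows "bij_betw flip (boxes T) (boxes T')"
proof -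
  have "boxes T = {0, 1, 2}" "boxes T' = {0, 1, 2}" using assms by (auto simp: boxes_def)
  then show ?thesis by (auto simp: bij_betw_def inj_on_def flip_def)
qed

lemma tensor_isotopic:
  "isotopic flip (ins_tangle s k (2 * l) 0 k) (tensor_tangle s k l)" "planar_tangle (tensor_tangle s k l)"
proof -
  interpret insertion s k "2 * l" 0 k by unfold_locales simp_all
  let ?Q = "\<lambda>\<phi> :: nat \<times> nat => nat + nat. ins_sys k (2 * l) 0 k (\<lambda>(e, p). \<phi> (flip e, p))"
  have pres: "presented (tensor_tangle s k l) ?Q"
    using tensor_presented unfolding flip_def .
  have sel: "outer (tensor_tangle s k l) = (k + l, s)" "inner (tensor_tangle s k l) = [(k, s), (l, s \<noteq> odd k)]"
    by (simp_all add: tensor_tangle_def Let_def)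
  have sz: "(k + 2 * l + k) div 2 = k + l" "(k + 0 + k) div 2 = k" by simp_all
  have bx: "box (tensor_tangle s k l) (flip e) = box T e" if "e \<in> boxes T" for e
    using that sz unfolding boxes_T by (auto simp: box_def sel)
  have fro: "\<exists>\<psi>'. ?Q \<psi>' \<and> (\<forall>e\<in>boxes T. \<forall>p\<le>4 * fst (box T e). \<psi>' (flip e, p) = \<psi> (e, p))"
    if "ins_sys k (2 * l) 0 k \<psi>" for \<psi>
  proof (intro exI[of _ "\<lambda>(e, p). \<psi> (flip e, p)"] conjI)
    have "ins_sys k (2 * l) 0 k (\<lambda>(e, p). case (flip e, p) of (e, p) => \<psi> (flip e, p))"
      using that unfolding ins_sys_eqs by simp
    then show "?Q (\<lambda>(e, p). \<psi> (flip e, p))" .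
    show "\<forall>e\<in>boxes T. \<forall>p\<le>4 * fst (box T e). (case (flip e, p) of (e, p) => \<psi> (flip e, p)) = \<psi> (e, p)"
      unfolding boxes_T by simp
  qed
  note * = isotopic_tangle_of[OF planar ins_presented pres[unfolded tensor_tangle_def Let_def]
      _ _ flip_bij bx[unfolded tensor_tangle_def Let_def] _ fro]
  show "isotopic flip T (tensor_tangle s k l)" "planar_tangle (tensor_tangle s k l)"
    unfolding tensor_tangle_def Let_def by (rule *; simp)+
qed

lemma reflect_isotopic:
  assumes "even (c + b)" "even (b + a)"
  shows "isotopic flip (ins_tangle s 0 a b c) (reflect (ins_tangle s 0 c b a))"
proof -
  interpret insertion s 0 c b a using assms by unfold_locales simp_all
  interpret V: insertion s 0 a b c using assms by unfold_locales (simp_all add: ac_simps)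
  let ?R = "reflect T"
  let ?rev = "\<lambda>\<phi> :: nat \<times> nat => nat + nat. \<lambda>(e, p). \<phi> (e, 4 * fst (box T e) - p)"
  have bx: "box ?R e = box T e" "boxes ?R = boxes T" for e
    by (simp_all add: reflect_def box_def boxes_def)
  have at: "strand_at ?R e j = strand_at T e (2 * fst (box T e) + 1 - j)"
    "region_at ?R e j = region_at T e (2 * fst (box T e) - j)" for e j
    by (simp_all add: reflect_def)
  have sel: "strands ?R = strands T" "regions ?R = regions T" "shaded ?R = shaded T" "uside ?R = uside T" "sside ?R = sside T"
    by (simp_all add: reflect_def)
  have sz: "4 * fst (box T 0) = 2 * (c + a)" "4 * fst (box T (Suc 0)) = 2 * (c + b)" "4 * fst (box T 2) = 2 * (b + a)"
    using size_T by simp_all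
  have nm: "name ?R (e, p) = name T (e, 4 * fst (box T e) - p)" if "p \<le> 4 * fst (box T e)" for e p
  proof (cases p rule: pos_cases)
    case (even j)
    then have "4 * fst (box T e) - p = 2 * (2 * fst (box T e) - j)" by simp
    then show ?thesis using even name_even[of ?R e j] by (simp add: at)
  next
    case (odd j)
    then have "4 * fst (box T e) - p = 2 * (2 * fst (box T e) + 1 - j) - Suc 0"
      "0 < 2 * fst (box T e) + 1 - j" using that by auto
    then show ?thesis using odd name_odd[of j ?R e] name_odd[of "2 * fst (box T e) + 1 - j" T e] by (simp add: at)
  qed
  note D = planar_tangleD[OF planar] and T_pres = presentedD[OF ins_presented]
  have refl_pt: "2 * fst t + 1 - j \<in> points t \<and> 2 * fst t + 1 - (2 * fst t + 1 - j) = j" if "j \<in> points t" for t j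
    using that by (auto simp: points_def)
  have refl_iv: "2 * fst t - j \<in> intervals t \<and> 2 * fst t - (2 * fst t - j) = j" if "j \<in> intervals t" for t j
    using that by (auto simp: intervals_def)
  have ui: "u_interval t (2 * fst t + 1 - j) = 2 * fst t - u_interval t j"
    "s_interval t (2 * fst t + 1 - j) = 2 * fst t - s_interval t j" if "j \<in> points t" for t j
    using that by (auto simp: u_interval_def s_interval_def shaded_interval_def points_def)
  have sh_refl: "shaded_interval t (2 * fst t - j) = shaded_interval t j" if "j \<in> intervals t" for t j
    using that by (auto simp: shaded_interval_def intervals_def)
  have att: "attached ?R"
    unfolding attached_def bx sel
  proof (intro conjI ballI)
    fix x assume "x \<in> strands T"
    then obtain e j where e: "e \<in> boxes T" "j \<in> points (box T e)" "x = strand_at T e j"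
      by (rule attached_strandE[OF T_pres(1)])
    then have "x = strand_at ?R e (2 * fst (box T e) + 1 - j)" unfolding at using refl_pt by simp
    then show "\<exists>e\<in>boxes T. \<exists>j\<in>points (box T e). x = strand_at ?R e j" using e refl_pt by blast
  next
    fix x assume "x \<in> regions T"
    then obtain e j where e: "e \<in> boxes T" "j \<in> intervals (box T e)" "x = region_at T e j"
      by (rule attached_regionE[OF T_pres(1)])
    then have "x = region_at ?R e (2 * fst (box T e) - j)" unfolding at using refl_iv by simp
    then show "\<exists>e\<in>boxes T. \<exists>j\<in>intervals (box T e). x = region_at ?R e j" using e refl_iv by blast
  qed
  have inc: "incident ?R"
    unfolding incident_def bx sel
  proof (intro conjI ballI)
    fix e j assume e: "e \<in> boxes T" "j \<in> points (box T e)"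
    then have e': "2 * fst (box T e) + 1 - j \<in> points (box T e)" using refl_pt by blast
    show "strand_at ?R e j \<in> strands T"
      "uside T (strand_at ?R e j) = region_at ?R e (u_interval (box T e) j)"
      "sside T (strand_at ?R e j) = region_at ?R e (s_interval (box T e) j)"
      unfolding at using D(11-13)[OF e(1) e'] ui[OF e(2)] by simp_all
  next
    fix e j assume e: "e \<in> boxes T" "j \<in> intervals (box T e)"
    then show "region_at ?R e j \<in> regions T" unfolding at using refl_iv D(8) by blast
  next
    have "{region_at ?R e j | e j. e \<in> boxes T \<and> j \<in> intervals (box T e) \<and> shaded_interval (box T e) j} =
      {region_at T e j | e j. e \<in> boxes T \<and> j \<in> intervals (box T e) \<and> shaded_interval (box T e) j}" (is "?A = ?B")
    proof (intro equalityI subsetI)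
      fix x assume "x \<in> ?A"
      then obtain e j where "x = region_at T e (2 * fst (box T e) - j)" "e \<in> boxes T" "j \<in> intervals (box T e)"
        "shaded_interval (box T e) j" unfolding at by blast
      then show "x \<in> ?B" using refl_iv[of j "box T e"] sh_refl[of j "box T e"] by blast
    next
      fix x assume "x \<in> ?B"
      then obtain e j where *: "x = region_at T e j" "e \<in> boxes T" "j \<in> intervals (box T e)"
        "shaded_interval (box T e) j" by blast
      then have "x = region_at ?R e (2 * fst (box T e) - j)" unfolding at using refl_iv by simp
      then show "x \<in> ?A" using * refl_iv[of j "box T e"] sh_refl[of j "box T e"] by blast
    qed
    then show "shaded T = {region_at ?R e j | e j. e \<in> boxes T \<and> j \<in> intervals (box T e) \<and> shaded_interval (box T e) j}"
      using incidentD(5)[OF planar_incident[OF planar T_pres(1)]] by simp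
  qed
  let ?Q = "\<lambda>\<phi>. ins_sys 0 c b a (?rev \<phi>)"
  have pres: "presented ?R ?Q"
    unfolding presented_def
  proof (intro conjI allI impI ballI)
    show "attached ?R" by (rule att)
    have "ins_eqs 0 c b a (\<lambda>p. ?rev (name ?R) (0, p)) (\<lambda>p. ?rev (name ?R) (1, p)) (\<lambda>p. ?rev (name ?R) (2, p))"
      by (rule ins_eqs_cong[OF T_pres(2)[unfolded ins_sys_eqs]]) (use sz in \<open>simp_all add: nm\<close>)
    then show "?Q (name ?R)" unfolding ins_sys_eqs .
    show "?Q (h \<circ> \<phi>)" if "?Q \<phi>" for \<phi> h
    proof -
      have "?rev (h \<circ> \<phi>) = h \<circ> ?rev \<phi>" by (rule ext) auto
      then show ?thesis using ins_sys_comp[OF that, of h] by (simp only:)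
    qed
    fix \<phi> u v assume \<phi>: "?Q \<phi>" and uv: "u \<in> nodes ?R" "v \<in> nodes ?R" "name ?R u = name ?R v"
    obtain e p e' p' where u: "u = (e, p)" and v: "v = (e', p')" by (cases u, cases v) blast
    have p: "e \<in> boxes T" "p \<le> 4 * fst (box T e)" "e' \<in> boxes T" "p' \<le> 4 * fst (box T e')"
      using uv(1,2) u v unfolding nodes_def bx by auto
    have "?rev \<phi> (e, 4 * fst (box T e) - p) = ?rev \<phi> (e', 4 * fst (box T e') - p')"
      by (rule T_pres(4)[OF \<phi>]) (use uv(3) u v p nm in \<open>auto simp: nodes_def\<close>)
    then show "\<phi> u = \<phi> v" using p u v by simp
  qed
  have flip_flip: "flip (flip e) = e" if "e \<in> boxes V.T" for e using that unfolding V.boxes_T by auto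
  have bxV: "box ?R (flip e) = box V.T e" if "e \<in> boxes V.T" for e
    using that unfolding V.boxes_T bx by (auto simp: box_def ac_simps)
  have eqs: "?Q \<psi> \<longleftrightarrow> ins_eqs 0 a b c (\<lambda>p. \<psi> (0, p)) (\<lambda>p. \<psi> (2, p)) (\<lambda>p. \<psi> (1, p))" for \<psi> :: "nat \<times> nat => nat + nat"
  proof -
    have "?Q \<psi> \<longleftrightarrow> ins_eqs 0 c b a (\<lambda>p. \<psi> (0, 2 * (c + a) - p)) (\<lambda>p. \<psi> (1, 2 * (c + b) - p))
        (\<lambda>p. \<psi> (2, 2 * (b + a) - p))"
      unfolding ins_sys_eqs prod.case One_nat_def sz ..
    also have "\<dots> \<longleftrightarrow> ins_eqs 0 a b c (\<lambda>p. \<psi> (0, p)) (\<lambda>p. \<psi> (2, p)) (\<lambda>p. \<psi> (1, p))"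
      by (rule reflect_eqs)
    finally show ?thesis .
  qed
  show ?thesis
  proof (rule isotopic_presented[OF ins_presented planar_incident[OF V.planar presentedD(1)[OF ins_presented]] pres inc])
    show "length (inner ?R) = length (inner V.T)" by (simp add: reflect_def)
    show "bij_betw flip (boxes V.T) (boxes ?R)" by (rule flip_bij) (simp_all add: reflect_def)
    show "ins_sys 0 a b c (\<lambda>(e, p). \<psi> (flip e, p))" if "?Q \<psi>" for \<psi>
      using that unfolding eqs unfolding ins_sys_eqs by simp
    show "\<exists>\<psi>'. ?Q \<psi>' \<and> (\<forall>e\<in>boxes V.T. \<forall>p\<le>4 * fst (box V.T e). \<psi>' (flip e, p) = \<psi> (e, p))"
      if "ins_sys 0 a b c \<psi>" for \<psi>
    proof (intro exI[of _ "\<lambda>(e, p). \<psi> (flip e, p)"] conjI)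
      show "?Q (\<lambda>(e, p). \<psi> (flip e, p))" using that unfolding eqs unfolding ins_sys_eqs by simp
    qed (use flip_flip in simp)
  qed (use bxV in auto)
qed

lemma unit_second_sys:
  "(\<exists>I. Pr I \<and> (\<exists>\<chi>. unit_sys k \<chi> \<and> (\<forall>p\<le>4 * k. I p = \<chi> (0, p)) \<and>
      (\<forall>e\<in>boxes (unit_tangle k s) - {0}. X e \<chi>))) \<longleftrightarrow> (\<exists>I. Pr I \<and> (\<forall>p\<le>4 * k. I p = I (4 * k - p)))"
proof -
  have "boxes (unit_tangle k s) - {0} = {}" by (auto simp: boxes_def unit_tangle_def)
  moreover have "(\<exists>\<chi>. unit_sys k \<chi> \<and> (\<forall>p\<le>4 * k. I p = \<chi> (0, p))) \<longleftrightarrow> (\<forall>p\<le>4 * k. I p = I (4 * k - p))" for I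
  proof
    assume "\<exists>\<chi>. unit_sys k \<chi> \<and> (\<forall>p\<le>4 * k. I p = \<chi> (0, p))"
    then obtain \<chi> where u: "unit_sys k \<chi>" and I: "\<forall>p\<le>4 * k. I p = \<chi> (0, p)" by (elim exE conjE)
    have \<chi>1: "\<chi> (0, p) = \<chi> (0, 4 * k - p)" if "p \<le> 4 * k" for p
      by (rule u[unfolded unit_sys_def, rule_format, OF that])
    have \<chi>2: "I p = \<chi> (0, p)" if "p \<le> 4 * k" for p by (rule I[rule_format, OF that])
    note \<chi> = \<chi>1 \<chi>2
    show "\<forall>p\<le>4 * k. I p = I (4 * k - p)"
    proof (intro allI impI)
      fix p assume "p \<le> 4 * k"
      show "I p = I (4 * k - p)"
        unfolding \<chi>(2)[OF \<open>p \<le> 4 * k\<close>] \<chi>(2)[OF diff_le_self] by (rule \<chi>(1)[OF \<open>p \<le> 4 * k\<close>])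
    qed
  next
    assume I: "\<forall>p\<le>4 * k. I p = I (4 * k - p)"
    have "unit_sys k (\<lambda>(e, p). I p)" unfolding unit_sys_def prod.case by (rule I)
    moreover have "\<forall>p\<le>4 * k. I p = (\<lambda>(e :: nat, p). I p) (0, p)"
      unfolding prod.case by (intro allI impI refl)
    ultimately show "\<exists>\<chi>. unit_sys k \<chi> \<and> (\<forall>p\<le>4 * k. I p = \<chi> (0, p))"
      by (intro exI[of _ "\<lambda>(e :: nat, p). I p"] conjI)
  qed
  ultimately show ?thesis by (simp only: ball_simps simp_thms)
qed

lemma unit_sel [simp]: "outer (unit_tangle k s) = (k, s)" "inner (unit_tangle k s) = []"
  by (simp_all add: unit_tangle_def)

lemma click_presented: "presented (click_tangle 1 s) (\<lambda>\<phi>. click_eqs (\<lambda>p. \<phi> (0, p)) (\<lambda>p. \<phi> (1, p)))"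
proof -
  have T: "click_tangle 1 s = tangle_of (1, \<not> s) [(1, s)]
     (\<lambda>i j. if i = 0 then (if j = 1 then 2 * 1 else j - 1) else j)
     (\<lambda>i j. if i = 0 then (if j = 0 then 2 * 1 - 1 else j - 1) else if j = 2 * 1 then 0 else j)" (is "_ = ?T")
    unfolding click_tangle_def ..
  have le2: "(\<forall>p\<le>2::nat. X p) \<longleftrightarrow> X 0 \<and> X 1 \<and> X 2" for X by (auto simp: le_Suc_eq numeral_2_eq_2)
  have nm: "name ?T (e, p) = (if even p then Inr (if e = 0 then (if p div 2 = 0 then 1 else p div 2 - 1) else if p div 2 = 2 then 0 else p div 2)
      else Inl (if e = 0 then (if Suc p div 2 = 1 then 2 else Suc p div 2 - 1) else Suc p div 2))" for e p
    by (simp add: name_def)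
  show ?thesis
    unfolding T
  proof (rule presented_tangle_ofI)
    show "click_eqs (\<lambda>p. name ?T (0, p)) (\<lambda>p. name ?T (1, p))"
      unfolding click_eqs_def le2 nm by simp
    show "click_eqs (\<lambda>p. (h \<circ> \<phi>) (0, p)) (\<lambda>p. (h \<circ> \<phi>) (1, p))"
      if "click_eqs (\<lambda>p. \<phi> (0, p)) (\<lambda>p. \<phi> (1, p))" for h and \<phi> :: "nat \<times> nat => nat + nat"
      using that unfolding click_eqs_def by simp
    fix \<phi> :: "nat \<times> nat => nat + nat" assume \<phi>: "click_eqs (\<lambda>p. \<phi> (0, p)) (\<lambda>p. \<phi> (1, p))"
    have c1: "\<phi> (0, p) = \<phi> (1, 2 + p)" and c2: "\<phi> (0, 2 + p) = \<phi> (1, p)" if "p \<le> 2" for p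
      using \<phi> that unfolding click_eqs_def by blast+
    have v: "\<phi> (0, 0) = \<phi> (1, 2)" "\<phi> (0, 1) = \<phi> (1, 3)" "\<phi> (0, 2) = \<phi> (1, 4)" "\<phi> (1, 4) = \<phi> (1, 0)"
      "\<phi> (0, 3) = \<phi> (1, 1)" "\<phi> (0, 4) = \<phi> (1, 2)"
      using c1[of 0] apply simp
      using c1[of 1] apply (simp add: numeral_3_eq_3)
      using c1[of 2] apply simp
      using c1[of 2] c2[of 0] apply simp
      using c2[of 1] apply (simp add: numeral_3_eq_3)
      using c2[of 2] apply simp
      done
    define d where "d = case_sum (\<lambda>n. \<phi> (1, 2 * n - 1)) (\<lambda>r. \<phi> (1, 2 * r))"
    have "\<phi> u = d (name ?T u)" if "u \<in> nodes ?T" for u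
    proof -
      obtain e p where u: "u = (e, p)" by (cases u)
      have "e \<le> 1" "p \<le> 4 * fst (box ?T e)" using that u by (auto simp: nodes_def)
      then have "(e = 0 \<or> e = 1) \<and> p \<le> 4" by (auto simp: box_def le_Suc_eq)
      then have "(e = 0 \<or> e = 1) \<and> (p = 0 \<or> p = 1 \<or> p = 2 \<or> p = 3 \<or> p = 4)" by auto
      then show ?thesis unfolding u nm d_def using v by (elim conjE disjE) simp_all
    qed
    then show "\<exists>d. \<forall>u\<in>nodes ?T. \<phi> u = d (name ?T u)" by blast
  qed
qed

lemma click_planar: "planar_tangle (click_tangle 1 s)"
proof -
  obtain R where R: "planar_tangle R" "outer R = ((1 + 1 + 0) div 2, \<not> s)"
    "inner R = ((1 + 1) div 2, (\<not> s) \<noteq> odd 1) # inner (unit_tangle 1 (\<not> s))"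
    "presented R (\<lambda>\<psi>. \<exists>I. ins_eqs 1 1 1 0 (\<lambda>p. \<psi> (0, p)) (\<lambda>p. \<psi> (1, p)) I \<and>
       (\<exists>\<chi>. unit_sys 1 \<chi> \<and> (\<forall>p\<le>2 * (1 + 1 + 0). I p = \<chi> (0, p)) \<and>
          (\<forall>e\<in>boxes (unit_tangle 1 (\<not> s)) - {0}. \<forall>p\<le>4 * fst (box (unit_tangle 1 (\<not> s)) e). \<psi> (e + 1, p) = \<chi> (e, p))))"
    by (rule ins_second[OF _ _ unit_planar unit_presented, of 1 1 1 0 1 "\<not> s" "\<not> s"]) simp_all
  have two: "2 * (1 + 1 + 0) = (4 * 1 :: nat)" by simp
  have sys: "(\<exists>I. ins_eqs 1 1 1 0 w x I \<and> (\<forall>p\<le>4 * 1. I p = I (4 * 1 - p))) \<longleftrightarrow> click_eqs w x"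
    for w x :: "nat => nat + nat"
  proof
    assume "\<exists>I. ins_eqs 1 1 1 0 w x I \<and> (\<forall>p\<le>4 * 1. I p = I (4 * 1 - p))"
    then obtain I where E: "ins_eqs 1 1 1 0 w x I" and I': "\<forall>p\<le>4 * 1. I p = I (4 * 1 - p)" by (elim exE conjE)
    have I: "I p = I (4 - p)" if "p \<le> 4" for p using I'[rule_format, of p] that by (simp only: mult_1_right)
    note E = ins_eqsD[OF E]
    show "click_eqs w x"
      unfolding click_eqs_def
    proof (intro conjI allI impI)
      fix p :: nat assume p: "p \<le> 2"
      have "w p = I (4 - p)" using E(1)[of p] I[of p] p by simp
      also have "4 - p = 2 * 1 + (2 - p)" using p by simp
      also have "I \<dots> = x (2 + p)" using E(3)[of p "2 - p"] p by simp
      finally show "w p = x (2 + p)" .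
      show "w (2 + p) = x p" using E(2)[of p] p by simp
    qed
  next
    assume "click_eqs w x"
    then have c: "w p = x (2 + p)" "w (2 + p) = x p" if "p \<le> 2" for p using that unfolding click_eqs_def by blast+
    define I where "I p = (if p \<le> 2 then w p else w (4 - p))" for p
    have "ins_eqs 1 1 1 0 w x I"
    proof (rule ins_eqsI)
      show "x (2 * 1 + u) = I (2 * 1 + v)" if "u + v = 2 * 1" for u v
      proof -
        have "x (2 * 1 + u) = w u" using c(1)[of u] that by simp
        moreover have "2 - v = u" using that by simp
        then have "I (2 * 1 + v) = w u" using that by (cases "v = 0") (auto simp: I_def)
        ultimately show ?thesis by simp
      qed
      show "w (2 * 1 + 2 * 1 + p) = I (2 * 1 + 2 * 1 + p)" if "p \<le> 2 * 0" for p
        using that c(2)[of 2] c(1)[of 0] by (simp add: I_def)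
    qed (use c in \<open>auto simp: I_def\<close>)
    moreover have "I p = I (4 * 1 - p)" if "p \<le> 4 * 1" for p
      using that by (cases "p = 2") (auto simp: I_def)
    then have "\<forall>p\<le>4 * 1. I p = I (4 * 1 - p)" by (intro allI impI)
    ultimately show "\<exists>I. ins_eqs 1 1 1 0 w x I \<and> (\<forall>p\<le>4 * 1. I p = I (4 * 1 - p))" by (intro exI[of _ I] conjI)
  qed
  show ?thesis
    unfolding click_tangle_def
  proof (rule isotopic_tangle_of_id(2)[OF R(1) R(4) click_presented[unfolded click_tangle_def]])
  qed (use R(2,3) in \<open>simp_all only: two unit_second_sys sys, simp_all\<close>)
qed

lemma closure_presented: "presented (closure_tangle False k s)
    (\<lambda>\<phi>. \<phi> (0, 0) = \<phi> (1, 0) \<and> (\<forall>p\<le>4 * k. \<phi> (1, p) = \<phi> (1, 4 * k - p)))" (is "presented _ ?Q")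
proof -
  let ?st = "\<lambda>i j. min j (2 * k + 1 - j) :: nat"
  let ?rg = "\<lambda>i j. if i = (0::nat) then 0 else min j (2 * k - j) :: nat"
  have T: "closure_tangle False k s = tangle_of (0, s) [(k, s)] ?st ?rg" (is "_ = ?T")
    unfolding closure_tangle_def by simp
  \<comment> \<open>The inner box carries the incidences of \<open>k\<close> parallel strands.\<close>
  let ?U = "unit_tangle k s"
  have nm1: "name ?T (1, p) = name ?U (0, p)" for p
    by (simp add: name_def unit_tangle_def)
  have nm0: "name ?T (0, 0) = name ?U (0, 0)" by (simp add: name_def unit_tangle_def)
  note U = presentedD[OF unit_presented[of k s]]
  show ?thesis
    unfolding T presented_def
  proof (intro conjI[OF tangle_of_attached] conjI allI impI ballI)
    show "name ?T (0, 0) = name ?T (1, 0)" unfolding nm0 nm1 ..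
    show "name ?T (1, p) = name ?T (1, 4 * k - p)" if "p \<le> 4 * k" for p
      unfolding nm1 by (rule U(2)[unfolded unit_sys_def, rule_format, OF that])
    show "(h \<circ> \<phi>) (0, 0) = (h \<circ> \<phi>) (1, 0)" if "?Q \<phi>" for \<phi> h
      using conjunct1[OF that] by (simp only: comp_def)
    show "(h \<circ> \<phi>) (1, p) = (h \<circ> \<phi>) (1, 4 * k - p)" if "?Q \<phi>" "p \<le> 4 * k" for \<phi> h p
    proof -
      have "\<phi> (1, p) = \<phi> (1, 4 * k - p)" by (rule conjunct2[OF that(1), rule_format, OF that(2)])
      then show ?thesis by (simp only: comp_def)
    qed
    fix \<phi> u v assume \<phi>: "?Q \<phi>" and uv: "u \<in> nodes ?T" "v \<in> nodes ?T" "name ?T u = name ?T v"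
    have Q: "unit_sys k (\<lambda>(e, p). \<phi> (1, p))" unfolding unit_sys_def prod.case by (rule conjunct2[OF \<phi>])
    have nd: "\<exists>p\<le>4 * k. name ?T u = name ?U (0, p) \<and> \<phi> u = \<phi> (1, p)" if "u \<in> nodes ?T" for u
    proof -
      obtain e p where u: "u = (e, p)" by (cases u)
      have "e \<le> 1" "p \<le> 4 * fst (box ?T e)" using that u by (auto simp: nodes_def)
      then consider "e = 0" "p = 0" | "e = 1" "p \<le> 4 * k" by (auto simp: box_def le_Suc_eq)
      then show ?thesis
      proof cases
        case 1 then show ?thesis using u conjunct1[OF \<phi>] nm0 by (intro exI[of _ 0]) simp
      next
        case 2 then show ?thesis using u nm1 by blast
      qed
    qed
    obtain p q where "p \<le> 4 * k" "name ?T u = name ?U (0, p)" "\<phi> u = \<phi> (1, p)"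
      "q \<le> 4 * k" "name ?T v = name ?U (0, q)" "\<phi> v = \<phi> (1, q)" using nd uv(1,2) by meson
    then show "\<phi> u = \<phi> v" using U(4)[OF Q, of "(0, p)" "(0, q)"] uv(3) by (simp add: nodes_def box_def)
  qed
qed

lemma closure_planar: "planar_tangle (closure_tangle False k s)"
proof -
  obtain R where R: "planar_tangle R" "outer R = ((0 + 0 + 0) div 2, s)"
    "inner R = inner (unit_tangle k s) @ [((0 + 2 * k + 0) div 2, s)]"
    "presented R (\<lambda>\<psi>. \<exists>I. ins_eqs 0 0 (2 * k) 0 (\<lambda>p. \<psi> (0, p)) I (\<lambda>p. \<psi> (length (inner (unit_tangle k s)) + 1, p)) \<and>
       (\<exists>\<chi>. unit_sys k \<chi> \<and> (\<forall>p\<le>2 * (0 + 2 * k). I p = \<chi> (0, p)) \<and>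
          (\<forall>e\<in>boxes (unit_tangle k s) - {0}. \<forall>p\<le>4 * fst (box (unit_tangle k s) e). \<psi> (e, p) = \<chi> (e, p))))"
    by (rule ins_first[OF _ _ unit_planar unit_presented, of 0 "2 * k" 0 0 k s s]) simp_all
  have two: "2 * (0 + 2 * k) = 4 * k" by simp
  have sys: "(\<exists>I. ins_eqs 0 0 (2 * k) 0 w I y \<and> (\<forall>p\<le>4 * k. I p = I (4 * k - p))) \<longleftrightarrow>
      w 0 = y 0 \<and> (\<forall>p\<le>4 * k. y p = y (4 * k - p))" for w y :: "nat => nat + nat"
  proof
    assume "\<exists>I. ins_eqs 0 0 (2 * k) 0 w I y \<and> (\<forall>p\<le>4 * k. I p = I (4 * k - p))"
    then obtain I where E: "ins_eqs 0 0 (2 * k) 0 w I y" and I': "\<forall>p\<le>4 * k. I p = I (4 * k - p)" by (elim exE conjE)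
    have I: "I p = I (4 * k - p)" if "p \<le> 4 * k" for p by (rule I'[rule_format, OF that])
    note E = ins_eqsD[OF E]
    have "y p = y (4 * k - p)" if "p \<le> 4 * k" for p
    proof -
      have "y p = I (4 * k - p)" "y (4 * k - p) = I p"
        using E(3)[of "4 * k - p" p] E(3)[of p "4 * k - p"] that by simp_all
      then show ?thesis using I[OF that] by simp
    qed
    moreover have "w 0 = y 0" using E(1)[of 0] by simp
    ultimately show "w 0 = y 0 \<and> (\<forall>p\<le>4 * k. y p = y (4 * k - p))" by (intro conjI allI impI)
  next
    assume *: "w 0 = y 0 \<and> (\<forall>p\<le>4 * k. y p = y (4 * k - p))"
    have y: "y u = y v" if "u + v = 4 * k" for u v
    proof -
      have "u \<le> 4 * k" and v: "4 * k - u = v" using that by auto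
      then have "y u = y (4 * k - u)" by (intro conjunct2[OF *, rule_format])
      then show ?thesis unfolding v .
    qed
    note w0 = conjunct1[OF *] and y0 = y[of 0 "4 * k"]
    have "ins_eqs 0 0 (2 * k) 0 w y y"
    proof (rule ins_eqsI)
      show "y (2 * 0 + u) = y (2 * 0 + v)" if "u + v = 2 * (2 * k)" for u v using y[of u v] that by simp
    qed (use w0 y0 in simp_all)
    from exI[of "\<lambda>I. ins_eqs 0 0 (2 * k) 0 w I y \<and> (\<forall>p\<le>4 * k. I p = I (4 * k - p))", OF conjI[OF this conjunct2[OF *]]]
    show "\<exists>I. ins_eqs 0 0 (2 * k) 0 w I y \<and> (\<forall>p\<le>4 * k. I p = I (4 * k - p))" .
  qed
  have sys': "(\<exists>I. ins_eqs 0 0 (2 * k) 0 (\<lambda>p. \<psi> (0, p)) I (\<lambda>p. \<psi> (length (inner (unit_tangle k s)) + 1, p)) \<and>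
       (\<exists>\<chi>. unit_sys k \<chi> \<and> (\<forall>p\<le>2 * (0 + 2 * k). I p = \<chi> (0, p)) \<and>
          (\<forall>e\<in>boxes (unit_tangle k s) - {0}. \<forall>p\<le>4 * fst (box (unit_tangle k s) e). \<psi> (e, p) = \<chi> (e, p)))) \<longleftrightarrow>
    \<psi> (0, 0) = \<psi> (1, 0) \<and> (\<forall>p\<le>4 * k. \<psi> (1, p) = \<psi> (1, 4 * k - p))" for \<psi> :: "nat \<times> nat => nat + nat"
  proof -
    have one: "length (inner (unit_tangle k s)) + 1 = 1" by simp
    show ?thesis unfolding two unit_second_sys sys one ..
  qed
  have T: "closure_tangle False k s = tangle_of (0, s) [(k, s)] (\<lambda>i j. min j (2 * k + 1 - j))
     (\<lambda>i j. if i = 0 then 0 else min j (2 * k - j))" by (simp add: closure_tangle_def)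
  show ?thesis
    unfolding T
  proof (rule isotopic_tangle_of_id(2)[OF R(1) R(4) closure_presented[of k s, unfolded T]])
  qed (use R(2,3) in \<open>simp_all only: sys', simp_all only: unit_sel, simp_all\<close>)
qed

definition swap12 :: "nat => nat" where
  "swap12 e = (if e = 1 then 2 else if e = 2 then 1 else e)"

lemma swap12_simps [simp]: "swap12 0 = 0" "swap12 (Suc 0) = 2" "swap12 2 = Suc 0" "swap12 3 = 3"
  "swap12 (swap12 e) = e"
  by (simp_all add: swap12_def)

lemma isotopic_swap12:
  assumes "planar_tangle T" "presented T Q" "planar_tangle T'" "presented T' Q'"
    "outer T' = outer T" "inner T = [t1, t2, t3]" "inner T' = [t2, t1, t3]"
    "!!\<psi>. Q' \<psi> \<longleftrightarrow> Q (\<lambda>(e, p). \<psi> (swap12 e, p))"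
  shows "isotopic swap12 T T'"
proof (rule isotopic_presented[OF assms(2) planar_incident[OF assms(1) presentedD(1)[OF assms(2)]]
      assms(4) planar_incident[OF assms(3) presentedD(1)[OF assms(4)]]])
  have b: "boxes T = {0, 1, 2, 3}" "boxes T' = {0, 1, 2, 3}" using assms(6,7) by (auto simp: boxes_def)
  show "bij_betw swap12 (boxes T) (boxes T')"
    unfolding b bij_betw_def inj_on_def by (auto simp: swap12_def)
  show "box T' (swap12 e) = box T e" if "e \<in> boxes T" for e
    using that assms(5-7) unfolding b by (auto simp: box_def)
  show "\<exists>\<psi>'. Q' \<psi>' \<and> (\<forall>e\<in>boxes T. \<forall>p\<le>4 * fst (box T e). \<psi>' (swap12 e, p) = \<psi> (e, p))" if "Q \<psi>" for \<psi>
    by (rule exI[of _ "\<lambda>(e, p). \<psi> (swap12 e, p)"]) (use that assms(8) in simp)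
qed (use assms(6-8) in simp_all)

lemma identity_tangleI:
  assumes "planar_tangle R" "presented R Q" "inner R = [outer R]"
    "!!\<psi> p. Q \<psi> ==> p \<le> 4 * fst (outer R) ==> \<psi> (0, p) = \<psi> (1, p)"
  shows "identity_tangle R"
proof -
  have nm: "name R (0, p) = name R (1, p)" if "p \<le> 4 * fst (outer R)" for p
    using assms(4)[OF presentedD(2)[OF assms(2)] that] .
  have st: "strand_at R 1 j = strand_at R 0 j" if "j \<in> points (outer R)" for j
  proof -
    have "2 * j - Suc 0 \<le> 4 * fst (outer R)" "0 < j" using that by (auto simp: points_def)
    then show ?thesis using nm[of "2 * j - Suc 0"] name_odd[of j R 0] name_odd[of j R 1] by simp
  qed
  have rg: "region_at R 1 j = region_at R 0 j" if "j \<in> intervals (outer R)" for j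
    using nm[of "2 * j"] that name_even[of R 0 j] name_even[of R 1 j] by (simp add: intervals_def)
  have bx: "box R 0 = outer R" "box R 1 = outer R" using assms(3) by (simp_all add: box_def)
  have b: "boxes R = {0, 1}" using assms(3) by (auto simp: boxes_def)
  have "strands R = strand_at R 0 ` points (outer R)"
  proof (intro equalityI subsetI)
    fix s assume "s \<in> strands R"
    then obtain e j where "e \<in> boxes R" "j \<in> points (box R e)" "s = strand_at R e j"
      by (rule attached_strandE[OF presentedD(1)[OF assms(2)]])
    then have "j \<in> points (outer R)" "s = strand_at R 0 j" unfolding b using bx st by auto
    then show "s \<in> strand_at R 0 ` points (outer R)" by blast
  next
    fix s assume "s \<in> strand_at R 0 ` points (outer R)"
    then show "s \<in> strands R" using planar_tangleD(11)[OF assms(1), of 0] bx by auto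
  qed
  then show ?thesis unfolding identity_tangle_def using assms(1,3) st rg by blast
qed

lemma trace_sys:
  "(\<exists>v :: nat => 'a. w 0 = v 0 \<and> (\<forall>p\<le>4 * k. v p = v (4 * k - p)) \<and> ins_eqs 0 k l k v x y) \<longleftrightarrow>
   ins_eqs 0 0 (k + l) 0 w x y"
proof
  assume "\<exists>v. w 0 = v 0 \<and> (\<forall>p\<le>4 * k. v p = v (4 * k - p)) \<and> ins_eqs 0 k l k v x y"
  then obtain v where w: "w 0 = v 0" and v': "\<forall>p\<le>4 * k. v p = v (4 * k - p)" and E: "ins_eqs 0 k l k v x y"
    by (elim exE conjE)
  have v: "v p = v (4 * k - p)" if "p \<le> 4 * k" for p by (rule v'[rule_format, OF that])
  note E = ins_eqsD[OF E]
  show "ins_eqs 0 0 (k + l) 0 w x y"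
  proof (rule ins_eqsI)
    show "x (2 * 0 + u) = y (2 * 0 + t)" if ut: "u + t = 2 * (k + l)" for u t
    proof -
      have "u \<le> 2 * k + 2 * l" using ut by simp
      then show ?thesis
      proof (cases rule: split2)
        case 1
        then obtain r where r: "u + r = 2 * k" using le_Suc_ex by metis
        have "x u = v u" using E(2)[of u] 1 by simp
        also have "\<dots> = v (4 * k - u)" using v[of u] 1 by simp
        also have "4 * k - u = 2 * 0 + 2 * k + r" using r by simp
        also have "v \<dots> = y (2 * 0 + 2 * l + r)" using E(4)[of r] r by simp
        also have "2 * 0 + 2 * l + r = 2 * 0 + t" using r ut by simp
        finally show ?thesis by simp
      next
        case (2 r)
        then show ?thesis using E(3)[of r t] ut by simp
      qed
    qed
  qed (use w E(1)[of 0] E(2)[of 0] E(5) in \<open>simp_all add: add.commute[of "2 * l"]\<close>)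
next
  assume "ins_eqs 0 0 (k + l) 0 w x y"
  note E = ins_eqsD[OF this]
  define v where "v = ins_fun 0 k l x y"
  have F: "ins_eqs 0 k l k v x y"
    unfolding v_def
  proof (rule ins_fun_eqs)
    show "x (2 * k + u) = y (2 * 0 + t)" if "u + t = 2 * l" for u t using E(3)[of "2 * k + u" t] that by simp
  qed (use E(1)[of 0] E(2)[of 0] E(5) in \<open>simp_all add: add.commute[of "2 * l"]\<close>)
  note F' = ins_eqsD[OF F]
  have half: "v p = v (4 * k - p)" if le: "p \<le> 2 * k" for p
  proof -
    obtain r where r: "p + r = 2 * k" using le_add_diff_inverse[OF le] by blast
    then have "4 * k - p = 2 * 0 + 2 * k + r" by simp
    then show ?thesis using F'(2)[of p] F'(4)[of r] E(3)[of p "2 * l + r"] r by simp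
  qed
  have "v p = v (4 * k - p)" if "p \<le> 4 * k" for p
  proof (cases "p \<le> 2 * k")
    case False
    then have "4 * k - p \<le> 2 * k" "4 * k - (4 * k - p) = p" using that by auto
    then show ?thesis using half[of "4 * k - p"] by simp
  qed (rule half)
  then have "\<forall>p\<le>4 * k. v p = v (4 * k - p)" by (intro allI impI)
  moreover have "w 0 = v 0" using E(1)[of 0] F'(1)[of 0] by simp
  ultimately show "\<exists>v. w 0 = v 0 \<and> (\<forall>p\<le>4 * k. v p = v (4 * k - p)) \<and> ins_eqs 0 k l k v x y"
    using F by (intro exI[of _ v] conjI)
qed

text \<open>
Closing the product of two elements joins them along all their points.
\<close>

lemma trace_composite:
  assumes "even (k + l)"
  obtains R where "composite (closure_tangle False k s) 1 (ins_tangle s 0 k l k) R" "planar_tangle R"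
    "inner R = inner (ins_tangle s 0 k l k)" "isotopic id (ins_tangle s 0 0 (k + l) 0) R"
proof -
  interpret insertion s 0 k l k using assms by unfold_locales simp_all
  interpret V: insertion s 0 0 "k + l" 0 using assms by unfold_locales simp_all
  let ?C = "closure_tangle False k s"
  let ?QC = "\<lambda>\<phi> :: nat \<times> nat => nat + nat. \<phi> (0, 0) = \<phi> (1, 0) \<and> (\<forall>p\<le>4 * k. \<phi> (1, p) = \<phi> (1, 4 * k - p))"
  have C: "outer ?C = (0, s)" "inner ?C = [(k, s)]" by (simp_all add: closure_tangle_def)
  have out: "outer T = (k, s)" by simp
  obtain R where R: "composite ?C 1 T R" "planar_tangle R" "outer R = outer ?C"
    "inner R = take (1 - 1) (inner ?C) @ inner T @ drop 1 (inner ?C)"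
    "presented R (comp_sys ?C 1 T ?QC (ins_sys 0 k l k))"
    by (rule composite_realized[OF closure_planar[of k s] closure_presented[of k s] planar ins_presented, of 1])
      (use C out ins_touching[OF _ even1 even2, of 0 s] in \<open>simp_all add: box_def\<close>)
  have bC: "boxes ?C - {1} = {0}" "box ?C 0 = (0, s)" using C by (auto simp: boxes_def box_def)
  have bT: "boxes T - {0} = {1, 2}" unfolding boxes_T by auto
  have sz: "4 * fst (outer T) = 4 * k" "4 * fst (box T 1) = 2 * (k + l)" "4 * fst (box T 2) = 2 * (l + k)"
    using size_T by simp_all
  have len: "(if (0::nat) < 1 then 0 else 0 + length (inner T) - 1) = (0::nat)" "(1::nat) + 1 - 1 = 1" "(1::nat) + 2 - 1 = 2"
    by simp_all
  have sys: "comp_sys ?C 1 T ?QC (ins_sys 0 k l k) \<psi> \<longleftrightarrow> ins_sys 0 0 (k + l) 0 \<psi>" (is "?L \<longleftrightarrow> ?R") for \<psi>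
  proof
    assume ?L
    then obtain \<phi> \<chi> where c0: "\<phi> (0, 0) = \<phi> (1, 0)" and c1: "\<forall>p\<le>4 * k. \<phi> (1, p) = \<phi> (1, 4 * k - p)"
      and *: "ins_sys 0 k l k \<chi>" "\<forall>p\<le>4 * k. \<phi> (1, p) = \<chi> (0, p)"
      and out0: "\<forall>b\<in>{0}. \<forall>p\<le>4 * fst (box ?C b). \<psi> (if b < 1 then b else b + length (inner T) - 1, p) = \<phi> (b, p)"
      and in12: "\<forall>b\<in>{1, 2}. \<forall>p\<le>4 * fst (box T b). \<psi> (1 + b - 1, p) = \<chi> (b, p)"
      unfolding comp_sys_def bC(1) bT sz(1) by (elim exE conjE)
    have "\<psi> (0, 0) = \<phi> (0, 0)" using out0 by simp
    moreover have "\<psi> (1, p) = \<chi> (1, p)" if "p \<le> 2 * (k + l)" for p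
      using in12[rule_format, of 1 p, unfolded sz len] that by blast
    moreover have "\<psi> (2, p) = \<chi> (2, p)" if "p \<le> 2 * (l + k)" for p
      using in12[rule_format, of 2 p, unfolded sz len] that by blast
    ultimately have "\<psi> (0, 0) = \<phi> (0, 0)" "\<forall>p\<le>2 * (k + l). \<psi> (1, p) = \<chi> (1, p)"
      "\<forall>p\<le>2 * (l + k). \<psi> (2, p) = \<chi> (2, p)" by blast+
    note * = conjI[OF c0 c1] * this
    have "ins_eqs 0 k l k (\<lambda>p. \<phi> (1, p)) (\<lambda>p. \<psi> (1, p)) (\<lambda>p. \<psi> (2, p))"
      using *(2) unfolding ins_sys_eqs by (rule ins_eqs_cong) (use *(3,5,6) in simp_all)
    moreover have "\<psi> (0, 0) = \<phi> (1, 0)" using *(4) conjunct1[OF *(1)] by simp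
    ultimately show ?R unfolding ins_sys_eqs trace_sys[symmetric, where l = l]
      using conjunct2[OF *(1)] by (intro exI[of _ "\<lambda>p. \<phi> (1, p)"] conjI)
  next
    assume ?R
    then obtain v where v: "\<psi> (0, 0) = v 0" "\<forall>p\<le>4 * k. v p = v (4 * k - p)"
      "ins_eqs 0 k l k v (\<lambda>p. \<psi> (1, p)) (\<lambda>p. \<psi> (2, p))"
      unfolding ins_sys_eqs trace_sys[symmetric, where l = l] by (elim exE conjE)
    define \<phi> where "\<phi> = (\<lambda>(e :: nat, p). if e = 0 then \<psi> (0, p) else v p)"
    define \<chi> where "\<chi> = (\<lambda>(e :: nat, p). if e = 0 then v p else \<psi> (e, p))"
    have \<phi>1: "\<phi> (1, p) = v p" for p by (simp add: \<phi>_def)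
    have "\<phi> (0, 0) = \<phi> (1, 0)" unfolding \<phi>1 by (simp add: \<phi>_def v(1))
    then have QC: "?QC \<phi>" unfolding \<phi>1 using v(2) by (intro conjI)
    have IS: "ins_sys 0 k l k \<chi>" unfolding ins_sys_eqs \<chi>_def prod.case using v(3) by simp
    have ch: "\<forall>p\<le>4 * k. \<phi> (1, p) = \<chi> (0, p)" by (simp add: \<phi>_def \<chi>_def)
    have out0: "\<forall>b\<in>{0}. \<forall>p\<le>4 * fst (box ?C b). \<psi> (if b < 1 then b else b + length (inner T) - 1, p) = \<phi> (b, p)"
      by (simp add: \<phi>_def)
    have in12: "\<forall>b\<in>{1, 2}. \<forall>p\<le>4 * fst (box T b). \<psi> (1 + b - 1, p) = \<chi> (b, p)"
      by (simp add: \<chi>_def)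
    show ?L
      unfolding comp_sys_def bC(1) bT sz(1)
      by (rule exI[of _ \<phi>], rule exI[of _ \<chi>], intro conjI QC[THEN conjunct1] QC[THEN conjunct2] IS ch out0 in12)
  qed
  have "isotopic id V.T R"
    by (rule isotopic_id[OF V.planar ins_presented R(2,5)]) (use R(3,4) C sys in \<open>simp_all add: ac_simps\<close>)
  then show thesis using that R(1,2,4) C by simp
qed

section \<open>Laws of insertion\<close>

context planar_algebra
begin

abbreviation Ins :: "bool => nat => nat => nat => nat => 'v => 'v => 'v" where
  "Ins s j c b d x y \<equiv> Z (ins_tangle s j c b d) [x, y]"

lemma ins_planar: "even (c + b) ==> even (j + b + d) ==> planar_tangle (ins_tangle s j c b d)"
  by (rule insertion.planar) (simp add: insertion_def)

lemma Ins_in: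
  assumes "even (c + b)" "even (j + b + d)" "x \<in> \<P> ((c + b) div 2, s \<noteq> odd j)" "y \<in> \<P> ((j + b + d) div 2, s)"
  shows "Ins s j c b d x y \<in> \<P> ((j + c + d) div 2, s)"
  using Z_type[OF ins_planar[OF assms(1,2)], of "[x, y]" s] assms(3,4) by simp

lemma Z_iso_id:
  assumes "isotopic id T T'" "planar_tangle T" "planar_tangle T'" "list_all2 (\<lambda>x t. x \<in> \<P> t) xs (inner T)"
  shows "Z T' xs = Z T xs"
  by (rule Z_isotopic[OF assms(2,3,1,4)]) simp_all

lemma Z_second:
  assumes "composite (ins_tangle s j c b d) 2 S R" "planar_tangle S" "planar_tangle R"
    "even (c + b)" "even (j + b + d)" "inner R = ((c + b) div 2, s \<noteq> odd j) # inner S"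
    "x \<in> \<P> ((c + b) div 2, s \<noteq> odd j)" "list_all2 (\<lambda>x t. x \<in> \<P> t) ys (inner S)"
  shows "Z R (x # ys) = Ins s j c b d x (Z S ys)"
  using Z_composite[OF ins_planar[OF assms(4,5)] assms(2,3,1), of "[x]" ys "[]"] assms(6-8) by simp

lemma Z_first:
  assumes "composite (ins_tangle s j c b d) 1 S R" "planar_tangle S" "planar_tangle R"
    "even (c + b)" "even (j + b + d)" "inner R = inner S @ [((j + b + d) div 2, s)]"
    "z \<in> \<P> ((j + b + d) div 2, s)" "list_all2 (\<lambda>x t. x \<in> \<P> t) ys (inner S)"
  shows "Z R (ys @ [z]) = Ins s j c b d (Z S ys) z"
proof -
  have "list_all2 (\<lambda>x t. x \<in> \<P> t) ([] @ ys @ [z]) (inner R)"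
    using assms(6-8) by (simp add: list_all2_appendI)
  from Z_composite[OF ins_planar[OF assms(4,5)] assms(2,3,1) _ this assms(8)] show ?thesis by simp
qed

text \<open>
The inner insertion is into the element \<open>y\<close>, away from the points by which \<open>y\<close> is attached.
\<close>

lemma Ins_nested:
  assumes ev: "even (c + b)" "even (p + b + q + b')" "even (j + b' + d)"
    and x: "x \<in> \<P> ((c + b) div 2, s \<noteq> odd (j + p))" and y: "y \<in> \<P> ((p + b + q + b') div 2, s \<noteq> odd j)"
    and z: "z \<in> \<P> ((j + b' + d) div 2, s)"
  shows "Ins s (j + p) c b (q + d) x (Ins s j (p + b + q) b' d y z) =
         Ins s j (p + c + q) b' d (Ins (s \<noteq> odd j) p c b (q + b') x y) z"
proof -
  have ev': "even (j + p + b + (q + d))" "even (p + c + q + b')" "even (p + b + (q + b'))" using ev by auto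
  obtain R where R: "composite (ins_tangle s (j + p) c b (q + d)) 2 (ins_tangle s j (p + b + q) b' d) R" "planar_tangle R"
    "outer R = ((j + p + c + (q + d)) div 2, s)"
    "inner R = [((c + b) div 2, s \<noteq> odd (j + p)), ((p + b + q + b') div 2, s \<noteq> odd j), ((j + b' + d) div 2, s)]"
    "presented R (\<lambda>\<psi>. \<exists>I. ins_eqs (j + p) c b (q + d) (\<lambda>p. \<psi> (0, p)) (\<lambda>p. \<psi> (1, p)) I \<and>
       ins_eqs j (p + b + q) b' d I (\<lambda>p. \<psi> (2, p)) (\<lambda>p. \<psi> (3, p)))"
    by (rule ins_ins_second[OF ev(1) ev'(1) ev(2,3), of s]) simp
  obtain R' where R': "composite (ins_tangle s j (p + c + q) b' d) 1 (ins_tangle (s \<noteq> odd j) p c b (q + b')) R'" "planar_tangle R'"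
    "outer R' = ((j + (p + c + q) + d) div 2, s)"
    "inner R' = [((c + b) div 2, (s \<noteq> odd j) \<noteq> odd p), ((p + b + (q + b')) div 2, s \<noteq> odd j), ((j + b' + d) div 2, s)]"
    "presented R' (\<lambda>\<psi>. \<exists>I. ins_eqs j (p + c + q) b' d (\<lambda>p. \<psi> (0, p)) I (\<lambda>p. \<psi> (3, p)) \<and>
       ins_eqs p c b (q + b') I (\<lambda>p. \<psi> (1, p)) (\<lambda>p. \<psi> (2, p)))"
    by (rule ins_ins_first[OF ev'(2) ev(3,1) ev'(3), of s]) simp
  have sh: "((s \<noteq> odd j) \<noteq> odd p) = (s \<noteq> odd (j + p))" by auto
  have in': "inner R' = inner R" unfolding R(4) R'(4) sh by (simp add: ac_simps)
  have mem: "list_all2 (\<lambda>x t. x \<in> \<P> t) [x, y, z] (inner R)" using x y z R(4) by simp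
  have out: "outer R' = outer R" unfolding R(3) R'(3) by (simp add: ac_simps)
  have "Z R' [x, y, z] = Z R [x, y, z]"
    by (rule Z_iso_id[OF isotopic_id[OF R(2,5) R'(2,5) out in' nested_eqs] R(2) R'(2) mem])
  moreover have "Z R (x # [y, z]) = Ins s (j + p) c b (q + d) x (Ins s j (p + b + q) b' d y z)"
    by (rule Z_second[OF R(1) ins_planar[OF ev(2,3)] R(2) ev(1) ev'(1)]) (use R(4) x y z in simp_all)
  moreover have "Z R' ([x, y] @ [z]) = Ins s j (p + c + q) b' d (Ins (s \<noteq> odd j) p c b (q + b') x y) z"
    by (rule Z_first[OF R'(1) ins_planar[OF ev(1) ev'(3)] R'(2) ev'(2) ev(3)])
      (use R'(4) x y z sh in \<open>simp_all add: ac_simps\<close>)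
  ultimately show ?thesis by simp
qed

lemma Ins_parallel:
  assumes ev: "even (c1 + b1)" "even (c2 + b2)" "even (j + b1 + e + b2 + d)"
    and y: "y \<in> \<P> ((c1 + b1) div 2, s \<noteq> odd j)" and x: "x \<in> \<P> ((c2 + b2) div 2, s \<noteq> odd (j + b1 + e))"
    and z: "z \<in> \<P> ((j + b1 + e + b2 + d) div 2, s)"
  shows "Ins s j c1 b1 (e + c2 + d) y (Ins s (j + b1 + e) c2 b2 d x z) =
         Ins s (j + c1 + e) c2 b2 d x (Ins s j c1 b1 (e + b2 + d) y z)"
proof -
  have ev': "even (j + b1 + (e + c2 + d))" "even (j + c1 + e + b2 + d)" "even (j + b1 + (e + b2 + d))"
    using ev by auto
  obtain R where R: "composite (ins_tangle s j c1 b1 (e + c2 + d)) 2 (ins_tangle s (j + b1 + e) c2 b2 d) R" "planar_tangle R"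
    "outer R = ((j + c1 + (e + c2 + d)) div 2, s)"
    "inner R = [((c1 + b1) div 2, s \<noteq> odd j), ((c2 + b2) div 2, s \<noteq> odd (j + b1 + e)), ((j + b1 + e + b2 + d) div 2, s)]"
    "presented R (\<lambda>\<psi>. \<exists>I. ins_eqs j c1 b1 (e + c2 + d) (\<lambda>p. \<psi> (0, p)) (\<lambda>p. \<psi> (1, p)) I \<and>
       ins_eqs (j + b1 + e) c2 b2 d I (\<lambda>p. \<psi> (2, p)) (\<lambda>p. \<psi> (3, p)))"
    by (rule ins_ins_second[OF ev(1) ev'(1) ev(2,3), of s]) simp
  obtain R' where R': "composite (ins_tangle s (j + c1 + e) c2 b2 d) 2 (ins_tangle s j c1 b1 (e + b2 + d)) R'" "planar_tangle R'"
    "outer R' = ((j + c1 + e + c2 + d) div 2, s)"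
    "inner R' = [((c2 + b2) div 2, s \<noteq> odd (j + c1 + e)), ((c1 + b1) div 2, s \<noteq> odd j), ((j + b1 + (e + b2 + d)) div 2, s)]"
    "presented R' (\<lambda>\<psi>. \<exists>I. ins_eqs (j + c1 + e) c2 b2 d (\<lambda>p. \<psi> (0, p)) (\<lambda>p. \<psi> (1, p)) I \<and>
       ins_eqs j c1 b1 (e + b2 + d) I (\<lambda>p. \<psi> (2, p)) (\<lambda>p. \<psi> (3, p)))"
    by (rule ins_ins_second[OF ev(2) ev'(2) ev(1) ev'(3), of s]) simp
  have sh: "(s \<noteq> odd (j + c1 + e)) = (s \<noteq> odd (j + b1 + e))" using ev(1) by auto
  have mem: "list_all2 (\<lambda>x t. x \<in> \<P> t) [y, x, z] (inner R)" using x y z R(4) by simp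
  have sys: "(\<exists>I. ins_eqs (j + c1 + e) c2 b2 d (\<lambda>p. \<psi> (0, p)) (\<lambda>p. \<psi> (1, p)) I \<and>
       ins_eqs j c1 b1 (e + b2 + d) I (\<lambda>p. \<psi> (2, p)) (\<lambda>p. \<psi> (3, p))) \<longleftrightarrow>
     (\<exists>I. ins_eqs j c1 b1 (e + c2 + d) (\<lambda>p. case (0, p) of (e, p) => \<psi> (swap12 e, p)) (\<lambda>p. case (1, p) of (e, p) => \<psi> (swap12 e, p)) I \<and>
       ins_eqs (j + b1 + e) c2 b2 d I (\<lambda>p. case (2, p) of (e, p) => \<psi> (swap12 e, p)) (\<lambda>p. case (3, p) of (e, p) => \<psi> (swap12 e, p)))"
    for \<psi> :: "nat \<times> nat => nat + nat"
    unfolding parallel_eqs by simp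
  have iso: "isotopic swap12 R R'"
    by (rule isotopic_swap12[OF R(2,5) R'(2,5) _ R(4) _ sys]) (use R(3) R'(3,4) sh in \<open>simp_all add: ac_simps\<close>)
  have "Z R' [x, y, z] = Z R [y, x, z]"
  proof (rule Z_isotopic[OF R(2) R'(2) iso mem])
    fix i assume "i \<in> {1..length [y, x, z]}"
    then have "i = 1 \<or> i = 2 \<or> i = 3" by auto
    then show "[x, y, z] ! (swap12 i - 1) = [y, x, z] ! (i - 1)" by auto
  qed simp
  moreover have "Z R (y # [x, z]) = Ins s j c1 b1 (e + c2 + d) y (Ins s (j + b1 + e) c2 b2 d x z)"
    by (rule Z_second[OF R(1) ins_planar[OF ev(2,3)] R(2) ev(1) ev'(1)]) (use R(4) x y z in simp_all)
  moreover have "Z R' (x # [y, z]) = Ins s (j + c1 + e) c2 b2 d x (Ins s j c1 b1 (e + b2 + d) y z)"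
    by (rule Z_second[OF R'(1) ins_planar[OF ev(1) ev'(3)] R'(2) ev(2) ev'(2)])
      (use R'(4) x y z sh in \<open>simp_all add: ac_simps\<close>)
  ultimately show ?thesis by simp
qed

text \<open>
Two elements attached side by side can first be juxtaposed; juxtaposition is insertion along no points.
\<close>

lemma Ins_adjacent:
  assumes ev: "even (c + b)" "even (c' + b')" "even (j + b + b' + d)"
    and x: "x \<in> \<P> ((c + b) div 2, s \<noteq> odd (j + c'))" and y: "y \<in> \<P> ((c' + b') div 2, s \<noteq> odd j)"
    and z: "z \<in> \<P> ((j + b + b' + d) div 2, s)"
  shows "Ins s j (c' + c) (b + b') d (Ins (s \<noteq> odd j) c' (c + b) 0 b' x y) z =
         Ins s (j + c') c b d x (Ins s j c' b' (b + d) y z)"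
proof -
  have ev': "even (c' + c + (b + b'))" "even (j + (b + b') + d)" "even (c + b + 0)" "even (c' + 0 + b')"
    "even (j + c' + b + d)" "even (j + b' + (b + d))" using ev by auto
  obtain R where R: "composite (ins_tangle s j (c' + c) (b + b') d) 1 (ins_tangle (s \<noteq> odd j) c' (c + b) 0 b') R" "planar_tangle R"
    "outer R = ((j + (c' + c) + d) div 2, s)"
    "inner R = [((c + b + 0) div 2, (s \<noteq> odd j) \<noteq> odd c'), ((c' + 0 + b') div 2, s \<noteq> odd j), ((j + (b + b') + d) div 2, s)]"
    "presented R (\<lambda>\<psi>. \<exists>I. ins_eqs j (c' + c) (b + b') d (\<lambda>p. \<psi> (0, p)) I (\<lambda>p. \<psi> (3, p)) \<and>
       ins_eqs c' (c + b) 0 b' I (\<lambda>p. \<psi> (1, p)) (\<lambda>p. \<psi> (2, p)))"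
    by (rule ins_ins_first[OF ev'(1-4), of s]) simp
  obtain R' where R': "composite (ins_tangle s (j + c') c b d) 2 (ins_tangle s j c' b' (b + d)) R'" "planar_tangle R'"
    "outer R' = ((j + c' + c + d) div 2, s)"
    "inner R' = [((c + b) div 2, s \<noteq> odd (j + c')), ((c' + b') div 2, s \<noteq> odd j), ((j + b' + (b + d)) div 2, s)]"
    "presented R' (\<lambda>\<psi>. \<exists>I. ins_eqs (j + c') c b d (\<lambda>p. \<psi> (0, p)) (\<lambda>p. \<psi> (1, p)) I \<and>
       ins_eqs j c' b' (b + d) I (\<lambda>p. \<psi> (2, p)) (\<lambda>p. \<psi> (3, p)))"
    by (rule ins_ins_second[OF ev(1) ev'(5) ev(2) ev'(6), of s]) simp
  have sh: "((s \<noteq> odd j) \<noteq> odd c') = (s \<noteq> odd (j + c'))" by auto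
  have in': "inner R = inner R'" unfolding R(4) R'(4) sh by (simp add: ac_simps)
  have mem: "list_all2 (\<lambda>x t. x \<in> \<P> t) [x, y, z] (inner R')" using x y z R'(4) by (simp add: ac_simps)
  have out: "outer R = outer R'" unfolding R(3) R'(3) by (simp add: ac_simps)
  have "Z R [x, y, z] = Z R' [x, y, z]"
    by (rule Z_iso_id[OF isotopic_id[OF R'(2,5) R(2,5) out in' adjacent_eqs[symmetric]] R'(2) R(2) mem])
  moreover have "Z R' (x # [y, z]) = Ins s (j + c') c b d x (Ins s j c' b' (b + d) y z)"
    by (rule Z_second[OF R'(1) ins_planar[OF ev(2) ev'(6)] R'(2) ev(1) ev'(5)]) (use R'(4) x y z in \<open>simp_all add: ac_simps\<close>)
  moreover have "Z R ([x, y] @ [z]) = Ins s j (c' + c) (b + b') d (Ins (s \<noteq> odd j) c' (c + b) 0 b' x y) z"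
    by (rule Z_first[OF R(1) ins_planar[OF ev'(3,4)] R(2) ev'(1,2)]) (use R(4) x y z sh in \<open>simp_all add: ac_simps\<close>)
  ultimately show ?thesis by simp
qed

end

lemma click_sys:
  "(\<exists>\<rho>. click_eqs (\<lambda>p. \<rho> (0, p)) (\<lambda>p. \<rho> (1, p)) \<and> (\<forall>p\<le>4. J p = \<rho> (0 :: nat, p)) \<and>
      (\<forall>e\<in>{1}. \<forall>p\<le>4. \<chi> (e :: nat, p) = \<rho> (e, p))) \<longleftrightarrow> click_eqs J (\<lambda>p. \<chi> (1 :: nat, p))"
proof
  assume "\<exists>\<rho>. click_eqs (\<lambda>p. \<rho> (0, p)) (\<lambda>p. \<rho> (1, p)) \<and> (\<forall>p\<le>4. J p = \<rho> (0 :: nat, p)) \<and>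
      (\<forall>e\<in>{1}. \<forall>p\<le>4. \<chi> (e :: nat, p) = \<rho> (e, p))"
  then show "click_eqs J (\<lambda>p. \<chi> (1, p))" unfolding click_eqs_def by auto
next
  assume "click_eqs J (\<lambda>p. \<chi> (1, p))"
  then show "\<exists>\<rho>. click_eqs (\<lambda>p. \<rho> (0, p)) (\<lambda>p. \<rho> (1, p)) \<and> (\<forall>p\<le>4. J p = \<rho> (0 :: nat, p)) \<and>
      (\<forall>e\<in>{1}. \<forall>p\<le>4. \<chi> (e :: nat, p) = \<rho> (e, p))"
    by (intro exI[of _ "\<lambda>(e, p). if e = 0 then J p else \<chi> (e, p)"]) simp
qed

lemma click_sel [simp]: "outer (click_tangle k s) = (k, \<not> s)" "inner (click_tangle k s) = [(k, s)]"
  by (simp_all add: click_tangle_def)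

context planar_algebra
begin

text \<open>
The label \<open>x\<close> sits on a strand between \<open>h\<close> and \<open>y\<close>. Seen from \<open>h\<close> this strand is
bent, so \<open>x\<close> appears rotated by \<open>\<pi>\<close>.
\<close>

lemma Ins_slide:
  assumes ev: "even (c + (i + 1 + i'))" "even (i + 1 + i' + d)"
    and h: "h \<in> \<P> ((c + (i + 1 + i')) div 2, s)" and x: "x \<in> \<P> (1, s \<noteq> odd i)"
    and y: "y \<in> \<P> ((i + 1 + i' + d) div 2, s)"
  shows "Ins s 0 c (i + 1 + i') d h (Ins s i 1 1 (i' + d) x y) =
         Ins s 0 c (i + 1 + i') d (Ins s (c + i') 1 1 i (click (1, s \<noteq> odd i) x) h) y"
proof -
  have ev': "even (0 + (i + 1 + i') + d)" "even (1 + 1 :: nat)" "even (i + 1 + (i' + d))" "even (c + i' + 1 + i)"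
    using ev by auto
  have sz0: "0 + (i + 1 + i') + d = i + 1 + (i' + d)" by simp
  let ?C = "click_tangle 1 (s \<noteq> odd i)"
  let ?QC = "\<lambda>\<phi> :: nat \<times> nat => nat + nat. click_eqs (\<lambda>p. \<phi> (0, p)) (\<lambda>p. \<phi> (1, p))"
  have sh: "(\<not> (s \<noteq> odd i)) = (s \<noteq> odd (c + i'))" using ev(1) by auto
  obtain R where R: "composite (ins_tangle s 0 c (i + 1 + i') d) 2 (ins_tangle s i 1 1 (i' + d)) R" "planar_tangle R"
    "outer R = ((0 + c + d) div 2, s)"
    "inner R = [((c + (i + 1 + i')) div 2, s \<noteq> odd 0), ((1 + 1) div 2, s \<noteq> odd i), ((i + 1 + (i' + d)) div 2, s)]"
    "presented R (\<lambda>\<psi>. \<exists>I. ins_eqs 0 c (i + 1 + i') d (\<lambda>p. \<psi> (0, p)) (\<lambda>p. \<psi> (1, p)) I \<and>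
       ins_eqs i 1 1 (i' + d) I (\<lambda>p. \<psi> (2, p)) (\<lambda>p. \<psi> (3, p)))"
    by (rule ins_ins_second[OF ev(1) ev'(1-3) sz0, of s]) simp
  obtain S where S: "composite (ins_tangle s (c + i') 1 1 i) 1 ?C S" "planar_tangle S"
    "outer S = ((c + i' + 1 + i) div 2, s)" "inner S = inner ?C @ [((c + i' + 1 + i) div 2, s)]"
    "presented S (\<lambda>\<psi>. \<exists>I. ins_eqs (c + i') 1 1 i (\<lambda>p. \<psi> (0, p)) I (\<lambda>p. \<psi> (length (inner ?C) + 1, p)) \<and>
       (\<exists>\<chi>. ?QC \<chi> \<and> (\<forall>p\<le>2 * (1 + 1). I p = \<chi> (0, p)) \<and>
          (\<forall>e\<in>boxes ?C - {0}. \<forall>p\<le>4 * fst (box ?C e). \<psi> (e, p) = \<chi> (e, p))))"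
    by (rule ins_first[OF ev'(2,4) click_planar[of "s \<noteq> odd i"] click_presented[of "s \<noteq> odd i"], of s]) (use sh in simp)
  have cl: "boxes ?C - {0} = {1}" "length (inner ?C) + 1 = 2" "2 * (1 + 1) = (4::nat)"
    by (auto simp: boxes_def)
  have "(\<forall>e\<in>boxes ?C - {0}. \<forall>p\<le>4 * fst (box ?C e). \<psi> (e, p) = \<chi> (e, p)) \<longleftrightarrow>
      (\<forall>e\<in>{1}. \<forall>p\<le>4. \<psi> (e, p) = \<chi> (e, p))" for \<psi> \<chi> :: "nat \<times> nat => nat + nat"
    unfolding cl(1) by (simp add: box_def)
  note S5 = S(5)[unfolded this cl(2,3) click_sys]
  let ?QS = "\<lambda>\<psi> :: nat \<times> nat => nat + nat. \<exists>J. ins_eqs (c + i') 1 1 i (\<lambda>p. \<psi> (0, p)) J (\<lambda>p. \<psi> (2, p)) \<and> click_eqs J (\<lambda>p. \<psi> (1, p))"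
  have outS: "outer S = ((c + (i + 1 + i')) div 2, s \<noteq> odd 0)" using S(3) by (simp add: ac_simps)
  obtain R' where R': "composite (ins_tangle s 0 c (i + 1 + i') d) 1 S R'" "planar_tangle R'"
    "outer R' = ((0 + c + d) div 2, s)" "inner R' = inner S @ [((0 + (i + 1 + i') + d) div 2, s)]"
    "presented R' (\<lambda>\<psi>. \<exists>I. ins_eqs 0 c (i + 1 + i') d (\<lambda>p. \<psi> (0, p)) I (\<lambda>p. \<psi> (length (inner S) + 1, p)) \<and>
       (\<exists>\<chi>. ?QS \<chi> \<and> (\<forall>p\<le>2 * (c + (i + 1 + i')). I p = \<chi> (0, p)) \<and>
          (\<forall>e\<in>boxes S - {0}. \<forall>p\<le>4 * fst (box S e). \<psi> (e, p) = \<chi> (e, p))))"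
    by (rule ins_first[OF ev(1) ev'(1) S(2) S5 outS])
  have inS: "inner S = [(1, s \<noteq> odd i), ((c + i' + 1 + i) div 2, s)]" using S(4) by simp
  have bS: "boxes S - {0} = {1, 2}" using inS by (auto simp: boxes_def)
  have szS: "4 * fst (box S 1) = 4" "4 * fst (box S 2) = 2 * (c + i' + 1 + i)"
    using inS four_half[OF ev'(4)] by (simp_all add: box_def)
  have sys': "(\<exists>\<chi>. ?QS \<chi> \<and> (\<forall>p\<le>2 * (c + (i + 1 + i')). I p = \<chi> (0, p)) \<and>
          (\<forall>e\<in>boxes S - {0}. \<forall>p\<le>4 * fst (box S e). \<psi> (e, p) = \<chi> (e, p))) \<longleftrightarrow>
      (\<exists>J. ins_eqs (c + i') 1 1 i I J (\<lambda>p. \<psi> (2, p)) \<and> click_eqs J (\<lambda>p. \<psi> (1, p)))" (is "?L \<longleftrightarrow> ?R")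
    for I and \<psi> :: "nat \<times> nat => nat + nat"
  proof
    assume ?L
    then obtain \<chi> J where *: "ins_eqs (c + i') 1 1 i (\<lambda>p. \<chi> (0, p)) J (\<lambda>p. \<chi> (2, p))" "click_eqs J (\<lambda>p. \<chi> (1, p))"
      "\<forall>p\<le>2 * (c + (i + 1 + i')). I p = \<chi> (0, p)" "\<forall>e\<in>{1, 2}. \<forall>p\<le>4 * fst (box S e). \<psi> (e, p) = \<chi> (e, p)"
      unfolding bS by blast
    have v: "\<forall>p\<le>4. \<psi> (1, p) = \<chi> (1, p)" "\<forall>p\<le>2 * (c + i' + 1 + i). \<psi> (2, p) = \<chi> (2, p)"
      using bspec[OF *(4), of 1] bspec[OF *(4), of 2] unfolding szS by simp_all
    have "ins_eqs (c + i') 1 1 i I J (\<lambda>p. \<psi> (2, p))"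
      by (rule ins_eqs_cong[OF *(1)]) (use *(3) v(2) in simp_all)
    moreover have "click_eqs J (\<lambda>p. \<psi> (1, p))" using *(2) v(1) unfolding click_eqs_def by auto
    ultimately show ?R by blast
  next
    assume ?R
    then obtain J where J: "ins_eqs (c + i') 1 1 i I J (\<lambda>p. \<psi> (2, p))" "click_eqs J (\<lambda>p. \<psi> (1, p))" by blast
    show ?L
      unfolding bS by (intro exI[of _ "\<lambda>(e, p). if e = 0 then I p else \<psi> (e, p)"] conjI exI[of _ J]) (use J in simp_all)
  qed
  have len: "length (inner S) + 1 = 3" using inS by simp
  note R5 = R'(5)[unfolded sys' len]
  have sys: "(\<exists>K. ins_eqs 0 c (i + 1 + i') d (\<lambda>p. \<psi> (0, p)) K (\<lambda>p. \<psi> (3, p)) \<and>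
       (\<exists>J. ins_eqs (c + i') 1 1 i K J (\<lambda>p. \<psi> (2, p)) \<and> click_eqs J (\<lambda>p. \<psi> (1, p)))) \<longleftrightarrow>
     (\<exists>I. ins_eqs 0 c (i + 1 + i') d (\<lambda>p. case (0, p) of (e, p) => \<psi> (swap12 e, p)) (\<lambda>p. case (1, p) of (e, p) => \<psi> (swap12 e, p)) I \<and>
       ins_eqs i 1 1 (i' + d) I (\<lambda>p. case (2, p) of (e, p) => \<psi> (swap12 e, p)) (\<lambda>p. case (3, p) of (e, p) => \<psi> (swap12 e, p)))"
    for \<psi> :: "nat \<times> nat => nat + nat"
    unfolding slide_eqs by simp
  have sz: "c + i' + 1 + i = c + (i + 1 + i')" "0 + (i + 1 + i') + d = i + 1 + (i' + d)" by simp_all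
  have inR': "inner R' = [((1 + 1) div 2, s \<noteq> odd i), ((c + (i + 1 + i')) div 2, s \<noteq> odd 0), ((i + 1 + (i' + d)) div 2, s)]"
    unfolding R'(4) inS sz by simp
  have outR': "outer R' = outer R" unfolding R(3) R'(3) ..
  have iso: "isotopic swap12 R R'"
    by (rule isotopic_swap12[OF R(2,5) R'(2) R5 outR' R(4) inR' sys])
  have y': "y \<in> \<P> ((i + 1 + (i' + d)) div 2, s)" using y by (simp add: add.assoc)
  have mem: "list_all2 (\<lambda>x t. x \<in> \<P> t) [h, x, y] (inner R)" using h x y' R(4) by simp
  have "Z R' [x, h, y] = Z R [h, x, y]"
  proof (rule Z_isotopic[OF R(2) R'(2) iso mem])
    fix k assume "k \<in> {1..length [h, x, y]}"
    then have "k = 1 \<or> k = 2 \<or> k = 3" by auto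
    then show "[x, h, y] ! (swap12 k - 1) = [h, x, y] ! (k - 1)" by auto
  qed simp
  moreover have "Z R (h # [x, y]) = Ins s 0 c (i + 1 + i') d h (Ins s i 1 1 (i' + d) x y)"
    by (rule Z_second[OF R(1) ins_planar[OF ev'(2,3)] R(2) ev(1) ev'(1)]) (use R(4) h x y' in simp_all)
  moreover have h': "h \<in> \<P> ((c + i' + 1 + i) div 2, s)" using h unfolding sz by simp
  have "Z R' ([x, h] @ [y]) = Ins s 0 c (i + 1 + i') d (Z S [x, h]) y"
    by (rule Z_first[OF R'(1) S(2) R'(2) ev(1) ev'(1) R'(4)]) (use inS x h' y' in \<open>simp_all add: add.assoc\<close>)
  moreover have "Z S ([x] @ [h]) = Ins s (c + i') 1 1 i (Z ?C [x]) h"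
    by (rule Z_first[OF S(1) click_planar S(2) ev'(2,4)]) (use S(4) x h' in simp_all)
  ultimately show ?thesis unfolding click_def by simp
qed

text \<open>
Rotating a strand twice by \<open>\<pi>\<close> is isotopic to the identity.
\<close>

lemma click_click:
  assumes x: "x \<in> \<P> (1, s)"
  shows "click (1, \<not> s) (click (1, s) x) = x"
proof -
  let ?T = "click_tangle 1 (\<not> s)" and ?S = "click_tangle 1 s"
  let ?Q = "\<lambda>\<phi> :: nat \<times> nat => nat + nat. click_eqs (\<lambda>p. \<phi> (0, p)) (\<lambda>p. \<phi> (1, p))"
  have nd: "(b, p) \<in> nodes ?T" if "b \<le> 1" "p \<le> 4" for b p
    using that by (cases "b = 0") (auto simp: nodes_def boxes_def box_def)
  have "click_eqs (\<lambda>p. name ?T (0, p)) (\<lambda>p. name ?T (1, p))" by (rule presentedD(2)[OF click_presented])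
  then have c: "name ?T (0, p) = name ?T (1, 2 + p)" "name ?T (0, 2 + p) = name ?T (1, p)" if "p \<le> 2" for p
    using that unfolding click_eqs_def by blast+
  have touch: "touching ?T 1"
    unfolding touching_def
  proof (intro allI impI)
    fix p assume "p \<le> 4 * fst (box ?T 1)"
    then have p: "p \<le> 4" by (simp add: box_def)
    show "\<exists>u\<in>nodes ?T. fst u \<noteq> 1 \<and> name ?T (1, p) = name ?T u"
    proof (cases "p \<le> 2")
      case True
      then show ?thesis using c(2)[of p] by (intro bexI[of _ "(0, 2 + p)"] conjI nd) simp_all
    next
      case False
      then have e: "2 + (p - 2) = p" by simp
      show ?thesis using c(1)[of "p - 2", unfolded e] p by (intro bexI[of _ "(0, p - 2)"] conjI nd) simp_all
    qed
  qed
  obtain R where R: "composite ?T 1 ?S R" "planar_tangle R" "outer R = outer ?T"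
    "inner R = take (1 - 1) (inner ?T) @ inner ?S @ drop 1 (inner ?T)" "presented R (comp_sys ?T 1 ?S ?Q ?Q)"
    by (rule composite_realized[OF click_planar[of "\<not> s"] click_presented[of "\<not> s"] click_planar[of s] click_presented[of s], of 1])
      (use touch in \<open>simp_all add: box_def\<close>)
  have "identity_tangle R"
  proof (rule identity_tangleI[OF R(2,5)])
    show "inner R = [outer R]" using R(3,4) by simp
    fix \<psi> :: "nat \<times> nat => nat + nat" and p
    assume "comp_sys ?T 1 ?S ?Q ?Q \<psi>"
    then obtain \<phi> \<chi> where \<phi>: "?Q \<phi>" and \<chi>: "?Q \<chi>" and m: "\<forall>p\<le>4 * fst (outer ?S). \<phi> (1, p) = \<chi> (0, p)"
      and o: "\<forall>b\<in>boxes ?T - {1}. \<forall>p\<le>4 * fst (box ?T b). \<psi> (if b < 1 then b else b + length (inner ?S) - 1, p) = \<phi> (b, p)"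
      and i: "\<forall>b\<in>boxes ?S - {0}. \<forall>p\<le>4 * fst (box ?S b). \<psi> (1 + b - 1, p) = \<chi> (b, p)"
      unfolding comp_sys_def by (elim exE conjE)
    assume "p \<le> 4 * fst (outer R)"
    then have p: "p \<le> 4" using R(3) by simp
    have "\<psi> (0, p) = \<phi> (0, p)" using bspec[OF o, of 0] p by (simp add: boxes_def box_def)
    also have "\<dots> = \<chi> (1, p)"
    proof (cases "p \<le> 2")
      case True
      then have "\<phi> (0, p) = \<phi> (1, 2 + p)" using \<phi> unfolding click_eqs_def by blast
      also have "\<dots> = \<chi> (0, 2 + p)" using m True by simp
      also have "\<dots> = \<chi> (1, p)" using \<chi> True unfolding click_eqs_def by blast
      finally show ?thesis .
    next
      case False
      then have q: "p = 2 + (p - 2)" "p - 2 \<le> 2" using p by simp_all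
      have "\<phi> (0, 2 + (p - 2)) = \<phi> (1, p - 2)" using \<phi> q unfolding click_eqs_def by blast
      also have "\<dots> = \<chi> (0, p - 2)" using m q by simp
      also have "\<dots> = \<chi> (1, 2 + (p - 2))" using \<chi> q unfolding click_eqs_def by blast
      finally show ?thesis using q(1) by simp
    qed
    also have "\<dots> = \<psi> (1, p)" using bspec[OF i, of 1] p by (simp add: boxes_def box_def)
    finally show "\<psi> (0, p) = \<psi> (1, p)" .
  qed
  then have "Z R [x] = x" using Z_identity[of R x] x R(3) by simp
  moreover have "Z R ([] @ [x] @ []) = Z ?T ([] @ Z ?S [x] # [])"
    by (rule Z_composite[OF click_planar click_planar R(2,1)]) (use R(4) x in simp_all)
  ultimately show ?thesis unfolding click_def by simp
qed

lemma Ins_unit_first: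
  assumes ev: "even (j + 1 + d)" and y: "y \<in> \<P> ((j + 1 + d) div 2, s)"
  shows "Ins s j 1 1 d (one 1 (s \<noteq> odd j)) y = y"
proof -
  let ?U = "unit_tangle 1 (s \<noteq> odd j)"
  obtain R where R: "composite (ins_tangle s j 1 1 d) 1 ?U R" "planar_tangle R"
    "outer R = ((j + 1 + d) div 2, s)" "inner R = inner ?U @ [((j + 1 + d) div 2, s)]"
    "presented R (\<lambda>\<psi>. \<exists>I. ins_eqs j 1 1 d (\<lambda>p. \<psi> (0, p)) I (\<lambda>p. \<psi> (length (inner ?U) + 1, p)) \<and>
       (\<exists>\<chi>. unit_sys 1 \<chi> \<and> (\<forall>p\<le>2 * (1 + 1). I p = \<chi> (0, p)) \<and>
          (\<forall>e\<in>boxes ?U - {0}. \<forall>p\<le>4 * fst (box ?U e). \<psi> (e, p) = \<chi> (e, p))))"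
    by (rule ins_first[OF _ ev unit_planar[of 1 "s \<noteq> odd j"] unit_presented[of 1 "s \<noteq> odd j"], of 1 s]) simp_all
  have cl: "length (inner ?U) + 1 = 1" "2 * (1 + 1) = (4 * 1 :: nat)" by simp_all
  note R5 = R(5)[unfolded cl unit_second_sys]
  have "identity_tangle R"
  proof (rule identity_tangleI[OF R(2) R5])
    show "inner R = [outer R]" using R(3,4) by simp
    fix \<psi> :: "nat \<times> nat => nat + nat" and p
    assume "\<exists>I. ins_eqs j 1 1 d (\<lambda>p. \<psi> (0, p)) I (\<lambda>p. \<psi> (1, p)) \<and> (\<forall>p\<le>4 * 1. I p = I (4 * 1 - p))"
    then obtain I where E: "ins_eqs j 1 1 d (\<lambda>p. \<psi> (0, p)) I (\<lambda>p. \<psi> (1, p))" and I': "\<forall>p\<le>4 * 1. I p = I (4 * 1 - p)"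
      by (elim exE conjE)
    note E = ins_eqsD[OF E]
    assume "p \<le> 4 * fst (outer R)"
    then have "p \<le> 2 * j + 2 + 2 * d" using R(3) four_half[OF ev] by simp
    then show "\<psi> (0, p) = \<psi> (1, p)"
    proof (cases rule: split3)
      case 1 then show ?thesis using E(1) by simp
    next
      case (2 u)
      have "\<psi> (0, p) = I u" using E(2)[of u] 2 by simp
      also have "\<dots> = I (4 * 1 - u)" by (rule I'[rule_format]) (use 2 in simp)
      also have "4 * 1 - u = 2 * 1 + (2 - u)" using 2 by simp
      also have "I \<dots> = \<psi> (1, p)" using E(3)[of "2 - u" u] E(3)[of u "2 - u"] 2 by simp
      finally show ?thesis .
    next
      case (3 u) then show ?thesis using E(4)[of u] by simp
    qed
  qed
  moreover have "Z R ([] @ [y]) = Ins s j 1 1 d (Z ?U []) y"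
    by (rule Z_first[OF R(1) unit_planar[of 1 "s \<noteq> odd j"] R(2)]) (use ev y R(4) in simp_all)
  ultimately show ?thesis using Z_identity[of R y] y R(3) unfolding one_def by simp
qed

lemma Ins_unit_second:
  assumes x: "x \<in> \<P> (1, s)"
  shows "Ins s 0 1 1 1 x (one 1 s) = x"
proof -
  let ?U = "unit_tangle 1 s"
  obtain R where R: "composite (ins_tangle s 0 1 1 1) 2 ?U R" "planar_tangle R"
    "outer R = ((0 + 1 + 1) div 2, s)" "inner R = ((1 + 1) div 2, s \<noteq> odd 0) # inner ?U"
    "presented R (\<lambda>\<psi>. \<exists>I. ins_eqs 0 1 1 1 (\<lambda>p. \<psi> (0, p)) (\<lambda>p. \<psi> (1, p)) I \<and>
       (\<exists>\<chi>. unit_sys 1 \<chi> \<and> (\<forall>p\<le>2 * (0 + 1 + 1). I p = \<chi> (0, p)) \<and>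
          (\<forall>e\<in>boxes ?U - {0}. \<forall>p\<le>4 * fst (box ?U e). \<psi> (e + 1, p) = \<chi> (e, p))))"
    by (rule ins_second[OF _ _ unit_planar[of 1 s] unit_presented[of 1 s], of 1 1 0 1 s]) simp_all
  have cl: "2 * (0 + 1 + 1) = (4 * 1 :: nat)" by simp
  note R5 = R(5)[unfolded cl unit_second_sys]
  have "identity_tangle R"
  proof (rule identity_tangleI[OF R(2) R5])
    show "inner R = [outer R]" using R(3,4) by simp
    fix \<psi> :: "nat \<times> nat => nat + nat" and p
    assume "\<exists>I. ins_eqs 0 1 1 1 (\<lambda>p. \<psi> (0, p)) (\<lambda>p. \<psi> (1, p)) I \<and> (\<forall>p\<le>4 * 1. I p = I (4 * 1 - p))"
    then obtain I where E: "ins_eqs 0 1 1 1 (\<lambda>p. \<psi> (0, p)) (\<lambda>p. \<psi> (1, p)) I" and I': "\<forall>p\<le>4 * 1. I p = I (4 * 1 - p)"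
      by (elim exE conjE)
    note E = ins_eqsD[OF E]
    assume "p \<le> 4 * fst (outer R)"
    then have "p \<le> 2 + 2" using R(3) by simp
    then show "\<psi> (0, p) = \<psi> (1, p)"
    proof (cases rule: split2)
      case 1 then show ?thesis using E(2)[of p] by simp
    next
      case (2 u)
      have "\<psi> (0, p) = I (2 + u)" using E(4)[of u] 2 by simp
      also have "\<dots> = I (2 - u)" using I'[rule_format, of "2 + u"] 2 by simp
      also have "\<dots> = \<psi> (1, p)" using E(3)[of u "2 - u"] 2 by simp
      finally show ?thesis .
    qed
  qed
  moreover have "Z R (x # []) = Ins s 0 1 1 1 x (Z ?U [])"
    by (rule Z_second[OF R(1) unit_planar[of 1 s] R(2)]) (use x R(4) in simp_all)
  ultimately show ?thesis using Z_identity[of R x] x R(3) unfolding one_def by simp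
qed

lemma Ins_empty:
  assumes ev: "even (j + d)" and y: "y \<in> \<P> ((j + d) div 2, s)"
  shows "Ins s j 0 0 d (empty (s \<noteq> odd j)) y = y"
proof -
  let ?U = "unit_tangle 0 (s \<noteq> odd j)"
  have ev': "even (j + 0 + d)" using ev by simp
  obtain R where R: "composite (ins_tangle s j 0 0 d) 1 ?U R" "planar_tangle R"
    "outer R = ((j + 0 + d) div 2, s)" "inner R = inner ?U @ [((j + 0 + d) div 2, s)]"
    "presented R (\<lambda>\<psi>. \<exists>I. ins_eqs j 0 0 d (\<lambda>p. \<psi> (0, p)) I (\<lambda>p. \<psi> (length (inner ?U) + 1, p)) \<and>
       (\<exists>\<chi>. unit_sys 0 \<chi> \<and> (\<forall>p\<le>2 * (0 + 0). I p = \<chi> (0, p)) \<and>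
          (\<forall>e\<in>boxes ?U - {0}. \<forall>p\<le>4 * fst (box ?U e). \<psi> (e, p) = \<chi> (e, p))))"
    by (rule ins_first[OF _ ev' unit_planar[of 0 "s \<noteq> odd j"] unit_presented[of 0 "s \<noteq> odd j"], of 0 s]) simp_all
  have "identity_tangle R"
  proof (rule identity_tangleI[OF R(2,5)])
    show "inner R = [outer R]" using R(3,4) by simp
    fix \<psi> :: "nat \<times> nat => nat + nat" and p
    assume "\<exists>I. ins_eqs j 0 0 d (\<lambda>p. \<psi> (0, p)) I (\<lambda>p. \<psi> (length (inner ?U) + 1, p)) \<and>
       (\<exists>\<chi>. unit_sys 0 \<chi> \<and> (\<forall>p\<le>2 * (0 + 0). I p = \<chi> (0, p)) \<and>
          (\<forall>e\<in>boxes ?U - {0}. \<forall>p\<le>4 * fst (box ?U e). \<psi> (e, p) = \<chi> (e, p)))"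
    then obtain I where E: "ins_eqs j 0 0 d (\<lambda>p. \<psi> (0, p)) I (\<lambda>p. \<psi> (1, p))" by auto
    note E = ins_eqsD[OF E]
    assume "p \<le> 4 * fst (outer R)"
    then have "p \<le> 2 * j + 2 * d" using R(3) four_half[OF ev] by simp
    then show "\<psi> (0, p) = \<psi> (1, p)"
      by (cases rule: split2) (use E(1)[of p] E(4) in auto)
  qed
  moreover have "Z R ([] @ [y]) = Ins s j 0 0 d (Z ?U []) y"
    by (rule Z_first[OF R(1) unit_planar[of 0 "s \<noteq> odd j"] R(2)]) (use ev' y R(4) in simp_all)
  ultimately show ?thesis using Z_identity[of R y] y R(3) unfolding empty_def one_def by simp
qed

text \<open>
The closure of a product depends only on the cyclic arrangement of all boundary points, not on how they
are divided into top and bottom points.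
\<close>

lemma tr_right_Ins:
  assumes ev: "even (k + l)" and x: "x \<in> \<P> ((k + l) div 2, s)" and y: "y \<in> \<P> ((k + l) div 2, s)"
  shows "tr_right (k, s) (Ins s 0 k l k x y) = Ins s 0 0 (k + l) 0 x y"
proof -
  obtain R where R: "composite (closure_tangle False k s) 1 (ins_tangle s 0 k l k) R" "planar_tangle R"
    "inner R = inner (ins_tangle s 0 k l k)" "isotopic id (ins_tangle s 0 0 (k + l) 0) R"
    by (rule trace_composite[OF ev])
  have pl: "planar_tangle (ins_tangle s 0 k l k)" "planar_tangle (ins_tangle s 0 0 (k + l) 0)"
    by (rule ins_planar; use ev in simp)+
  have mem: "list_all2 (\<lambda>x t. x \<in> \<P> t) ([] @ [x, y] @ []) (inner R)"
    "list_all2 (\<lambda>x t. x \<in> \<P> t) [x, y] (inner (ins_tangle s 0 k l k))"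
    "list_all2 (\<lambda>x t. x \<in> \<P> t) [x, y] (inner (ins_tangle s 0 0 (k + l) 0))"
    unfolding R(3) using x y by (simp_all add: ac_simps)
  have "Z R ([] @ [x, y] @ []) = Z (closure_tangle False k s) ([] @ Ins s 0 k l k x y # [])"
    by (rule Z_composite[OF closure_planar pl(1) R(2,1) _ mem(1,2)]) simp
  moreover have "Z R [x, y] = Ins s 0 0 (k + l) 0 x y"
    by (rule Z_iso_id[OF R(4) pl(2) R(2) mem(3)])
  ultimately show ?thesis unfolding tr_right_def by simp
qed

lemma stack_eq_Ins:
  assumes "even (c + b)" "even (b + a)" "x \<in> \<P> ((c + b) div 2, s)" "y \<in> \<P> ((b + a) div 2, s)"
  shows "stack s c b a x y = Ins s 0 c b a x y"
  unfolding stack_def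
  by (rule Z_iso_id[OF stack_isotopic(1)[OF assms(1,2)] ins_planar stack_isotopic(2)[OF assms(1,2)]])
    (use assms in simp_all)

lemma tensor_eq_Ins:
  assumes "x \<in> \<P> (k, s)" "y \<in> \<P> (l, s \<noteq> odd k)"
  shows "tensor s k l x y = Ins s k (2 * l) 0 k y x"
  unfolding tensor_def
proof (rule Z_isotopic[OF ins_planar tensor_isotopic(2) tensor_isotopic(1)])
  fix i assume "i \<in> {1..length [y, x]}"
  then have "i = 1 \<or> i = 2" by auto
  then show "[x, y] ! (flip i - 1) = [y, x] ! (i - 1)" by auto
qed (use assms in simp_all)

end

lemma (in subfactor_planar_algebra) adj_Ins:
  assumes "even (c + b)" "even (b + a)" "x \<in> \<P> ((c + b) div 2, s)" "y \<in> \<P> ((b + a) div 2, s)"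
  shows "adj ((c + a) div 2, s) (Ins s 0 c b a x y) =
    Ins s 0 a b c (adj ((b + a) div 2, s) y) (adj ((c + b) div 2, s) x)"
proof -
  have pl: "planar_tangle (ins_tangle s 0 c b a)" "planar_tangle (ins_tangle s 0 a b c)"
    by (rule ins_planar; use assms in \<open>simp add: ac_simps\<close>)+
  note iso = reflect_isotopic[OF assms(1,2), of s]
  have "adj (outer (ins_tangle s 0 c b a)) (Ins s 0 c b a x y) =
      Z (reflect (ins_tangle s 0 c b a)) (map2 adj (inner (ins_tangle s 0 c b a)) [x, y])"
    by (rule adj_Z[OF pl(1)]) (use assms in simp_all)
  also have "map2 adj (inner (ins_tangle s 0 c b a)) [x, y] =
      [adj ((c + b) div 2, s) x, adj ((b + a) div 2, s) y]" (is "_ = [?x, ?y]") by simp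
  also have "Z (reflect (ins_tangle s 0 c b a)) [?x, ?y] = Ins s 0 a b c ?y ?x"
  proof (rule Z_isotopic[OF pl(2) planar_isotopic[OF pl(2) iso] iso])
    show "list_all2 (\<lambda>x t. x \<in> \<P> t) [?y, ?x] (inner (ins_tangle s 0 a b c))"
      using adj_type[OF assms(3)] adj_type[OF assms(4)] by (simp add: ac_simps)
    fix i assume "i \<in> {1..length [?y, ?x]}"
    then have "i = 1 \<or> i = 2" by auto
    then show "[?x, ?y] ! (flip i - 1) = [?y, ?x] ! (i - 1)" by auto
  qed simp
  finally show ?thesis by simp
qed

section \<open>Coloured strands\<close>

context planar_algebra
begin

lemma P_zero [simp]: "0 \<in> \<P> t" using subspace_P subspace_0 by blast
lemma P_add: "x \<in> \<P> t ==> y \<in> \<P> t ==> x + y \<in> \<P> t" using subspace_P subspace_add by blast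
lemma P_scale: "x \<in> \<P> t ==> scale a x \<in> \<P> t" using subspace_P subspace_scale by blast

lemma Ins_linear:
  assumes ev: "even (c + b)" "even (j + b + d)"
    and x: "x \<in> \<P> ((c + b) div 2, s \<noteq> odd j)" and y: "y \<in> \<P> ((j + b + d) div 2, s)"
  shows Ins_add_first: "x' \<in> \<P> ((c + b) div 2, s \<noteq> odd j) ==> Ins s j c b d (x + x') y = Ins s j c b d x y + Ins s j c b d x' y"
    and Ins_add_second: "y' \<in> \<P> ((j + b + d) div 2, s) ==> Ins s j c b d x (y + y') = Ins s j c b d x y + Ins s j c b d x y'"
    and Ins_scale_first: "Ins s j c b d (scale a x) y = scale a (Ins s j c b d x y)"
    and Ins_scale_second: "Ins s j c b d x (scale a y) = scale a (Ins s j c b d x y)"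
    and Ins_zero_first: "Ins s j c b d 0 y = 0"
    and Ins_zero_second: "Ins s j c b d x 0 = 0"
proof -
  note pl = ins_planar[OF ev]
  have first: "Ins s j c b d (scale a u + v) y = scale a (Ins s j c b d u y) + Ins s j c b d v y"
    if "u \<in> \<P> ((c + b) div 2, s \<noteq> odd j)" "v \<in> \<P> ((c + b) div 2, s \<noteq> odd j)" for a u v
    using Z_multilinear[OF pl, of "[]" u "[y]" s v a] that y by simp
  have second: "Ins s j c b d x (scale a u + v) = scale a (Ins s j c b d x u) + Ins s j c b d x v"
    if "u \<in> \<P> ((j + b + d) div 2, s)" "v \<in> \<P> ((j + b + d) div 2, s)" for a u v
    using Z_multilinear[OF pl, of "[x]" u "[]" s v a] that x by simp
  show "Ins s j c b d (x + x') y = Ins s j c b d x y + Ins s j c b d x' y" if "x' \<in> \<P> ((c + b) div 2, s \<noteq> odd j)"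
    using first[of x x' 1] x that by simp
  show "Ins s j c b d x (y + y') = Ins s j c b d x y + Ins s j c b d x y'" if "y' \<in> \<P> ((j + b + d) div 2, s)"
    using second[of y y' 1] y that by simp
  show z1: "Ins s j c b d 0 y = 0" using first[of 0 0 1] by simp
  show z2: "Ins s j c b d x 0 = 0" using second[of 0 0 1] by simp
  show "Ins s j c b d (scale a x) y = scale a (Ins s j c b d x y)" using first[of x 0 a] x z1 by simp
  show "Ins s j c b d x (scale a y) = scale a (Ins s j c b d x y)" using second[of y 0 a] y z2 by simp
qed

lemma one_in: "one k s \<in> \<P> (k, s)"
  using Z_type[OF unit_planar[of k s], of "[]"] unfolding one_def by simp

lemma click_in: "x \<in> \<P> (1, s) ==> click (1, s) x \<in> \<P> (1, \<not> s)"
  using Z_type[OF click_planar[of s], of "[x]"] unfolding click_def by simp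

lemma Ins_bend:
  assumes h: "h \<in> \<P> (1, s)" and x: "x \<in> \<P> (1, s)"
  shows "Ins s 1 1 1 0 (click (1, s) x) h = Ins s 0 1 1 1 h x"
proof -
  have sl: "Ins s 0 1 1 1 h (Ins s 0 1 1 1 x (one 1 s)) = Ins s 0 1 1 1 (Ins s 1 1 1 0 (click (1, s) x) h) (one 1 s)"
    using Ins_slide[of 1 0 0 1 h s x "one 1 s"] h x one_in[of 1 s] by simp
  have "Ins s 1 1 1 0 (click (1, s) x) h \<in> \<P> (1, s)"
    using Ins_in[of 1 1 1 0 "click (1, s) x" s h] click_in[OF x] h by simp
  from Ins_unit_second[OF this] Ins_unit_second[OF x] sl show ?thesis by simp
qed

lemma click_eq_Ins:
  assumes z: "z \<in> \<P> (1, \<not> s)"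
  shows "click (1, \<not> s) z = Ins s 1 1 1 0 z (one 1 s)"
proof -
  have z': "click (1, \<not> s) z \<in> \<P> (1, s)" using click_in[OF z] by simp
  have "z = click (1, s) (click (1, \<not> s) z)" using click_click[OF z] by simp
  then have "Ins s 1 1 1 0 z (one 1 s) = Ins s 0 1 1 1 (one 1 s) (click (1, \<not> s) z)"
    using Ins_bend[OF one_in z'] by simp
  also have "\<dots> = click (1, \<not> s) z" using Ins_unit_first[of 0 1 "click (1, \<not> s) z" s] z' by simp
  finally show ?thesis ..
qed

lemma click_one: "click (1, \<not> s) (one 1 (\<not> s)) = one 1 s"
  using Ins_unit_first[of 1 0 "one 1 s" s] one_in[of 1 s] click_eq_Ins[OF one_in[of 1 "\<not> s"]] by simp

text \<open>
Both sides are the labels \<open>x\<close> and \<open>y\<close> on one bent strand.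
\<close>

lemma click_mult:
  assumes x: "x \<in> \<P> (1, s)" and y: "y \<in> \<P> (1, s)"
  shows "click (1, \<not> s) (Ins (\<not> s) 0 1 1 1 (click (1, s) x) (click (1, s) y)) = Ins s 0 1 1 1 y x"
proof -
  note x' = click_in[OF x] and y' = click_in[OF y]
  have m: "Ins (\<not> s) 0 1 1 1 (click (1, s) x) (click (1, s) y) \<in> \<P> (1, \<not> s)"
    using Ins_in[of 1 1 0 1 "click (1, s) x" "\<not> s" "click (1, s) y"] x' y' by simp
  have "Ins s 1 1 1 0 (Ins (\<not> s) 0 1 1 1 (click (1, s) x) (click (1, s) y)) (one 1 s) =
      Ins s 1 1 1 0 (click (1, s) x) (Ins s 1 1 1 0 (click (1, s) y) (one 1 s))"
    using Ins_nested[of 1 1 0 0 1 1 0 "click (1, s) x" s "click (1, s) y" "one 1 s"] x' y' one_in[of 1 s] by simp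
  also have "Ins s 1 1 1 0 (click (1, s) y) (one 1 s) = y"
    using click_eq_Ins[OF y'] click_click[OF y] by simp
  finally show ?thesis using click_eq_Ins[OF m] Ins_bend[OF y x] by simp
qed

lemma click_zero: "click (1, s) 0 = 0"
  using Z_multilinear[OF click_planar[of s], of "[]" 0 "[]" 0 1] unfolding click_def by simp

end

text \<open>
\<open>e s True\<close> and \<open>e s False\<close> are the two colours of a strand whose left side has shading \<open>s\<close>. The names are chosen so
that rotation by \<open>\<pi>\<close> reverses the sign, whence an arc joins points of opposite signs:
for \<open>s = False\<close> the sign \<open>True\<close> is red, for \<open>s = True\<close> it is blue.
\<close>

locale coloured_strands = subfactor_planar_algebra scale \<P> Z adj
  for scale :: "complex => 'v::ab_group_add => 'v" and \<P> Z adj +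
  fixes e :: "bool => bool => 'v"
  assumes e_in: "e s a \<in> \<P> (1, s)"
    and e_sum: "e s True + e s False = one 1 s"
    and e_orth: "Ins s 0 1 1 1 (e s a) (e s (\<not> a)) = 0"
    and e_click: "click (1, s) (e s a) = e (\<not> s) (\<not> a)"
    and e_saddle: "Ins s 0 2 0 2 (e s a) (e s a) = Ins s 1 2 0 1 (e (\<not> s) (\<not> a)) (e s a)"
    and e_loop: "tr_right (1, s) (e s a) = empty s"
begin

lemma e_idem: "Ins s 0 1 1 1 (e s a) (e s a) = e s a"
proof -
  have "e s a = Ins s 0 1 1 1 (e s a) (one 1 s)" by (rule Ins_unit_second[OF e_in, symmetric])
  also have "one 1 s = e s a + e s (\<not> a)" using e_sum[of s] by (cases a) (simp_all add: add.commute)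
  also have "Ins s 0 1 1 1 (e s a) (e s a + e s (\<not> a)) = Ins s 0 1 1 1 (e s a) (e s a)"
    using Ins_add_second[of 1 1 0 1 "e s a" s "e s a" "e s (\<not> a)"] e_in e_orth by simp
  finally show ?thesis ..
qed

text \<open>
The colour of an arc can be read off at either leg.
\<close>

lemma e_bent: "Ins s 1 1 1 0 (e (\<not> s) (\<not> a)) (e s a) = e s a"
  using Ins_bend[OF e_in e_in, of s a a] e_idem e_click by simp

lemma e_pairing: "Ins s 0 0 2 0 (e s a) (e s a) = empty s"
  using tr_right_Ins[of 1 1 "e s a" s "e s a"] e_in e_idem e_loop by (simp add: numeral_2_eq_2)

abbreviation (input) cut :: "bool => nat => nat => bool => 'v => 'v" where
  "cut s j d a f \<equiv> Ins s j 1 1 d (e (s \<noteq> odd j) a) f"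

abbreviation (input) cap :: "bool => nat => nat => bool => 'v => 'v" where
  "cap s j d a f \<equiv> Ins s j 0 2 d (e (s \<noteq> odd j) a) f"

abbreviation (input) cup :: "bool => nat => nat => bool => 'v => 'v" where
  "cup s j d a g \<equiv> Ins s j 2 0 d (e (s \<noteq> odd j) a) g"

lemma cut_in: "even (j + 1 + d) ==> f \<in> \<P> ((j + 1 + d) div 2, s) ==> cut s j d a f \<in> \<P> ((j + 1 + d) div 2, s)"
  using Ins_in[of 1 1 j d "e (s \<noteq> odd j) a" s f] e_in by simp

lemma cut_cut: 
  assumes "even (j + 1 + d)" "f \<in> \<P> ((j + 1 + d) div 2, s)"
  shows "cut s j d a (cut s j d b f) = (if a = b then cut s j d a f else 0)"
proof -
  have "cut s j d a (cut s j d b f) = Ins s j 1 1 d (Ins (s \<noteq> odd j) 0 1 1 1 (e (s \<noteq> odd j) a) (e (s \<noteq> odd j) b)) f"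
    using Ins_nested[of 1 1 0 0 1 j d "e (s \<noteq> odd j) a" s "e (s \<noteq> odd j) b" f] assms e_in by simp
  also have "\<dots> = (if a = b then cut s j d a f else 0)"
  proof (cases "a = b")
    case False
    then have "b = (\<not> a)" by simp
    then show ?thesis using e_orth[of "s \<noteq> odd j" a] Ins_zero_first[of 1 1 j d 0 s f] assms by simp
  qed (simp add: e_idem[simplified])
  finally show ?thesis .
qed

lemma cut_sum:
  assumes "even (j + 1 + d)" "f \<in> \<P> ((j + 1 + d) div 2, s)"
  shows "f = cut s j d True f + cut s j d False f"
proof -
  have "f = Ins s j 1 1 d (e (s \<noteq> odd j) True + e (s \<noteq> odd j) False) f"
    using Ins_unit_first[OF assms] e_sum by simp
  also have "\<dots> = cut s j d True f + cut s j d False f"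
    using Ins_add_first[of 1 1 j d "e (s \<noteq> odd j) True" s f "e (s \<noteq> odd j) False"] assms e_in by simp
  finally show ?thesis .
qed

lemma cut_commute:
  assumes "i < j" "even (j + 1 + d)" "f \<in> \<P> ((j + 1 + d) div 2, s)"
  shows "cut s i (j + d - i) a (cut s j d b f) = cut s j d b (cut s i (j + d - i) a f)"
proof -
  have j: "j = i + 1 + (j - i - 1)" "j + d - i = (j - i - 1) + 1 + d" using assms(1) by simp_all
  show ?thesis
    using Ins_parallel[of 1 1 1 1 i "j - i - 1" d "e (s \<noteq> odd i) a" s "e (s \<noteq> odd j) b" f] e_in assms
    unfolding j(1)[symmetric] j(2)[symmetric] by simp
qed

text \<open>
This is the bubble relation: cap and cup close up to a loop.
\<close>

lemma cap_cup:
  assumes "even (j + d)" "g \<in> \<P> ((j + d) div 2, s)"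
  shows "cap s j d a (cup s j d a g) = g"
proof -
  have "cap s j d a (cup s j d a g) = Ins s j 0 0 d (Ins (s \<noteq> odd j) 0 0 2 0 (e (s \<noteq> odd j) a) (e (s \<noteq> odd j) a)) g"
    using Ins_nested[of 0 2 0 0 0 j d "e (s \<noteq> odd j) a" s "e (s \<noteq> odd j) a" g] assms e_in by (simp add: numeral_2_eq_2)
  then show ?thesis unfolding e_pairing using Ins_empty[OF assms] by simp
qed

text \<open>
This is the saddle relation, applied to two neighbouring points.
\<close>

lemma cup_cap:
  assumes "even (j + 2 + d)" "f \<in> \<P> ((j + 2 + d) div 2, s)"
  shows "cup s j d a (cap s j d a f) = cut s (j + 1) d (\<not> a) (cut s j (1 + d) a f)"
proof -
  let ?e = "e (s \<noteq> odd j) a"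
  have sh: "(s \<noteq> odd (j + 1)) = (\<not> (s \<noteq> odd j))" by simp
  have "cup s j d a (cap s j d a f) = Ins s j 2 2 d (Ins (s \<noteq> odd j) 0 2 0 2 ?e ?e) f"
    using Ins_nested[of 2 0 0 0 2 j d ?e s ?e f] assms e_in by (simp add: numeral_2_eq_2)
  also have "\<dots> = Ins s j 2 2 d (Ins (s \<noteq> odd j) 1 2 0 1 (e (\<not> (s \<noteq> odd j)) (\<not> a)) ?e) f" unfolding e_saddle ..
  also have "\<dots> = cut s (j + 1) d (\<not> a) (cut s j (1 + d) a f)"
    using Ins_adjacent[of 1 1 1 1 j d "e (s \<noteq> odd (j + 1)) (\<not> a)" s ?e f] assms e_in sh by (simp add: numeral_2_eq_2)
  finally show ?thesis .
qed

end

section \<open>Words of colours\<close>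

definition balance :: "bool list => int" where
  "balance w = (\<Sum>a\<leftarrow>w. if a then 1 else - 1)"

lemma balance_simps [simp]:
  "balance [] = 0" "balance (a # w) = (if a then 1 else - 1) + balance w"
  "balance (u @ v) = balance u + balance v" "balance (replicate k a) = (if a then int k else - int k)"
  "balance (rev w) = balance w" "balance (map Not w) = - balance w"
proof -
  show app: "balance (u @ v) = balance u + balance v" for u v by (simp add: balance_def)
  show cons: "balance (a # w) = (if a then 1 else - 1) + balance w" for a w by (simp add: balance_def)
  show nil: "balance [] = 0" by (simp add: balance_def)
  show "balance (replicate k a) = (if a then int k else - int k)" by (induction k) (simp_all add: cons nil)
  show "balance (rev w) = balance w" by (induction w) (simp_all add: app cons nil)
  show "balance (map Not w) = - balance w" by (induction w) (simp_all add: cons nil)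
qed

lemma word_cases:
  fixes w :: "bool list"
  obtains (const) k a where "w = replicate k a"
  | (cancel) u a v where "w = u @ a # (\<not> a) # v"
proof -
  have "(\<exists>k a. w = replicate k a) \<or> (\<exists>u a v. w = u @ a # (\<not> a) # v)"
  proof (induction w)
    case (Cons b w)
    from Cons.IH show ?case
    proof (elim disjE exE)
      fix k a assume w: "w = replicate k a"
      show ?thesis
      proof (cases "b = a \<or> k = 0")
        case True
        then have "b # w = replicate (Suc k) b" using w by auto
        then show ?thesis by blast
      next
        case False
        then obtain k' where "k = Suc k'" by (cases k) auto
        then have "b # w = [] @ b # (\<not> b) # replicate k' a" using w False by simp
        then show ?thesis by blast
      qed
    next
      fix u a v assume "w = u @ a # (\<not> a) # v"
      then have "b # w = (b # u) @ a # (\<not> a) # v" by simp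
      then show ?thesis by blast
    qed
  qed simp
  then show thesis using that by blast
qed

lemma (in vector_space) dim_one:
  assumes "dim S = 1" "x \<in> S" "y \<in> S" "x \<noteq> 0"
  shows "\<exists>r. y = scale r x"
proof -
  obtain B where B: "S \<subseteq> span B" "card B = dim S" using basis_exists[of S] by metis
  then obtain v where v: "B = {v}" using assms(1) by (metis card_1_singletonE)
  then have "x \<in> span {v}" "y \<in> span {v}" using B(1) assms(2,3) by blast+
  then obtain a b where ab: "x = scale a v" "y = scale b v" unfolding span_singleton by blast
  then have "a \<noteq> 0" using assms(4) by auto
  then have "y = scale (b / a) x" using ab by simp
  then show ?thesis ..
qed

context coloured_strands
begin

definition point_coloured :: "bool => nat => nat => bool => 'v => bool" where
  "point_coloured s m i a f \<longleftrightarrow> cut s i (m - Suc i) a f = f"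

text \<open>
Only the first \<open>length w\<close> of the \<open>m\<close> points are required to carry the colours of \<open>w\<close>.
\<close>

definition coloured :: "bool => bool list => nat => 'v => bool" where
  "coloured s w m f \<longleftrightarrow> even m \<and> length w \<le> m \<and> f \<in> \<P> (m div 2, s) \<and>
     (\<forall>i<length w. point_coloured s m i (w ! i) f)"

lemma point_coloured_Ins:
  assumes ev: "even (c + b)" "even (j + b + d)"
    and y: "y \<in> \<P> ((c + b) div 2, s \<noteq> odd j)" and z: "z \<in> \<P> ((j + b + d) div 2, s)"
  shows point_coloured_before:
      "i < j ==> point_coloured s (j + b + d) i a z ==> point_coloured s (j + c + d) i a (Ins s j c b d y z)"
    and point_coloured_inside:
      "i < c ==> point_coloured (s \<noteq> odd j) (c + b) i a y ==> point_coloured s (j + c + d) (j + i) a (Ins s j c b d y z)"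
    and point_coloured_after:
      "i < d ==> point_coloured s (j + b + d) (j + b + i) a z ==>
        point_coloured s (j + c + d) (j + c + i) a (Ins s j c b d y z)"
proof -
  show "point_coloured s (j + c + d) i a (Ins s j c b d y z)" if i: "i < j" and *: "point_coloured s (j + b + d) i a z"
  proof -
    have j: "i + 1 + (j - Suc i) = j" "j + c + d - Suc i = j - Suc i + c + d" "j + b + d - Suc i = j - Suc i + b + d"
      using i by simp_all
    have "cut s i (j - Suc i + c + d) a (Ins s j c b d y z) = Ins s j c b d y (cut s i (j - Suc i + b + d) a z)"
      using Ins_parallel[of 1 1 c b i "j - Suc i" d "e (s \<noteq> odd i) a" s y z, unfolded j(1)] ev y z e_in by simp
    then show ?thesis using * unfolding point_coloured_def j by simp
  qed
  show "point_coloured s (j + c + d) (j + i) a (Ins s j c b d y z)"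
    if i: "i < c" and *: "point_coloured (s \<noteq> odd j) (c + b) i a y"
  proof -
    have j: "i + 1 + (c - Suc i) = c" "j + c + d - Suc (j + i) = c - Suc i + d" "c + b - Suc i = c - Suc i + b"
      using i by simp_all
    have sh: "((s \<noteq> odd j) \<noteq> odd i) = (s \<noteq> odd (j + i))" by auto
    have "cut s (j + i) (c - Suc i + d) a (Ins s j c b d y z) =
        Ins s j c b d (Ins (s \<noteq> odd j) i 1 1 (c - Suc i + b) (e (s \<noteq> odd (j + i)) a) y) z"
      using Ins_nested[of 1 1 i "c - Suc i" b j d "e (s \<noteq> odd (j + i)) a" s y z, unfolded j(1)] ev y z e_in by simp
    then show ?thesis using * unfolding point_coloured_def j sh by simp
  qed
  show "point_coloured s (j + c + d) (j + c + i) a (Ins s j c b d y z)"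
    if i: "i < d" and *: "point_coloured s (j + b + d) (j + b + i) a z"
  proof -
    have j: "i + 1 + (d - Suc i) = d" "j + b + i + 1 + (d - Suc i) = j + b + d"
      "j + c + d - Suc (j + c + i) = d - Suc i" "j + b + d - Suc (j + b + i) = d - Suc i"
      using i by simp_all
    have sh: "(s \<noteq> odd (j + b + i)) = (s \<noteq> odd (j + c + i))" using ev by auto
    have "Ins s j c b d y (cut s (j + b + i) (d - Suc i) a z) = cut s (j + c + i) (d - Suc i) a (Ins s j c b d y z)"
      using Ins_parallel[of c b 1 1 j i "d - Suc i" y s "e (s \<noteq> odd (j + b + i)) a" z, unfolded j(1,2)] ev y z e_in
      unfolding sh by simp
    then show ?thesis using * unfolding point_coloured_def j by simp
  qed
qed

lemma colouredD:
  assumes "coloured s w m f"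
  shows "even m" "length w \<le> m" "f \<in> \<P> (m div 2, s)" "i < length w ==> point_coloured s m i (w ! i) f"
  using assms unfolding coloured_def by blast+

text \<open>
The word of the inserted element replaces the part of the word along which it is glued.
\<close>

lemma coloured_insert:
  assumes z: "coloured s (u @ w @ v) (length u + length w + d) z"
    and y: "coloured (s \<noteq> odd (length u)) w' (length w' + length w) y"
  shows "coloured s (u @ w' @ v) (length u + length w' + d) (Ins s (length u) (length w') (length w) d y z)"
proof -
  let ?j = "length u" and ?c = "length w'" and ?b = "length w"
  note ev = colouredD(1)[OF y] colouredD(1)[OF z] and P = colouredD(3)[OF y] colouredD(3)[OF z]
  have v: "length v \<le> d" using colouredD(2)[OF z] by simp
  have "point_coloured s (?j + ?c + d) i ((u @ w' @ v) ! i) (Ins s ?j ?c ?b d y z)" if "i < length (u @ w' @ v)" for i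
  proof -
    consider "i < ?j" | i' where "i = ?j + i'" "i' < ?c" | i' where "i = ?j + ?c + i'" "i' < length v"
    proof -
      consider "i < ?j" | "?j \<le> i \<and> i < ?j + ?c" | "?j + ?c \<le> i" by linarith
      then show thesis
      proof cases
        case 1 then show thesis by (rule that(1))
      next
        case 2 then show thesis by (intro that(2)[of "i - ?j"]) auto
      next
        case 3 then show thesis using \<open>i < length (u @ w' @ v)\<close> by (intro that(3)[of "i - ?j - ?c"]) auto
      qed
    qed
    then show ?thesis
    proof cases
      case 1
      then show ?thesis using point_coloured_before[OF ev P 1] colouredD(4)[OF z, of i] by (simp add: nth_append)
    next
      case 2
      then show ?thesis using point_coloured_inside[OF ev P 2(2)] colouredD(4)[OF y, of i'] by (simp add: nth_append)
    next
      case 3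
      have "point_coloured s (?j + ?b + d) (?j + ?b + i') (v ! i') z"
        using colouredD(4)[OF z, of "?j + ?b + i'"] 3 by (simp add: nth_append)
      then show ?thesis using point_coloured_after[OF ev P, of i' "v ! i'"] 3 v by (simp add: nth_append)
    qed
  qed
  moreover have "Ins s ?j ?c ?b d y z \<in> \<P> ((?j + ?c + d) div 2, s)" by (rule Ins_in[OF ev P])
  moreover have "even (?j + ?c + d)" using ev by auto
  ultimately show ?thesis unfolding coloured_def using v by simp
qed

text \<open>
Neighbouring points of opposite signs are joined by a cap without loss.
\<close>

lemma coloured_cap:
  assumes f: "coloured s (u @ a # (\<not> a) # v) (length u + 2 + d) f"
  shows "coloured s (u @ v) (length u + d) (cap s (length u) d a f)"
    and "cup s (length u) d a (cap s (length u) d a f) = f"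
proof -
  have "coloured (s \<noteq> odd (length u)) [] (length ([] :: bool list) + length [a, \<not> a]) (e (s \<noteq> odd (length u)) a)"
    unfolding coloured_def using e_in by simp
  from coloured_insert[of s u "[a, \<not> a]" v d f, OF _ this] f
  show "coloured s (u @ v) (length u + d) (cap s (length u) d a f)" by (simp add: numeral_2_eq_2)
  have "cut s (length u) (1 + d) a f = f" "cut s (length u + 1) d (\<not> a) f = f"
    using colouredD(4)[OF f, of "length u"] colouredD(4)[OF f, of "length u + 1"]
    unfolding point_coloured_def by (simp_all add: nth_append)
  then show "cup s (length u) d a (cap s (length u) d a f) = f"
    using cup_cap[of "length u" d f s a] colouredD(1,3)[OF f] by simp
qed

lemma coloured_cup:
  assumes g: "coloured s (u @ v) (length u + d) g"
  shows "coloured s (u @ a # (\<not> a) # v) (length u + 2 + d) (cup s (length u) d a g)"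
    and "cap s (length u) d a (cup s (length u) d a g) = g"
proof -
  have "coloured s' [a, \<not> a] (length [a, \<not> a] + length ([] :: bool list)) (e s' a)" for s'
    unfolding coloured_def point_coloured_def using e_in e_bent[of s' a] e_idem[of s' a]
    by (auto simp: less_Suc_eq)
  from coloured_insert[of s u "[]" v d g, OF _ this] g
  show "coloured s (u @ a # (\<not> a) # v) (length u + 2 + d) (cup s (length u) d a g)" by (simp add: numeral_2_eq_2)
  show "cap s (length u) d a (cup s (length u) d a g) = g"
    by (rule cap_cup) (use colouredD(1,3)[OF g] in simp_all)
qed

lemma coloured_split:
  assumes f: "coloured s w m f" and "length w < m"
  shows "coloured s (w @ [a]) m (cut s (length w) (m - Suc (length w)) a f)"
    and "f = cut s (length w) (m - Suc (length w)) True f + cut s (length w) (m - Suc (length w)) False f"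
proof -
  let ?j = "length w"
  define d where "d = m - Suc (length w)"
  have m: "m = ?j + 1 + d" using assms(2) by (simp add: d_def)
  have ev: "even (?j + 1 + d)" and P: "f \<in> \<P> ((?j + 1 + d) div 2, s)" using colouredD(1,3)[OF f] unfolding m .
  have "coloured s (w @ [a]) m (cut s ?j d a f)" for a
  proof -
    have "point_coloured s m i ((w @ [a]) ! i) (cut s ?j d a f)" if "i < Suc ?j" for i
    proof (cases "i = ?j")
      case True
      then show ?thesis unfolding point_coloured_def m using cut_cut[OF ev P, of a a] by simp
    next
      case False
      then have i: "i < ?j" "m - Suc i = ?j + d - i" using that unfolding m by simp_all
      then show ?thesis using cut_commute[OF i(1) ev P, of "w ! i" a] colouredD(4)[OF f i(1)]
        unfolding point_coloured_def by (simp add: nth_append)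
    qed
    moreover have "cut s ?j d a f \<in> \<P> (m div 2, s)" using cut_in[OF ev P] unfolding m .
    ultimately show ?thesis using ev unfolding coloured_def by (simp add: m)
  qed
  then show "coloured s (w @ [a]) m (cut s (length w) (m - Suc (length w)) a f)" unfolding d_def .
  show "f = cut s (length w) (m - Suc (length w)) True f + cut s (length w) (m - Suc (length w)) False f"
    using cut_sum[OF ev P] unfolding d_def .
qed

text \<open>
A word of sum zero cancels down to the empty word, and the caps that do this are injective on coloured
elements. Only scalars remain, and they form a line.
\<close>

lemma balanced_unique:
  assumes "coloured s w (length w) f" "coloured s w (length w) g" "balance w = 0" "f \<noteq> 0"
  shows "\<exists>r. g = scale r f"
  using assms
proof (induction "length w" arbitrary: w f g rule: less_induct)
  case less
  show ?case
  proof (cases w rule: word_cases)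
    case (const k a)
    then have "w = []" using less.prems(3) by (simp split: if_splits)
    then show ?thesis using dim_one[OF dim_P0[of s]] less.prems(4) colouredD(3)[OF less.prems(1)] colouredD(3)[OF less.prems(2)] by simp
  next
    case (cancel u a v)
    let ?d = "length v"
    have m: "length w = length u + 2 + ?d" and m': "length (u @ v) = length u + ?d" using cancel by simp_all
    note f = coloured_cap[of s u a v ?d f, folded cancel, OF less.prems(1)[unfolded m]]
      and g = coloured_cap[of s u a v ?d g, folded cancel, OF less.prems(2)[unfolded m]]
    have b: "balance (u @ v) = 0" using less.prems(3) cancel by (cases a) simp_all
    have ev: "even (length u + ?d)" using colouredD(1)[OF f(1)] .
    have "cap s (length u) ?d a f \<noteq> 0"
    proof
      assume "cap s (length u) ?d a f = 0"
      then have "f = cup s (length u) ?d a 0" using f(2) by simp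
      also have "\<dots> = 0" using Ins_zero_second[of 2 0 "length u" ?d "e (s \<noteq> odd (length u)) a" s 0] e_in ev by simp
      finally show False using less.prems(4) by simp
    qed
    then obtain r where r: "cap s (length u) ?d a g = scale r (cap s (length u) ?d a f)"
      using less.hyps[of "u @ v", OF _ f(1)[folded m'] g(1)[folded m'] b] m by auto
    have "g = cup s (length u) ?d a (scale r (cap s (length u) ?d a f))" using g(2) r by simp
    also have "\<dots> = scale r (cup s (length u) ?d a (cap s (length u) ?d a f))"
      using Ins_scale_second[of 2 0 "length u" ?d "e (s \<noteq> odd (length u)) a" s] e_in ev colouredD(3)[OF f(1)] by simp
    finally show ?thesis using f(2) by auto
  qed
qed

end

text \<open>
Cancelling as long as possible turns a word into a power of one letter, determined by the sum.
\<close>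

lemma word_transport:
  assumes cancel: "!!u a v. S (u @ a # (\<not> a) # v) ==> S (u @ v)"
    and insert: "!!u a v. S (u @ v) ==> S (u @ a # (\<not> a) # v)"
    and "S w" "balance w = balance w'"
  shows "S w'"
proof -
  let ?c = "\<lambda>b. replicate (nat \<bar>b\<bar>) (b \<ge> 0)"
  have canonical: "S w \<longleftrightarrow> S (?c (balance w))" for w
  proof (induction "length w" arbitrary: w rule: less_induct)
    case less
    show ?case
    proof (cases w rule: word_cases)
      case (const k a)
      then have "?c (balance w) = w" by (cases "k = 0") simp_all
      then show ?thesis by simp
    next
      case (cancel u a v)
      have "S w \<longleftrightarrow> S (u @ v)" unfolding cancel using assms(1,2) by blast
      moreover have "balance w = balance (u @ v)" unfolding cancel by simp
      ultimately show ?thesis using less[of "u @ v"] cancel by simp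
    qed
  qed
  show ?thesis using canonical[of w] canonical[of w'] assms(3,4) by simp
qed

lemma (in vector_space) dim_one_nonzero:
  assumes "dim S = 1"
  shows "\<exists>x\<in>S. x \<noteq> 0"
proof -
  obtain B where B: "B \<subseteq> S" "independent B" "card B = dim S" using basis_exists[of S] by metis
  then obtain v where "B = {v}" using assms by (metis card_1_singletonE)
  then have "v \<in> S" "v \<noteq> 0" using B(1,2) dependent_zero[of B] by auto
  then show ?thesis by (rule bexI[rotated])
qed

section \<open>Minimal projections\<close>

context subfactor_planar_algebra
begin

lemma empty_nonzero: "empty s \<noteq> 0"
proof
  assume e: "empty s = 0"
  obtain x where x: "x \<in> \<P> (0, s)" "x \<noteq> 0" using dim_one_nonzero[OF dim_P0] by blast
  have "x = Ins s 0 0 0 0 (empty s) x" using Ins_empty[of 0 0 x s] x by simp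
  also have "\<dots> = 0" unfolding e using Ins_zero_first[of 0 0 0 0 0 s x] x by simp
  finally show False using x by simp
qed

text \<open>
The type of a map from \<open>k\<close> points at the bottom to \<open>l\<close> points on top. With it the parity and
membership conditions of the laws of insertion become composability in a category.
\<close>

definition arr :: "bool => nat => nat => 'v => bool" where
  "arr s k l f \<longleftrightarrow> even (k + l) \<and> f \<in> \<P> ((k + l) div 2, s)"

abbreviation dag :: "bool => nat => nat => 'v => 'v" where
  "dag s k l f \<equiv> adj ((k + l) div 2, s) f"

lemma arr_comp: "arr s l m f ==> arr s k l g ==> arr s k m (Ins s 0 m l k f g)"
  using Ins_in[of m l 0 k f s g] unfolding arr_def by (simp add: add.commute)

lemma arr_assoc:
  "arr s l m f ==> arr s k l g ==> arr s j k h ==>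
    Ins s 0 m l j f (Ins s 0 l k j g h) = Ins s 0 m k j (Ins s 0 m l k f g) h"
  using Ins_nested[of m l 0 0 k 0 j f s g h] unfolding arr_def by (simp add: add.commute)

lemma arr_dag: "arr s k l f ==> arr s l k (dag s k l f)"
  using adj_type unfolding arr_def by (simp add: add.commute)

lemma dag_comp:
  assumes "arr s l m f" "arr s k l g"
  shows "dag s k m (Ins s 0 m l k f g) = Ins s 0 k l m (dag s k l g) (dag s l m f)"
  using adj_Ins[of m l k f s g] assms unfolding arr_def by (simp add: add.commute)

lemma dag_dag: "arr s k l f ==> dag s l k (dag s k l f) = f"
  using adj_adj unfolding arr_def by (simp add: add.commute)

lemma arr_scale: "arr s k l f ==> arr s k l (scale a f)"
  unfolding arr_def using P_scale by blast

lemma comp_scale: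
  assumes "arr s l m f" "arr s k l g"
  shows "Ins s 0 m l k (scale a f) g = scale a (Ins s 0 m l k f g)"
    and "Ins s 0 m l k f (scale a g) = scale a (Ins s 0 m l k f g)"
    and "Ins s 0 m l k 0 g = 0" and "Ins s 0 m l k f 0 = 0"
  using Ins_scale_first[of m l 0 k f s g a] Ins_scale_second[of m l 0 k f s g a]
    Ins_zero_first[of m l 0 k f s g] Ins_zero_second[of m l 0 k f s g] assms
  unfolding arr_def by (simp_all add: add.commute)

lemma dag_scale: "arr s k l f ==> dag s k l (scale a f) = scale (cnj a) (dag s k l f)"
  using adj_antilinear[of f "((k + l) div 2, s)" 0 a] adj_antilinear[of 0 "((k + l) div 2, s)" 0 1]
  unfolding arr_def by simp

lemma pairing_positive:
  assumes "even m" "x \<in> \<P> (m div 2, s)" "x \<noteq> 0"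
  shows "\<exists>r>0. Ins s 0 0 m 0 (adj (m div 2, s) x) x = scale (complex_of_real r) (empty s)"
proof -
  let ?k = "m div 2"
  have m: "?k + ?k = m" using assms(1) by presburger
  have x': "adj (?k, s) x \<in> \<P> (?k, s)" using adj_type assms(2) .
  obtain r where "r > 0" "tr_right (?k, s) (stack s ?k ?k ?k (adj (?k, s) x) x) = scale (complex_of_real r) (empty s)"
    using positive_definite[OF assms(2,3)] by auto
  moreover have "stack s ?k ?k ?k (adj (?k, s) x) x = Ins s 0 ?k ?k ?k (adj (?k, s) x) x"
    by (rule stack_eq_Ins) (use x' assms in simp_all)
  moreover have "tr_right (?k, s) (Ins s 0 ?k ?k ?k (adj (?k, s) x) x) = Ins s 0 0 (?k + ?k) 0 (adj (?k, s) x) x"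
    by (rule tr_right_Ins) (use x' assms in simp_all)
  ultimately show ?thesis unfolding m by auto
qed

lemma tr_dag_comp:
  assumes f: "arr s k l f" "f \<noteq> 0"
  shows "\<exists>r>0. tr_right (k, s) (Ins s 0 k l k (dag s k l f) f) = scale (complex_of_real r) (empty s)"
proof -
  have "tr_right (k, s) (Ins s 0 k l k (dag s k l f) f) = Ins s 0 0 (k + l) 0 (dag s k l f) f"
    by (rule tr_right_Ins) (use f adj_type in \<open>auto simp: arr_def\<close>)
  then show ?thesis using pairing_positive[of "k + l" f s] f unfolding arr_def by simp
qed

lemma tr_scale: "x \<in> \<P> (k, s) ==> tr_right (k, s) (scale a x) = scale a (tr_right (k, s) x)"
  and tr_zero: "tr_right (k, s) 0 = 0"
proof -
  have C: "inner (closure_tangle False k s) = [(k, s)]" by (simp add: closure_tangle_def)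
  show z: "tr_right (k, s) 0 = 0"
    using Z_multilinear[OF closure_planar[of k s], of "[]" 0 "[]" 0 1] C unfolding tr_right_def by simp
  show "tr_right (k, s) (scale a x) = scale a (tr_right (k, s) x)" if "x \<in> \<P> (k, s)"
    using Z_multilinear[OF closure_planar[of k s], of "[]" x "[]" 0 a] C that z unfolding tr_right_def by simp
qed

lemma dag_comp_nonzero:
  assumes f: "arr s k l f" "f \<noteq> 0"
  shows "Ins s 0 k l k (dag s k l f) f \<noteq> 0"
  using tr_dag_comp[OF f] tr_zero empty_nonzero by (metis of_real_eq_0_iff order_less_irrefl scale_eq_0_iff)

text \<open>
The last fact is minimality: every endomorphism of \<open>p\<close> is a multiple of \<open>p\<close>.
\<close>

lemma minimalD:
  assumes "(k, p) \<in> minimal_projections s"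
  shows "arr s k k p" "Ins s 0 k k k p p = p" "dag s k k p = p" "p \<noteq> 0"
    and "arr s k k f ==> Ins s 0 k k k p f = f ==> Ins s 0 k k k f p = f ==> \<exists>c. f = scale c p"
proof -
  have p: "p \<in> \<P> (k, s)" "stack s k k k p p = p" "adj (k, s) p = p" and d: "dim (Hom s (k, p) (k, p)) = 1"
    using assms unfolding minimal_projections_def by auto
  show ap: "arr s k k p" using p(1) unfolding arr_def by simp
  show pp: "Ins s 0 k k k p p = p" using stack_eq_Ins[of k k k p s p] p by simp
  show "dag s k k p = p" using p(3) by simp
  have Hom: "Hom s (k, p) (k, p) = {f \<in> \<P> (k, s). Ins s 0 k k k p (Ins s 0 k k k f p) = f}"
  proof -
    have "stack s k k k p (stack s k k k f p) = Ins s 0 k k k p (Ins s 0 k k k f p)" if f: "f \<in> \<P> (k, s)" for f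
    proof -
      have "stack s k k k f p = Ins s 0 k k k f p" using stack_eq_Ins[of k k k f s p] f p(1) by simp
      moreover have "Ins s 0 k k k f p \<in> \<P> (k, s)" using Ins_in[of k k 0 k f s p] f p(1) by simp
      ultimately show ?thesis using stack_eq_Ins[of k k k p s "Ins s 0 k k k f p"] p(1) by simp
    qed
    then show ?thesis unfolding Hom_def by auto
  qed
  show p0: "p \<noteq> 0"
  proof
    assume "p = 0"
    then have "f = 0" if "f \<in> Hom s (k, p) (k, p)" for f
      using that comp_scale(3)[OF ap arr_comp[of s k k f k p]] ap unfolding Hom arr_def by auto
    then show False using dim_one_nonzero[OF d] by blast
  qed
  show "\<exists>c. f = scale c p" if f: "arr s k k f" "Ins s 0 k k k p f = f" "Ins s 0 k k k f p = f"
  proof (rule dim_one[OF d _ _ p0])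
    show "p \<in> Hom s (k, p) (k, p)" "f \<in> Hom s (k, p) (k, p)"
      unfolding Hom using f pp p(1) by (simp_all add: arr_def)
  qed
qed

lemma proj_iso_iff:
  assumes P: "(k, p) \<in> minimal_projections s" and Q: "(l, q) \<in> minimal_projections s"
  shows "((k, p), (l, q)) \<in> proj_iso s \<longleftrightarrow>
    (\<exists>f. arr s k l f \<and> Ins s 0 l l k q f = f \<and> Ins s 0 l k k f p = f \<and>
      Ins s 0 k l k (dag s k l f) f = p \<and> Ins s 0 l k l f (dag s k l f) = q)"
proof -
  note p = minimalD(1,2)[OF P] and q = minimalD(1,2)[OF Q]
  have st: "stack s l m k f g = Ins s 0 l m k f g" if "arr s m l f" "arr s k m g" for l m k f g
    using stack_eq_Ins[of l m k f s g] that unfolding arr_def by (simp add: add.commute)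
  have H: "f \<in> Hom s (k, p) (l, q) \<longleftrightarrow> Ins s 0 l l k q f = f \<and> Ins s 0 l k k f p = f" if f: "arr s k l f" for f
  proof -
    have fp: "arr s k l (Ins s 0 l k k f p)" by (rule arr_comp[OF f p(1)])
    have "f \<in> Hom s (k, p) (l, q) \<longleftrightarrow> Ins s 0 l l k q (Ins s 0 l k k f p) = f"
      unfolding Hom_def using f st[OF f p(1)] st[OF q(1) fp] by (simp add: arr_def)
    also have "\<dots> \<longleftrightarrow> Ins s 0 l l k q f = f \<and> Ins s 0 l k k f p = f"
    proof
      assume *: "Ins s 0 l l k q (Ins s 0 l k k f p) = f"
      have "Ins s 0 l l k q f = Ins s 0 l l k q (Ins s 0 l l k q (Ins s 0 l k k f p))" unfolding * ..
      also have "\<dots> = f" using arr_assoc[OF q(1) q(1) fp] q(2) * by simp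
      finally have 1: "Ins s 0 l l k q f = f" .
      have "Ins s 0 l k k f p = Ins s 0 l k k (Ins s 0 l k k (Ins s 0 l l k q f) p) p"
        using * arr_assoc[OF q(1) f p(1)] by simp
      also have "\<dots> = Ins s 0 l k k f p" using 1 arr_assoc[OF f p(1) p(1)] p(2) by simp
      finally show "Ins s 0 l l k q f = f \<and> Ins s 0 l k k f p = f"
        using 1 * arr_assoc[OF q(1) f p(1)] by simp
    qed simp
    finally show ?thesis .
  qed
  show ?thesis
  proof
    assume "((k, p), (l, q)) \<in> proj_iso s"
    then obtain f where f: "even (k + l)" "f \<in> Hom s (k, p) (l, q)" "stack s k l k (dag s k l f) f = p"
      "stack s l k l f (dag s k l f) = q" unfolding proj_iso_def by auto
    then have a: "arr s k l f" unfolding Hom_def arr_def by auto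
    show "\<exists>f. arr s k l f \<and> Ins s 0 l l k q f = f \<and> Ins s 0 l k k f p = f \<and>
      Ins s 0 k l k (dag s k l f) f = p \<and> Ins s 0 l k l f (dag s k l f) = q"
      using a f(2-4) unfolding H[OF a] st[OF arr_dag[OF a] a] st[OF a arr_dag[OF a]] by blast
  next
    assume "\<exists>f. arr s k l f \<and> Ins s 0 l l k q f = f \<and> Ins s 0 l k k f p = f \<and>
      Ins s 0 k l k (dag s k l f) f = p \<and> Ins s 0 l k l f (dag s k l f) = q"
    then obtain f where a: "arr s k l f" and f: "Ins s 0 l l k q f = f \<and> Ins s 0 l k k f p = f"
      "Ins s 0 k l k (dag s k l f) f = p" "Ins s 0 l k l f (dag s k l f) = q" by blast
    then show "((k, p), (l, q)) \<in> proj_iso s"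
      unfolding proj_iso_def using P Q H[OF a] st[OF arr_dag[OF a] a] st[OF a arr_dag[OF a]] a
      by (auto simp: arr_def)
  qed
qed

text \<open>
Schur's lemma: for a non-zero \<open>g\<close> both \<open>g* g\<close> and \<open>g g*\<close> are multiples of the projections, by the
same constant. Comparing traces shows that it is positive, so \<open>g\<close> can be rescaled to an isometry.
\<close>

lemma proj_isoI:
  assumes P: "(k, p) \<in> minimal_projections s" and Q: "(l, q) \<in> minimal_projections s"
    and g: "arr s k l g" "g \<noteq> 0" "Ins s 0 l l k q g = g" "Ins s 0 l k k g p = g"
  shows "((k, p), (l, q)) \<in> proj_iso s"
proof -
  note p = minimalD[OF P] and q = minimalD[OF Q]
  let ?g = "dag s k l g"
  note g' = arr_dag[OF g(1)]
  have g'p: "Ins s 0 k k l p ?g = ?g" using dag_comp[OF g(1) p(1)] g(4) p(3) by simp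
  have g'q: "Ins s 0 k l l ?g q = ?g" using dag_comp[OF q(1) g(1)] g(3) q(3) by simp
  have ad: "arr s k k (Ins s 0 k l k ?g g)" "arr s l l (Ins s 0 l k l g ?g)" by (intro arr_comp g(1) g')+
  have "Ins s 0 k k k p (Ins s 0 k l k ?g g) = Ins s 0 k l k ?g g"
    using arr_assoc[OF p(1) g' g(1)] g'p by simp
  moreover have "Ins s 0 k k k (Ins s 0 k l k ?g g) p = Ins s 0 k l k ?g g"
    using arr_assoc[OF g' g(1) p(1)] g(4) by simp
  ultimately obtain c where c: "Ins s 0 k l k ?g g = scale c p" using p(5)[OF ad(1)] by blast
  have "Ins s 0 l l l q (Ins s 0 l k l g ?g) = Ins s 0 l k l g ?g"
    using arr_assoc[OF q(1) g(1) g'] g(3) by simp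
  moreover have "Ins s 0 l l l (Ins s 0 l k l g ?g) q = Ins s 0 l k l g ?g"
    using arr_assoc[OF g(1) g' q(1)] g'q by simp
  ultimately obtain c' where c': "Ins s 0 l k l g ?g = scale c' q" using q(5)[OF ad(2)] by blast
  have "scale c g = Ins s 0 l k k g (Ins s 0 k l k ?g g)" unfolding c comp_scale(2)[OF g(1) p(1)] g(4) ..
  also have "\<dots> = scale c' g" unfolding arr_assoc[OF g(1) g' g(1)] c' comp_scale(1)[OF q(1) g(1)] g(3) ..
  finally have cc: "c' = c" using g(2) by simp
  obtain r where r: "r > 0" "tr_right (k, s) (Ins s 0 k l k ?g g) = scale (complex_of_real r) (empty s)"
    using tr_dag_comp[OF g(1,2)] by blast
  obtain r' where r': "r' > 0" "tr_right (k, s) (Ins s 0 k k k (dag s k k p) p) = scale (complex_of_real r') (empty s)"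
    using tr_dag_comp[OF p(1,4)] by blast
  have "tr_right (k, s) p = scale (complex_of_real r') (empty s)" using r'(2) p(2,3) by simp
  then have "scale (complex_of_real r) (empty s) = scale (c * complex_of_real r') (empty s)"
    using r(2) unfolding c using tr_scale[of p k s c] p(1) by (simp add: arr_def)
  then have "complex_of_real r = c * complex_of_real r'" using empty_nonzero by simp
  then have "c = complex_of_real (r / r')" using r'(1) by (simp add: field_simps)
  moreover define t where "t = 1 / sqrt (r / r')"
  moreover have "t * t * (r / r') = 1"
    using real_sqrt_mult_self[of "r / r'"] r(1) r'(1) unfolding t_def by simp
  ultimately have t: "complex_of_real t * complex_of_real t * c = 1" by (metis of_real_mult of_real_1)
  let ?f = "scale (complex_of_real t) g"
  have f: "arr s k l ?f" by (rule arr_scale[OF g(1)])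
  have df: "dag s k l ?f = scale (complex_of_real t) ?g" using dag_scale[OF g(1)] by simp
  have tg: "arr s l k (scale (complex_of_real t) ?g)" by (rule arr_scale[OF g'])
  have "Ins s 0 k l k (dag s k l ?f) ?f = p"
    unfolding df comp_scale(2)[OF tg g(1)] comp_scale(1)[OF g' g(1)] c using t by (simp add: mult.assoc)
  moreover have "Ins s 0 l k l ?f (dag s k l ?f) = q"
    unfolding df comp_scale(2)[OF f g'] comp_scale(1)[OF g(1) g'] c' cc using t by (simp add: mult.assoc)
  moreover have "Ins s 0 l l k q ?f = ?f" "Ins s 0 l k k ?f p = ?f"
    using comp_scale(2)[OF q(1) g(1)] comp_scale(1)[OF g(1) p(1)] g(3,4) by simp_all
  ultimately show ?thesis unfolding proj_iso_iff[OF P Q] using f by blast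
qed

end

section \<open>Words of minimal projections\<close>

context coloured_strands
begin

lemma coloured_arr: "coloured s w (l + k) f ==> arr s k l f"
  unfolding coloured_def arr_def by (simp add: add.commute)

lemma coloured_comp:
  assumes f: "coloured s w (length w + l) f" and g: "arr s k l g"
  shows "coloured s w (length w + k) (Ins s 0 (length w) l k f g)"
proof -
  note f' = coloured_arr[OF f]
  have "point_coloured s (length w + k) i (w ! i) (Ins s 0 (length w) l k f g)" if "i < length w" for i
    using point_coloured_inside[of "length w" l 0 k f s g i "w ! i"] colouredD(4)[OF f that] that f' g
    unfolding arr_def by (simp add: add.commute)
  then show ?thesis
    using arr_comp[OF f' g] unfolding coloured_def arr_def by (simp add: add.commute)
qed

text \<open>
If the top of \<open>y\<close> is coloured, its colours can be slid one after the other to the bottom of a map \<open>h\<close>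
composed with it. The adjoint of a coloured map is thus made coloured although the colours are not
assumed to be self-adjoint.
\<close>

lemma slide_colours:
  assumes h: "arr s l c h" and y: "coloured s w (l + d) y" and l: "length w = l"
  shows "\<exists>D. arr s l c D \<and> Ins s 0 c l d D y = Ins s 0 c l d h y \<and>
    (\<forall>i<l. point_coloured s (c + l) (c + (l - 1 - i)) (\<not> w ! i) D) \<and>
    (\<forall>q. arr s c c q --> Ins s 0 c c l q h = h --> Ins s 0 c c l q D = D)"
proof -
  have "\<exists>D. arr s l c D \<and> Ins s 0 c l d D y = Ins s 0 c l d h y \<and>
    (\<forall>i<t. point_coloured s (c + l) (c + (l - 1 - i)) (\<not> w ! i) D) \<and>
    (\<forall>q. arr s c c q --> Ins s 0 c c l q h = h --> Ins s 0 c c l q D = D)" if "t \<le> l" for t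
    using that
  proof (induction t)
    case 0
    then show ?case using h by auto
  next
    case (Suc t)
    then obtain D where D: "arr s l c D" "Ins s 0 c l d D y = Ins s 0 c l d h y"
      "\<forall>i<t. point_coloured s (c + l) (c + (l - 1 - i)) (\<not> w ! i) D"
      "\<forall>q. arr s c c q --> Ins s 0 c c l q h = h --> Ins s 0 c c l q D = D" by auto
    define r where "r = l - 1 - t"
    have lt: "l = t + 1 + r" using Suc.prems by (simp add: r_def)
    have lc: "l + c = c + (t + 1 + r)" "l + d = t + 1 + r + d" using lt by simp_all
    have evl: "even (c + (t + 1 + r))" "even (t + 1 + r + d)" and P: "D \<in> \<P> ((c + (t + 1 + r)) div 2, s)" "y \<in> \<P> ((t + 1 + r + d) div 2, s)"
      using D(1)[unfolded arr_def lc] colouredD(1,3)[OF y, unfolded lc] by blast+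
    have sz: "c + (t + 1 + r) = c + r + 1 + t" by simp
    have sh: "(\<not> (s \<noteq> odd t)) = (s \<noteq> odd (c + r))" using evl by auto
    define D' where "D' = cut s (c + r) t (\<not> w ! t) D"
    have D'_in: "D' \<in> \<P> ((c + r + 1 + t) div 2, s)"
      unfolding D'_def by (rule cut_in[OF evl(1)[unfolded sz] P(1)[unfolded sz]])
    have "cut s t (r + d) (w ! t) y = y"
      using colouredD(4)[OF y, of t] l lt unfolding point_coloured_def by simp
    then have "Ins s 0 c l d D' y = Ins s 0 c l d D y"
      using Ins_slide[OF evl P(1) e_in P(2), of "w ! t"] sh unfolding lt D'_def e_click by simp
    moreover have "arr s l c D'" using D'_in evl unfolding arr_def lt by (simp add: ac_simps)
    moreover have "point_coloured s (c + l) (c + (l - 1 - i)) (\<not> w ! i) D'" if i: "i < Suc t" for i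
    proof (cases "i = t")
      case True
      have 1: "c + l - Suc (c + r) = t" "l - 1 - t = r" using lt by simp_all
      show ?thesis
        using cut_cut[of "c + r" t D s "\<not> w ! t" "\<not> w ! t"] evl P(1) unfolding True 1 point_coloured_def D'_def sz by simp
    next
      case False
      let ?j = "c + (l - 1 - i)"
      have i': "c + r < ?j" "?j + i - (c + r) = t" "?j + 1 + i = c + (t + 1 + r)" "c + l - Suc ?j = i"
        using False i lt by simp_all
      have "point_coloured s (c + l) ?j (\<not> w ! i) D" using D(3) False i by simp
      then have "cut s ?j i (\<not> w ! i) D = D" unfolding point_coloured_def i'(4) .
      then show ?thesis
        using cut_commute[OF i'(1), of i D s "\<not> w ! t" "\<not> w ! i"] evl(1) P(1)
        unfolding i'(2,3) point_coloured_def i'(4) D'_def by simp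
    qed
    moreover have "Ins s 0 c c l q D' = D'" if q: "arr s c c q" "Ins s 0 c c l q h = h" for q
    proof -
      have "Ins s 0 c c l q D = D" using D(4) q by blast
      moreover have "Ins s 0 c c (r + 1 + t) q (cut s (c + r) t (\<not> w ! t) D) =
          cut s (c + r) t (\<not> w ! t) (Ins s 0 c c (r + 1 + t) q D)"
        using Ins_parallel[of c c 1 1 0 r t q s "e (s \<noteq> odd (c + r)) (\<not> w ! t)" D] q(1) evl(1)[unfolded sz] P(1)[unfolded sz] e_in
        unfolding arr_def by simp
      moreover have "r + 1 + t = l" using lt by simp
      ultimately show ?thesis unfolding D'_def by simp
    qed
    ultimately show ?case using D(2) by (intro exI[of _ D']) simp
  qed
  from this[of l] show ?thesis by simp
qed

text \<open>
The words that colour the top of some non-zero map starting at the projection \<open>p\<close>.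
\<close>

definition words :: "bool => nat => 'v => bool list set" where
  "words s k p = {w. \<exists>f. coloured s w (length w + k) f \<and> f \<noteq> 0 \<and> Ins s 0 (length w) k k f p = f}"

lemma Ins_comp:
  assumes "even (c + b)" "even (j + b + q + k)" "arr s k k z"
    and "x \<in> \<P> ((c + b) div 2, s \<noteq> odd j)" "y \<in> \<P> ((j + b + q + k) div 2, s)"
  shows "Ins s j c b (q + k) x (Ins s 0 (j + b + q) k k y z) = Ins s 0 (j + c + q) k k (Ins s j c b (q + k) x y) z"
  using Ins_nested[of c b j q k 0 k x s y z] assms unfolding arr_def by simp

lemma words_cancel:
  assumes p: "arr s k k p" and w: "u @ a # (\<not> a) # v \<in> words s k p"
  shows "u @ v \<in> words s k p"
proof -
  let ?j = "length u" and ?q = "length v"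
  have l: "length (u @ a # (\<not> a) # v) + k = ?j + 2 + (?q + k)" by simp
  obtain f where f: "coloured s (u @ a # (\<not> a) # v) (?j + 2 + (?q + k)) f" "f \<noteq> 0"
    "Ins s 0 (?j + 2 + ?q) k k f p = f"
    using w unfolding words_def mem_Collect_eq l by (auto simp: add.assoc)
  note g = coloured_cap[OF f(1)]
  let ?g = "cap s ?j (?q + k) a f"
  have "?g = Ins s 0 (?j + 0 + ?q) k k ?g p"
    using Ins_comp[of 0 2 ?j ?q k s p "e (s \<noteq> odd ?j) a" f] f(3) p e_in colouredD(1,3)[OF f(1)] by (simp add: add.assoc)
  moreover have "?g \<noteq> 0"
  proof
    assume "?g = 0"
    then have "f = cup s ?j (?q + k) a 0" using g(2) by simp
    then show False
      using Ins_zero_second[of 2 0 ?j "?q + k" "e (s \<noteq> odd ?j) a" s 0] e_in colouredD(1)[OF g(1)] f(2) by simp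
  qed
  ultimately show ?thesis using g(1) unfolding words_def by (intro CollectI exI[of _ ?g]) (simp add: add.assoc)
qed

lemma words_insert:
  assumes p: "arr s k k p" and w: "u @ v \<in> words s k p"
  shows "u @ a # (\<not> a) # v \<in> words s k p"
proof -
  let ?j = "length u" and ?q = "length v"
  obtain f where f: "coloured s (u @ v) (?j + (?q + k)) f" "f \<noteq> 0" "Ins s 0 (?j + ?q) k k f p = f"
    using w unfolding words_def by (auto simp: add.assoc)
  note g = coloured_cup[OF f(1), of a]
  let ?g = "cup s ?j (?q + k) a f"
  have "?g = Ins s 0 (?j + 2 + ?q) k k ?g p"
    using Ins_comp[of 2 0 ?j ?q k s p "e (s \<noteq> odd ?j) a" f] f(3) p e_in colouredD(1,3)[OF f(1)] by (simp add: add.assoc)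
  moreover have "?g \<noteq> 0"
  proof
    assume "?g = 0"
    then have "f = cap s ?j (?q + k) a 0" using g(2) by simp
    then show False
      using Ins_zero_second[of 0 2 ?j "?q + k" "e (s \<noteq> odd ?j) a" s 0] e_in colouredD(1)[OF g(1)] f(2) by simp
  qed
  ultimately show ?thesis using g(1) unfolding words_def by (intro CollectI exI[of _ ?g]) (simp add: add.assoc)
qed

lemma words_balance:
  assumes "arr s k k p" "w \<in> words s k p" "balance w = balance w'"
  shows "w' \<in> words s k p"
  by (rule word_transport[of "\<lambda>w. w \<in> words s k p", OF _ _ assms(2,3)])
    (use words_cancel[OF assms(1)] words_insert[OF assms(1)] in blast)+

text \<open>
Pairing \<open>v\<close> with its adjoint shows that juxtaposing \<open>v\<close> is injective.
\<close>

lemma words_prefix: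
  assumes p: "arr s k k p" and w: "w \<in> words s k p" and v: "coloured s u (length u) v" "v \<noteq> 0"
  shows "u @ w \<in> words s k p"
proof -
  let ?m = "length u" and ?q = "length w"
  obtain f where f: "coloured s w (?q + k) f" "f \<noteq> 0" "Ins s 0 ?q k k f p = f"
    using w unfolding words_def by auto
  let ?g = "Ins s 0 ?m 0 (?q + k) v f"
  note ev = colouredD(1)[OF v(1)] colouredD(1)[OF f(1)] and P = colouredD(3)[OF v(1)] colouredD(3)[OF f(1)]
  have "coloured s (u @ w) (?m + ?q + k) ?g"
    using coloured_insert[of s "[]" "[]" w "?q + k" f u v] f(1) v(1) by (simp add: add.assoc)
  moreover have "?g = Ins s 0 (0 + ?m + ?q) k k ?g p"
    using Ins_comp[of ?m 0 0 ?q k s p v f] f(3) p ev P by simp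
  moreover have "?g \<noteq> 0"
  proof
    assume g: "?g = 0"
    let ?v = "adj (?m div 2, s) v"
    have v': "?v \<in> \<P> (?m div 2, s)" by (rule adj_type[OF P(1)])
    obtain r where r: "r > 0" "Ins s 0 0 ?m 0 ?v v = scale (complex_of_real r) (empty s)"
      using pairing_positive[OF ev(1) P(1) v(2)] by blast
    have "0 = Ins s 0 0 ?m (?q + k) ?v ?g"
      unfolding g using Ins_zero_second[of 0 ?m 0 "?q + k" ?v s 0] v' ev by simp
    also have "\<dots> = Ins s 0 0 0 (?q + k) (Ins s 0 0 ?m 0 ?v v) f"
      using Ins_nested[of 0 ?m 0 0 0 0 "?q + k" ?v s v f] v' ev P by simp
    also have "\<dots> = scale (complex_of_real r) (Ins s 0 0 0 (?q + k) (empty s) f)"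
      unfolding r(2) using Ins_scale_first[of 0 0 0 "?q + k" "empty s" s f] one_in[of 0 s] ev P by (simp add: empty_def)
    also have "Ins s 0 0 0 (?q + k) (empty s) f = f" using Ins_empty[of 0 "?q + k" f s] ev P by simp
    finally show False using r(1) f(2) by simp
  qed
  ultimately show ?thesis unfolding words_def by (intro CollectI exI[of _ ?g]) simp
qed

lemma words_nonempty:
  assumes "(k, p) \<in> minimal_projections s"
  shows "words s k p \<noteq> {}"
proof -
  note p = minimalD[OF assms]
  have "\<exists>w f. length w = j \<and> coloured s w (k + k) f \<and> f \<noteq> 0 \<and> Ins s 0 k k k f p = f" if "j \<le> k" for j
    using that
  proof (induction j)
    case 0
    have "coloured s [] (k + k) p" using p(1) unfolding coloured_def arr_def by simp
    then show ?case using p(2,4) by (intro exI[of _ "[]"] exI[of _ p]) simp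
  next
    case (Suc j)
    then obtain w f where w: "length w = j" "coloured s w (k + k) f" "f \<noteq> 0" "Ins s 0 k k k f p = f" by auto
    let ?f = "\<lambda>a. cut s j (k + k - Suc j) a f"
    have sp: "coloured s (w @ [a]) (k + k) (?f a)" for a
      using coloured_split(1)[OF w(2), of a] w(1) Suc.prems by simp
    have "f = ?f True + ?f False" using coloured_split(2)[OF w(2)] w(1) Suc.prems by simp
    then obtain a where a: "?f a \<noteq> 0" using w(3) by (metis add.right_neutral)
    have q: "k + k - Suc j = k - Suc j + k" "j + 1 + (k - Suc j) = k" using Suc.prems by simp_all
    have "Ins s 0 k k k (?f a) p = ?f a"
      using Ins_comp[of 1 1 j "k - Suc j" k s p "e (s \<noteq> odd j) a" f, unfolded q(2)] e_in p(1) colouredD(1,3)[OF w(2)] w(4)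
      unfolding q(1) by simp
    then show ?case using sp[of a] a w(1) by (intro exI[of _ "w @ [a]"] exI[of _ "?f a"]) simp
  qed
  from this[of k] show ?thesis unfolding words_def by auto
qed

text \<open>
Let \<open>F\<close> and \<open>F'\<close> be maps from the two projections to the common word, and \<open>D\<close>, \<open>D'\<close> coloured
versions of their adjoints, so \<open>D F = c p\<close> with \<open>c \<noteq> 0\<close>. The elements \<open>F D\<close> and \<open>F' D'\<close> are both
coloured by \<open>w\<close> followed by its reversed opposite, a word of sum zero; hence they are proportional.
Therefore \<open>F' (D' F) D\<close> is a non-zero multiple of \<open>F D\<close>, so \<open>D' F\<close> is a non-zero map between the projections.
\<close>

lemma common_word:
  assumes P: "(k, p) \<in> minimal_projections s" and Q: "(k', p') \<in> minimal_projections s"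
    and w: "w \<in> words s k p" "w \<in> words s k' p'"
  shows "((k, p), (k', p')) \<in> proj_iso s"
proof -
  let ?l = "length w"
  have half: "\<exists>F D B c. arr s k ?l F \<and> Ins s 0 ?l k k F p = F \<and> arr s ?l k D \<and> Ins s 0 k k ?l p D = D \<and>
      c \<noteq> 0 \<and> Ins s 0 k ?l k D F = scale c p \<and> B = Ins s 0 ?l k ?l F D \<and> B \<noteq> 0 \<and> Ins s 0 ?l ?l ?l B B = scale c B \<and>
      coloured s (w @ rev (map Not w)) (?l + ?l) B"
    if P: "(k, p) \<in> minimal_projections s" and w: "w \<in> words s k p" for k p
  proof -
    note p = minimalD[OF P]
    obtain F where F: "coloured s w (?l + k) F" "F \<noteq> 0" "Ins s 0 ?l k k F p = F" using w unfolding words_def by blast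
    note aF = coloured_arr[OF F(1)]
    note aF' = arr_dag[OF aF]
    from slide_colours[OF aF' F(1) refl] obtain D where D: "arr s ?l k D" "Ins s 0 k ?l k D F = Ins s 0 k ?l k (dag s k ?l F) F"
      "\<forall>i<?l. point_coloured s (k + ?l) (k + (?l - 1 - i)) (\<not> w ! i) D"
      "\<forall>q. arr s k k q --> Ins s 0 k k ?l q (dag s k ?l F) = dag s k ?l F --> Ins s 0 k k ?l q D = D"
      by (elim exE conjE)
    have "Ins s 0 k k ?l p (dag s k ?l F) = dag s k ?l F" using dag_comp[OF aF p(1)] F(3) p(3) by simp
    then have pD: "Ins s 0 k k ?l p D = D" using D(4) p(1) by blast
    have DF: "Ins s 0 k k k p (Ins s 0 k ?l k D F) = Ins s 0 k ?l k D F"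
      "Ins s 0 k k k (Ins s 0 k ?l k D F) p = Ins s 0 k ?l k D F"
      using arr_assoc[OF p(1) D(1) aF] pD arr_assoc[OF D(1) aF p(1)] F(3) by simp_all
    obtain c where c: "Ins s 0 k ?l k D F = scale c p" using p(5)[OF arr_comp[OF D(1) aF] DF] by blast
    have c0: "c \<noteq> 0" using dag_comp_nonzero[OF aF F(2)] D(2) c by auto
    let ?B = "Ins s 0 ?l k ?l F D"
    have aB: "arr s ?l ?l ?B" by (rule arr_comp[OF aF D(1)])
    have DB: "Ins s 0 k ?l ?l D ?B = scale c D"
      unfolding arr_assoc[OF D(1) aF D(1)] c comp_scale(1)[OF p(1) D(1)] pD ..
    have BB: "Ins s 0 ?l ?l ?l ?B ?B = scale c ?B"
      using arr_assoc[OF aF D(1) aB] DB comp_scale(2)[OF aF D(1), of c] by simp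
    have D0: "D \<noteq> 0" using c c0 p(4) comp_scale(3)[OF D(1) aF] by auto
    have B0: "?B \<noteq> 0" using DB c0 D0 comp_scale(4)[OF D(1) aB] by auto
    have "point_coloured s (?l + ?l) i ((w @ rev (map Not w)) ! i) ?B" if i: "i < ?l + ?l" for i
    proof (cases "i < ?l")
      case True
      then show ?thesis using colouredD(4)[OF coloured_comp[OF F(1) D(1)], of i] by (simp add: nth_append)
    next
      case False
      define i' where "i' = i - ?l"
      have i': "i = ?l + i'" "i' < ?l" "?l - 1 - (?l - 1 - i') = i'" "?l - 1 - i' < ?l" using False i by (simp_all add: i'_def)
      have "point_coloured s (k + ?l) (k + i') (\<not> w ! (?l - 1 - i')) D" using D(3)[rule_format, OF i'(4)] unfolding i'(3) .
      then have "point_coloured s (?l + ?l) (?l + i') (\<not> w ! (?l - 1 - i')) ?B"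
        using point_coloured_after[of ?l k 0 ?l F s D i' "\<not> w ! (?l - 1 - i')"] i'(2) aF D(1)
        unfolding arr_def by (simp add: add.commute)
      then show ?thesis using i'(2,4) unfolding i'(1) by (simp add: nth_append rev_nth)
    qed
    then have "coloured s (w @ rev (map Not w)) (?l + ?l) ?B" using aB unfolding coloured_def arr_def by simp
    then show ?thesis using aF F(3) D(1) pD c0 c B0 BB by blast
  qed
  obtain F D B c where 1: "arr s k ?l F" "Ins s 0 ?l k k F p = F" "arr s ?l k D" "Ins s 0 k k ?l p D = D"
      "c \<noteq> 0" "B = Ins s 0 ?l k ?l F D" "B \<noteq> 0" "Ins s 0 ?l ?l ?l B B = scale c B"
      "coloured s (w @ rev (map Not w)) (?l + ?l) B" using half[OF P w(1)] by blast
  obtain F' D' B' c' where 2: "arr s k' ?l F'" "Ins s 0 ?l k' k' F' p' = F'" "arr s ?l k' D'" "Ins s 0 k' k' ?l p' D' = D'"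
      "c' \<noteq> 0" "B' = Ins s 0 ?l k' ?l F' D'" "B' \<noteq> 0" "Ins s 0 ?l ?l ?l B' B' = scale c' B'"
      "coloured s (w @ rev (map Not w)) (?l + ?l) B'" using half[OF Q w(2)] by blast
  note p = minimalD[OF P] and p' = minimalD[OF Q]
  have "\<exists>r. B' = scale r B"
    by (rule balanced_unique[of s "w @ rev (map Not w)"]) (use 1(7,9) 2(9) in simp_all)
  then obtain r where r: "B' = scale r B" by blast
  then have r0: "r \<noteq> 0" using 2(7) by auto
  let ?G = "Ins s 0 k' ?l k D' F"
  have G: "arr s k k' ?G" by (rule arr_comp[OF 2(3) 1(1)])
  have aB: "arr s ?l ?l B" unfolding 1(6) by (rule arr_comp[OF 1(1,3)])
  have "?G \<noteq> 0"
  proof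
    assume "?G = 0"
    then have "Ins s 0 ?l k' k F' ?G = 0" using comp_scale(4)[OF 2(1) G] by simp
    then have "Ins s 0 ?l ?l k B' F = 0" using arr_assoc[OF 2(1,3) 1(1)] 2(6) by simp
    then have "Ins s 0 ?l ?l k B F = 0" using r r0 comp_scale(1)[OF aB 1(1), of r] by simp
    then have "Ins s 0 ?l k ?l (Ins s 0 ?l ?l k B F) D = 0"
      using comp_scale(3)[OF arr_comp[OF aB 1(1)] 1(3)] by simp
    then have "Ins s 0 ?l ?l ?l B B = 0" using arr_assoc[OF aB 1(1,3)] 1(6) by simp
    then show False using 1(5,7,8) by simp
  qed
  moreover have "Ins s 0 k' k' k p' ?G = ?G" using arr_assoc[OF p'(1) 2(3) 1(1)] 2(4) by simp
  moreover have "Ins s 0 k' k k ?G p = ?G" using arr_assoc[OF 2(3) 1(1) p(1)] 1(2) by simp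
  ultimately show ?thesis by (intro proj_isoI[OF P Q G])
qed

lemma words_iso:
  assumes iso: "((k, p), (l, q)) \<in> proj_iso s" and w: "w \<in> words s k p"
  shows "w \<in> words s l q"
proof -
  have P: "(k, p) \<in> minimal_projections s" and Q: "(l, q) \<in> minimal_projections s"
    using iso unfolding proj_iso_def by auto
  note p = minimalD[OF P] and q = minimalD[OF Q]
  obtain f where f: "arr s k l f" "Ins s 0 l l k q f = f" "Ins s 0 k l k (dag s k l f) f = p"
    using iso unfolding proj_iso_iff[OF P Q] by blast
  note f' = arr_dag[OF f(1)]
  have fq: "Ins s 0 k l l (dag s k l f) q = dag s k l f" using dag_comp[OF q(1) f(1)] f(2) q(3) by simp
  let ?n = "length w"
  obtain F where F: "coloured s w (?n + k) F" "F \<noteq> 0" "Ins s 0 ?n k k F p = F" using w unfolding words_def by blast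
  note aF = coloured_arr[OF F(1)]
  let ?G = "Ins s 0 ?n k l F (dag s k l f)"
  have "coloured s w (?n + l) ?G" by (rule coloured_comp[OF F(1) f'])
  moreover have "Ins s 0 ?n l l ?G q = ?G" using arr_assoc[OF aF f' q(1)] fq by simp
  moreover have "?G \<noteq> 0"
  proof
    assume "?G = 0"
    then have "Ins s 0 ?n l k ?G f = 0" using comp_scale(3)[OF arr_comp[OF aF f'] f(1)] by simp
    then show False using arr_assoc[OF aF f' f(1)] f(3) F(2,3) by simp
  qed
  ultimately show ?thesis unfolding words_def by blast
qed

text \<open>
Two projections whose words have the same sum modulo \<open>m\<close> have a common word, since prefixing powers of
the word of \<open>v\<close> to one or the other makes the sums equal. As only one direction is available,
the prefixes are distributed according to the sign of the difference.
\<close>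

lemma card_vertices_le:
  assumes v: "coloured s (replicate m a) m v" "v \<noteq> 0" and m: "0 < m"
  shows "card (graph_vertices s) \<le> m"
proof -
  have pump: "\<exists>w'\<in>words s k p. balance w' = balance w + int t * (if a then int m else - int m)"
    if p: "arr s k k p" and w: "w \<in> words s k p" for k p w t
  proof (induction t)
    case 0
    then show ?case using w by auto
  next
    case (Suc t)
    then obtain w' where w': "w' \<in> words s k p" "balance w' = balance w + int t * (if a then int m else - int m)" by blast
    have "replicate m a @ w' \<in> words s k p" using words_prefix[OF p w'(1), of "replicate m a" v] v by simp
    moreover have "balance (replicate m a @ w') = balance w + int (Suc t) * (if a then int m else - int m)"
      using w'(2) by (simp add: algebra_simps)
    ultimately show ?case by blast
  qed
  have ex: "\<exists>k p w. (k, p) \<in> minimal_projections s \<and> C = proj_iso s `` {(k, p)} \<and> w \<in> words s k p"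
    if C: "C \<in> graph_vertices s" for C
  proof -
    obtain kp where "kp \<in> minimal_projections s" "C = proj_iso s `` {kp}"
      using C unfolding graph_vertices_def quotient_def by blast
    moreover obtain k p where "kp = (k, p)" by (cases kp)
    ultimately show ?thesis using words_nonempty by blast
  qed
  define K where "K C = (SOME (k, p, w). (k, p) \<in> minimal_projections s \<and> C = proj_iso s `` {(k, p)} \<and> w \<in> words s k p)" for C
  have K: "case K C of (k, p, w) => (k, p) \<in> minimal_projections s \<and> C = proj_iso s `` {(k, p)} \<and> w \<in> words s k p"
    if "C \<in> graph_vertices s" for C
    unfolding K_def by (rule someI_ex) (use ex[OF that] in auto)
  define \<rho> where "\<rho> C = (case K C of (k, p, w) => balance w mod int m)" for C
  have "inj_on \<rho> (graph_vertices s)"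
  proof (rule inj_onI)
    fix C C' assume C: "C \<in> graph_vertices s" "C' \<in> graph_vertices s" "\<rho> C = \<rho> C'"
    obtain k p w where 1: "K C = (k, p, w)" by (cases "K C")
    obtain k' p' w' where 2: "K C' = (k', p', w')" by (cases "K C'")
    have P: "(k, p) \<in> minimal_projections s" "C = proj_iso s `` {(k, p)}" "w \<in> words s k p" using K[OF C(1)] 1 by auto
    have Q: "(k', p') \<in> minimal_projections s" "C' = proj_iso s `` {(k', p')}" "w' \<in> words s k' p'" using K[OF C(2)] 2 by auto
    note ap = minimalD(1)[OF P(1)] and aq = minimalD(1)[OF Q(1)]
    have "balance w' mod int m = balance w mod int m" using C(3) 1 2 unfolding \<rho>_def by simp
    then have "int m dvd balance w' - balance w" by (simp add: mod_eq_dvd_iff)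
    then obtain z where "balance w' - balance w = int m * z" by (rule dvdE)
    then have z: "balance w' = balance w + int m * z" by simp
    define t t' where "t = nat (if a then z else - z)" and "t' = nat (if a then - z else z)"
    obtain u where u: "u \<in> words s k p" "balance u = balance w + int t * (if a then int m else - int m)"
      using pump[OF ap P(3)] by blast
    obtain u' where u': "u' \<in> words s k' p'" "balance u' = balance w' + int t' * (if a then int m else - int m)"
      using pump[OF aq Q(3)] by blast
    have "balance u = balance u'"
      unfolding u(2) u'(2) z t_def t'_def by (cases "z \<ge> 0") (simp_all add: algebra_simps)
    then have u: "u \<in> words s k' p'" "u \<in> words s k p" using words_balance[OF aq u'(1)] u(1) by simp_all
    have sub: "proj_iso s `` {(k, p)} \<subseteq> proj_iso s `` {(k', p')}"
      if "(k', p') \<in> minimal_projections s" "u \<in> words s k p" "u \<in> words s k' p'" for k p k' p'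
    proof
      fix r assume r: "r \<in> proj_iso s `` {(k, p)}"
      obtain l q where lq: "r = (l, q)" by (cases r)
      have "(l, q) \<in> minimal_projections s" using r unfolding lq proj_iso_def by auto
      moreover have "u \<in> words s l q" using words_iso[of k p l q s u] r that(2) unfolding lq by blast
      ultimately show "r \<in> proj_iso s `` {(k', p')}" using common_word[OF that(1) _ that(3)] unfolding lq by blast
    qed
    show "C = C'" unfolding P(2) Q(2) using sub[OF Q(1) u(2,1)] sub[OF P(1) u] by blast
  qed
  moreover have "\<rho> ` graph_vertices s \<subseteq> {0..<int m}" using m unfolding \<rho>_def by (auto split: prod.splits)
  ultimately show ?thesis using card_inj_on_le[of \<rho> "graph_vertices s" "{0..<int m}"] by simp
qed

end

section \<open>Generation\<close>

context planar_algebra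
begin

definition diagrams :: "(btype \<times> 'v) set => btype => 'v set" where
  "diagrams G t = {Z T xs | T xs. planar_tangle T \<and> outer T = t \<and> list_all2 (\<lambda>x t. (t, x) \<in> G) xs (inner T)}"

lemma generates_iff: "generates G \<longleftrightarrow> (\<forall>t. \<P> t \<subseteq> span (diagrams G t))"
  unfolding generates_def diagrams_def ..

context
  fixes G :: "(btype \<times> 'v) set"
  assumes typed: "!!t x. (t, x) \<in> G ==> x \<in> \<P> t"
begin

lemma diagrams_in: "diagrams G t \<subseteq> \<P> t"
proof
  fix x assume "x \<in> diagrams G t"
  then obtain T xs where T: "x = Z T xs" "planar_tangle T" "outer T = t" and xs: "list_all2 (\<lambda>x t. (t, x) \<in> G) xs (inner T)"
    unfolding diagrams_def by blast
  have "list_all2 (\<lambda>x t. x \<in> \<P> t) xs (inner T)" by (rule list_all2_mono[OF xs], erule typed)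
  then show "x \<in> \<P> t" using Z_type[of T xs] T by simp
qed

lemma span_diagrams_in: "span (diagrams G t) \<subseteq> \<P> t"
  by (rule span_minimal[OF diagrams_in subspace_P])

text \<open>
Linear combinations of diagrams are plugged into the boxes \<open>us\<close> from right to left, while the boxes
\<open>ts\<close> already carry generators. By linearity the entry of the last box of \<open>us\<close> is a diagram, which
becomes part of the tangle.
\<close>

lemma plug_partial:
  assumes "planar_tangle T" "inner T = us @ ts" "list_all2 (\<lambda>x t. x \<in> span (diagrams G t)) xs us"
    "list_all2 (\<lambda>x t. (t, x) \<in> G) zs ts"
  shows "Z T (xs @ zs) \<in> span (diagrams G (outer T))"
  using assms
proof (induction us arbitrary: T ts xs zs rule: rev_induct)
  case Nil
  then have "Z T (xs @ zs) \<in> diagrams G (outer T)" unfolding diagrams_def by auto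
  then show ?case by (rule span_base)
next
  case (snoc u us)
  obtain xs' x where xs: "xs = xs' @ [x]" "list_all2 (\<lambda>x t. x \<in> span (diagrams G t)) xs' us" "x \<in> span (diagrams G u)"
    using snoc.prems(3) by (auto simp: list_all2_append2 list_all2_Cons2)
  have len: "length xs' = length us" using xs(2) by (rule list_all2_lengthD)
  have P: "list_all2 (\<lambda>x t. x \<in> \<P> t) xs' us" "list_all2 (\<lambda>x t. x \<in> \<P> t) zs ts"
    by (rule list_all2_mono[OF xs(2)], erule subsetD[OF span_diagrams_in])
      (rule list_all2_mono[OF snoc.prems(4)], erule typed)
  have all: "list_all2 (\<lambda>x t. x \<in> \<P> t) (xs' @ y # zs) (inner T)" if "y \<in> \<P> u" for y
    unfolding snoc.prems(2) using P that by (simp add: list_all2_appendI)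
  have base: "Z T (xs' @ y # zs) \<in> span (diagrams G (outer T))" if y: "y \<in> diagrams G u" for y
  proof -
    obtain S ys where S: "y = Z S ys" "planar_tangle S" "outer S = u" "list_all2 (\<lambda>x t. (t, x) \<in> G) ys (inner S)"
      using y unfolding diagrams_def by blast
    have i: "Suc (length us) \<in> {1..length (inner T)}" "box T (Suc (length us)) = outer S"
      using snoc.prems(2) S(3) by (simp_all add: box_def)
    obtain R where R: "composite T (Suc (length us)) S R" "planar_tangle R"
      using composite_exists[OF snoc.prems(1) S(2) i] by blast
    have oi: "outer R = outer T" "inner R = us @ (inner S @ ts)"
      using R(1) snoc.prems(2) unfolding composite_def by simp_all
    have ys: "list_all2 (\<lambda>x t. x \<in> \<P> t) ys (inner S)" by (rule list_all2_mono[OF S(4)], erule typed)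
    have "Z R (xs' @ (ys @ zs)) \<in> span (diagrams G (outer R))"
      by (rule snoc.IH[OF R(2) oi(2) xs(2)]) (use S(4) snoc.prems(4) in \<open>simp add: list_all2_appendI\<close>)
    moreover have "Z R (xs' @ ys @ zs) = Z T (xs' @ Z S ys # zs)"
      by (rule Z_composite[OF snoc.prems(1) S(2) R(2,1)]) (use len P ys oi(2) in \<open>simp_all add: list_all2_appendI\<close>)
    ultimately show ?thesis using S(1) oi(1) by simp
  qed
  have lin: "Z T (xs' @ (scale c y + y') # zs) = scale c (Z T (xs' @ y # zs)) + Z T (xs' @ y' # zs)"
    if "y \<in> \<P> u" "y' \<in> \<P> u" for c y y'
    by (rule Z_multilinear[OF snoc.prems(1) all[OF that(1)] all[OF that(2)]])
  have z: "Z T (xs' @ 0 # zs) = 0" using lin[of 0 0 1] by simp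
  have "x \<in> \<P> u \<and> Z T (xs' @ x # zs) \<in> span (diagrams G (outer T))"
    using xs(3)
  proof (induction rule: span_induct_alt)
    case base
    then show ?case using z by (simp add: span_zero)
  next
    case (step c y y')
    have y: "y \<in> \<P> u" using step(1) diagrams_in by blast
    have "Z T (xs' @ y # zs) \<in> span (diagrams G (outer T))" by (rule base[OF step(1)])
    then show ?case using step(2) lin[of y y' c] y by (simp add: P_add P_scale span_add span_scale)
  qed
  then show ?case using xs(1) by simp
qed

lemma plug: "planar_tangle T ==> list_all2 (\<lambda>x t. x \<in> span (diagrams G t)) xs (inner T) ==> Z T xs \<in> span (diagrams G (outer T))"
  using plug_partial[of T "inner T" "[]" xs "[]"] by simp

lemma Ins_span:
  assumes "even (c + b)" "even (j + b + d)" "x \<in> span (diagrams G ((c + b) div 2, s \<noteq> odd j))"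
    "y \<in> span (diagrams G ((j + b + d) div 2, s))"
  shows "Ins s j c b d x y \<in> span (diagrams G ((j + c + d) div 2, s))"
  using plug[OF ins_planar[OF assms(1,2)], of "[x, y]" s] assms(3,4) by simp

lemma empty_span: "empty s \<in> span (diagrams G (0, s))"
  using plug[OF unit_planar[of 0 s], of "[]"] unfolding empty_def one_def by simp

lemma click_span: "x \<in> span (diagrams G (1, s)) ==> click (1, s) x \<in> span (diagrams G (1, \<not> s))"
  using plug[OF click_planar[of s], of "[x]"] unfolding click_def by simp

text \<open>
The diagram of a generator alone is obtained by inserting an empty diagram next to it.
\<close>

lemma generator_span:
  assumes "((k, s), x) \<in> G"
  shows "x \<in> span (diagrams G (k, s))"
proof -
  have "Z (ins_tangle s 0 0 0 (2 * k)) ([empty s] @ [x]) \<in> span (diagrams G (outer (ins_tangle s 0 0 0 (2 * k))))"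
    by (rule plug_partial[of _ "[(0, s)]" "[(k, s)]"]) (use assms empty_span ins_planar[of 0 0 0 "2 * k" s] in simp_all)
  then show ?thesis using Ins_empty[of 0 "2 * k" x s] typed[OF assms] by simp
qed

end

end

context coloured_strands
begin

text \<open>
\<open>m\<close> parallel strands of sign \<open>a\<close>; these are the elements \<open>P_n\<close>, \<open>Q_n\<close>, \<open>P_n'\<close> and \<open>Q_n'\<close>.
\<close>

primrec strip :: "bool => bool => nat => 'v" where
  "strip s a 0 = empty s"
| "strip s a (Suc m) = Ins s m 2 0 m (e (s \<noteq> odd m) a) (strip s a m)"

lemma strip_coloured: "coloured s (replicate m a) (m + m) (strip s a m)"
proof (induction m)
  case 0
  show ?case using one_in[of 0 s] unfolding coloured_def by (simp add: empty_def)
next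
  case (Suc m)
  have ev: "even (2 + 0 :: nat)" "even (m + 0 + m)" by simp_all
  have y: "e (s \<noteq> odd m) a \<in> \<P> ((2 + 0) div 2, s \<noteq> odd m)" and z: "strip s a m \<in> \<P> ((m + 0 + m) div 2, s)"
    using e_in colouredD(3)[OF Suc] by simp_all
  have sz: "Suc m + Suc m = m + 2 + m" by simp
  have "point_coloured (s \<noteq> odd m) (2 + 0) 0 a (e (s \<noteq> odd m) a)"
    unfolding point_coloured_def using e_idem[of "s \<noteq> odd m" a] by simp
  then have "point_coloured s (m + 2 + m) (m + 0) a (strip s a (Suc m))"
    using point_coloured_inside[OF ev y z, of 0 a] by simp
  moreover have "point_coloured s (m + 2 + m) i a (strip s a (Suc m))" if "i < m" for i
    using point_coloured_before[OF ev y z that, of a] colouredD(4)[OF Suc, of i] that by simp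
  ultimately have "point_coloured s (m + 2 + m) i (replicate (Suc m) a ! i) (strip s a (Suc m))" if "i < Suc m" for i
    using that by (cases "i = m") (simp_all del: replicate_Suc strip.simps)
  moreover have "strip s a (Suc m) \<in> \<P> ((m + 2 + m) div 2, s)" using Ins_in[OF ev y z] by simp
  ultimately show ?case unfolding coloured_def sz by (simp del: replicate_Suc strip.simps)
qed

lemma strip_acts:
  assumes "even (m + d)" "f \<in> \<P> ((m + d) div 2, s)" "!!i. i < m ==> point_coloured s (m + d) i a f"
  shows "Ins s 0 m m d (strip s a m) f = f"
  using assms
proof (induction m arbitrary: d)
  case 0
  then show ?case using Ins_empty[of 0 d f s] by simp
next
  case (Suc m)
  have sz: "Suc m + d = m + (1 + d)" by simp
  have two: "Suc (Suc 0) dvd m + m" by presburger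
  have "Ins s 0 (m + 1) (1 + m) d (Ins s m 2 0 m (e (s \<noteq> odd m) a) (strip s a m)) f =
      cut s m d a (Ins s 0 m m (1 + d) (strip s a m) f)"
    using two Ins_adjacent[of 1 1 m m 0 d "e (s \<noteq> odd m) a" s "strip s a m" f] Suc.prems(1,2) e_in
      colouredD(3)[OF strip_coloured[of s m a]] by (simp add: numeral_2_eq_2)
  moreover have "Ins s 0 m m (1 + d) (strip s a m) f = f"
    by (rule Suc.IH) (use Suc.prems(1,2) Suc.prems(3) in \<open>simp_all only: sz less_SucI\<close>)
  moreover have "cut s m d a f = f" using Suc.prems(3)[of m] unfolding point_coloured_def by simp
  ultimately show ?case by simp
qed

lemma alternating_strip: "alternating s (e s a) (e (\<not> s) a) m = strip s a m"
proof (induction m)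
  case (Suc m)
  have "(if even m then e s a else e (\<not> s) a) = e (s \<noteq> odd m) a" by simp
  then show ?case
    using Suc tensor_eq_Ins[of "strip s a m" m s "e (s \<noteq> odd m) a" 1] e_in colouredD(3)[OF strip_coloured[of s m a]] by simp
qed simp

text \<open>
\<open>M\<close> absorbs the coloured strands at both ends since these are idempotent. The strands at its bottom
are \<open>M* M\<close>, which is self-adjoint, so taking adjoints gives the second claim.
\<close>

lemma unitary_absorbs:
  assumes M: "M \<in> \<P> (n, s)" "Ins s 0 n n n (strip s a n) (Ins s 0 n n n M (strip s (\<not> a) n)) = M"
    and B: "Ins s 0 n n n (adj (n, s) M) M = strip s (\<not> a) n"
  shows "Ins s 0 n n n (strip s a n) M = M" "Ins s 0 n n n (strip s (\<not> a) n) (adj (n, s) M) = adj (n, s) M"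
proof -
  have aM: "arr s n n M" using M(1) unfolding arr_def by simp
  have st: "arr s n n (strip s b n)" for b using coloured_arr[OF strip_coloured] .
  have idem: "Ins s 0 n n n (strip s b n) (strip s b n) = strip s b n" for b
    by (rule strip_acts) (use colouredD[OF strip_coloured[of s n b]] in \<open>simp_all add: nth_replicate\<close>)
  have aM': "arr s n n (adj (n, s) M)" using arr_dag[OF aM] by simp
  have "Ins s 0 n n n (strip s a n) M = Ins s 0 n n n (Ins s 0 n n n (strip s a n) (strip s a n)) (Ins s 0 n n n M (strip s (\<not> a) n))"
    using M(2) arr_assoc[OF st[of a] st[of a] arr_comp[OF aM st[of "\<not> a"]]] by simp
  then show 1: "Ins s 0 n n n (strip s a n) M = M" using M(2) idem by simp
  have "Ins s 0 n n n M (strip s (\<not> a) n) =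
      Ins s 0 n n n (Ins s 0 n n n (strip s a n) (Ins s 0 n n n M (strip s (\<not> a) n))) (strip s (\<not> a) n)" using M(2) by simp
  also have "\<dots> = Ins s 0 n n n (strip s a n) (Ins s 0 n n n M (Ins s 0 n n n (strip s (\<not> a) n) (strip s (\<not> a) n)))"
    using arr_assoc[OF st[of a] arr_comp[OF aM st[of "\<not> a"]] st[of "\<not> a"]] arr_assoc[OF aM st[of "\<not> a"] st[of "\<not> a"]] by simp
  finally have 2: "Ins s 0 n n n M (strip s (\<not> a) n) = M" using M(2) idem by simp
  have "adj (n, s) (strip s (\<not> a) n) = strip s (\<not> a) n"
    using dag_comp[OF aM' aM] dag_dag[OF aM] B by simp
  then show "Ins s 0 n n n (strip s (\<not> a) n) (adj (n, s) M) = adj (n, s) M"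
    using dag_comp[OF aM st[of "\<not> a"]] 2 by simp
qed

text \<open>
Induction on the length of the word. In the last case \<open>W' f\<close> has the word of \<open>f\<close> with its first
\<open>n\<close> signs reversed, and the letters number \<open>n\<close> and \<open>n + 1\<close> cancel.
\<close>

lemma generation:
  assumes typed: "!!t x. (t, x) \<in> G ==> x \<in> \<P> t"
    and n: "n \<ge> 1"
    and letters: "!!s a. e s a \<in> span (diagrams G (1, s))"
    and vanish: "!!s a m f. coloured s (replicate m a) m f ==> 0 < m ==> m \<le> n ==> f = 0"
    and flip: "!!s a. \<exists>W W'. W \<in> span (diagrams G (n, s)) \<and> W' \<in> span (diagrams G (n, s)) \<and>
        Ins s 0 n n n W W' = strip s a n \<and> Ins s 0 n n n (strip s (\<not> a) n) W' = W'"
  shows "generates G"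
proof -
  have gen_in: "x \<in> \<P> t" if "x \<in> span (diagrams G t)" for x t
    by (rule subsetD[OF span_diagrams_in that]) (rule typed)
  note gen_Ins = Ins_span[of G, OF typed]
  have full: "f \<in> span (diagrams G (length w div 2, s))" if "coloured s w (length w) f" for w s f
    using that
  proof (induction "length w" arbitrary: w f rule: less_induct)
    case less
    have cancelling: "g \<in> span (diagrams G ((length u + 2 + length v) div 2, s))"
      if g: "coloured s (u @ a # (\<not> a) # v) (length u + 2 + length v) g" and l: "length u + 2 + length v = length w" for u a v g
    proof -
      note c = coloured_cap[OF g]
      have ev: "even (length u + length v)" using colouredD(1)[OF c(1)] .
      have c': "cap s (length u) (length v) a g \<in> span (diagrams G ((length u + length v) div 2, s))"
        using less.hyps[of "u @ v"] c(1) l by simp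
      have "cup s (length u) (length v) a (cap s (length u) (length v) a g) \<in> span (diagrams G ((length u + 2 + length v) div 2, s))"
        by (rule gen_Ins) (use letters ev c' in simp_all)
      then show ?thesis using c(2) by simp
    qed
    show ?case
    proof (cases w rule: word_cases)
      case (cancel u a v)
      then have l: "length u + 2 + length v = length w" by simp
      show ?thesis using cancelling[of u a v f] less.prems unfolding l unfolding cancel by simp
    next
      case (const k a)
      consider "k = 0" | "0 < k" "k \<le> n" | "n < k" by linarith
      then show ?thesis
      proof cases
        case 1
        then have "f \<in> \<P> (0, s)" using colouredD(3)[OF less.prems] const by simp
        moreover have "empty s \<in> \<P> (0, s)" using one_in[of 0 s] by (simp add: empty_def)
        ultimately obtain r where "f = scale r (empty s)" using dim_one[OF dim_P0 _ _ empty_nonzero] by blast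
        then show ?thesis using span_scale[OF empty_span[of G, OF typed]] 1 const by simp
      next
        case 2
        then have "f = 0" using vanish[of s k a f] less.prems const by simp
        then show ?thesis by (simp add: span_zero)
      next
        case 3
        define d where "d = k - n"
        have k: "k = n + d" "0 < d" using 3 by (simp_all add: d_def)
        have f: "coloured s (replicate k a) (n + d) f" using less.prems unfolding const k(1) by simp
        obtain W W' where W: "W \<in> span (diagrams G (n, s))" "W' \<in> span (diagrams G (n, s))"
          "Ins s 0 n n n W W' = strip s a n" "Ins s 0 n n n (strip s (\<not> a) n) W' = W'" using flip by blast
        have arr: "arr s n n W" "arr s n n W'" "arr s d n f"
          using gen_in[OF W(1)] gen_in[OF W(2)] coloured_arr[OF f] unfolding arr_def by simp_all
        let ?g = "Ins s 0 n n d W' f"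
        have "f = Ins s 0 n n d (strip s a n) f"
          by (rule strip_acts[symmetric]) (use colouredD(1,3)[OF f] colouredD(4)[OF f] k in \<open>simp_all add: nth_replicate\<close>)
        also have "\<dots> = Ins s 0 n n d W ?g" unfolding W(3)[symmetric] arr_assoc[OF arr] ..
        finally have fg: "f = Ins s 0 n n d W ?g" .
        have W'_col: "coloured s (replicate n (\<not> a)) (n + n) W'"
          using coloured_comp[of s "replicate n (\<not> a)" n "strip s (\<not> a) n" n W'] strip_coloured[of s n "\<not> a"] arr(2) W(4) by simp
        have c1: "coloured s (replicate n (\<not> a) @ replicate d a) (n + d) ?g"
          using coloured_insert[of s "[]" "replicate n a" "replicate d a" d f "replicate n (\<not> a)" W'] f W'_col k(1)
          by (simp add: replicate_add)
        obtain n' d' where nd: "n = Suc n'" "d = Suc d'" using n k(2) by (metis Suc_le_D One_nat_def gr0_implies_Suc)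
        have flipped: "replicate n (\<not> a) @ replicate d a = replicate n' (\<not> a) @ (\<not> a) # (\<not> \<not> a) # replicate d' a"
          unfolding nd by (simp add: replicate_append_same[symmetric])
        have size: "n + d = n' + 2 + d'" using nd by simp
        have "coloured s (replicate n' (\<not> a) @ (\<not> a) # (\<not> \<not> a) # replicate d' a) (n' + 2 + d') ?g"
          using c1 unfolding flipped size .
        then have "?g \<in> span (diagrams G ((n' + 2 + d') div 2, s))"
          using cancelling[of "replicate n' (\<not> a)" "\<not> a" "replicate d' a" ?g] const k nd by simp
        then have g: "?g \<in> span (diagrams G ((0 + n + d) div 2, s))" unfolding nd by simp
        have "Ins s 0 n n d W ?g \<in> span (diagrams G ((0 + n + d) div 2, s))"
          by (rule gen_Ins) (use W(1) g colouredD(1)[OF f] in simp_all)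
        then show ?thesis using fg const k(1) by simp
      qed
    qed
  qed
  have part: "f \<in> span (diagrams G (m div 2, s))" if "coloured s w m f" for m w s f
    using that
  proof (induction "m - length w" arbitrary: w f rule: less_induct)
    case less
    show ?case
    proof (cases "length w < m")
      case True
      have "cut s (length w) (m - Suc (length w)) a f \<in> span (diagrams G (m div 2, s))" for a
        by (rule less.hyps[OF _ coloured_split(1)[OF less.prems True, of a]]) (use True in simp)
      then show ?thesis using coloured_split(2)[OF less.prems True] span_add by metis
    next
      case False
      then have "m = length w" using colouredD(2)[OF less.prems] by simp
      then show ?thesis using full less.prems by simp
    qed
  qed
  show ?thesis
    unfolding generates_iff
  proof (intro allI subsetI)
    fix t x assume x: "x \<in> \<P> t"
    obtain k s where t: "t = (k, s)" by (cases t)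
    have "coloured s [] (2 * k) x" using x unfolding t coloured_def by simp
    from part[OF this] show "x \<in> span (diagrams G t)" unfolding t by simp
  qed
qed

end

lemma (in subfactor_planar_algebra) affine_A_generates:
  assumes n: "n \<ge> 1"
    and cycle: "graph_is_cycle False (2 * n)" "graph_is_cycle True (2 * n)"
    and P1: "P1 \<in> \<P> (1, False)" and Q1: "Q1 \<in> \<P> (1, False)"
    and U: "U \<in> \<P> (n, False)" and V: "V \<in> \<P> (n, True)"
    and rel: "affine_A_relations n \<sigma> P1 Q1 U V"
  shows "generates {((1, False), P1), ((1, False), Q1), ((n, False), U), ((n, False), adj (n, False) U),
            ((n, True), V), ((n, True), adj (n, True) V)}" (is "generates ?G")
proof -
  let ?P = "bar False P1" and ?Q = "bar False Q1"
  define e where "e s a = (if s then (if a then ?Q else ?P) else (if a then P1 else Q1))" for s a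
  have ee: "e False True = P1" "e False False = Q1" "e True True = ?Q" "e True False = ?P" by (simp_all add: e_def)
  note r = rel[unfolded affine_A_relations_def Let_def]
  have PQ: "?P \<in> \<P> (1, True)" "?Q \<in> \<P> (1, True)" using click_in[of _ False] P1 Q1 unfolding bar_def by simp_all
  have st: "stack s l l l x y = Ins s 0 l l l x y" if "x \<in> \<P> (l, s)" "y \<in> \<P> (l, s)" for s l x y
    using stack_eq_Ins[of l l l x s y] that by simp
  have e_in: "e s a \<in> \<P> (1, s)" for s a using P1 Q1 PQ by (cases s; cases a) (simp_all add: ee)
  have e_click: "click (1, s) (e s a) = e (\<not> s) (\<not> a)" for s a
    using click_click[of P1 False] click_click[of Q1 False] P1 Q1
    by (cases s; cases a) (simp_all add: ee bar_def)
  have orthF: "Ins False 0 1 1 1 (e False a) (e False (\<not> a)) = 0" for a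
    using r st[of P1 1 False Q1] st[of Q1 1 False P1] P1 Q1 by (cases a) (simp_all add: ee)
  interpret coloured_strands scale \<P> Z adj e
  proof
    show "e s a \<in> \<P> (1, s)" for s a by (rule e_in)
    show "e s True + e s False = one 1 s" for s
    proof (cases s)
      case True
      have "Y = ?P + ?Q" using r by (elim conjE)
      then have "?P + ?Q = click (1, False) (one 1 False)" unfolding Y_def X_def bar_def ..
      then show ?thesis using click_one[of True] True by (simp add: ee add.commute)
    next
      case False
      then show ?thesis using r by (simp add: ee X_def)
    qed
    show "click (1, s) (e s a) = e (\<not> s) (\<not> a)" for s a by (rule e_click)
    show "Ins s 0 1 1 1 (e s a) (e s (\<not> a)) = 0" for s a
    proof (cases s)
      case True
      let ?z = "Ins True 0 1 1 1 (e True a) (e True (\<not> a))"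
      have "click (1, True) ?z = Ins False 0 1 1 1 (e False a) (e False (\<not> a))"
        using click_mult[OF e_in[of False "\<not> a"] e_in[of False a]] e_click[of False a] e_click[of False "\<not> a"] by simp
      then have "click (1, True) ?z = 0" using orthF by simp
      moreover have "?z \<in> \<P> (1, True)" using Ins_in[of 1 1 0 1 "e True a" True] e_in by simp
      ultimately have "?z = 0" using click_click[of ?z True] click_zero by simp
      then show ?thesis using True by simp
    next
      case False
      then show ?thesis using orthF[of a] by simp
    qed
    show "Ins s 0 2 0 2 (e s a) (e s a) = Ins s 1 2 0 1 (e (\<not> s) (\<not> a)) (e s a)" for s a
    proof -
      have "saddle s (e s a) = tensor s 1 1 (e s a) (e (\<not> s) (\<not> a))"
        using r by (cases s; cases a) (simp_all add: ee)
      then show ?thesis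
        using stack_eq_Ins[of 2 0 2 "e s a" s "e s a"] tensor_eq_Ins[of "e s a" 1 s "e (\<not> s) (\<not> a)" 1] e_in
        unfolding saddle_def by simp
    qed
    show "tr_right (1, s) (e s a) = empty s" for s a using r by (cases s; cases a) (simp_all add: ee)
  qed
  have typed: "x \<in> \<P> t" if "(t, x) \<in> ?G" for t x using that P1 Q1 U V adj_type by auto
  note gen = generator_span[of ?G, OF typed]
  note alt = alternating_strip[of False True n] alternating_strip[of False False n]
    alternating_strip[of True True n] alternating_strip[of True False n]
  note strips = alt[unfolded ee not_True_eq_False not_False_eq_True]
  have strip_in: "strip s a n \<in> \<P> (n, s)" for s a using colouredD(3)[OF strip_coloured[of s n a]] by simp
  have adj_in: "adj (n, False) U \<in> \<P> (n, False)" "adj (n, True) V \<in> \<P> (n, True)" using adj_type U V by simp_all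
  have UQ: "Ins False 0 n n n U (strip False False n) \<in> \<P> (n, False)" "Ins True 0 n n n V (strip True True n) \<in> \<P> (n, True)"
    using Ins_in[of n n 0 n U False "strip False False n"] Ins_in[of n n 0 n V True "strip True True n"] U V strip_in by simp_all
  have rUV: "mult (n, False) (alternating False P1 ?Q n) (mult (n, False) U (alternating False Q1 ?P n)) = U"
    "mult (n, True) (alternating True ?P Q1 n) (mult (n, True) V (alternating True ?Q P1 n)) = V"
    "mult (n, False) U (adj (n, False) U) = alternating False P1 ?Q n"
    "mult (n, False) (adj (n, False) U) U = alternating False Q1 ?P n"
    "mult (n, True) (adj (n, True) V) V = alternating True ?Q P1 n"
    "mult (n, True) V (adj (n, True) V) = alternating True ?P Q1 n"
    using r by blast+
  have UV: "Ins False 0 n n n (strip False True n) (Ins False 0 n n n U (strip False False n)) = U"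
    "Ins True 0 n n n (strip True False n) (Ins True 0 n n n V (strip True True n)) = V"
    "Ins False 0 n n n U (adj (n, False) U) = strip False True n" "Ins False 0 n n n (adj (n, False) U) U = strip False False n"
    "Ins True 0 n n n (adj (n, True) V) V = strip True True n" "Ins True 0 n n n V (adj (n, True) V) = strip True False n"
    using rUV st[OF strip_in UQ(1)] st[OF strip_in UQ(2)]
      st[OF U strip_in] st[OF V strip_in] st[OF U adj_in(1)] st[OF adj_in(1) U] st[OF V adj_in(2)] st[OF adj_in(2) V]
      strips U V strip_in by (simp_all)
  note absU = unitary_absorbs[of U n False True] and absV = unitary_absorbs[of V n True False]
  show ?thesis
  proof (rule generation[OF typed n])
    have "e False a \<in> span (diagrams ?G (1, False))" for a using gen[of 1 False] by (cases a) (simp_all add: ee)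
    then have "e True a \<in> span (diagrams ?G (1, True))" for a
      using click_span[of ?G "e False (\<not> a)" False, OF typed] e_click[of False "\<not> a"] by simp
    with \<open>!!a. e False a \<in> span (diagrams ?G (1, False))\<close> show "e s a \<in> span (diagrams ?G (1, s))" for s a by (cases s) simp_all
    show "f = 0" if "coloured s (replicate m a) m f" "0 < m" "m \<le> n" for s a m f
    proof (rule ccontr)
      assume "f \<noteq> 0"
      then have "card (graph_vertices s) \<le> m" using card_vertices_le that(1,2) by blast
      moreover have "card (graph_vertices s) = 2 * n"
      proof -
        have "graph_is_cycle s (2 * n)" using cycle by (cases s) simp_all
        then obtain \<phi> where "bij_betw \<phi> {..<2 * n} (graph_vertices s)" unfolding graph_is_cycle_def by (elim exE conjE)
        from bij_betw_same_card[OF this] show ?thesis by simp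
      qed
      ultimately show False using that(3) n by simp
    qed
    have gU: "U \<in> span (diagrams ?G (n, False))" "adj (n, False) U \<in> span (diagrams ?G (n, False))"
      "V \<in> span (diagrams ?G (n, True))" "adj (n, True) V \<in> span (diagrams ?G (n, True))"
      by (rule gen; simp)+
    show "\<exists>W W'. W \<in> span (diagrams ?G (n, s)) \<and> W' \<in> span (diagrams ?G (n, s)) \<and>
        Ins s 0 n n n W W' = strip s a n \<and> Ins s 0 n n n (strip s (\<not> a) n) W' = W'" for s a
    proof (cases s; cases a)
      assume s: "s" "a"
      show ?thesis
        by (rule exI[of _ "adj (n, True) V"], rule exI[of _ V]) (use s gU UV absV V in simp)
    next
      assume s: "s" "\<not> a"
      show ?thesis
        by (rule exI[of _ V], rule exI[of _ "adj (n, True) V"]) (use s gU UV absV V in simp)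
    next
      assume s: "\<not> s" "a"
      show ?thesis
        by (rule exI[of _ U], rule exI[of _ "adj (n, False) U"]) (use s gU UV absU U in simp)
    next
      assume s: "\<not> s" "\<not> a"
      show ?thesis
        by (rule exI[of _ "adj (n, False) U"], rule exI[of _ U]) (use s gU UV absU U in simp)
    qed
  qed
qed

theorem mainTheorem3:
  fixes scale :: "complex \<Rightarrow> 'v::ab_group_add \<Rightarrow> 'v"
    and \<P> :: "btype \<Rightarrow> 'v set"
    and Z :: "tangle \<Rightarrow> 'v list \<Rightarrow> 'v"
    and adj :: "btype \<Rightarrow> 'v \<Rightarrow> 'v"
    and n :: nat and \<sigma> :: complex
    and P1 Q1 U V :: 'v
  assumes "n \<ge> 1"
    and "subfactor_planar_algebra scale \<P> Z adj"
    and "subfactor_planar_algebra.graph_is_cycle scale \<P> Z adj False (2 * n)"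
    and "subfactor_planar_algebra.graph_is_cycle scale \<P> Z adj True (2 * n)"
    and "\<sigma> ^ n = 1"
    and "P1 \<in> \<P> (1, False)" and "Q1 \<in> \<P> (1, False)"
    and "U \<in> \<P> (n, False)" and "V \<in> \<P> (n, True)"
    and "subfactor_planar_algebra.affine_A_relations scale Z adj n \<sigma> P1 Q1 U V"
  shows "planar_algebra.generates scale \<P> Z
           {((1, False), P1), ((1, False), Q1),
            ((n, False), U), ((n, False), adj (n, False) U),
            ((n, True), V), ((n, True), adj (n, True) V)}"
  by (rule subfactor_planar_algebra.affine_A_generates[OF assms(2,1,3,4,6-10)])

end
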